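(* Let $n\ge1$ and $m_1,m_2,m_3\in\mathbb{R}$. Let $$Tu(x)=(2\pi)^{-n}\int_{\mathbb{R}^n}\int_{\mathbb{R}^n}e^{i(\phi(x,\xi)-y\cdot\xi)}a(x,y,\xi)u(y)\,dy\,d\xi .$$ Let the real-valued phase $\phi\in C^\infty(\mathbb{R}^n\times\mathbb{R}^n)$ be such that, for some $C_1,C_2>0$, $$C_1\langle x\rangle\le\langle\nabla_\xi\phi(x,\xi)\rangle\le C_2\langle x\rangle\quad\text{for all }x,\xi\in\mathbb{R}^n,$$ and such that for all multi-indices with $|\alpha|,|\beta|\ge1$ $$|\partial_\xi^\beta\phi(x,\xi)|\le C_\beta\langle x\rangle,\qquad|\partial_x^\alpha\partial_\xi^\beta\phi(x,\xi)|\le C_{\alpha\beta}\quad\text{for all }x,\xi\in\mathbb{R}^n.$$ Let $a\in C^\infty(\mathbb{R}^n\times\mathbb{R}^n\times\mathbb{R}^n)$ satisfy $$|\partial_x^\alpha\partial_y^\beta\partial_\xi^\gamma a(x,y,\xi)|\le C_{\alpha\beta\gamma}\langle x\rangle^{m_1}\langle y\rangle^{m_2-|\beta|}\langle\xi\rangle^{m_3}$$ for all $\alpha,\beta,\gamma$ and all $x,y,\xi\in\mathbb{R}^n$. Then $T$ can be written in the form $$Tu(x)=(2\pi)^{-n}\int_{\mathbb{R}^n}e^{i\phi(x,\xi)}c(x,\xi)\widehat{u}(\xi)\,d\xi,$$ with an amplitude $c(x,\xi)$ satisfying $$|\partial_x^\alpha\partial_\xi^\beta c(x,\xi)|\le C_{\alpha\beta}\langle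 x\rangle^{m_1+m_2}\langle\xi\rangle^{m_3}$$ for all $\alpha,\beta$ and all $x,\xi\in\mathbb{R}^n$. Moreover, $c$ has the asymptotic expansion (improving in $x$) $$c(x,\xi)\sim\sum_\beta\frac{i^{-|\beta|}}{\beta!}\,\partial_\eta^\beta\left[e^{i\Psi(\eta,\xi,x)}\,\partial_y^\beta a(x,y,\eta)\big|_{y=\nabla_\xi\phi(x,\xi)}\right]\Big|_{\eta=\xi},$$ where $\Psi(\eta,\xi,x)=\phi(x,\eta)-\phi(x,\xi)+(\xi-\eta)\cdot\nabla_\xi\phi(x,\xi)$.
   Context: $\langle x\rangle=(1+|x|^2)^{1/2}$; $\widehat{u}(\xi)=\int e^{-iy\cdot\xi}u(y)\,dy$. Operators given by double integrals are understood as oscillatory integrals acting on $u\in\mathcal{S}(\mathbb{R}^n)$: the limit as $\epsilon\to0$ of the operators with amplitude $a(x,y,\xi)$ multiplied by $\gamma(\epsilon y,\epsilon\xi)$, where $\gamma\in C_0^\infty(\mathbb{R}^n\times\mathbb{R}^n)$ equals $1$ near the origin. In the expansion, $\partial_\eta$ is taken with $x,\xi$ (hence $\nabla_\xi\phi(x,\xi)$) fixed. Asymptotic expansion improving in $x$: for every $\alpha,\beta$ and every $M$ there exist $N$ and $C$ such that the difference between $c$ and the partial sum of the series (over multi-indices of length less than $N$), differentiated by $\partial_x^\alpha\partial_\xi^\beta$, is bounded by $C\langle x\rangle^{m_1+m_2-M}\langle\xi\rangle^{m_3}$ for all $x,\xi$. *)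

theory Defs
  imports "HOL-Analysis.Analysis"
begin

definition dir_deriv :: "'a::real_normed_vector \<Rightarrow> ('a \<Rightarrow> 'b::real_normed_vector) \<Rightarrow> 'a \<Rightarrow> 'b"
  where "dir_deriv v f x = vector_derivative (\<lambda>t. f (x + t *\<^sub>R v)) (at 0)"

primrec Ck :: "nat \<Rightarrow> ('a::euclidean_space \<Rightarrow> 'b::real_normed_vector) \<Rightarrow> bool"
  where
    "Ck 0 f \<longleftrightarrow> continuous_on UNIV f"
  | "Ck (Suc k) f \<longleftrightarrow> (\<forall>x. f differentiable (at x)) \<and> (\<forall>b\<in>Basis. Ck k (dir_deriv b f))"

definition C_infinity :: "('a::euclidean_space \<Rightarrow> 'b::real_normed_vector) \<Rightarrow> bool"
  where "C_infinity f \<longleftrightarrow> (\<forall>k. Ck k f)"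

type_synonym 'n multi_index = "'n \<Rightarrow> nat"

definition mi_length :: "'n::finite multi_index \<Rightarrow> nat"
  where "mi_length \<alpha> = (\<Sum>i\<in>UNIV. \<alpha> i)"

definition mi_fact :: "'n::finite multi_index \<Rightarrow> nat"
  where "mi_fact \<alpha> = (\<Prod>i\<in>UNIV. fact (\<alpha> i))"

lemma finite_mi_length_less: "finite {\<alpha> :: 'n::finite multi_index. mi_length \<alpha> < N}"
proof (rule finite_subset)
  have "\<alpha> i \<le> mi_length \<alpha>" for \<alpha> :: "'n multi_index" and i
    unfolding mi_length_def by (rule member_le_sum) simp_all
  then show "{\<alpha> :: 'n multi_index. mi_length \<alpha> < N} \<subseteq> PiE UNIV (\<lambda>_. {..<N})"
    using le_less_trans by (fastforce simp: PiE_UNIV_domain)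
  show "finite (PiE UNIV (\<lambda>_::'n. {..<N}))"
    by (rule finite_PiE) simp_all
qed

definition partial :: "'n::finite \<Rightarrow> (real^'n \<Rightarrow> 'b::real_normed_vector) \<Rightarrow> real^'n \<Rightarrow> 'b"
  where "partial i = dir_deriv (axis i 1)"

(* The coordinates are processed in some fixed order; the order is immaterial for smooth
   functions, to which alone this operator is applied. *)
definition mi_deriv :: "'n::finite multi_index \<Rightarrow> (real^'n \<Rightarrow> 'b::real_normed_vector) \<Rightarrow> real^'n \<Rightarrow> 'b"
  where "mi_deriv \<alpha> f =
    foldr (\<lambda>i. partial i ^^ \<alpha> i) (SOME is. distinct is \<and> set is = (UNIV :: 'n set)) f"

definition mi_deriv2 :: "'n::finite multi_index \<Rightarrow> 'n multi_index \<Rightarrow>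
    (real^'n \<Rightarrow> real^'n \<Rightarrow> 'b::real_normed_vector) \<Rightarrow> real^'n \<Rightarrow> real^'n \<Rightarrow> 'b"
  where "mi_deriv2 \<alpha> \<beta> f x \<xi> = mi_deriv \<alpha> (\<lambda>x. mi_deriv \<beta> (\<lambda>\<xi>. f x \<xi>) \<xi>) x"

definition mi_deriv3 :: "'n::finite multi_index \<Rightarrow> 'n multi_index \<Rightarrow> 'n multi_index \<Rightarrow>
    (real^'n \<Rightarrow> real^'n \<Rightarrow> real^'n \<Rightarrow> 'b::real_normed_vector) \<Rightarrow>
    real^'n \<Rightarrow> real^'n \<Rightarrow> real^'n \<Rightarrow> 'b"
  where "mi_deriv3 \<alpha> \<beta> \<gamma> f x y \<xi> =
    mi_deriv \<alpha> (\<lambda>x. mi_deriv \<beta> (\<lambda>y. mi_deriv \<gamma> (\<lambda>\<xi>. f x y \<xi>) \<xi>) y) x"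

definition grad_snd :: "(real^'n::finite \<Rightarrow> real^'n \<Rightarrow> real) \<Rightarrow> real^'n \<Rightarrow> real^'n \<Rightarrow> real^'n"
  where "grad_snd \<phi> x \<xi> = (\<chi> i. partial i (\<lambda>\<xi>. \<phi> x \<xi>) \<xi>)"

definition bracket :: "'a::real_normed_vector \<Rightarrow> real"
  where "bracket x = sqrt (1 + (norm x)\<^sup>2)"

definition schwartz :: "(real^'n::finite \<Rightarrow> complex) \<Rightarrow> bool"
  where "schwartz u \<longleftrightarrow> C_infinity u \<and>
    (\<forall>\<alpha> \<beta>. \<exists>C. \<forall>x. norm ((\<Prod>i\<in>UNIV. (x $ i) ^ \<alpha> i) *\<^sub>R mi_deriv \<beta> u x) \<le> C)"

definition fourier :: "(real^'n::finite \<Rightarrow> complex) \<Rightarrow> real^'n \<Rightarrow> complex"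
  where "fourier u \<xi> = (LINT y|lborel. exp (- \<i> * complex_of_real (y \<bullet> \<xi>)) * u y)"

definition cutoff :: "('a::euclidean_space \<Rightarrow> complex) \<Rightarrow> bool"
  where "cutoff \<gamma> \<longleftrightarrow> C_infinity \<gamma> \<and> compact (closure {z. \<gamma> z \<noteq> 0}) \<and>
    (\<forall>\<^sub>F z in nhds 0. \<gamma> z = 1)"

definition fio_double :: "(real^'n::finite \<Rightarrow> real^'n \<Rightarrow> real) \<Rightarrow>
    (real^'n \<Rightarrow> real^'n \<Rightarrow> real^'n \<Rightarrow> complex) \<Rightarrow> (real^'n \<Rightarrow> complex) \<Rightarrow> real^'n \<Rightarrow> complex"
  where "fio_double \<phi> a u x = complex_of_real (1 / (2 * pi) ^ CARD('n)) *
    (LINT \<xi>|lborel. LINT y|lborel.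
       exp (\<i> * complex_of_real (\<phi> x \<xi> - y \<bullet> \<xi>)) * a x y \<xi> * u y)"

(* The oscillatory integral with phase \<phi> and amplitude a, applied to u at x, has the value L:
   the regularized integrals converge to L, whichever cutoff is used. *)
definition has_osc_value :: "(real^'n::finite \<Rightarrow> real^'n \<Rightarrow> real) \<Rightarrow>
    (real^'n \<Rightarrow> real^'n \<Rightarrow> real^'n \<Rightarrow> complex) \<Rightarrow> (real^'n \<Rightarrow> complex) \<Rightarrow> real^'n \<Rightarrow>
    complex \<Rightarrow> bool"
  where "has_osc_value \<phi> a u x L \<longleftrightarrow>
    (\<forall>\<gamma> :: (real^'n) \<times> (real^'n) \<Rightarrow> complex. cutoff \<gamma> \<longrightarrow>
      ((\<lambda>\<epsilon>. fio_double \<phi> (\<lambda>x y \<xi>. a x y \<xi> * \<gamma> (\<epsilon> *\<^sub>R y, \<epsilon> *\<^sub>R \<xi>)) u x) \<longlongrightarrow> L) (at 0))"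

definition fio_single :: "(real^'n::finite \<Rightarrow> real^'n \<Rightarrow> real) \<Rightarrow>
    (real^'n \<Rightarrow> real^'n \<Rightarrow> complex) \<Rightarrow> (real^'n \<Rightarrow> complex) \<Rightarrow> real^'n \<Rightarrow> complex"
  where "fio_single \<phi> c u x = complex_of_real (1 / (2 * pi) ^ CARD('n)) *
    (LINT \<xi>|lborel. exp (\<i> * complex_of_real (\<phi> x \<xi>)) * c x \<xi> * fourier u \<xi>)"

definition Psi :: "(real^'n::finite \<Rightarrow> real^'n \<Rightarrow> real) \<Rightarrow> real^'n \<Rightarrow> real^'n \<Rightarrow> real^'n \<Rightarrow> real"
  where "Psi \<phi> \<eta> \<xi> x = \<phi> x \<eta> - \<phi> x \<xi> + (\<xi> - \<eta>) \<bullet> grad_snd \<phi> x \<xi>"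

definition expansion_term :: "(real^'n::finite \<Rightarrow> real^'n \<Rightarrow> real) \<Rightarrow>
    (real^'n \<Rightarrow> real^'n \<Rightarrow> real^'n \<Rightarrow> complex) \<Rightarrow> 'n multi_index \<Rightarrow>
    real^'n \<Rightarrow> real^'n \<Rightarrow> complex"
  where "expansion_term \<phi> a \<beta> x \<xi> =
    \<i> powi (- int (mi_length \<beta>)) / of_nat (mi_fact \<beta>) *
    mi_deriv \<beta> (\<lambda>\<eta>. exp (\<i> * complex_of_real (Psi \<phi> \<eta> \<xi> x)) *
      mi_deriv \<beta> (\<lambda>y. a x y \<eta>) (grad_snd \<phi> x \<xi>)) \<xi>"

definition asymp_expansion_x :: "(real^'n::finite \<Rightarrow> real^'n \<Rightarrow> complex) \<Rightarrow>
    ('n multi_index \<Rightarrow> real^'n \<Rightarrow> real^'n \<Rightarrow> complex) \<Rightarrow> real \<Rightarrow> real \<Rightarrow> bool"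
  where "asymp_expansion_x c s p q \<longleftrightarrow>
    (\<forall>\<alpha> \<beta>. \<forall>M :: real. \<exists>N :: nat. \<exists>C :: real. \<forall>x \<xi>.
      norm (mi_deriv2 \<alpha> \<beta> (\<lambda>x \<xi>. c x \<xi> - (\<Sum>\<kappa> | mi_length \<kappa> < N. s \<kappa> x \<xi>)) x \<xi>)
        \<le> C * bracket x powr (p - M) * bracket \<xi> powr q)"

end

theory Submission
  imports Defs "HOL-Probability.Probability"
begin

text \<open>
  Applying \<open>T\<close> to an exponential shows that \<open>exp (\<i> \<phi>(x, \<xi>)) c(x, \<xi>)\<close> must be the integral of
  \<open>exp (\<i> (\<phi>(x, \<eta>) - y \<cdot> (\<eta> - \<xi>))) a(x, y, \<eta>)\<close> over \<open>y\<close> and \<open>\<eta>\<close>, up to the factor \<open>(2\<pi>)\<close> to the power \<open>- n\<close>. A cutoff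
  in \<open>\<langle>y\<rangle> / \<langle>x\<rangle>\<close> splits \<open>a\<close> into a part with \<open>\<langle>y\<rangle>\<close> comparable to \<open>\<langle>x\<rangle>\<close> and a part where
  \<open>F = \<nabla>\<^sub>\<eta>\<phi>(x, \<eta>) - y\<close> has size at least \<open>\<langle>x\<rangle> + \<langle>y\<rangle>\<close>. In the second part, integrating by parts in \<open>\<eta>\<close> along
  \<open>F / |F|\<^sup>2\<close> gains any power of \<open>\<langle>x\<rangle> + \<langle>y\<rangle>\<close>. In the first part, the substitution \<open>y = \<nabla>\<^sub>\<xi>\<phi>(x, \<xi>) + \<langle>x\<rangle> w\<close>,
  \<open>\<eta> = \<xi> + \<kappa> / \<langle>x\<rangle>\<close> leads to the double integral of \<open>exp (- \<i> w \<cdot> \<kappa>) H(w, \<kappa>)\<close>, where \<open>H\<close> contains the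
  factor \<open>exp (\<i> \<Psi>)\<close>, has compact support in \<open>w\<close>, and gains \<open>\<langle>x\<rangle>\<close> to the power \<open>- 1/2\<close> with every
  \<open>\<kappa>\<close>-derivative. Replacing \<open>H(w, \<kappa>)\<close> by \<open>H(w, t \<kappa>)\<close> and expanding in Taylor's formula from \<open>t = 0\<close>, where
  Fourier inversion applies, to \<open>t = 1\<close> gives the asymptotic series with its remainder. The value of the
  oscillatory integral is identified by dominated convergence and Fourier inversion for \<open>u\<close>.
\<close>

section \<open>Directional derivatives and smooth functions\<close>

text \<open>The hypotheses bound only derivatives of \<phi> that contain a \<xi>-derivative; pure
  x-derivatives may grow without control. Hence \<phi> enters the estimates only through differences
  such as \<phi>(x, \<eta>) - \<phi>(x, \<xi>), which vanish on a diagonal and are recovered from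
  their \<xi>-derivatives along rays (\<open>symb_vanish\<close>). The second \<kappa>-derivative of
  the rescaled phase has size 1 / <x>, and two derivatives share it; this is the rate 1/2. The
  growth in \<kappa> that it costs is harmless: derivatives in w are free, so the inner integral
  over w decays faster than any power of \<kappa>. In the far part every derivative in (x, \<xi>)
  loses a factor <x>, which more integrations by parts make up for. Their number depends on the
  wanted order, while c has to be one function; therefore the far integral is shown not to depend on
  that number once it is large (\<open>dec_sec_Lk\<close>).\<close>

lemma dir_deriv_eqI:
  assumes "(f has_derivative f') (at x)"
  shows "dir_deriv v f x = f' v"
proof -
  interpret f': bounded_linear f' using assms by (rule has_derivative_bounded_linear)
  have "((\<lambda>t. x + t *\<^sub>R v) has_derivative (\<lambda>t. t *\<^sub>R v)) (at 0)"
    by (auto intro!: derivative_eq_intros)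
  moreover have "(f has_derivative f') (at (x + 0 *\<^sub>R v))" using assms by simp
  ultimately have "((\<lambda>t. f (x + t *\<^sub>R v)) has_derivative (\<lambda>t. f' (t *\<^sub>R v))) (at 0)"
    using diff_chain_at[of "\<lambda>t. x + t *\<^sub>R v" "\<lambda>t. t *\<^sub>R v" 0 f f'] by (simp add: o_def)
  then have "((\<lambda>t. f (x + t *\<^sub>R v)) has_vector_derivative f' v) (at 0)"
    by (simp add: has_vector_derivative_def f'.scaleR)
  then show ?thesis unfolding dir_deriv_def by (rule vector_derivative_at)
qed

lemma has_derivative_dir_deriv:
  assumes "f differentiable (at x)"
  shows "(f has_derivative (\<lambda>h. dir_deriv h f x)) (at x)"
proof -
  obtain f' where f': "(f has_derivative f') (at x)" using assms by (auto simp: differentiable_def)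
  then have "(\<lambda>h. dir_deriv h f x) = f'" by (auto intro!: dir_deriv_eqI)
  then show ?thesis using f' by simp
qed

lemma linear_dir_deriv:
  assumes "f differentiable (at x)"
  shows "bounded_linear (\<lambda>h. dir_deriv h f x)"
  using has_derivative_dir_deriv[OF assms] by (rule has_derivative_bounded_linear)

lemma dir_deriv_Basis:
  fixes f :: "'a::euclidean_space \<Rightarrow> 'b::real_normed_vector"
  assumes "f differentiable (at x)"
  shows "dir_deriv h f x = (\<Sum>b\<in>Basis. (h \<bullet> b) *\<^sub>R dir_deriv b f x)"
proof -
  interpret l: bounded_linear "\<lambda>h. dir_deriv h f x" by (rule linear_dir_deriv[OF assms])
  show ?thesis
    by (subst euclidean_representation[of h, symmetric]) (simp only: l.sum l.scaleR)
qed

lemma dir_deriv_line: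
  assumes "f differentiable (at (x + t *\<^sub>R v))"
  shows "((\<lambda>t. f (x + t *\<^sub>R v)) has_vector_derivative dir_deriv v f (x + t *\<^sub>R v)) (at t within S)"
proof -
  have "((\<lambda>t. x + t *\<^sub>R v) has_derivative (\<lambda>t. t *\<^sub>R v)) (at t within S)"
    by (auto intro!: derivative_eq_intros)
  from diff_chain_within[OF this, of f "\<lambda>h. dir_deriv h f (x + t *\<^sub>R v)"]
  have "((\<lambda>t. f (x + t *\<^sub>R v)) has_derivative (\<lambda>s. dir_deriv (s *\<^sub>R v) f (x + t *\<^sub>R v))) (at t within S)"
    using has_derivative_dir_deriv[OF assms] by (auto simp: o_def intro: has_derivative_at_withinI)
  then show ?thesis
    using linear_cmul[OF bounded_linear.linear[OF linear_dir_deriv[OF assms]]]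
    by (simp add: has_vector_derivative_def)
qed

lemma dir_deriv_zero [simp]: "dir_deriv 0 f x = 0"
  by (simp add: dir_deriv_def)

lemma dir_deriv_const [simp]: "dir_deriv v (\<lambda>x. c) x = 0"
  by (simp add: dir_deriv_def)

lemma dir_deriv_add:
  "f differentiable (at x) \<Longrightarrow> g differentiable (at x) \<Longrightarrow>
    dir_deriv v (\<lambda>x. f x + g x) x = dir_deriv v f x + dir_deriv v g x"
  by (rule dir_deriv_eqI[of _ "\<lambda>h. dir_deriv h f x + dir_deriv h g x"])
     (intro has_derivative_add has_derivative_dir_deriv)

lemma dir_deriv_linear:
  "bounded_linear l \<Longrightarrow> f differentiable (at x) \<Longrightarrow>
    dir_deriv v (\<lambda>x. l (f x)) x = l (dir_deriv v f x)"
  by (rule dir_deriv_eqI[of _ "\<lambda>h. l (dir_deriv h f x)"])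
     (auto intro: bounded_linear.has_derivative has_derivative_dir_deriv)

lemma dir_deriv_bilinear:
  "bounded_bilinear p \<Longrightarrow> f differentiable (at x) \<Longrightarrow> g differentiable (at x) \<Longrightarrow>
    dir_deriv v (\<lambda>x. p (f x) (g x)) x = p (f x) (dir_deriv v g x) + p (dir_deriv v f x) (g x)"
  by (rule dir_deriv_eqI[of _ "\<lambda>h. p (f x) (dir_deriv h g x) + p (dir_deriv h f x) (g x)"])
     (auto intro: bounded_bilinear.FDERIV has_derivative_dir_deriv)

lemma dir_deriv_compose:
  fixes f :: "'b::euclidean_space \<Rightarrow> 'c::real_normed_vector" and g :: "'a::real_normed_vector \<Rightarrow> 'b"
  assumes "f differentiable (at (g x))" "g differentiable (at x)"
  shows "dir_deriv v (\<lambda>x. f (g x)) x =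
    (\<Sum>b\<in>Basis. dir_deriv v (\<lambda>x. g x \<bullet> b) x *\<^sub>R dir_deriv b f (g x))"
proof -
  have "dir_deriv v (\<lambda>x. f (g x)) x = dir_deriv (dir_deriv v g x) f (g x)"
    using diff_chain_at[OF has_derivative_dir_deriv[OF assms(2)] has_derivative_dir_deriv[OF assms(1)]]
    by (intro dir_deriv_eqI) (simp add: o_def)
  also have "\<dots> = (\<Sum>b\<in>Basis. (dir_deriv v g x \<bullet> b) *\<^sub>R dir_deriv b f (g x))"
    by (rule dir_deriv_Basis[OF assms(1)])
  finally show ?thesis
    by (simp add: dir_deriv_linear[OF bounded_linear_inner_left assms(2)])
qed

lemma dir_deriv_real_compose:
  fixes f :: "real \<Rightarrow> 'c::real_normed_vector" and g :: "'a::real_normed_vector \<Rightarrow> real"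
  assumes "(f has_vector_derivative f') (at (g x))" "g differentiable (at x)"
  shows "dir_deriv v (\<lambda>x. f (g x)) x = dir_deriv v g x *\<^sub>R f'"
  using diff_chain_at[OF has_derivative_dir_deriv[OF assms(2)], of f "\<lambda>t. t *\<^sub>R f'"] assms(1)
  by (intro dir_deriv_eqI[where f' = "\<lambda>h. dir_deriv h g x *\<^sub>R f'"])
     (simp add: o_def has_vector_derivative_def)

lemma differentiable_real_compose:
  fixes f :: "real \<Rightarrow> 'c::real_normed_vector" and g :: "'a::real_normed_vector \<Rightarrow> real"
  assumes "(f has_vector_derivative f') (at (g x))" "g differentiable (at x)"
  shows "(\<lambda>x. f (g x)) differentiable (at x)"
  using differentiable_chain_at[OF assms(2), of f] assms(1)
  by (auto simp: o_def has_vector_derivative_def differentiable_def)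

lemma Ck_SucD: "Ck (Suc k) f \<Longrightarrow> Ck k f"
proof (induction k arbitrary: f)
  case 0
  then show ?case
    by (auto simp: continuous_on_eq_continuous_at intro: differentiable_imp_continuous_within)
qed auto

lemma Ck_const [simp]: "Ck k (\<lambda>x. c)"
proof (induction k arbitrary: c)
  case (Suc k)
  have "dir_deriv v (\<lambda>x. c) = (\<lambda>x. 0)" for v :: 'a by auto
  then show ?case using Suc[of 0] by simp
qed simp

lemma Ck_add: "Ck k f \<Longrightarrow> Ck k g \<Longrightarrow> Ck k (\<lambda>x. f x + g x)"
proof (induction k arbitrary: f g)
  case (Suc k)
  then have "dir_deriv v (\<lambda>x. f x + g x) = (\<lambda>x. dir_deriv v f x + dir_deriv v g x)" for v
    by (auto simp: dir_deriv_add)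
  with Suc show ?case by auto
qed (auto intro: continuous_intros)

lemma Ck_linear:
  assumes "bounded_linear l" shows "Ck k f \<Longrightarrow> Ck k (\<lambda>x. l (f x))"
proof (induction k arbitrary: f)
  case 0
  then show ?case using assms by (auto intro: bounded_linear.continuous_on)
next
  case (Suc k)
  then have "dir_deriv v (\<lambda>x. l (f x)) = (\<lambda>x. l (dir_deriv v f x))" for v
    using assms by (auto simp: dir_deriv_linear)
  moreover have "(\<lambda>x. l (f x)) differentiable at x" for x
    using Suc.prems assms bounded_linear.has_derivative[OF assms]
    by (auto simp: differentiable_def) blast
  ultimately show ?case using Suc by auto
qed

lemma Ck_bilinear:
  assumes "bounded_bilinear p" shows "Ck k f \<Longrightarrow> Ck k g \<Longrightarrow> Ck k (\<lambda>x. p (f x) (g x))"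
proof (induction k arbitrary: f g)
  case 0
  then show ?case using assms by (auto intro: bounded_bilinear.continuous_on)
next
  case (Suc k)
  then have "dir_deriv v (\<lambda>x. p (f x) (g x)) = 
      (\<lambda>x. p (f x) (dir_deriv v g x) + p (dir_deriv v f x) (g x))" for v
    using assms by (auto simp: dir_deriv_bilinear)
  moreover have "(\<lambda>x. p (f x) (g x)) differentiable at x" for x
    using Suc.prems bounded_bilinear.FDERIV[OF assms]
    by (auto simp: differentiable_def) blast
  ultimately show ?case
    using Suc.prems Ck_SucD[OF Suc.prems(1)] Ck_SucD[OF Suc.prems(2)]
    by (auto intro!: Ck_add Suc.IH)
qed

lemma Ck_sum: "(\<And>i. i \<in> I \<Longrightarrow> Ck k (f i)) \<Longrightarrow> Ck k (\<lambda>x. \<Sum>i\<in>I. f i x)"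
  by (induction I rule: infinite_finite_induct) (auto intro: Ck_add)

lemma Ck_bounded_linear: assumes "bounded_linear l" shows "Ck k l"
proof (cases k)
  case 0
  then show ?thesis using assms by (auto intro: linear_continuous_on)
next
  case (Suc k)
  have d: "(l has_derivative l) (at x)" for x
    using assms by (rule bounded_linear_imp_has_derivative)
  then have "dir_deriv v l = (\<lambda>x. l v)" for v by (auto intro!: dir_deriv_eqI)
  then show ?thesis using d Suc by (auto simp: differentiable_def)
qed

lemma Ck_compose:
  fixes f :: "'b::euclidean_space \<Rightarrow> 'c::real_normed_vector" and g :: "'a::euclidean_space \<Rightarrow> 'b"
  shows "Ck k f \<Longrightarrow> Ck k g \<Longrightarrow> Ck k (\<lambda>x. f (g x))"
proof (induction k arbitrary: f g)
  case 0
  then show ?case by (auto intro: continuous_on_compose2)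
next
  case (Suc k)
  then have "dir_deriv v (\<lambda>x. f (g x)) =
      (\<lambda>x. \<Sum>b\<in>Basis. dir_deriv v (\<lambda>x. g x \<bullet> b) x *\<^sub>R dir_deriv b f (g x))" for v
    by (auto simp: dir_deriv_compose)
  moreover have "(\<lambda>x. f (g x)) differentiable at x" for x
    using Suc.prems differentiable_chain_at[of g x f] by (auto simp: o_def)
  moreover have "Ck k (\<lambda>x. \<Sum>b\<in>Basis. dir_deriv v (\<lambda>x. g x \<bullet> b) x *\<^sub>R dir_deriv b f (g x))"
    if "v \<in> Basis" for v
  proof (intro Ck_sum Ck_bilinear[OF bounded_bilinear_scaleR])
    fix b :: 'b assume b: "b \<in> Basis"
    have "Ck (Suc k) (\<lambda>x. g x \<bullet> b)"
      using Suc.prems(2) by (rule Ck_linear[OF bounded_linear_inner_left])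
    then show "Ck k (dir_deriv v (\<lambda>x. g x \<bullet> b))" using that by simp
    show "Ck k (\<lambda>x. dir_deriv b f (g x))"
      using Suc.prems(1) Ck_SucD[OF Suc.prems(2)] b by (intro Suc.IH) auto
  qed
  ultimately show ?case by simp
qed

lemma Ck_inverse:
  fixes f :: "'a::euclidean_space \<Rightarrow> real"
  assumes "\<And>x. f x \<noteq> 0"
  shows "Ck k f \<Longrightarrow> Ck k (\<lambda>x. inverse (f x))"
proof (induction k)
  case 0
  then show ?case using assms by (auto intro: continuous_intros)
next
  case (Suc k)
  have d: "(inverse has_vector_derivative - (inverse (f x) * inverse (f x))) (at (f x))" for x
    using assms[of x] unfolding has_real_derivative_iff_has_vector_derivative[symmetric]
    by (auto intro!: derivative_eq_intros simp: power2_eq_square)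
  have "dir_deriv v (\<lambda>x. inverse (f x)) = (\<lambda>x. dir_deriv v f x * (- (inverse (f x) * inverse (f x))))" for v
    using Suc.prems by (auto simp: fun_eq_iff intro!: dir_deriv_real_compose[where f=inverse and g=f, OF d, simplified])
  moreover have "(\<lambda>x. inverse (f x)) differentiable at x" for x
    using Suc.prems by (intro differentiable_real_compose[where f=inverse and g=f, OF d]) auto
  moreover have "Ck k (\<lambda>x. inverse (f x))" using Suc Ck_SucD by blast
  ultimately show ?case
    using Suc.prems 
    by (simp del: mult_minus_right) (intro ballI Ck_bilinear[OF bounded_bilinear_mult]
      Ck_linear[OF bounded_linear_minus[OF bounded_linear_ident]]; simp)
qed

lemma has_vector_derivative_cis:
  "((\<lambda>t. exp (\<i> * complex_of_real t)) has_vector_derivative \<i> * exp (\<i> * complex_of_real t)) (at t)"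
proof -
  have "((\<lambda>z. exp (\<i> * z)) has_field_derivative exp (\<i> * of_real t) * \<i>) (at (of_real t))"
    by (auto intro!: derivative_eq_intros)
  from field_vector_diff_chain_at[OF has_vector_derivative_of_real[OF DERIV_ident] this]
  show ?thesis by (simp add: o_def mult.commute)
qed

lemma Ck_cis:
  fixes f :: "'a::euclidean_space \<Rightarrow> real"
  shows "Ck k f \<Longrightarrow> Ck k (\<lambda>x. exp (\<i> * complex_of_real (f x)))"
proof (induction k)
  case 0
  then show ?case by (simp, intro continuous_intros)
next
  case (Suc k)
  have "dir_deriv v (\<lambda>x. exp (\<i> * complex_of_real (f x))) =
      (\<lambda>x. dir_deriv v f x *\<^sub>R (\<i> * exp (\<i> * complex_of_real (f x))))" for v
    using Suc.prems by (auto simp: fun_eq_iff intro!: dir_deriv_real_compose[OF has_vector_derivative_cis])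
  moreover have "(\<lambda>x. exp (\<i> * complex_of_real (f x))) differentiable at x" for x
    using Suc.prems by (intro differentiable_real_compose[OF has_vector_derivative_cis]) auto
  moreover have "Ck k (\<lambda>x. exp (\<i> * complex_of_real (f x)))" using Suc Ck_SucD by blast
  ultimately show ?case
    using Suc.prems 
    by (simp del: scaleR_conv_of_real) (intro ballI Ck_bilinear[OF bounded_bilinear_scaleR]
      Ck_bilinear[OF bounded_bilinear_mult] Ck_const; simp)
qed

lemma smooth_differentiable: "C_infinity f \<Longrightarrow> f differentiable (at x)"
  unfolding C_infinity_def using Ck.simps(2) by blast

lemma smooth_dir_deriv:
  fixes f :: "'a::euclidean_space \<Rightarrow> 'b::real_normed_vector"
  assumes "C_infinity f" shows "C_infinity (dir_deriv v f)"
proof -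
  have 1: "Ck k (dir_deriv b f)" if "b \<in> Basis" for b k
    using assms that unfolding C_infinity_def by (meson Ck.simps(2))
  have "dir_deriv v f = (\<lambda>x. \<Sum>b\<in>Basis. (v \<bullet> b) *\<^sub>R dir_deriv b f x)"
    by (intro ext dir_deriv_Basis smooth_differentiable assms)
  then show ?thesis
    unfolding C_infinity_def
    by (simp only:) (intro allI Ck_sum Ck_linear[OF bounded_linear_scaleR_right] 1)
qed

lemma smooth_continuous: "C_infinity f \<Longrightarrow> continuous_on S f"
  unfolding C_infinity_def by (metis Ck.simps(1) continuous_on_subset subset_UNIV)

lemma smooth_measurable [measurable_dest]: "C_infinity f \<Longrightarrow> f \<in> borel_measurable borel"
  by (intro borel_measurable_continuous_onI smooth_continuous)

lemma smooth_const: "C_infinity (\<lambda>x. c)" by (simp add: C_infinity_def)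

lemma smooth_add: "C_infinity f \<Longrightarrow> C_infinity g \<Longrightarrow> C_infinity (\<lambda>x. f x + g x)"
  by (simp add: C_infinity_def Ck_add)

lemma smooth_linear: "bounded_linear l \<Longrightarrow> C_infinity f \<Longrightarrow> C_infinity (\<lambda>x. l (f x))"
  by (simp add: C_infinity_def Ck_linear)

lemma smooth_bounded_linear: "bounded_linear l \<Longrightarrow> C_infinity l"
  by (simp add: C_infinity_def Ck_bounded_linear)

lemma smooth_bilinear:
  "bounded_bilinear p \<Longrightarrow> C_infinity f \<Longrightarrow> C_infinity g \<Longrightarrow> C_infinity (\<lambda>x. p (f x) (g x))"
  by (simp add: C_infinity_def Ck_bilinear)

lemma smooth_sum: "(\<And>i. i \<in> I \<Longrightarrow> C_infinity (f i)) \<Longrightarrow> C_infinity (\<lambda>x. \<Sum>i\<in>I. f i x)"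
  by (simp add: C_infinity_def Ck_sum)

lemma smooth_compose:
  fixes f :: "'b::euclidean_space \<Rightarrow> 'c::real_normed_vector" and g :: "'a::euclidean_space \<Rightarrow> 'b"
  shows "C_infinity f \<Longrightarrow> C_infinity g \<Longrightarrow> C_infinity (\<lambda>x. f (g x))"
  by (simp add: C_infinity_def Ck_compose)

lemma smooth_inverse:
  fixes f :: "'a::euclidean_space \<Rightarrow> real"
  shows "(\<And>x. f x \<noteq> 0) \<Longrightarrow> C_infinity f \<Longrightarrow> C_infinity (\<lambda>x. inverse (f x))"
  by (simp add: C_infinity_def Ck_inverse)

lemma smooth_divide:
  fixes f :: "'a::euclidean_space \<Rightarrow> real"
  shows "(\<And>x. g x \<noteq> 0) \<Longrightarrow> C_infinity f \<Longrightarrow> C_infinity g \<Longrightarrow> C_infinity (\<lambda>x. f x / g x)"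
  unfolding divide_inverse by (intro smooth_bilinear[OF bounded_bilinear_mult] smooth_inverse)

lemma smooth_cis:
  fixes f :: "'a::euclidean_space \<Rightarrow> real"
  shows "C_infinity f \<Longrightarrow> C_infinity (\<lambda>x. exp (\<i> * complex_of_real (f x)))"
  by (simp add: C_infinity_def Ck_cis)

lemmas smooth_mult = smooth_bilinear[OF bounded_bilinear_mult]
lemmas smooth_scaleR = smooth_bilinear[OF bounded_bilinear_scaleR]
lemmas smooth_inner = smooth_bilinear[OF bounded_bilinear_inner]
lemmas smooth_of_real = smooth_linear[OF bounded_linear_of_real]
lemmas smooth_uminus = smooth_linear[OF bounded_linear_minus[OF bounded_linear_ident]]
lemmas smooth_fst = smooth_linear[OF bounded_linear_fst]
lemmas smooth_snd = smooth_linear[OF bounded_linear_snd]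
lemmas smooth_id = smooth_bounded_linear[OF bounded_linear_ident]

lemma smooth_diff: "C_infinity f \<Longrightarrow> C_infinity g \<Longrightarrow> C_infinity (\<lambda>x. f x - g x)"
  using smooth_add[OF _ smooth_uminus, of f g] by simp

lemma smooth_Pair:
  fixes f :: "'a::euclidean_space \<Rightarrow> 'b::euclidean_space" and g :: "'a \<Rightarrow> 'c::euclidean_space"
  assumes "C_infinity f" "C_infinity g"
  shows "C_infinity (\<lambda>x. (f x, g x))"
proof -
  have "bounded_linear (\<lambda>y::'b. (y, 0::'c))" "bounded_linear (\<lambda>y::'c. (0::'b, y))"
    by (auto intro!: bounded_linear_Pair bounded_linear_ident bounded_linear_zero)
  then have "C_infinity (\<lambda>x. (f x, 0::'c) + (0::'b, g x))"
    using assms by (intro smooth_add) (auto intro: smooth_linear)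
  then show ?thesis by simp
qed

lemmas smooth_intros = smooth_const smooth_id smooth_add smooth_diff smooth_uminus smooth_mult smooth_scaleR smooth_inner
  smooth_of_real smooth_fst smooth_snd smooth_sum smooth_Pair smooth_cis smooth_dir_deriv

text \<open>Differentiating f(z + t w) - f(z), written as the integral of the w-derivative over
  [0, t], in direction v under the integral sign expresses the increment of the v-derivative along w
  as an integral of the mixed derivative. Its one-sided derivative at t = 0 is then computed in two
  ways.\<close>

lemma dir_deriv_commute:
  fixes f :: "'a::euclidean_space \<Rightarrow> 'b::euclidean_space"
  assumes f: "C_infinity f"
  shows "dir_deriv v (dir_deriv w f) z = dir_deriv w (dir_deriv v f) z"
proof -
  note [simp] = smooth_differentiable[OF f] smooth_differentiable[OF smooth_dir_deriv[OF f]]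
    smooth_differentiable[OF smooth_dir_deriv[OF smooth_dir_deriv[OF f]]]
  let ?D = "dir_deriv v (dir_deriv w f)"
  have sD: "C_infinity ?D" by (intro smooth_intros f)
  have I: "((\<lambda>\<tau>. dir_deriv w f (x + \<tau> *\<^sub>R w)) has_integral (f (x + t *\<^sub>R w) - f x)) {0..t}"
    if "t \<ge> 0" for x t
    using fundamental_theorem_of_calculus[OF that, of "\<lambda>\<tau>. f (x + \<tau> *\<^sub>R w)"] by (simp add: dir_deriv_line)
  have J: "dir_deriv v f (z + t *\<^sub>R w) - dir_deriv v f z = integral {0..t} (\<lambda>\<tau>. ?D (z + \<tau> *\<^sub>R w))"
    if t: "t \<ge> 0" for t
  proof -
    have a: "((\<lambda>s. f ((z + t *\<^sub>R w) + s *\<^sub>R v) - f (z + s *\<^sub>R v)) has_vector_derivative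
        dir_deriv v f ((z + t *\<^sub>R w) + 0 *\<^sub>R v) - dir_deriv v f (z + 0 *\<^sub>R v)) (at 0)"
      by (intro has_vector_derivative_diff dir_deriv_line) auto
    have "((\<lambda>s. integral (cbox 0 t) (\<lambda>\<tau>. dir_deriv w f ((z + \<tau> *\<^sub>R w) + s *\<^sub>R v))) has_vector_derivative
        integral (cbox 0 t) (\<lambda>\<tau>. ?D ((z + \<tau> *\<^sub>R w) + 0 *\<^sub>R v))) (at 0 within UNIV)"
    proof (rule leibniz_rule_vector_derivative[where U=UNIV])
      show "continuous_on (UNIV \<times> cbox 0 t) (\<lambda>(s, \<tau>). ?D ((z + \<tau> *\<^sub>R w) + s *\<^sub>R v))"
        unfolding split_beta
        by (rule continuous_on_compose2[OF smooth_continuous[OF sD, of UNIV]]) (auto intro!: continuous_intros)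
      show "(\<lambda>\<tau>. dir_deriv w f (z + \<tau> *\<^sub>R w + s *\<^sub>R v)) integrable_on cbox 0 t" for s
        by (intro integrable_continuous
          continuous_on_compose2[OF smooth_continuous[OF smooth_dir_deriv[OF f], of UNIV]])
          (auto intro!: continuous_intros)
    qed (auto intro: dir_deriv_line)
    moreover have "integral (cbox 0 t) (\<lambda>\<tau>. dir_deriv w f ((z + \<tau> *\<^sub>R w) + s *\<^sub>R v)) =
       f ((z + t *\<^sub>R w) + s *\<^sub>R v) - f (z + s *\<^sub>R v)" for s
      using I[OF t, of "z + s *\<^sub>R v"] by (auto simp: algebra_simps dest: integral_unique)
    ultimately show ?thesis using a by (auto dest: vector_derivative_unique_at)
  qed
  have "((\<lambda>t. dir_deriv v f (z + t *\<^sub>R w) - dir_deriv v f z) has_vector_derivative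
      dir_deriv w (dir_deriv v f) (z + 0 *\<^sub>R w) - 0) (at 0 within {0..1})"
    by (intro has_vector_derivative_diff dir_deriv_line has_vector_derivative_const) auto
  then have 1: "((\<lambda>t. dir_deriv v f (z + t *\<^sub>R w) - dir_deriv v f z) has_vector_derivative
      dir_deriv w (dir_deriv v f) z) (at 0 within {0..1})" by simp
  have "((\<lambda>t. integral {0..t} (\<lambda>\<tau>. ?D (z + \<tau> *\<^sub>R w))) has_vector_derivative ?D (z + 0 *\<^sub>R w)) (at 0 within {0..1})"
    (is "(?F has_vector_derivative _) _")
    by (intro integral_has_vector_derivative
        continuous_on_compose2[OF smooth_continuous[OF sD, of UNIV]]) (auto intro!: continuous_intros)
  then have 2: "((\<lambda>t. dir_deriv v f (z + t *\<^sub>R w) - dir_deriv v f z) has_vector_derivative ?D z) (at 0 within {0..1})"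
    by (rule_tac has_vector_derivative_transform[of 0 "{0..1}" _ ?F]) (simp_all add: J)
  show ?thesis
    using vector_derivative_unique_within[OF _ 1 2] by (simp add: trivial_limit_within islimpt_Icc)
qed

lemma dir_deriv_commute_fun:
  fixes f :: "'a::euclidean_space \<Rightarrow> 'b::euclidean_space"
  shows "C_infinity f \<Longrightarrow> dir_deriv v (dir_deriv w f) = dir_deriv w (dir_deriv v f)"
  by (rule ext) (rule dir_deriv_commute)

definition dir_derivs :: "'a list \<Rightarrow> ('a::real_normed_vector \<Rightarrow> 'b::real_normed_vector) \<Rightarrow> 'a \<Rightarrow> 'b"
  where "dir_derivs vs f = foldr dir_deriv vs f"

lemma dir_derivs_simps [simp]:
  "dir_derivs [] f = f" "dir_derivs (v # vs) f = dir_deriv v (dir_derivs vs f)"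
  "dir_derivs (us @ vs) f = dir_derivs us (dir_derivs vs f)"
  by (auto simp: dir_derivs_def)

lemma smooth_dir_derivs:
  fixes f :: "'a::euclidean_space \<Rightarrow> 'b::real_normed_vector"
  shows "C_infinity f \<Longrightarrow> C_infinity (dir_derivs vs f)"
  by (induction vs) (auto intro: smooth_dir_deriv)

lemma dir_derivs_commute1:
  fixes f :: "'a::euclidean_space \<Rightarrow> 'b::euclidean_space"
  shows "C_infinity f \<Longrightarrow> dir_derivs vs (dir_deriv v f) = dir_deriv v (dir_derivs vs f)"
  by (induction vs) (auto simp: dir_deriv_commute_fun[OF smooth_dir_derivs])

text \<open>Bridges the coordinate order fixed by \<open>mi_deriv\<close> and the order in which
  directions arise in calculations: for smooth functions a list of directions matters only as a
  multiset.\<close>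

lemma dir_derivs_mset:
  fixes f :: "'a::euclidean_space \<Rightarrow> 'b::euclidean_space"
  assumes f: "C_infinity f"
  shows "mset us = mset vs \<Longrightarrow> dir_derivs us f = dir_derivs vs f"
proof (induction us arbitrary: vs)
  case (Cons u us)
  then have "u \<in> set vs" by (metis list.set_intros(1) set_mset_mset)
  then obtain v1 v2 where vs: "vs = v1 @ u # v2" by (meson split_list)
  then have "dir_derivs us f = dir_derivs (v1 @ v2) f" using Cons.prems by (intro Cons.IH) simp
  then show ?case using vs by (simp add: dir_derivs_commute1[OF smooth_dir_derivs[OF f], symmetric])
qed simp

section \<open>Weighted symbol classes\<close>

text \<open>The finite order k is kept because several estimates are bootstrapped: order k of a
  bracket, an inverse or an exponential is what its own derivative formula needs for order k + 1.
  The costs \<sigma> b may depend on the point, so variables with and without gain are treated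
  uniformly.\<close>

primrec est :: "nat \<Rightarrow> 'a set \<Rightarrow> ('a \<Rightarrow> 'a \<Rightarrow> real) \<Rightarrow> ('a \<Rightarrow> real) \<Rightarrow>
    ('a::euclidean_space \<Rightarrow> 'b::real_normed_vector) \<Rightarrow> bool"
  where
    "est 0 D \<sigma> W f \<longleftrightarrow> (\<exists>C. \<forall>z. norm (f z) \<le> C * W z)"
  | "est (Suc k) D \<sigma> W f \<longleftrightarrow> (\<exists>C. \<forall>z. norm (f z) \<le> C * W z) \<and>
      (\<forall>b\<in>D. est k D \<sigma> (\<lambda>z. W z * \<sigma> b z) (dir_deriv b f))"

text \<open>A derivative in a direction \<open>b \<in> D\<close> costs the factor \<open>\<sigma> b\<close>.\<close>

definition symb :: "'a set \<Rightarrow> ('a \<Rightarrow> 'a \<Rightarrow> real) \<Rightarrow> ('a \<Rightarrow> real) \<Rightarrow>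
    ('a::euclidean_space \<Rightarrow> 'b::real_normed_vector) \<Rightarrow> bool"
  where "symb D \<sigma> W f \<longleftrightarrow> C_infinity f \<and> (\<forall>k. est k D \<sigma> W f)"

lemma symb_smooth: "symb D \<sigma> W f \<Longrightarrow> C_infinity f"
  by (simp add: symb_def)

lemma est_bound: "est k D \<sigma> W f \<Longrightarrow> \<exists>C. \<forall>z. norm (f z) \<le> C * W z"
  by (cases k) auto

lemma symb_bound: "symb D \<sigma> W f \<Longrightarrow> \<exists>C. \<forall>z. norm (f z) \<le> C * W z"
  using est_bound unfolding symb_def by blast

lemma est_SucD: "est (Suc k) D \<sigma> W f \<Longrightarrow> est k D \<sigma> W f"
  by (induction k arbitrary: W f) auto

lemma symb_dir_deriv: "symb D \<sigma> W f \<Longrightarrow> b \<in> D \<Longrightarrow> symb D \<sigma> (\<lambda>z. W z * \<sigma> b z) (dir_deriv b f)"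
  unfolding symb_def using est.simps(2) by (blast intro: smooth_dir_deriv)

lemma est_zero: "est k D \<sigma> W (\<lambda>z. 0)"
proof (induction k arbitrary: W)
  case (Suc k)
  have "dir_deriv b (\<lambda>z::'a. 0::'b) = (\<lambda>z. 0)" for b by auto
  then show ?case using Suc by (auto intro!: exI[of _ 0])
qed (auto intro!: exI[of _ 0])

text \<open>The closed form of the recursion. The recursion takes the derivative in b first, so b is
  the last entry of the list; hence the case distinction from the right end.\<close>

lemma est_list_iff:
  "est k D \<sigma> W f \<longleftrightarrow> (\<forall>ds. set ds \<subseteq> D \<and> length ds \<le> k \<longrightarrow>
    (\<exists>C. \<forall>z. norm (dir_derivs ds f z) \<le> C * (W z * (\<Prod>d\<leftarrow>ds. \<sigma> d z))))"
proof (induction k arbitrary: W f)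
  case (Suc k)
  show ?case
  proof safe
    fix ds assume a: "est (Suc k) D \<sigma> W f" "set ds \<subseteq> D" "length ds \<le> Suc k"
    show "\<exists>C. \<forall>z. norm (dir_derivs ds f z) \<le> C * (W z * (\<Prod>d\<leftarrow>ds. \<sigma> d z))"
    proof (cases ds rule: rev_cases)
      case (snoc es b)
      then have "est k D \<sigma> (\<lambda>z. W z * \<sigma> b z) (dir_deriv b f)" using a by simp
      then have "\<exists>C. \<forall>z. norm (dir_derivs es (dir_deriv b f) z) \<le> C * (W z * \<sigma> b z * (\<Prod>d\<leftarrow>es. \<sigma> d z))"
        using a snoc by (subst (asm) Suc.IH) auto
      then show ?thesis using snoc by (simp add: mult_ac)
    qed (use a in auto)
  next
    assume a: "\<forall>ds. set ds \<subseteq> D \<and> length ds \<le> Suc k \<longrightarrow>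
      (\<exists>C. \<forall>z. norm (dir_derivs ds f z) \<le> C * (W z * (\<Prod>d\<leftarrow>ds. \<sigma> d z)))"
    show "est (Suc k) D \<sigma> W f"
      unfolding est.simps
    proof (intro conjI ballI)
      show "\<exists>C. \<forall>z. norm (f z) \<le> C * W z" using a[rule_format, of "[]"] by simp
      fix b assume b: "b \<in> D"
      show "est k D \<sigma> (\<lambda>z. W z * \<sigma> b z) (dir_deriv b f)"
      proof (subst Suc.IH, intro allI impI)
        fix ds assume "set ds \<subseteq> D \<and> length ds \<le> k"
        then show "\<exists>C. \<forall>z. norm (dir_derivs ds (dir_deriv b f) z) \<le> C * (W z * \<sigma> b z * (\<Prod>d\<leftarrow>ds. \<sigma> d z))"
          using a[rule_format, of "ds @ [b]"] b by (simp add: mult_ac)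
      qed
    qed
  qed
qed auto

lemma symb_list_iff:
  "symb D \<sigma> W f \<longleftrightarrow> C_infinity f \<and> (\<forall>ds. set ds \<subseteq> D \<longrightarrow>
    (\<exists>C. \<forall>z. norm (dir_derivs ds f z) \<le> C * (W z * (\<Prod>d\<leftarrow>ds. \<sigma> d z))))"
  unfolding symb_def est_list_iff by blast

text \<open>Costs are compared only where W is nonzero, because all derivatives under estimate
  vanish where W does. With an indicator function inside the weight, a comparison of costs therefore
  has to hold on a support only.\<close>

lemma est_mono:
  assumes "est k D \<sigma> W f" "D' \<subseteq> D" "\<exists>C. \<forall>z. W z \<le> C * V z"
    and "\<And>b. b \<in> D' \<Longrightarrow> \<exists>C. \<forall>z. W z \<noteq> 0 \<longrightarrow> \<sigma> b z \<le> C * \<tau> b z"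
    and "\<And>z. W z \<ge> 0" "\<And>z. V z \<ge> 0" "\<And>b z. b \<in> D' \<Longrightarrow> \<sigma> b z \<ge> 0" "\<And>b z. b \<in> D' \<Longrightarrow> \<tau> b z \<ge> 0"
  shows "est k D' \<tau> V f"
  using assms
proof (induction k arbitrary: W V f)
  case 0
  then obtain C C' where C: "\<And>z. norm (f z) \<le> C * W z" "\<And>z. W z \<le> C' * V z" by auto
  have "norm (f z) \<le> \<bar>C\<bar> * C' * V z" for z
  proof -
    have "norm (f z) \<le> \<bar>C\<bar> * W z" using C(1)[of z] 0(5)[of z]
      by (meson abs_ge_self mult_right_mono order_trans)
    also have "\<dots> \<le> \<bar>C\<bar> * (C' * V z)" using C(2) by (intro mult_left_mono) auto
    finally show ?thesis by (simp add: mult_ac)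
  qed
  then show ?case by auto
next
  case (Suc k)
  have "est 0 D' \<tau> V f"
  proof -
    obtain C C' where C: "\<And>z. norm (f z) \<le> C * W z" "\<And>z. W z \<le> C' * V z" using Suc.prems by auto
    have "norm (f z) \<le> \<bar>C\<bar> * C' * V z" for z
    proof -
      have "norm (f z) \<le> \<bar>C\<bar> * W z" using C(1)[of z] Suc(6)[of z]
        by (meson abs_ge_self mult_right_mono order_trans)
      also have "\<dots> \<le> \<bar>C\<bar> * (C' * V z)" using C(2) by (intro mult_left_mono) auto
      finally show ?thesis by (simp add: mult_ac)
    qed
    then show ?thesis by auto
  qed
  moreover have "est k D' \<tau> (\<lambda>z. V z * \<tau> b z) (dir_deriv b f)" if b: "b \<in> D'" for b
  proof (rule Suc.IH)
    show "est k D \<sigma> (\<lambda>z. W z * \<sigma> b z) (dir_deriv b f)" using Suc.prems b by auto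
    obtain C where C: "\<And>z. W z \<le> C * V z" using Suc.prems by auto
    obtain C' where C': "\<And>z. W z \<noteq> 0 \<Longrightarrow> \<sigma> b z \<le> C' * \<tau> b z" using Suc.prems(4)[OF b] by auto
    have "W z * \<sigma> b z \<le> \<bar>C\<bar> * \<bar>C'\<bar> * (V z * \<tau> b z)" for z
    proof (cases "W z = 0")
      case False
      have "W z \<le> \<bar>C\<bar> * V z" "\<sigma> b z \<le> \<bar>C'\<bar> * \<tau> b z"
        using C[of z] C'[OF False] Suc.prems(6,8) b
        by (meson abs_ge_self mult_right_mono order_trans)+
      then have "W z * \<sigma> b z \<le> (\<bar>C\<bar> * V z) * (\<bar>C'\<bar> * \<tau> b z)"
        using Suc.prems b by (intro mult_mono) auto
      then show ?thesis by (simp add: mult_ac)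
    qed (use Suc.prems b in auto)
    then show "\<exists>C. \<forall>z. W z * \<sigma> b z \<le> C * (V z * \<tau> b z)" by blast
    show "\<exists>C. \<forall>z. W z * \<sigma> b z \<noteq> 0 \<longrightarrow> \<sigma> d z \<le> C * \<tau> d z" if "d \<in> D'" for d
      using Suc.prems(4)[OF that] by auto
  qed (use Suc.prems b in auto)
  ultimately show ?case by simp
qed

lemma symb_mono:
  assumes "symb D \<sigma> W f" "D' \<subseteq> D" "\<exists>C. \<forall>z. W z \<le> C * V z"
    and "\<And>b. b \<in> D' \<Longrightarrow> \<exists>C. \<forall>z. W z \<noteq> 0 \<longrightarrow> \<sigma> b z \<le> C * \<tau> b z"
    and "\<And>z. W z \<ge> 0" "\<And>z. V z \<ge> 0" "\<And>b z. b \<in> D' \<Longrightarrow> \<sigma> b z \<ge> 0" "\<And>b z. b \<in> D' \<Longrightarrow> \<tau> b z \<ge> 0"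
  shows "symb D' \<tau> V f"
  using assms est_mono[of _ D \<sigma> W f D' V \<tau>] unfolding symb_def by blast

lemma symb_weight_mono:
  assumes "symb D \<sigma> W f" "\<And>z. W z \<le> C * V z"
    and "\<And>z. W z \<ge> 0" "\<And>z. V z \<ge> 0" "\<And>b z. b \<in> D \<Longrightarrow> \<sigma> b z \<ge> 0"
  shows "symb D \<sigma> V f"
proof (rule symb_mono[OF assms(1) subset_refl])
  show "\<exists>C. \<forall>z. W z \<noteq> 0 \<longrightarrow> \<sigma> b z \<le> C * \<sigma> b z" for b by (rule exI[of _ 1]) simp
qed (use assms in auto)

lemma est_weight_mono:
  assumes "est k D \<sigma> W f" "\<And>z. W z \<le> C * V z"
    and "\<And>z. W z \<ge> 0" "\<And>z. V z \<ge> 0" "\<And>b z. b \<in> D \<Longrightarrow> \<sigma> b z \<ge> 0"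
  shows "est k D \<sigma> V f"
proof (rule est_mono[OF assms(1) subset_refl])
  show "\<exists>C. \<forall>z. W z \<noteq> 0 \<longrightarrow> \<sigma> b z \<le> C * \<sigma> b z" for b by (rule exI[of _ 1]) simp
qed (use assms in auto)

lemma est_add:
  assumes "C_infinity f" "C_infinity g"
  shows "est k D \<sigma> W f \<Longrightarrow> est k D \<sigma> W g \<Longrightarrow> est k D \<sigma> W (\<lambda>z. f z + g z)"
  using assms
proof (induction k arbitrary: W f g)
  case (Suc k)
  have *: "\<exists>C. \<forall>z. norm (f z + g z) \<le> C * W z"
  proof -
    obtain C C' where "\<And>z. norm (f z) \<le> C * W z" "\<And>z. norm (g z) \<le> C' * W z" using Suc.prems by auto
    then show ?thesis
      by (intro exI[of _ "C + C'"]) (auto simp: distrib_right intro: norm_triangle_mono)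
  qed
  have "dir_deriv b (\<lambda>z. f z + g z) = (\<lambda>z. dir_deriv b f z + dir_deriv b g z)" for b
    using Suc.prems by (auto simp: dir_deriv_add smooth_differentiable)
  then show ?case using Suc * by (auto simp: smooth_dir_deriv)
next
  case 0
  then obtain C C' where "\<And>z. norm (f z) \<le> C * W z" "\<And>z. norm (g z) \<le> C' * W z" by auto
  then show ?case
    by (auto simp: distrib_right intro!: exI[of _ "C + C'"] norm_triangle_mono)
qed

lemma symb_add: "symb D \<sigma> W f \<Longrightarrow> symb D \<sigma> W g \<Longrightarrow> symb D \<sigma> W (\<lambda>z. f z + g z)"
  by (simp add: symb_def est_add smooth_add)

lemma symb_zero: "symb D \<sigma> W (\<lambda>z. 0)"
  by (simp add: symb_def est_zero smooth_const)

lemma symb_sum: "(\<And>i. i \<in> I \<Longrightarrow> symb D \<sigma> W (f i)) \<Longrightarrow> symb D \<sigma> W (\<lambda>z. \<Sum>i\<in>I. f i z)"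
  by (induction I rule: infinite_finite_induct) (auto intro: symb_add symb_zero)

lemma est_linear:
  assumes "bounded_linear l" "C_infinity f"
  shows "est k D \<sigma> W f \<Longrightarrow> est k D \<sigma> W (\<lambda>z. l (f z))"
  using assms(2)
proof (induction k arbitrary: W f)
  case 0
  obtain K where K: "\<And>x. norm (l x) \<le> norm x * K" "K > 0" using bounded_linear.pos_bounded[OF assms(1)] by blast
  obtain C where "\<And>z. norm (f z) \<le> C * W z" using 0 by auto
  then have "norm (l (f z)) \<le> C * K * W z" for z
    using order_trans[OF K(1) mult_right_mono[of _ "C * W z" K]] K(2) by (simp add: mult_ac)
  then show ?case by auto
next
  case (Suc k)
  obtain K where K: "\<And>x. norm (l x) \<le> norm x * K" "K > 0" using bounded_linear.pos_bounded[OF assms(1)] by blast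
  obtain C where "\<And>z. norm (f z) \<le> C * W z" using Suc by auto
  then have *: "norm (l (f z)) \<le> C * K * W z" for z
    using order_trans[OF K(1) mult_right_mono[of _ "C * W z" K]] K(2) by (simp add: mult_ac)
  have "dir_deriv b (\<lambda>z. l (f z)) = (\<lambda>z. l (dir_deriv b f z))" for b
    using Suc.prems assms(1) by (auto simp: dir_deriv_linear smooth_differentiable)
  then show ?case using Suc * by (auto simp: smooth_dir_deriv)
qed

lemma symb_linear: "bounded_linear l \<Longrightarrow> symb D \<sigma> W f \<Longrightarrow> symb D \<sigma> W (\<lambda>z. l (f z))"
  by (simp add: symb_def est_linear smooth_linear)

lemmas symb_uminus = symb_linear[OF bounded_linear_minus[OF bounded_linear_ident]]
lemmas symb_of_real = symb_linear[OF bounded_linear_of_real]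
lemmas symb_mult_left = symb_linear[OF bounded_linear_mult_right]

lemma symb_diff: "symb D \<sigma> W f \<Longrightarrow> symb D \<sigma> W g \<Longrightarrow> symb D \<sigma> W (\<lambda>z. f z - g z)"
  using symb_add[OF _ symb_uminus, of D \<sigma> W f g] by simp

lemma est_bilinear:
  assumes p: "bounded_bilinear p" and "C_infinity f" "C_infinity g"
  shows "est k D \<sigma> W f \<Longrightarrow> est k D \<sigma> V g \<Longrightarrow> est k D \<sigma> (\<lambda>z. W z * V z) (\<lambda>z. p (f z) (g z))"
  using assms(2,3)
proof (induction k arbitrary: W V f g)
  case 0
  obtain K where K: "\<And>x y. norm (p x y) \<le> norm x * norm y * K" "K > 0"
    using bounded_bilinear.pos_bounded[OF p] by blast
  obtain C C' where C: "\<And>z. norm (f z) \<le> C * W z" "\<And>z. norm (g z) \<le> C' * V z" using 0 by auto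
  have "norm (p (f z) (g z)) \<le> C * C' * K * (W z * V z)" for z
  proof -
    have "norm (f z) * norm (g z) \<le> (C * W z) * (C' * V z)"
      using C by (intro mult_mono) (auto intro: order_trans[OF norm_ge_zero])
    then have "norm (f z) * norm (g z) * K \<le> (C * W z) * (C' * V z) * K" using K by simp
    then show ?thesis using K(1)[of "f z" "g z"] by (simp add: mult_ac)
  qed
  then show ?case by auto
next
  case (Suc k)
  obtain K where K: "\<And>x y. norm (p x y) \<le> norm x * norm y * K" "K > 0"
    using bounded_bilinear.pos_bounded[OF p] by blast
  obtain C C' where C: "\<And>z. norm (f z) \<le> C * W z" "\<And>z. norm (g z) \<le> C' * V z" using Suc by auto
  have *: "norm (p (f z) (g z)) \<le> C * C' * K * (W z * V z)" for z
  proof -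
    have "norm (f z) * norm (g z) \<le> (C * W z) * (C' * V z)"
      using C by (intro mult_mono) (auto intro: order_trans[OF norm_ge_zero])
    then have "norm (f z) * norm (g z) * K \<le> (C * W z) * (C' * V z) * K" using K by simp
    then show ?thesis using K(1)[of "f z" "g z"] by (simp add: mult_ac)
  qed
  have eq: "dir_deriv b (\<lambda>z. p (f z) (g z)) = (\<lambda>z. p (f z) (dir_deriv b g z) + p (dir_deriv b f z) (g z))" for b
    using Suc.prems p by (auto simp: dir_deriv_bilinear smooth_differentiable)
  have "est k D \<sigma> (\<lambda>z. W z * V z * \<sigma> b z) (\<lambda>z. p (f z) (dir_deriv b g z) + p (dir_deriv b f z) (g z))"
    if b: "b \<in> D" for b
  proof (intro est_add)
    have "est k D \<sigma> (\<lambda>z. W z * (V z * \<sigma> b z)) (\<lambda>z. p (f z) (dir_deriv b g z))"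
      using Suc.prems b est_SucD[OF Suc.prems(1)] by (intro Suc.IH) (auto simp: smooth_dir_deriv)
    then show "est k D \<sigma> (\<lambda>z. W z * V z * \<sigma> b z) (\<lambda>z. p (f z) (dir_deriv b g z))"
      by (simp add: mult_ac)
    have "est k D \<sigma> (\<lambda>z. (W z * \<sigma> b z) * V z) (\<lambda>z. p (dir_deriv b f z) (g z))"
      using Suc.prems b est_SucD[OF Suc.prems(2)] by (intro Suc.IH) (auto simp: smooth_dir_deriv)
    then show "est k D \<sigma> (\<lambda>z. W z * V z * \<sigma> b z) (\<lambda>z. p (dir_deriv b f z) (g z))"
      by (simp add: mult_ac)
  qed (use Suc.prems p in \<open>auto intro: smooth_bilinear smooth_dir_deriv\<close>)
  with * eq show ?case by auto
qed

lemma symb_bilinear: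
  "bounded_bilinear p \<Longrightarrow> symb D \<sigma> W f \<Longrightarrow> symb D \<sigma> V g \<Longrightarrow>
    symb D \<sigma> (\<lambda>z. W z * V z) (\<lambda>z. p (f z) (g z))"
  by (simp add: symb_def est_bilinear smooth_bilinear)

lemmas symb_mult = symb_bilinear[OF bounded_bilinear_mult]

lemma symb_const: "symb D \<sigma> (\<lambda>z. 1) (\<lambda>z. c)"
proof -
  have *: "dir_deriv b (\<lambda>z::'a. c) = (\<lambda>z. 0)" for b by auto
  have "est k D \<sigma> (\<lambda>z. 1) (\<lambda>z. c)" for k
    by (cases k) (auto simp: * est_zero)
  then show ?thesis by (simp add: symb_def smooth_const)
qed

lemma symb_SucI:
  assumes "C_infinity f" "\<And>z. norm (f z) \<le> C * W z"
    and "\<And>b. b \<in> D \<Longrightarrow> symb D \<sigma> (\<lambda>z. W z * \<sigma> b z) (dir_deriv b f)"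
  shows "symb D \<sigma> W f"
proof -
  have "est k D \<sigma> W f" for k
    using assms by (cases k) (auto simp: symb_def)
  then show ?thesis using assms by (simp add: symb_def)
qed

text \<open>The weights are matched through the chain rule: \<omega> b * \<tau> c is the size of the
  b-derivative of the component g . c, and \<sigma> c is the cost of differentiating f in c. The
  product \<sigma> c * \<tau> c has to be bounded only where the weight is nonzero, which is how
  cutoffs enter.\<close>

lemma est_compose:
  fixes f :: "'b::euclidean_space \<Rightarrow> 'c::real_normed_vector" and g :: "'a::euclidean_space \<Rightarrow> 'b"
  assumes f: "C_infinity f" and g: "C_infinity g"
    and "est k Basis \<sigma> W f"
    and "\<And>b c. b \<in> D \<Longrightarrow> c \<in> Basis \<Longrightarrow> est k D \<omega> (\<lambda>z. \<omega> b z * \<tau> c z) (dir_deriv b (\<lambda>z. g z \<bullet> c))"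
    and "\<And>c. c \<in> Basis \<Longrightarrow> \<exists>C. \<forall>z. W (g z) \<noteq> 0 \<longrightarrow> \<sigma> c (g z) * \<tau> c z \<le> C"
    and "\<And>z. W z \<ge> 0" and nn: "\<And>c z. c \<in> Basis \<Longrightarrow> \<sigma> c z \<ge> 0" "\<And>c z. c \<in> Basis \<Longrightarrow> \<tau> c z \<ge> 0"
      "\<And>b z. b \<in> D \<Longrightarrow> \<omega> b z \<ge> 0"
  shows "est k D \<omega> (\<lambda>z. W (g z)) (\<lambda>z. f (g z))"
  using f assms(3-6)
proof (induction k arbitrary: f W)
  case (Suc k)
  have eq: "dir_deriv b (\<lambda>z. f (g z)) =
      (\<lambda>z. \<Sum>c\<in>Basis. dir_deriv b (\<lambda>z. g z \<bullet> c) z *\<^sub>R dir_deriv c f (g z))" for b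
    using Suc.prems(1) g by (auto simp: dir_deriv_compose smooth_differentiable)
  have sg: "C_infinity (dir_deriv b (\<lambda>z. g z \<bullet> c))" for b c
    by (intro smooth_intros g)
  have sf: "C_infinity (\<lambda>z. dir_deriv c f (g z))" for c
    by (intro smooth_compose[OF smooth_dir_deriv] g Suc.prems)
  have "est k D \<omega> (\<lambda>z. W (g z) * \<omega> b z)
      (\<lambda>z. \<Sum>c\<in>Basis. dir_deriv b (\<lambda>z. g z \<bullet> c) z *\<^sub>R dir_deriv c f (g z))" if b: "b \<in> D" for b
  proof -
    have 1: "est k D \<omega> (\<lambda>z. W (g z) * \<omega> b z) (\<lambda>z. dir_deriv b (\<lambda>z. g z \<bullet> c) z *\<^sub>R dir_deriv c f (g z))"
      if c: "c \<in> Basis" for c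
    proof -
      have "est k D \<omega> (\<lambda>z. W (g z) * \<sigma> c (g z)) (\<lambda>z. dir_deriv c f (g z))"
      proof (rule Suc.IH[where W = "\<lambda>z. W z * \<sigma> c z"])
        show "est k D \<omega> (\<lambda>z. \<omega> b z * \<tau> c z) (dir_deriv b (\<lambda>z. g z \<bullet> c))" if "b \<in> D" "c \<in> Basis" for b c
          using Suc.prems(3)[OF that] by (rule est_SucD)
        show "\<exists>C. \<forall>z. W (g z) * \<sigma> c (g z) \<noteq> 0 \<longrightarrow> \<sigma> d (g z) * \<tau> d z \<le> C" if "d \<in> Basis" for d
          using Suc.prems(4)[OF that] by auto
      qed (use Suc.prems nn c in \<open>auto intro: smooth_dir_deriv\<close>)
      with Suc.prems(3)[OF b c, THEN est_SucD]
      have a: "est k D \<omega> (\<lambda>z. (\<omega> b z * \<tau> c z) * (W (g z) * \<sigma> c (g z)))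
          (\<lambda>z. dir_deriv b (\<lambda>z. g z \<bullet> c) z *\<^sub>R dir_deriv c f (g z))"
        by (intro est_bilinear[OF bounded_bilinear_scaleR] sg sf)
      obtain C where C: "\<And>z. W (g z) \<noteq> 0 \<Longrightarrow> \<sigma> c (g z) * \<tau> c z \<le> C" using Suc.prems(4)[OF c] by auto
      have "(\<omega> b z * \<tau> c z) * (W (g z) * \<sigma> c (g z)) \<le> C * (W (g z) * \<omega> b z)" for z
      proof (cases "W (g z) = 0")
        case False
        have "(\<sigma> c (g z) * \<tau> c z) * (W (g z) * \<omega> b z) \<le> C * (W (g z) * \<omega> b z)"
          using C[OF False] Suc.prems nn b by (intro mult_right_mono) auto
        then show ?thesis by (simp add: mult_ac)
      qed simp
      then show ?thesis
        using Suc.prems nn b c by (rule_tac est_weight_mono[OF a, of C]) auto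
    qed
    have "est k D \<omega> (\<lambda>z. W (g z) * \<omega> b z) (\<lambda>z. \<Sum>c\<in>B. dir_deriv b (\<lambda>z. g z \<bullet> c) z *\<^sub>R dir_deriv c f (g z))"
      if "B \<subseteq> Basis" for B
      using finite_subset[OF that finite_Basis] that
      by (induction B) (auto intro!: est_zero est_add 1 smooth_sum smooth_scaleR sg sf)
    then show ?thesis by blast
  qed
  moreover have "\<exists>C. \<forall>z. norm (f (g z)) \<le> C * W (g z)" using Suc.prems(2) by auto
  ultimately show ?case by (simp add: eq)
qed auto

lemma symb_compose:
  fixes f :: "'b::euclidean_space \<Rightarrow> 'c::real_normed_vector" and g :: "'a::euclidean_space \<Rightarrow> 'b"
  assumes "symb Basis \<sigma> W f" and g: "C_infinity g"
    and "\<And>b c. b \<in> D \<Longrightarrow> c \<in> Basis \<Longrightarrow> symb D \<omega> (\<lambda>z. \<omega> b z * \<tau> c z) (dir_deriv b (\<lambda>z. g z \<bullet> c))"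
    and "\<And>c. c \<in> Basis \<Longrightarrow> \<exists>C. \<forall>z. W (g z) \<noteq> 0 \<longrightarrow> \<sigma> c (g z) * \<tau> c z \<le> C"
    and "\<And>z. W z \<ge> 0" and "\<And>c z. c \<in> Basis \<Longrightarrow> \<sigma> c z \<ge> 0" "\<And>c z. c \<in> Basis \<Longrightarrow> \<tau> c z \<ge> 0"
      "\<And>b z. b \<in> D \<Longrightarrow> \<omega> b z \<ge> 0"
  shows "symb D \<omega> (\<lambda>z. W (g z)) (\<lambda>z. f (g z))"
  unfolding symb_def
proof (intro conjI allI)
  show "C_infinity (\<lambda>z. f (g z))" using assms by (intro smooth_compose[of f g]) (simp_all only: symb_def)
  show "est k D \<omega> (\<lambda>z. W (g z)) (\<lambda>z. f (g z))" for k
    by (rule est_compose[OF _ g, where \<sigma> = \<sigma> and \<tau> = \<tau>]) (use assms in \<open>simp_all add: symb_def\<close>)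
qed

text \<open>In directions in which g is affine, a derivative of the composition is a single
  derivative of f. So f may be controlled in the selected directions \<open>D'\<close> only, and
  directions that g forgets (L b = 0) contribute 0.\<close>

lemma est_affine:
  fixes f :: "'b::euclidean_space \<Rightarrow> 'c::real_normed_vector" and g :: "'a::euclidean_space \<Rightarrow> 'b"
  assumes g: "\<And>b z t. b \<in> D \<Longrightarrow> g (z + t *\<^sub>R b) = g z + t *\<^sub>R L b"
    and L: "\<And>b. b \<in> D \<Longrightarrow> L b = 0 \<or> (L b \<in> D' \<and> (\<forall>z. \<sigma> (L b) (g z) \<le> \<omega> b z))"
    and "est k D' \<sigma> W f"
    and "\<And>z. W z \<ge> 0" and nn: "\<And>c z. c \<in> D' \<Longrightarrow> \<sigma> c z \<ge> 0" "\<And>b z. b \<in> D \<Longrightarrow> \<omega> b z \<ge> 0"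
  shows "est k D \<omega> (\<lambda>z. W (g z)) (\<lambda>z. f (g z))"
  using assms(3,4)
proof (induction k arbitrary: f W)
  case (Suc k)
  have eq: "dir_deriv b (\<lambda>z. f (g z)) = (\<lambda>z. dir_deriv (L b) f (g z))" if "b \<in> D" for b
    using g[OF that] by (auto simp: dir_deriv_def)
  have "est k D \<omega> (\<lambda>z. W (g z) * \<omega> b z) (\<lambda>z. dir_deriv (L b) f (g z))" if b: "b \<in> D" for b
    using L[OF b]
  proof
    assume "L b = 0" then show ?thesis by (simp add: est_zero)
  next
    assume l: "L b \<in> D' \<and> (\<forall>z. \<sigma> (L b) (g z) \<le> \<omega> b z)"
    then have "est k D \<omega> (\<lambda>z. W (g z) * \<sigma> (L b) (g z)) (\<lambda>z. dir_deriv (L b) f (g z))"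
      using Suc.prems nn by (intro Suc.IH[where W = "\<lambda>z. W z * \<sigma> (L b) z"]) auto
    then show ?thesis
    proof (rule est_weight_mono[where C = 1])
      show "W (g z) * \<sigma> (L b) (g z) \<le> 1 * (W (g z) * \<omega> b z)" for z
        using l Suc.prems(2) by (simp add: mult_left_mono)
    qed (use l Suc.prems(2) nn b in simp_all)
  qed
  moreover have "\<exists>C. \<forall>z. norm (f (g z)) \<le> C * W (g z)" using Suc.prems(1) by auto
  ultimately show ?case by (simp add: eq)
qed auto

lemma symb_affine:
  fixes f :: "'b::euclidean_space \<Rightarrow> 'c::real_normed_vector" and g :: "'a::euclidean_space \<Rightarrow> 'b"
  assumes "symb D' \<sigma> W f" and "C_infinity g"
    and "\<And>b z t. b \<in> D \<Longrightarrow> g (z + t *\<^sub>R b) = g z + t *\<^sub>R L b"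
    and "\<And>b. b \<in> D \<Longrightarrow> L b = 0 \<or> (L b \<in> D' \<and> (\<forall>z. \<sigma> (L b) (g z) \<le> \<omega> b z))"
    and "\<And>z. W z \<ge> 0" and "\<And>c z. c \<in> D' \<Longrightarrow> \<sigma> c z \<ge> 0" "\<And>b z. b \<in> D \<Longrightarrow> \<omega> b z \<ge> 0"
  shows "symb D \<omega> (\<lambda>z. W (g z)) (\<lambda>z. f (g z))"
  unfolding symb_def
proof (intro conjI allI)
  show "C_infinity (\<lambda>z. f (g z))" using assms by (intro smooth_compose[of f g]) (simp_all only: symb_def)
  show "est k D \<omega> (\<lambda>z. W (g z)) (\<lambda>z. f (g z))" for k
    using assms(1,3-) by (intro est_affine[of D g L D' \<sigma> \<omega>]) (simp_all only: symb_def)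
qed

lemma dir_deriv_inverse:
  fixes f :: "'a::real_normed_vector \<Rightarrow> real"
  assumes "f x \<noteq> 0" "f differentiable (at x)"
  shows "dir_deriv v (\<lambda>x. inverse (f x)) x = - (dir_deriv v f x * (inverse (f x) * inverse (f x)))"
proof -
  have "(inverse has_vector_derivative - (inverse (f x) * inverse (f x))) (at (f x))"
    using assms unfolding has_real_derivative_iff_has_vector_derivative[symmetric]
    by (auto intro!: derivative_eq_intros simp: power2_eq_square)
  from dir_deriv_real_compose[where f = inverse and g = f, OF this assms(2)] show ?thesis by simp
qed

lemma dir_deriv_cis:
  assumes "f differentiable (at x)"
  shows "dir_deriv v (\<lambda>x. exp (\<i> * complex_of_real (f x))) x =
    \<i> * complex_of_real (dir_deriv v f x) * exp (\<i> * complex_of_real (f x))"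
  using dir_deriv_real_compose[OF has_vector_derivative_cis assms] by (simp add: scaleR_conv_of_real mult_ac)

text \<open>The derivative of 1 / Q is - Q' / Q^2, where Q' carries the weight V \<sigma> and each
  factor 1 / Q the weight 1 / V known at order k. The ellipticity V \<le> C Q gives order 0.\<close>

lemma est_inverse:
  fixes Q :: "'a::euclidean_space \<Rightarrow> real"
  assumes Q: "C_infinity Q" "\<And>z. Q z > 0" "\<And>z. V z \<le> C * Q z" "\<And>z. V z > 0"
    and nn: "\<And>b z. b \<in> D \<Longrightarrow> \<sigma> b z \<ge> 0"
  shows "est k D \<sigma> V Q \<Longrightarrow> est k D \<sigma> (\<lambda>z. inverse (V z)) (\<lambda>z. inverse (Q z))"
proof (induction k)
  case 0
  have "norm (inverse (Q z)) \<le> C * inverse (V z)" for z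
    using Q(2,3,4)[of z] by (simp add: field_simps)
  then show ?case by auto
next
  case (Suc k)
  have nz: "Q z \<noteq> 0" for z using Q(2)[of z] by simp
  have b: "norm (inverse (Q z)) \<le> C * inverse (V z)" for z
    using Q(2,3,4)[of z] by (simp add: field_simps)
  have eq: "dir_deriv b (\<lambda>z. inverse (Q z)) = (\<lambda>z. - (dir_deriv b Q z * (inverse (Q z) * inverse (Q z))))" for b
    using Q by (auto simp: dir_deriv_inverse smooth_differentiable nz)
  have e: "est k D \<sigma> (\<lambda>z. inverse (V z)) (\<lambda>z. inverse (Q z))" using Suc est_SucD by blast
  have s: "C_infinity (\<lambda>z. inverse (Q z))" using smooth_inverse[of Q] Q nz by blast
  have "est k D \<sigma> (\<lambda>z. inverse (V z) * \<sigma> b z)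
      (\<lambda>z. - (dir_deriv b Q z * (inverse (Q z) * inverse (Q z))))" if "b \<in> D" for b
  proof -
    have "est k D \<sigma> (\<lambda>z. (V z * \<sigma> b z) * (inverse (V z) * inverse (V z)))
        (\<lambda>z. dir_deriv b Q z * (inverse (Q z) * inverse (Q z)))"
      using Suc.prems that Q s e by (intro est_bilinear[OF bounded_bilinear_mult] smooth_intros) auto
    moreover have "(V z * \<sigma> b z) * (inverse (V z) * inverse (V z)) = inverse (V z) * \<sigma> b z" for z
      using Q(4)[of z] by (simp add: field_simps)
    ultimately show ?thesis
      using est_linear[OF bounded_linear_minus[OF bounded_linear_ident],
        where f = "\<lambda>z. dir_deriv b Q z * (inverse (Q z) * inverse (Q z))"] s Q
      by (simp add: smooth_mult smooth_dir_deriv)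
  qed
  then show ?case using b by (auto simp: eq)
qed

lemma symb_inverse:
  fixes Q :: "'a::euclidean_space \<Rightarrow> real"
  assumes "symb D \<sigma> V Q" "\<And>z. Q z > 0" "\<And>z. V z \<le> C * Q z" "\<And>z. V z > 0"
    and "\<And>b z. b \<in> D \<Longrightarrow> \<sigma> b z \<ge> 0"
  shows "symb D \<sigma> (\<lambda>z. inverse (V z)) (\<lambda>z. inverse (Q z))"
proof -
  have "Q z \<noteq> 0" for z using assms(2)[of z] by simp
  then show ?thesis using assms est_inverse[of Q V C D \<sigma>] unfolding symb_def
    by (simp add: smooth_inverse)
qed

text \<open>Here \<sigma> b is itself the size of the b-derivative of the phase. That is the factor
  each derivative of the exponential brings down, and derivatives falling on such factors cost no
  more.\<close>

lemma symb_cis: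
  fixes f :: "'a::euclidean_space \<Rightarrow> real"
  assumes f: "C_infinity f" and d: "\<And>b. b \<in> D \<Longrightarrow> symb D \<sigma> (\<sigma> b) (dir_deriv b f)"
  shows "symb D \<sigma> (\<lambda>z. 1) (\<lambda>z. exp (\<i> * complex_of_real (f z)))"
proof -
  let ?E = "\<lambda>z. exp (\<i> * complex_of_real (f z))"
  have s: "C_infinity ?E" using f by (rule smooth_cis)
  have eq: "dir_deriv b ?E = (\<lambda>z. \<i> * complex_of_real (dir_deriv b f z) * ?E z)" for b
    using f by (auto simp: dir_deriv_cis smooth_differentiable)
  have "est k D \<sigma> (\<lambda>z. 1) ?E" for k
  proof (induction k)
    case 0 then show ?case by (auto intro: exI[of _ 1])
  next
    case (Suc k)
    have "est k D \<sigma> (\<lambda>z. \<sigma> b z * 1) (\<lambda>z. \<i> * complex_of_real (dir_deriv b f z) * ?E z)" if "b \<in> D" for b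
      using d[OF that] Suc s
      by (intro est_bilinear[OF bounded_bilinear_mult] smooth_intros f
        est_linear[OF bounded_linear_mult_right] est_linear[OF bounded_linear_of_real]) (auto simp: symb_def)
    then show ?case by (auto simp: eq intro: exI[of _ 1])
  qed
  then show ?thesis using s by (simp add: symb_def)
qed

section \<open>Brackets as weights and as symbols\<close>

lemma bracket_ge_1: "bracket x \<ge> 1"
  by (simp add: bracket_def)

lemma bracket_pos: "bracket x > 0"
  using bracket_ge_1[of x] by linarith

lemma bracket_nz [simp]: "bracket x \<noteq> 0"
  using bracket_pos[of x] by simp

lemma bracket_nonneg [simp]: "bracket x \<ge> 0"
  using bracket_pos[of x] by simp

lemma norm_le_bracket: "norm x \<le> bracket x"
  unfolding bracket_def by (rule real_le_rsqrt) simp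

lemma abs_inner_le_bracket: "b \<in> Basis \<Longrightarrow> \<bar>x \<bullet> b\<bar> \<le> bracket x"
  using Basis_le_norm norm_le_bracket order_trans by blast

lemma bracket_sq: "(bracket x)\<^sup>2 = 1 + (norm x)\<^sup>2"
  by (simp add: bracket_def)

lemma bracket_le_norm: "bracket x \<le> 1 + norm x"
  unfolding bracket_def by (rule real_le_lsqrt) (auto simp: power2_eq_square algebra_simps)

lemma bracket_mono: "norm x \<le> norm y \<Longrightarrow> bracket x \<le> bracket y"
  by (simp add: bracket_def power_mono)

lemma bracket_add_le: "bracket (x + y) \<le> bracket x + norm y"
proof (rule power2_le_imp_le)
  have "(norm (x + y))\<^sup>2 \<le> (norm x + norm y)\<^sup>2"
    by (simp add: norm_triangle_ineq power_mono)
  also have "\<dots> \<le> (norm x)\<^sup>2 + 2 * (bracket x * norm y) + (norm y)\<^sup>2"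
    using mult_right_mono[OF norm_le_bracket[of x] norm_ge_zero[of y]] by (simp add: power2_sum)
  finally show "(bracket (x + y))\<^sup>2 \<le> (bracket x + norm y)\<^sup>2"
    by (simp add: bracket_sq power2_sum)
qed (simp add: add_nonneg_nonneg)

lemma bracket_peetre: "bracket (x + y) \<le> 2 * bracket x * bracket y"
proof -
  have "bracket (x + y) \<le> bracket x + bracket y"
    using bracket_add_le[of x y] norm_le_bracket[of y] by simp
  also have "\<dots> \<le> bracket x * bracket y + bracket x * bracket y"
    using mult_left_mono[OF bracket_ge_1[of y] bracket_nonneg[of x]]
      mult_right_mono[OF bracket_ge_1[of x] bracket_nonneg[of y]] by simp
  finally show ?thesis by simp
qed

text \<open>Peetre's inequality. For m < 0 it is the case - m applied to x = (x + y) + (- y), hence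
  the exponent |m| on the bracket of y.\<close>

lemma bracket_powr_peetre:
  "bracket (x + y) powr m \<le> 2 powr \<bar>m\<bar> * bracket x powr m * bracket y powr \<bar>m\<bar>"
proof (cases "m \<ge> 0")
  case True
  have "bracket (x + y) powr m \<le> (2 * bracket x * bracket y) powr m"
    using True bracket_peetre by (intro powr_mono2) auto
  then show ?thesis using True by (simp add: powr_mult)
next
  case False
  have "bracket x \<le> 2 * bracket (x + y) * bracket y"
    using bracket_peetre[of "x + y" "- y"] by (simp add: bracket_def)
  then have "bracket x powr (- m) \<le> (2 * bracket (x + y) * bracket y) powr (- m)"
    using False by (intro powr_mono2) auto
  also have "\<dots> = 2 powr (- m) * bracket (x + y) powr (- m) * bracket y powr (- m)"
    by (simp add: powr_mult)
  finally have "inverse (bracket x powr m) \<le> 2 powr (- m) * inverse (bracket (x + y) powr m) * bracket y powr (- m)"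
    by (simp only: powr_minus[of "bracket x"] powr_minus[of "bracket (x + y)"])
  moreover have "bracket x powr m > 0" "bracket (x + y) powr m > 0" by simp_all
  moreover have "\<bar>m\<bar> = - m" using False by simp
  ultimately show ?thesis by (simp only:) (simp add: field_simps)
qed

lemma sqrt_add_sq_gt_0: "0 < 1 + (norm x)\<^sup>2"
  by (simp add: add_pos_nonneg)

lemma dir_deriv_bracket:
  fixes x :: "'a::euclidean_space"
  shows "bracket differentiable (at x)" "dir_deriv b bracket x = (x \<bullet> b) * inverse (bracket x)"
proof -
  have eq: "bracket = (\<lambda>x::'a. sqrt (1 + x \<bullet> x))" by (auto simp: bracket_def power2_norm_eq_inner)
  have "0 < 1 + x \<bullet> x" using sqrt_add_sq_gt_0[of x] by (simp add: power2_norm_eq_inner)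
  then have d: "((\<lambda>x::'a. sqrt (1 + x \<bullet> x)) has_derivative (\<lambda>h. (x \<bullet> h) * inverse (sqrt (1 + x \<bullet> x)))) (at x)"
    by (auto intro!: derivative_eq_intros simp: inner_commute field_simps)
  then show "bracket differentiable (at x)" "dir_deriv b bracket x = (x \<bullet> b) * inverse (bracket x)"
    using dir_deriv_eqI[OF d, of b] by (auto simp: eq differentiable_def)
qed

lemma smooth_inner_left: "C_infinity (\<lambda>x::'a::euclidean_space. x \<bullet> b)"
  by (intro smooth_bounded_linear bounded_linear_inner_left)

lemma smooth_bracket: "C_infinity (bracket :: 'a::euclidean_space \<Rightarrow> real)"
proof -
  have "Ck k (bracket :: 'a \<Rightarrow> real)" for k
  proof (induction k)
    case 0
    show ?case by (auto simp: continuous_on_eq_continuous_at intro: differentiable_imp_continuous_within dir_deriv_bracket)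
  next
    case (Suc k)
    have "dir_deriv b bracket = (\<lambda>x::'a. (x \<bullet> b) * inverse (bracket x))" for b :: 'a
      by (auto simp: dir_deriv_bracket)
    moreover have "Ck k (\<lambda>x::'a. (x \<bullet> b) * inverse (bracket x))" for b
      using smooth_inner_left[of b]
      by (intro Ck_bilinear[OF bounded_bilinear_mult] Ck_inverse Suc) (auto simp: C_infinity_def)
    ultimately show ?case by (simp add: dir_deriv_bracket)
  qed
  then show ?thesis by (simp add: C_infinity_def)
qed

lemma symb_inner_left:
  fixes b :: "'a::euclidean_space"
  assumes "b \<in> Basis"
  shows "symb Basis (\<lambda>_ x. inverse (bracket x)) bracket (\<lambda>x::'a. x \<bullet> b)"
proof (rule symb_SucI[where C = 1])
  fix d :: 'a assume "d \<in> Basis"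
  have "dir_deriv d (\<lambda>x::'a. x \<bullet> b) = (\<lambda>x. d \<bullet> b)"
    by (intro ext dir_deriv_eqI[of _ "\<lambda>h. h \<bullet> b"]) (auto intro!: derivative_eq_intros)
  then show "symb Basis (\<lambda>_ x. inverse (bracket x)) (\<lambda>z. bracket z * inverse (bracket z)) (dir_deriv d (\<lambda>x::'a. x \<bullet> b))"
    by (simp add: symb_const)
qed (use assms in \<open>auto simp: smooth_inner_left abs_inner_le_bracket\<close>)

text \<open>The derivative of <x> in b is (x . b) / <x>, so order k of <x> gives order k of 1 / <x>,
  and with it order k + 1 of <x>.\<close>

lemma symb_bracket:
  "symb Basis (\<lambda>_ x. inverse (bracket x)) bracket (bracket :: 'a::euclidean_space \<Rightarrow> real)"
proof -
  let ?\<sigma> = "\<lambda>_ x::'a. inverse (bracket x)"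
  have "est k Basis ?\<sigma> bracket (bracket :: 'a \<Rightarrow> real)" for k
  proof (induction k)
    case 0
    then show ?case by (auto intro!: exI[of _ 1])
  next
    case (Suc k)
    have "est k Basis ?\<sigma> (\<lambda>x. inverse (bracket x)) (\<lambda>x::'a. inverse (bracket x))"
      by (rule est_inverse[OF smooth_bracket _ _ _ _ Suc, of 1]) (auto simp: bracket_pos)
    then have "est k Basis ?\<sigma> (\<lambda>x. bracket x * inverse (bracket x)) (\<lambda>x::'a. (x \<bullet> b) * inverse (bracket x))"
      if "b \<in> Basis" for b
      using symb_inner_left[OF that]
      by (intro est_bilinear[OF bounded_bilinear_mult] smooth_inner_left smooth_inverse smooth_bracket)
         (auto simp: symb_def)
    moreover have "dir_deriv b bracket = (\<lambda>x::'a. (x \<bullet> b) * inverse (bracket x))" for b :: 'a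
      by (auto simp: dir_deriv_bracket)
    ultimately show ?case by (auto intro!: exI[of _ 1])
  qed
  then show ?thesis by (simp add: symb_def smooth_bracket)
qed

section \<open>Estimates for functions that vanish on a subspace\<close>

lemma norm_diff_line_bound:
  fixes f :: "'a::real_normed_vector \<Rightarrow> 'b::real_normed_vector"
  assumes "\<And>z. f differentiable (at z)" "\<And>t. t \<in> {0..1} \<Longrightarrow> norm (dir_deriv v f (z + t *\<^sub>R v)) \<le> B"
  shows "norm (f (z + v) - f z) \<le> B"
proof -
  have "norm (f (z + 1 *\<^sub>R v) - f (z + 0 *\<^sub>R v)) \<le> B * norm (1 - 0 :: real)"
  proof (rule differentiable_bound[where S = "{0..1::real}" and f' = "\<lambda>t h. h *\<^sub>R dir_deriv v f (z + t *\<^sub>R v)"])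
    show "((\<lambda>t. f (z + t *\<^sub>R v)) has_derivative (\<lambda>h. h *\<^sub>R dir_deriv v f (z + t *\<^sub>R v))) (at t within {0..1})" for t
      using dir_deriv_line[OF assms(1)] by (simp add: has_vector_derivative_def)
    show "onorm (\<lambda>h. h *\<^sub>R dir_deriv v f (z + t *\<^sub>R v)) \<le> B" if "t \<in> {0..1}" for t
      using assms(2)[OF that] mult_right_mono[OF assms(2)[OF that], of "\<bar>h\<bar>" for h]
      by (intro onorm_bound) (auto intro: order_trans[OF norm_ge_zero] simp: mult.commute)
  qed auto
  then show ?thesis by simp
qed

text \<open>Mean value inequality along the ray from (p, 0) to (p, v). On the ray W is largest at
  the end point, and the direction v supplies the factor |v|.\<close>

lemma vanish_bound:
  fixes f :: "'p::euclidean_space \<times> 'v::euclidean_space \<Rightarrow> 'b::real_normed_vector"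
  assumes f: "C_infinity f" "\<And>p. f (p, 0) = 0"
    and C: "\<And>b. b \<in> Basis \<Longrightarrow> \<exists>C. \<forall>z. norm (dir_deriv (0, b) f z) \<le> C * W z"
    and W: "\<And>p v t. 0 \<le> t \<Longrightarrow> t \<le> 1 \<Longrightarrow> W (p, t *\<^sub>R v) \<le> W (p, v)" "\<And>z. W z \<ge> 0"
    and V: "\<And>p v. norm v * W (p, v) \<le> V (p, v)"
  shows "\<exists>C. \<forall>z. norm (f z) \<le> C * V z"
proof -
  obtain C where C: "\<And>b z. b \<in> Basis \<Longrightarrow> norm (dir_deriv (0, b::'v) f z) \<le> C b * W z"
    using C by metis
  define K where "K = (\<Sum>b\<in>Basis. \<bar>C b\<bar>)"
  have "norm (f (p, v)) \<le> K * V (p, v)" for p v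
  proof -
    have "norm (f ((p, 0) + (0, v)) - f (p, 0)) \<le> K * (norm v * W (p, v))"
    proof (rule norm_diff_line_bound[OF smooth_differentiable[OF f(1)]])
      fix t :: real assume t: "t \<in> {0..1}"
      let ?z = "(p, 0) + t *\<^sub>R (0, v)"
      interpret l: bounded_linear "\<lambda>h. dir_deriv h f ?z"
        by (rule linear_dir_deriv[OF smooth_differentiable[OF f(1)]])
      have v: "(0, v) = (\<Sum>b\<in>Basis. (v \<bullet> b) *\<^sub>R (0::'p, b))"
        by (simp add: prod_eq_iff fst_sum snd_sum euclidean_representation)
      have "dir_deriv (\<Sum>b\<in>Basis. (v \<bullet> b) *\<^sub>R (0, b)) f ?z = (\<Sum>b\<in>Basis. (v \<bullet> b) *\<^sub>R dir_deriv (0, b) f ?z)"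
        by (simp only: l.sum l.scaleR)
      then have "dir_deriv (0, v) f ?z = (\<Sum>b\<in>Basis. (v \<bullet> b) *\<^sub>R dir_deriv (0, b) f ?z)"
        by (simp only: v[symmetric])
      also have "norm \<dots> \<le> (\<Sum>b\<in>Basis. norm v * (\<bar>C b\<bar> * W (p, v)))"
      proof (rule sum_norm_le)
        fix b :: 'v assume b: "b \<in> Basis"
        have "norm (dir_deriv (0, b) f ?z) \<le> C b * W (p, t *\<^sub>R v)" using C[OF b, of ?z] by simp
        also have "\<dots> \<le> \<bar>C b\<bar> * W (p, v)"
          using W t by (intro mult_mono) auto
        finally show "norm ((v \<bullet> b) *\<^sub>R dir_deriv (0, b) f ?z) \<le> norm v * (\<bar>C b\<bar> * W (p, v))"
          using Basis_le_norm[OF b, of v] by (auto intro!: mult_mono)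
      qed
      also have "\<dots> = K * (norm v * W (p, v))"
        by (simp add: K_def sum_distrib_left sum_distrib_right mult_ac)
      finally show "norm (dir_deriv (0, v) f ?z) \<le> K * (norm v * W (p, v))" .
    qed
    also have "\<dots> \<le> K * V (p, v)"
      using V by (intro mult_left_mono) (auto simp: K_def intro: sum_nonneg)
    finally show ?thesis using f(2) by simp
  qed
  then show ?thesis by (metis surj_pair)
qed

text \<open>Recovers estimates of f from its v-derivatives alone. Derivatives in p vanish on v = 0
  again and commute with those in v, so the induction applies to them; derivatives in v are
  controlled by assumption. Phase differences are bounded in this way without any bound for the
  phase itself.\<close>

lemma est_vanish:
  fixes f :: "'p::euclidean_space \<times> 'v::euclidean_space \<Rightarrow> 'b::euclidean_space"
  assumes f: "C_infinity f" "\<And>p. f (p, 0) = 0"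
    and e: "\<And>b. b \<in> Basis \<Longrightarrow> est k Basis \<omega> W (dir_deriv (0, b) f)"
    and W: "\<And>p v t. 0 \<le> t \<Longrightarrow> t \<le> 1 \<Longrightarrow> W (p, t *\<^sub>R v) \<le> W (p, v)"
    and V: "\<And>p v. norm v * W (p, v) \<le> V (p, v)"
      "\<And>b z. b \<in> Basis \<Longrightarrow> W z \<le> V z * \<omega> (0, b) z"
    and nn: "\<And>z. W z \<ge> 0" "\<And>z. V z \<ge> 0"
    and \<omega>: "\<And>d p v t. d \<in> Basis \<Longrightarrow> 0 \<le> t \<Longrightarrow> t \<le> 1 \<Longrightarrow> \<omega> d (p, t *\<^sub>R v) \<le> \<omega> d (p, v)"
      "\<And>b z. b \<in> Basis \<Longrightarrow> \<omega> b z \<ge> 0"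
  shows "est k Basis \<omega> V f"
  using f e W V nn
proof (induction k arbitrary: f W V)
  case (Suc k)
  have B: "\<exists>C. \<forall>z. norm (f z) \<le> C * V z"
    by (rule vanish_bound[where W = W]) (use Suc.prems est_bound in blast)+
  have "est k Basis \<omega> (\<lambda>z. V z * \<omega> d z) (dir_deriv d f)" if d: "d \<in> Basis" for d
  proof -
    consider b where "d = (0, b)" "b \<in> Basis" | b where "d = (b, 0)" "b \<in> Basis"
      using d unfolding Basis_prod_def by auto
    then show ?thesis
    proof cases
      case 1
      then have "est k Basis \<omega> W (dir_deriv d f)" using Suc.prems(3) est_SucD by blast
      then show ?thesis
        using Suc.prems(6-8) 1 \<omega>(2) d by (rule_tac est_weight_mono[of k Basis \<omega> W "dir_deriv d f" 1]) simp_all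
    next
      case 2
      show ?thesis
      proof (rule Suc.IH[where W = "\<lambda>z. W z * \<omega> d z"])
        show "dir_deriv d f (p, 0) = 0" for p
          using Suc.prems(2) by (simp add: dir_deriv_def 2)
        show "est k Basis \<omega> (\<lambda>z. W z * \<omega> d z) (dir_deriv (0, c) (dir_deriv d f))" if "c \<in> Basis" for c
          using Suc.prems(3)[OF that] d by (simp add: dir_deriv_commute_fun[OF Suc.prems(1), of "(0, c)" d])
        show "norm v * (W (p, v) * \<omega> d (p, v)) \<le> V (p, v) * \<omega> d (p, v)" for p v
          using mult_right_mono[OF Suc.prems(5)[of v p] \<omega>(2)[OF d, of "(p, v)"]] by (simp add: mult_ac)
        show "W z * \<omega> d z \<le> V z * \<omega> d z * \<omega> (0, c) z" if "c \<in> Basis" for c z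
          using mult_right_mono[OF Suc.prems(6)[OF that, of z] \<omega>(2)[OF d, of z]] by (simp add: mult_ac)
        show "W (p, t *\<^sub>R v) * \<omega> d (p, t *\<^sub>R v) \<le> W (p, v) * \<omega> d (p, v)" if "0 \<le> t" "t \<le> 1" for p v t
          using that Suc.prems \<omega> d by (intro mult_mono) auto
      qed (use Suc.prems(1,7,8) \<omega>(2) d in \<open>simp_all add: smooth_dir_deriv\<close>)
    qed
  qed
  with B show ?case by simp
next
  case 0
  have "\<exists>C. \<forall>z. norm (f z) \<le> C * V z"
    by (rule vanish_bound[where W = W]) (use 0 est_bound in blast)+
  then show ?case by simp
qed

section \<open>Integrals over Euclidean space\<close>

text \<open>The exponent is twice the dimension because <y>^(2n) dominates the product of the n
  factors 1 + y_b^2, whose inverses are integrable in one variable each.\<close>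

abbreviation decay :: "'v::euclidean_space \<Rightarrow> real"
  where "decay y \<equiv> bracket y powr (- 2 * real DIM('v))"

lemma integrable_decay: "integrable lborel (decay :: 'v::euclidean_space \<Rightarrow> real)"
proof (rule integrableI_bounded)
  let ?h = "\<lambda>t::real. inverse (1 + t\<^sup>2)"
  have 1: "decay y \<le> (\<Prod>b\<in>Basis. ?h (y \<bullet> b))" for y :: 'v
  proof -
    have "(\<Prod>b\<in>(Basis::'v set). 1 + (y \<bullet> b)\<^sup>2) \<le> (\<Prod>b\<in>(Basis::'v set). (bracket y)\<^sup>2)"
    proof (rule prod_mono)
      fix b :: 'v assume "b \<in> Basis"
      then show "0 \<le> 1 + (y \<bullet> b)\<^sup>2 \<and> 1 + (y \<bullet> b)\<^sup>2 \<le> (bracket y)\<^sup>2"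
        using power_mono[OF Basis_le_norm[of b y], of 2] by (simp add: bracket_sq)
    qed
    also have "\<dots> = bracket y powr (2 * real DIM('v))"
      using powr_realpow[OF bracket_pos[of y], of "2 * DIM('v)"] by (simp add: power_mult)
    finally have le: "(\<Prod>b\<in>(Basis::'v set). 1 + (y \<bullet> b)\<^sup>2) \<le> bracket y powr (2 * real DIM('v))" .
    have "(\<Prod>b\<in>(Basis::'v set). 1 + (y \<bullet> b)\<^sup>2) > 0"
      by (intro prod_pos add_pos_nonneg ballI) simp_all
    from le_imp_inverse_le[OF le this] show ?thesis by (simp add: powr_minus prod_inversef[symmetric] o_def)
  qed
  have fin: "(\<integral>\<^sup>+t. ennreal (?h t) \<partial>lborel) < \<infinity>"
  proof -
    have "integrable lborel ?h"
      using integrable_inverse_1_plus_square by (simp add: set_integrable_def einterval_def)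
    then show ?thesis by (simp add: integrable_iff_bounded add_nonneg_nonneg)
  qed
  have "(\<integral>\<^sup>+y. ennreal (norm (decay (y::'v))) \<partial>lborel) \<le> (\<integral>\<^sup>+y. ennreal (\<Prod>b\<in>(Basis::'v set). ?h (y \<bullet> b)) \<partial>lborel)"
    using 1 by (intro nn_integral_mono ennreal_leI) simp
  also have "\<dots> = (\<integral>\<^sup>+y. (\<Prod>b\<in>(Basis::'v set). ennreal (?h (y \<bullet> b))) \<partial>lborel)"
    by (intro nn_integral_cong) (simp add: prod_ennreal add_nonneg_nonneg)
  also have "\<dots> = (\<Prod>b\<in>(Basis::'v set). (\<integral>\<^sup>+t. ennreal (?h t) \<partial>lborel))"
    by (rule nn_integral_lborel_prod) auto
  also have "\<dots> < \<infinity>" using fin by (simp add: power_less_top_ennreal)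
  finally show "(\<integral>\<^sup>+y. ennreal (norm (decay (y::'v))) \<partial>lborel) < \<infinity>" .
  show "(decay :: 'v \<Rightarrow> real) \<in> borel_measurable lborel"
    using smooth_measurable[OF smooth_bracket[where 'a='v]] by simp
qed

lemma integrable_by_decay:
  fixes f :: "'v::euclidean_space \<Rightarrow> 'b::{banach, second_countable_topology}"
  assumes "f \<in> borel_measurable borel" "\<And>y. norm (f y) \<le> C * decay y"
  shows "integrable lborel f"
proof (rule Bochner_Integration.integrable_bound)
  show "integrable lborel (\<lambda>y::'v. C * decay y)" by (intro integrable_mult_right integrable_decay)
  have "norm (f y) \<le> norm (C * decay y)" for y using assms(2)[of y] by simp
  then show "AE y in lborel. norm (f y) \<le> norm (C * decay y)" by simp
qed (use assms in auto)

lemma integral_decay_bound: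
  fixes f :: "'v::euclidean_space \<Rightarrow> 'b::{banach, second_countable_topology}"
  assumes "f \<in> borel_measurable borel" "\<And>y. norm (f y) \<le> C * decay y"
  shows "norm (integral\<^sup>L lborel f) \<le> C * (LINT y|lborel. decay (y::'v))"
proof -
  have "norm (integral\<^sup>L lborel f) \<le> (LINT y|lborel. C * decay (y::'v))"
    using integrable_by_decay[OF assms] assms(2)
    by (intro order_trans[OF integral_norm_bound] integral_mono integrable_norm integrable_mult_right integrable_decay)
  then show ?thesis by simp
qed

lemma integral_lborel_affine:
  fixes f :: "'v::euclidean_space \<Rightarrow> 'b::{banach, second_countable_topology}"
  assumes [measurable]: "f \<in> borel_measurable borel" and c: "c \<noteq> 0"
  shows "integral\<^sup>L lborel f = \<bar>c\<bar> ^ DIM('v) *\<^sub>R (LINT y|lborel. f (t + c *\<^sub>R y))"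
  by (subst lborel_affine[OF c, of t], subst integral_density) (auto simp: integral_distr)

lemma integrable_lborel_translate:
  fixes f :: "'v::euclidean_space \<Rightarrow> 'b::{banach, second_countable_topology}"
  assumes f: "integrable lborel f"
  shows "integrable lborel (\<lambda>y. f (y + t))"
proof -
  have [measurable]: "f \<in> borel_measurable borel" using f by auto
  have "integrable (distr lborel borel ((+) t)) f" using f by (simp add: lborel_distr_plus)
  then show ?thesis by (subst (asm) integrable_distr_eq) (auto simp: add.commute)
qed

lemma integral_lborel_translate:
  fixes f :: "'v::euclidean_space \<Rightarrow> 'b::{banach, second_countable_topology}"
  assumes "f \<in> borel_measurable borel"
  shows "(LINT y|lborel. f (y + t)) = integral\<^sup>L lborel f"
  using integral_lborel_affine[OF assms, of 1 t] by (simp add: add.commute)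

lemma borel_measurable_pairI:
  fixes f :: "'a::euclidean_space \<times> 'b::euclidean_space \<Rightarrow> 'c::topological_space"
  assumes "f \<in> borel_measurable borel"
  shows "f \<in> borel_measurable (lborel \<Otimes>\<^sub>M lborel)"
  using assms by (simp add: lborel_prod)

text \<open>Integrate the v-derivative at y + t v over all y and over t in [0, 1]. One order of
  integration gives the integral of g(y + v) - g(y), which is 0; the other gives the integral of the
  derivative, by translation invariance. Integrability of g and of its derivative takes the place of
  boundary terms.\<close>

lemma integral_dir_deriv_eq_0:
  fixes g :: "'v::euclidean_space \<Rightarrow> 'b::euclidean_space"
  assumes d: "\<And>x. g differentiable (at x)" and c: "continuous_on UNIV (dir_deriv v g)"
    and i: "integrable lborel g" "integrable lborel (dir_deriv v g)"
  shows "integral\<^sup>L lborel (dir_deriv v g) = 0"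
proof -
  let ?h = "\<lambda>(t::real, y). indicator {0..1} t *\<^sub>R dir_deriv v g (y + t *\<^sub>R v)"
  have FTC: "(LINT t|lborel. ?h (t, y)) = g (y + v) - g y" for y
  proof -
    have "continuous_on {0..1} (\<lambda>t. dir_deriv v g (y + t *\<^sub>R v))"
      by (rule continuous_on_compose2[OF c]) (auto intro!: continuous_intros)
    from integral_FTC_Icc[OF zero_le_one dir_deriv_line[OF d] this]
    show ?thesis by simp
  qed
  have [measurable]: "dir_deriv v g \<in> borel_measurable borel"
    using c by (rule borel_measurable_continuous_onI)
  have m: "?h \<in> borel_measurable (lborel \<Otimes>\<^sub>M lborel)"
    by measurable
  have it: "integrable lborel (\<lambda>y. dir_deriv v g (y + t *\<^sub>R v))" for t :: real
    by (rule integrable_lborel_translate[OF i(2)])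
  have ih: "integrable (lborel \<Otimes>\<^sub>M lborel) ?h"
  proof (rule lborel_pair.Fubini_integrable[OF m])
    have "(\<lambda>y. norm (dir_deriv v g y)) \<in> borel_measurable borel" by simp
    note tr = integral_lborel_translate[OF this]
    have "(LINT y|lborel. norm (?h (t, y))) = indicator {0..1} t * (LINT y|lborel. norm (dir_deriv v g y))" for t
      using tr[of "t *\<^sub>R v"] by simp
    then have "(\<lambda>t. LINT y|lborel. norm (?h (t, y))) =
        (\<lambda>t. indicator {0..1} t * (LINT y|lborel. norm (dir_deriv v g y)))" by blast
    then show "integrable lborel (\<lambda>t. LINT y|lborel. norm (?h (t, y)))"
      by (simp only:) (intro integrable_mult_left integrable_real_indicator; simp)
    show "AE t in lborel. integrable lborel (\<lambda>y. ?h (t, y))"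
      using it by auto
  qed
  have "(LINT t|lborel. LINT y|lborel. ?h (t, y)) = (LINT y|lborel. LINT t|lborel. ?h (t, y))"
    using lborel_pair.Fubini_integral[of "\<lambda>t y. ?h (t, y)"] ih by (simp add: split_beta)
  also have "\<dots> = (LINT y|lborel. g (y + v) - g y)" by (simp only: FTC)
  also have "\<dots> = 0"
    using i(1) integrable_lborel_translate[OF i(1), of v] integral_lborel_translate[of g v] by simp
  finally have "(LINT t|lborel. LINT y|lborel. ?h (t, y)) = 0" .
  moreover have "(LINT y|lborel. ?h (t, y)) = indicator {0..1} t *\<^sub>R integral\<^sup>L lborel (dir_deriv v g)" for t
    using integral_lborel_translate[of "dir_deriv v g"] by simp
  ultimately have "(LINT t|lborel. indicator {0..1::real} t *\<^sub>R integral\<^sup>L lborel (dir_deriv v g)) = 0"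
    by (simp only:)
  then show ?thesis by (subst (asm) integral_scaleR_left) (auto simp: integrable_real_indicator)
qed

lemma has_derivative_integral:
  fixes f :: "'p::euclidean_space \<Rightarrow> 'm \<Rightarrow> complex"
  assumes r: "r > 0"
    and i: "\<And>p. p \<in> ball p0 r \<Longrightarrow> integrable M (f p)"
    and m: "\<And>b. b \<in> Basis \<Longrightarrow> f' b p0 \<in> borel_measurable M"
    and d: "\<And>p v. p \<in> ball p0 r \<Longrightarrow> ((\<lambda>p. f p v) has_derivative (\<lambda>h. \<Sum>b\<in>Basis. (h \<bullet> b) *\<^sub>R f' b p v)) (at p)"
    and b: "\<And>p v b. p \<in> ball p0 r \<Longrightarrow> b \<in> Basis \<Longrightarrow> norm (f' b p v) \<le> g v"
    and g: "integrable M g"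
  shows "((\<lambda>p. LINT v|M. f p v) has_derivative
    (\<lambda>h. \<Sum>b\<in>Basis. (h \<bullet> b) *\<^sub>R (LINT v|M. f' b p0 v))) (at p0)"
  unfolding has_derivative_iff_norm
proof
  show "bounded_linear (\<lambda>h. \<Sum>b\<in>Basis. (h \<bullet> b) *\<^sub>R (LINT v|M. f' b p0 v))"
    by (intro bounded_linear_intros)
  have [measurable]: "f p \<in> borel_measurable M" if "p \<in> ball p0 r" for p
    using i[OF that] by auto
  have p0: "p0 \<in> ball p0 r" using r by simp
  have i': "integrable M (f' b p0)" if "b \<in> Basis" for b
    by (rule Bochner_Integration.integrable_bound[OF g m[OF that]])
       (use order_trans[OF b[OF p0 that] abs_ge_self] in auto)
  let ?L = "\<lambda>p v h. \<Sum>b\<in>Basis. (h \<bullet> b) *\<^sub>R f' b p v"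
  let ?q = "\<lambda>p v. norm (f p v - f p0 v - ?L p0 v (p - p0)) / norm (p - p0)"
  let ?N = "real DIM('p)"
  have L: "norm (?L p v h) \<le> ?N * g v * norm h" if "p \<in> ball p0 r" for p v h
  proof -
    have "norm (?L p v h) \<le> (\<Sum>b\<in>(Basis::'p set). norm h * g v)"
    proof (rule sum_norm_le)
      fix c :: 'p assume c: "c \<in> Basis"
      then show "norm ((h \<bullet> c) *\<^sub>R f' c p v) \<le> norm h * g v"
        using b[OF that c, of v] Basis_le_norm[OF c, of h] by (auto intro!: mult_mono)
    qed
    then show ?thesis by (simp add: mult_ac)
  qed
  \<comment> \<open>The majorant of the difference quotients: one share \<open>?N\<close> * g bounds
    the increment by the mean value inequality, the other bounds the linear part.\<close>
  have q: "?q p v \<le> 2 * ?N * g v" if p: "p \<in> ball p0 r" for p v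
  proof -
    have "norm (f p v - f p0 v) \<le> (?N * g v) * norm (p - p0)"
    proof (rule differentiable_bound[where S = "ball p0 r" and f' = "\<lambda>p. ?L p v"])
      fix x assume x: "x \<in> ball p0 r"
      then show "((\<lambda>p. f p v) has_derivative ?L x v) (at x within ball p0 r)"
        using d by (auto intro: has_derivative_at_withinI)
      show "onorm (?L x v) \<le> ?N * g v"
        using L[OF x, where v = v] order_trans[OF norm_ge_zero b[OF p0 SOME_Basis, of v]]
        by (intro onorm_bound) auto
    qed (use p p0 in auto)
    moreover have "norm (f p v - f p0 v - ?L p0 v (p - p0)) \<le> norm (f p v - f p0 v) + norm (?L p0 v (p - p0))"
      by (rule norm_triangle_ineq4)
    ultimately have "norm (f p v - f p0 v - ?L p0 v (p - p0)) \<le> (2 * ?N * g v) * norm (p - p0)"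
      using L[OF p0, where v = v and h = "p - p0"] by (simp add: algebra_simps)
    moreover have "0 \<le> 2 * ?N * g v"
      using order_trans[OF norm_ge_zero b[OF p0 SOME_Basis, of v]] by simp
    ultimately show ?thesis by (cases "p = p0") (auto simp: divide_simps)
  qed
  have lim0: "(\<lambda>n. LINT v|M. ?q (X n) v) \<longlonglongrightarrow> 0"
    if X: "\<And>n. X n \<in> ball p0 r - {p0}" "X \<longlonglongrightarrow> p0" for X :: "nat \<Rightarrow> 'p"
  proof -
    have "(\<lambda>n. LINT v|M. ?q (X n) v) \<longlonglongrightarrow> (LINT v|M. 0)"
    proof (rule integral_dominated_convergence[where w = "\<lambda>v. 2 * ?N * g v"])
      show "(\<lambda>v. ?q (X n) v) \<in> borel_measurable M" for n
      proof -
        have [measurable]: "f (X n) \<in> borel_measurable M" "f p0 \<in> borel_measurable M"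
          using X(1)[of n] p0 i by auto
        have [measurable]: "(\<lambda>v. ?L p0 v (X n - p0)) \<in> borel_measurable M"
          using m by (intro borel_measurable_sum borel_measurable_scaleR) auto
        show ?thesis by (intro borel_measurable_divide borel_measurable_const) measurable
      qed
      show "AE v in M. (\<lambda>n. ?q (X n) v) \<longlonglongrightarrow> 0"
      proof (rule AE_I2)
        fix v
        have "((\<lambda>p. ?q p v) \<longlongrightarrow> 0) (at p0)"
          using d[OF p0, of v] unfolding has_derivative_iff_norm by simp
        then show "(\<lambda>n. ?q (X n) v) \<longlonglongrightarrow> 0"
          using X unfolding tendsto_at_iff_sequentially by (auto simp: o_def)
      qed
      show "AE v in M. norm (?q (X n) v) \<le> 2 * ?N * g v" for n
        using q[of "X n"] X(1)[of n] by auto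
    qed (use g in auto)
    then show ?thesis by simp
  qed
  show "((\<lambda>y. norm ((LINT v|M. f y v) - (LINT v|M. f p0 v) - (\<Sum>b\<in>Basis. ((y - p0) \<bullet> b) *\<^sub>R (LINT v|M. f' b p0 v)))
      / norm (y - p0)) \<longlongrightarrow> 0) (at p0)"
  proof (rule Lim_transform_within_open[where s = "ball p0 r"])
    show "((\<lambda>p. if p \<in> ball p0 r then norm ((LINT v|M. f p v) - (LINT v|M. f p0 v) -
        (\<Sum>b\<in>Basis. ((p - p0) \<bullet> b) *\<^sub>R (LINT v|M. f' b p0 v))) / norm (p - p0) else 0) \<longlongrightarrow> 0) (at p0)" (is "(?Q \<longlongrightarrow> 0) _")
      unfolding tendsto_at_iff_sequentially
    proof (intro allI impI)
      fix X assume X: "\<forall>n. X n \<in> UNIV - {p0}" "X \<longlonglongrightarrow> p0"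
      then obtain N where N: "\<And>n. n \<ge> N \<Longrightarrow> X n \<in> ball p0 r"
        using r by (auto simp: lim_sequentially dist_commute[of _ p0]) blast
      let ?Y = "\<lambda>n. X (n + N)"
      have l: "(\<lambda>n. LINT v|M. ?q (?Y n) v) \<longlonglongrightarrow> 0"
        using X N by (intro lim0) (auto intro: LIMSEQ_ignore_initial_segment)
      have n: "norm (?Q (?Y n)) \<le> (LINT v|M. ?q (?Y n) v)" for n
      proof -
        have Y: "?Y n \<in> ball p0 r" using N by simp
        have il: "integrable M (\<lambda>v. ?L p0 v (?Y n - p0))"
          using i' by (intro Bochner_Integration.integrable_sum integrable_scaleR_right) auto
        have "(LINT v|M. f (?Y n) v) - (LINT v|M. f p0 v) -
            (\<Sum>b\<in>Basis. ((?Y n - p0) \<bullet> b) *\<^sub>R (LINT v|M. f' b p0 v)) =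
            (LINT v|M. f (?Y n) v - f p0 v - ?L p0 v (?Y n - p0))"
          using i[OF Y] i[OF p0] il i' by (simp add: Bochner_Integration.integral_diff Bochner_Integration.integral_sum)
        then have "norm (?Q (?Y n)) = norm (LINT v|M. f (?Y n) v - f p0 v - ?L p0 v (?Y n - p0)) / norm (?Y n - p0)"
          using Y by simp
        also have "\<dots> \<le> (LINT v|M. norm (f (?Y n) v - f p0 v - ?L p0 v (?Y n - p0))) / norm (?Y n - p0)"
          by (intro divide_right_mono integral_norm_bound) auto
        finally show ?thesis by simp
      qed
      have "(\<lambda>n. ?Q (?Y n)) \<longlonglongrightarrow> 0"
        by (rule Lim_null_comparison[OF always_eventually[OF allI] l]) (rule n)
      then show "(?Q \<circ> X) \<longlonglongrightarrow> 0"
        using LIMSEQ_offset[of "\<lambda>n. ?Q (X n)" N] by (simp add: o_def)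
    qed
  qed (use r in auto)
qed

section \<open>Partial Fourier transforms and iterated oscillatory integrals\<close>

definition FT :: "('q \<times> 'v::euclidean_space \<Rightarrow> complex) \<Rightarrow> 'q \<Rightarrow> 'v \<Rightarrow> complex"
  where "FT H q \<theta> = (LINT w|lborel. exp (- \<i> * complex_of_real (w \<bullet> \<theta>)) * H (q, w))"

text \<open>Only derivatives in the integrated variable are estimated; q is a parameter, in which
  smoothness is merely qualitative. In the applications \<tau> is 1, except for the regularized
  amplitude \<open>damp\<close>, where it is <\<epsilon>>.\<close>

definition dec :: "('q \<Rightarrow> real) \<Rightarrow> ('q \<Rightarrow> real) \<Rightarrow>
    ('q::euclidean_space \<times> 'v::euclidean_space \<Rightarrow> complex) \<Rightarrow> bool"
  where "dec \<tau> W H \<longleftrightarrow>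
    symb (Pair 0 ` Basis) (\<lambda>_ z. \<tau> (fst z)) (\<lambda>z. W (fst z) * decay (snd z)) H"

lemma norm_exp_uminus_i [simp]: "norm (exp (- \<i> * complex_of_real r)) = 1"
  by (simp add: norm_exp_eq_Re)

lemma norm_exp_i [simp]: "norm (exp (\<i> * complex_of_real r)) = 1"
  by (simp add: norm_exp_eq_Re)

lemma continuous_section:
  assumes "C_infinity H" shows "continuous_on S (\<lambda>w. H (q, w))"
  by (rule continuous_on_compose2[OF smooth_continuous[OF assms, of UNIV]]) (auto intro!: continuous_intros)

lemma FT_integrand_measurable:
  fixes H :: "'q::euclidean_space \<times> 'v::euclidean_space \<Rightarrow> complex"
  assumes "C_infinity H"
  shows "(\<lambda>w. exp (- \<i> * complex_of_real (w \<bullet> \<theta>)) * H (q, w)) \<in> borel_measurable borel"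
  by (intro borel_measurable_continuous_onI continuous_intros continuous_section assms)

lemma dec_bound:
  assumes "dec \<tau> W H"
  shows "\<exists>C. \<forall>q w. norm (H (q, w)) \<le> C * W q * decay w"
  using symb_bound[OF assms[unfolded dec_def]] by (metis fst_conv mult.assoc snd_conv)

lemma dec_smooth: "dec \<tau> W H \<Longrightarrow> C_infinity H"
  by (simp add: dec_def symb_smooth)

lemma dec_integrable:
  assumes "dec \<tau> W H"
  shows "integrable lborel (\<lambda>w. exp (- \<i> * complex_of_real (w \<bullet> \<theta>)) * H (q, w))"
proof -
  obtain C where "\<And>q w. norm (H (q, w)) \<le> C * W q * decay w" using dec_bound[OF assms] by blast
  then show ?thesis
    using FT_integrand_measurable[OF dec_smooth[OF assms]]
    by (intro integrable_by_decay[of _ "C * W q"]) (auto simp: norm_mult)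
qed

lemma dec_integrable0: "dec \<tau> W H \<Longrightarrow> integrable lborel (\<lambda>w. H (q, w))"
  using dec_integrable[of \<tau> W H 0 q] by simp

lemma dec_dir_deriv:
  assumes "dec \<tau> W H" "b \<in> Basis"
  shows "dec \<tau> (\<lambda>q. W q * \<tau> q) (dir_deriv (0, b) H)"
  using symb_dir_deriv[OF assms(1)[unfolded dec_def], of "(0, b)"] assms(2)
  by (simp add: dec_def mult_ac)

lemma dec_weight_mono:
  assumes "dec \<tau> W H" "\<And>q. W q \<le> C * V q" "\<And>q. W q \<ge> 0" "\<And>q. V q \<ge> 0" "\<And>q. \<tau> q \<ge> 0"
  shows "dec \<tau> V H"
  unfolding dec_def
proof (rule symb_weight_mono[OF assms(1)[unfolded dec_def]])
  show "W (fst z) * decay (snd z) \<le> C * (V (fst z) * decay (snd z))" for z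
    using mult_right_mono[OF assms(2)[of "fst z"], of "decay (snd z)"] by (simp add: mult_ac)
qed (use assms in auto)

lemma dec_add: "dec \<tau> W H \<Longrightarrow> dec \<tau> W G \<Longrightarrow> dec \<tau> W (\<lambda>z. H z + G z)"
  unfolding dec_def by (rule symb_add)

lemma dec_diff: "dec \<tau> W H \<Longrightarrow> dec \<tau> W G \<Longrightarrow> dec \<tau> W (\<lambda>z. H z - G z)"
  unfolding dec_def by (rule symb_diff)

lemma dec_sum: "(\<And>i. i \<in> I \<Longrightarrow> dec \<tau> W (H i)) \<Longrightarrow> dec \<tau> W (\<lambda>z. \<Sum>i\<in>I. H i z)"
  unfolding dec_def by (rule symb_sum)

lemma dec_mult_left: "dec \<tau> W H \<Longrightarrow> dec \<tau> W (\<lambda>z. c * H z)"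
  unfolding dec_def by (rule symb_mult_left)

lemma FT_bound:
  assumes "dec \<tau> W H"
  shows "\<exists>C. \<forall>q \<theta>. norm (FT H q \<theta>) \<le> C * W q"
proof -
  obtain C where C: "\<And>q w. norm (H (q, w)) \<le> C * W q * decay w" using dec_bound[OF assms] by blast
  have "norm (FT H q \<theta>) \<le> C * W q * (LINT y|lborel. decay (y::'b))" for q \<theta>
    unfolding FT_def
    using FT_integrand_measurable[OF dec_smooth[OF assms]] C
    by (intro integral_decay_bound) (auto simp: norm_mult)
  then show ?thesis by (metis mult.assoc mult.commute)
qed

lemma dir_deriv_section:
  "dir_deriv b (\<lambda>w. H (q, w)) w = dir_deriv (0, b) H (q, w)"
  by (simp add: dir_deriv_def)

lemma dir_deriv_section1:
  "dir_deriv b (\<lambda>q. H (q, w)) q = dir_deriv (b, 0) H (q, w)"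
  by (simp add: dir_deriv_def)

lemma smooth_section: "C_infinity H \<Longrightarrow> C_infinity (\<lambda>w. H (q, w))"
  by (rule smooth_compose[of H]) (auto intro!: smooth_intros)

lemma smooth_section1: "C_infinity H \<Longrightarrow> C_infinity (\<lambda>q. H (q, w))"
  by (rule smooth_compose[of H]) (auto intro!: smooth_intros)

lemma smooth_exp_inner: "C_infinity (\<lambda>w::'v::euclidean_space. exp (- \<i> * complex_of_real (w \<bullet> \<theta>)))"
  using smooth_cis[of "\<lambda>w::'v. - (w \<bullet> \<theta>)"] by (simp add: smooth_uminus smooth_inner_left)

lemma dir_deriv_exp_inner:
  "dir_deriv b (\<lambda>w::'v::euclidean_space. exp (- \<i> * complex_of_real (w \<bullet> \<theta>))) w =
    - \<i> * complex_of_real (b \<bullet> \<theta>) * exp (- \<i> * complex_of_real (w \<bullet> \<theta>))"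
proof -
  have "dir_deriv b (\<lambda>w::'v. - (w \<bullet> \<theta>)) w = - (b \<bullet> \<theta>)"
    by (rule dir_deriv_eqI[of _ "\<lambda>h. - (h \<bullet> \<theta>)"]) (auto intro!: derivative_eq_intros)
  then show ?thesis
    using dir_deriv_cis[of "\<lambda>w::'v. - (w \<bullet> \<theta>)" w b]
    by (simp add: smooth_differentiable[OF smooth_uminus[OF smooth_inner_left]])
qed

lemma FT_dir_deriv:
  assumes H: "dec \<tau> W H" and b: "b \<in> Basis"
  shows "FT (dir_deriv (0, b) H) q \<theta> = \<i> * complex_of_real (b \<bullet> \<theta>) * FT H q \<theta>"
proof -
  let ?e = "\<lambda>w::'b. exp (- \<i> * complex_of_real (w \<bullet> \<theta>))"
  let ?g = "\<lambda>w. ?e w * H (q, w)"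
  note s = dec_smooth[OF H]
  have sg: "C_infinity ?g" by (intro smooth_mult smooth_exp_inner smooth_section s)
  have eq: "dir_deriv b ?g = (\<lambda>w. ?e w * dir_deriv (0, b) H (q, w) - \<i> * complex_of_real (b \<bullet> \<theta>) * (?e w * H (q, w)))"
    by (rule ext, subst dir_deriv_bilinear[OF bounded_bilinear_mult
          smooth_differentiable[OF smooth_exp_inner] smooth_differentiable[OF smooth_section[OF s]]])
       (simp add: dir_deriv_section dir_deriv_exp_inner[simplified])
  have i: "integrable lborel (\<lambda>w. ?e w * dir_deriv (0, b) H (q, w))" "integrable lborel ?g"
    using dec_integrable[OF dec_dir_deriv[OF H b]] dec_integrable[OF H] by auto
  have "integral\<^sup>L lborel (dir_deriv b ?g) = 0"
  proof (rule integral_dir_deriv_eq_0)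
    show "integrable lborel (dir_deriv b ?g)"
      unfolding eq by (intro Bochner_Integration.integrable_diff integrable_mult_right i)
  qed (intro smooth_differentiable[OF sg] smooth_continuous[OF smooth_dir_deriv[OF sg]] i)+
  then show ?thesis
    unfolding eq using i by (simp add: FT_def)
qed

definition one_minus_laplace :: "('q::euclidean_space \<times> 'v::euclidean_space \<Rightarrow> complex) \<Rightarrow> 'q \<times> 'v \<Rightarrow> complex"
  where "one_minus_laplace H z = H z - (\<Sum>b\<in>Basis. dir_deriv (0, b) (dir_deriv (0, b) H) z)"

lemma dec_one_minus_laplace:
  assumes H: "dec \<tau> W H" and \<tau>: "\<And>q. \<tau> q \<ge> 1" and W: "\<And>q. W q \<ge> 0"
  shows "dec \<tau> (\<lambda>q. W q * (\<tau> q)\<^sup>2) (one_minus_laplace H)"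
proof -
  have "dec \<tau> (\<lambda>q. W q * (\<tau> q)\<^sup>2) (dir_deriv (0, b) (dir_deriv (0, b) H))" if "b \<in> Basis" for b
    using dec_dir_deriv[OF dec_dir_deriv[OF H that] that] by (simp add: power2_eq_square mult_ac)
  moreover have "dec \<tau> (\<lambda>q. W q * (\<tau> q)\<^sup>2) H"
  proof (rule dec_weight_mono[OF H, of 1])
    show "W q \<le> 1 * (W q * (\<tau> q)\<^sup>2)" for q
      using mult_left_mono[OF one_le_power[OF \<tau>[of q], of 2] W[of q]] by simp
  qed (use W order_trans[OF zero_le_one \<tau>] in auto)
  ultimately show ?thesis
    unfolding one_minus_laplace_def[abs_def] by (intro dec_diff dec_sum)
qed

lemma FT_one_minus_laplace:
  assumes H: "dec \<tau> W H"
  shows "FT (one_minus_laplace H) q \<theta> = complex_of_real ((bracket \<theta>)\<^sup>2) * FT H q \<theta>"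
proof -
  let ?e = "\<lambda>w::'b. exp (- \<i> * complex_of_real (w \<bullet> \<theta>))"
  have D: "dec \<tau> (\<lambda>q. W q * \<tau> q * \<tau> q) (dir_deriv (0, b) (dir_deriv (0, b) H))" if "b \<in> Basis" for b
    by (rule dec_dir_deriv[OF dec_dir_deriv[OF H that] that])
  have "FT (one_minus_laplace H) q \<theta> = (LINT w|lborel. ?e w * H (q, w) -
      (\<Sum>b\<in>Basis. ?e w * dir_deriv (0, b) (dir_deriv (0, b) H) (q, w)))"
    by (simp add: FT_def one_minus_laplace_def right_diff_distrib sum_distrib_left)
  also have "\<dots> = FT H q \<theta> - (\<Sum>b\<in>Basis. FT (dir_deriv (0, b) (dir_deriv (0, b) H)) q \<theta>)"
    using dec_integrable[OF H] dec_integrable[OF D]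
    by (simp add: FT_def Bochner_Integration.integral_diff Bochner_Integration.integral_sum)
  also have "\<dots> = FT H q \<theta> - (\<Sum>b\<in>Basis. - complex_of_real ((b \<bullet> \<theta>)\<^sup>2) * FT H q \<theta>)"
    by (intro arg_cong2[where f = "(-)"] sum.cong refl)
       (simp add: FT_dir_deriv[OF dec_dir_deriv[OF H]] FT_dir_deriv[OF H] power2_eq_square mult_ac)
  also have "\<dots> = (1 + complex_of_real (\<Sum>b\<in>Basis. (\<theta> \<bullet> b)\<^sup>2)) * FT H q \<theta>"
    by (simp add: sum_negf sum_distrib_left algebra_simps inner_commute)
  also have "(\<Sum>b\<in>Basis. (\<theta> \<bullet> b)\<^sup>2) = (norm \<theta>)\<^sup>2"
    unfolding power2_norm_eq_inner by (subst euclidean_inner) (simp add: power2_eq_square)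
  finally show ?thesis by (simp add: bracket_sq)
qed

text \<open>Each application of \<open>1 - \<Delta>\<close> in the integrated variable gains two powers of the dual variable.\<close>

lemma FT_decay:
  assumes "dec \<tau> W H" and \<tau>: "\<And>q. \<tau> q \<ge> 1" and W: "\<And>q. W q \<ge> 0"
  shows "\<exists>C. \<forall>q \<theta>. norm (FT H q \<theta>) \<le> C * W q * \<tau> q ^ (2 * l) * bracket \<theta> powr (- 2 * real l)"
  using assms(1,3)
proof (induction l arbitrary: H W)
  case 0
  then show ?case using FT_bound[OF 0(1)] by simp
next
  case (Suc l)
  have "dec \<tau> (\<lambda>q. W q * (\<tau> q)\<^sup>2) (one_minus_laplace H)" by (rule dec_one_minus_laplace[OF Suc.prems(1) \<tau> Suc.prems(2)])
  from Suc.IH[OF this] obtain C where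
    C: "\<And>q \<theta>. norm (FT (one_minus_laplace H) q \<theta>) \<le> C * (W q * (\<tau> q)\<^sup>2) * \<tau> q ^ (2 * l) * bracket \<theta> powr (- 2 * real l)"
    using Suc.prems(2) by auto
  have "norm (FT H q \<theta>) \<le> C * W q * \<tau> q ^ (2 * Suc l) * bracket \<theta> powr (- 2 * real (Suc l))" for q \<theta>
  proof -
    have "norm (FT (one_minus_laplace H) q \<theta>) = (bracket \<theta>)\<^sup>2 * norm (FT H q \<theta>)"
      by (simp add: FT_one_minus_laplace[OF Suc.prems(1)] norm_mult norm_power)
    then have "norm (FT H q \<theta>) = norm (FT (one_minus_laplace H) q \<theta>) * bracket \<theta> powr (- 2)"
      using bracket_pos[of \<theta>] by (simp add: powr_minus divide_inverse[symmetric])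
    also have "\<dots> \<le> (C * (W q * (\<tau> q)\<^sup>2) * \<tau> q ^ (2 * l) * bracket \<theta> powr (- 2 * real l)) * bracket \<theta> powr (- 2)"
      using C by (intro mult_right_mono) auto
    also have "\<dots> = C * W q * ((\<tau> q)\<^sup>2 * \<tau> q ^ (2 * l)) * (bracket \<theta> powr (- 2 * real l) * bracket \<theta> powr (- 2))"
      by (simp only: mult_ac)
    also have "\<dots> = C * W q * \<tau> q ^ (2 * Suc l) * bracket \<theta> powr (- 2 * real (Suc l))"
      by (simp add: powr_add[symmetric] power_add[symmetric] algebra_simps)
    finally show ?thesis .
  qed
  then show ?case by blast
qed

lemma FT_measurable:
  fixes H :: "'q::euclidean_space \<times> 'v::euclidean_space \<Rightarrow> complex" and g :: "'s::euclidean_space \<Rightarrow> 'q"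
  assumes H: "C_infinity H" and g: "continuous_on UNIV g" "continuous_on UNIV h"
  shows "(\<lambda>s. FT H (g s) (h s)) \<in> borel_measurable borel"
proof -
  have "(\<lambda>z::'s \<times> 'v. exp (- \<i> * complex_of_real (snd z \<bullet> h (fst z))) * H (g (fst z), snd z)) \<in> borel_measurable borel"
    by (intro borel_measurable_continuous_onI continuous_intros
        continuous_on_compose2[OF smooth_continuous[OF H, of UNIV]] 
        continuous_on_compose2[OF g(1)] continuous_on_compose2[OF g(2)]) auto
  from borel_measurable_pairI[OF this]
  have "(\<lambda>(s, w). exp (- \<i> * complex_of_real (w \<bullet> h s)) * H (g s, w)) \<in> borel_measurable (lborel \<Otimes>\<^sub>M lborel)"
    by (simp add: split_beta)
  then have "(\<lambda>s. FT H (g s) (h s)) \<in> borel_measurable lborel"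
    unfolding FT_def by (rule lborel.borel_measurable_lebesgue_integral)
  then show ?thesis by simp
qed

text \<open>Differentiation under the integral asks for domination only near the parameter, so a
  local bound of the weight is the right condition.\<close>

definition loc_bdd :: "('a::metric_space \<Rightarrow> real) \<Rightarrow> bool"
  where "loc_bdd W \<longleftrightarrow> (\<forall>p. \<exists>r>0. \<exists>M. \<forall>q\<in>ball p r. \<bar>W q\<bar> \<le> M)"

lemma loc_bdd_continuous: 
  assumes "continuous_on UNIV W" shows "loc_bdd W"
  unfolding loc_bdd_def
proof
  fix p
  have "isCont W p" using assms by (simp add: continuous_on_eq_continuous_at)
  then obtain d where d: "d > 0" "\<And>q. dist q p < d \<Longrightarrow> dist (W q) (W p) < 1"
    by (metis continuous_at_eps_delta zero_less_one)
  then have "\<bar>W q\<bar> \<le> \<bar>W p\<bar> + 1" if "q \<in> ball p d" for q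
    using d(2)[of q] that by (auto simp: dist_commute dist_real_def)
  then show "\<exists>r>0. \<exists>M. \<forall>q\<in>ball p r. \<bar>W q\<bar> \<le> M" using d(1) by blast
qed

lemma loc_bdd_family:
  assumes "finite B" "\<And>b. b \<in> B \<Longrightarrow> loc_bdd (W b)"
  shows "\<exists>r>0. \<exists>M\<ge>0. \<forall>b\<in>B. \<forall>q\<in>ball p r. \<bar>W b q\<bar> \<le> M"
  using assms
proof (induction B)
  case (insert b B)
  then obtain r M where 1: "r > 0" "M \<ge> 0" "\<And>b q. b \<in> B \<Longrightarrow> q \<in> ball p r \<Longrightarrow> \<bar>W b q\<bar> \<le> M" by auto
  obtain r' M' where 2: "r' > 0" "\<And>q. q \<in> ball p r' \<Longrightarrow> \<bar>W b q\<bar> \<le> M'"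
    using insert.prems unfolding loc_bdd_def by (metis insertI1)
  show ?case
    by (rule exI[of _ "min r r'"], intro conjI exI[of _ "max M M'"] ballI)
       (use 1 2 in \<open>force simp: le_max_iff_disj\<close>)+
qed (auto intro: exI[of _ 1])

text \<open>The parameter moves along an affine map g with linear part L. Two instances are used: g
  q = (q, \<kappa>) for derivatives in the outer parameter, and g t = (p, t \<kappa>) for the
  derivative in the scaling parameter.\<close>

lemma FT_has_derivative:
  fixes H :: "'q::euclidean_space \<times> 'v::euclidean_space \<Rightarrow> complex" and g :: "'s::euclidean_space \<Rightarrow> 'q"
  assumes H: "dec \<tau> W H" and g: "C_infinity g"
    and L: "\<And>b q t. b \<in> Basis \<Longrightarrow> g (q + t *\<^sub>R b) = g q + t *\<^sub>R L b"
    and D: "\<And>b. b \<in> Basis \<Longrightarrow> dec \<tau>' (V b) (dir_deriv (L b, 0) H)"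
    and V: "\<And>b. b \<in> Basis \<Longrightarrow> loc_bdd (\<lambda>s. V b (g s))"
  shows "((\<lambda>q. FT H (g q) \<theta>) has_derivative (\<lambda>h. \<Sum>b\<in>Basis. (h \<bullet> b) *\<^sub>R FT (dir_deriv (L b, 0) H) (g q) \<theta>)) (at q)"
proof -
  let ?e = "\<lambda>w::'v. exp (- \<i> * complex_of_real (w \<bullet> \<theta>))"
  have "\<forall>b\<in>Basis. \<exists>C. \<forall>q w. norm (dir_deriv (L b, 0) H (q, w)) \<le> C * V b q * decay w"
    using dec_bound[OF D] by blast
  then obtain C where C: "\<And>b q w. b \<in> Basis \<Longrightarrow> norm (dir_deriv (L b, 0) H (q, w)) \<le> C b * V b q * decay w"
    by metis
  obtain r M where r: "r > 0" "M \<ge> 0" "\<And>b q'. b \<in> Basis \<Longrightarrow> q' \<in> ball q r \<Longrightarrow> \<bar>V b (g q')\<bar> \<le> M"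
    using loc_bdd_family[of Basis "\<lambda>b s. V b (g s)" q] V by auto
  define K where "K = (\<Sum>b\<in>(Basis::'s set). \<bar>C b\<bar>)"
  have CK: "\<bar>C b\<bar> \<le> K" if "b \<in> Basis" for b
    unfolding K_def using that by (intro member_le_sum) auto
  note s = dec_smooth[OF H]
  show ?thesis
    unfolding FT_def
  proof (rule has_derivative_integral[where r = r and g = "\<lambda>w. K * M * decay w"])
    show "integrable lborel (\<lambda>w. ?e w * H (g p, w))" for p by (rule dec_integrable[OF H])
    show "(\<lambda>w. ?e w * dir_deriv (L b, 0) H (g q, w)) \<in> borel_measurable lborel" for b
      using FT_integrand_measurable[OF smooth_dir_deriv[OF s]] by simp
    show "((\<lambda>p. ?e w * H (g p, w)) has_derivative (\<lambda>h. \<Sum>b\<in>Basis. (h \<bullet> b) *\<^sub>R (?e w * dir_deriv (L b, 0) H (g p, w)))) (at p)"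
      for p w
    proof -
      have d: "(\<lambda>p. H (g p, w)) differentiable (at p)"
        by (rule smooth_differentiable[OF smooth_compose[OF smooth_section1[OF s] g]])
      have "((\<lambda>p. ?e w * H (g p, w)) has_derivative (\<lambda>h. ?e w * dir_deriv h (\<lambda>p. H (g p, w)) p)) (at p)"
        by (intro has_derivative_mult_right has_derivative_dir_deriv d)
      moreover have "dir_deriv b (\<lambda>p. H (g p, w)) p = dir_deriv (L b, 0) H (g p, w)" if "b \<in> Basis" for b
        by (simp add: dir_deriv_def L[OF that])
      then have "(\<lambda>h. ?e w * dir_deriv h (\<lambda>p. H (g p, w)) p) =
          (\<lambda>h. \<Sum>b\<in>Basis. (h \<bullet> b) *\<^sub>R (?e w * dir_deriv (L b, 0) H (g p, w)))"
        by (intro ext, subst dir_deriv_Basis[OF d]) (simp add: sum_distrib_left)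
      ultimately show ?thesis by simp
    qed
    show "norm (?e w * dir_deriv (L b, 0) H (g p, w)) \<le> K * M * decay w" if p: "p \<in> ball q r" and b: "b \<in> Basis" for p w b
    proof -
      have "norm (?e w * dir_deriv (L b, 0) H (g p, w)) \<le> C b * V b (g p) * decay w"
        using C[OF b] by (simp add: norm_mult)
      also have "\<dots> \<le> \<bar>C b\<bar> * \<bar>V b (g p)\<bar> * decay w"
        by (intro mult_right_mono) (auto simp: abs_mult[symmetric])
      also have "\<dots> \<le> K * M * decay w"
        using CK[OF b] r b p by (intro mult_right_mono mult_mono) (auto simp: order_trans[OF abs_ge_zero CK[OF b]])
      finally show ?thesis .
    qed
    show "integrable lborel (\<lambda>w::'v. K * M * decay w)"
      by (intro integrable_mult_right integrable_decay)
  qed (rule r)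
qed

text \<open>The double integral of exp(- i w . \<kappa>) H((p, \<kappa>), w), in iterated form. H
  may grow in \<kappa>, so absolute convergence as a double integral cannot be expected; the inner
  integral decays rapidly and makes the outer one absolutely convergent.\<close>

definition osc_int :: "(('p \<times> 'v::euclidean_space) \<times> 'v \<Rightarrow> complex) \<Rightarrow> 'p \<Rightarrow> complex"
  where "osc_int H p = (LINT \<kappa>|lborel. FT H (p, \<kappa>) \<kappa>)"

text \<open>The bound keeps \<kappa> and \<theta> independent because it is used at \<theta> =
  \<kappa> and also with t \<kappa> in place of \<kappa>. The number l of applications of 1 -
  \<Delta> is chosen to cover the growth K and to leave the integrable power - 2n.\<close>

lemma osc_int_integrand:
  fixes H :: "('p::euclidean_space \<times> 'v::euclidean_space) \<times> 'v \<Rightarrow> complex"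
  assumes H: "dec (\<lambda>_. 1) (\<lambda>q. W (fst q) * bracket (snd q) powr K) H" and W: "\<And>p. W p \<ge> 0"
  shows "\<exists>C\<ge>0. \<forall>p \<kappa> \<theta>. norm (FT H (p, \<kappa>) \<theta>) * bracket \<theta> powr K \<le> C * W p * bracket \<kappa> powr K * decay \<theta>"
proof -
  obtain l :: nat where l: "2 * real l \<ge> K + 2 * real DIM('v)"
    using real_arch_simple[of "(K + 2 * real DIM('v)) / 2"] by (auto simp: field_simps)
  obtain C where C: "\<And>q \<theta>. norm (FT H q \<theta>) \<le> C * (W (fst q) * bracket (snd q) powr K) * 1 ^ (2 * l) * bracket \<theta> powr (- 2 * real l)"
  proof -
    have "\<exists>C. \<forall>q \<theta>. norm (FT H q \<theta>) \<le> C * (W (fst q) * bracket (snd q) powr K) * 1 ^ (2 * l) * bracket \<theta> powr (- 2 * real l)"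
      by (rule FT_decay[OF H]) (use W in auto)
    then show ?thesis using that by blast
  qed
  have "norm (FT H (p, \<kappa>) \<theta>) * bracket \<theta> powr K \<le> \<bar>C\<bar> * W p * bracket \<kappa> powr K * decay \<theta>" for p \<kappa> \<theta>
  proof -
    have "norm (FT H (p, \<kappa>) \<theta>) * bracket \<theta> powr K \<le> (C * (W p * bracket \<kappa> powr K) * bracket \<theta> powr (- 2 * real l)) * bracket \<theta> powr K"
      using C[of "(p, \<kappa>)" \<theta>] by (intro mult_right_mono) auto
    also have "\<dots> = C * (W p * bracket \<kappa> powr K * bracket \<theta> powr (K - 2 * real l))"
      by (simp add: powr_diff powr_minus field_simps)
    also have "\<dots> \<le> \<bar>C\<bar> * (W p * bracket \<kappa> powr K * bracket \<theta> powr (K - 2 * real l))"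
      using W by (intro mult_right_mono) auto
    also have "\<dots> \<le> \<bar>C\<bar> * (W p * bracket \<kappa> powr K * decay \<theta>)"
      using W l bracket_ge_1[of \<theta>] by (intro mult_left_mono powr_mono) auto
    finally show ?thesis by (simp add: mult_ac)
  qed
  then show ?thesis by (intro exI[of _ "\<bar>C\<bar>"]) auto
qed

lemma osc_int_integrand_diag:
  fixes H :: "('p::euclidean_space \<times> 'v::euclidean_space) \<times> 'v \<Rightarrow> complex"
  assumes H: "dec (\<lambda>_. 1) (\<lambda>q. W (fst q) * bracket (snd q) powr K) H" and W: "\<And>p. W p \<ge> 0"
  shows "\<exists>C\<ge>0. \<forall>p \<kappa>. norm (FT H (p, \<kappa>) \<kappa>) \<le> C * W p * decay \<kappa>"
proof -
  obtain C where C: "C \<ge> 0" "\<And>p \<kappa> \<theta>. norm (FT H (p, \<kappa>) \<theta>) * bracket \<theta> powr K \<le> C * W p * bracket \<kappa> powr K * decay \<theta>"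
    using osc_int_integrand[OF assms] by blast
  have "norm (FT H (p, \<kappa>) \<kappa>) \<le> C * W p * decay \<kappa>" for p \<kappa>
  proof -
    have "norm (FT H (p, \<kappa>) \<kappa>) * bracket \<kappa> powr K \<le> (C * W p * decay \<kappa>) * bracket \<kappa> powr K"
      using C(2)[of p \<kappa> \<kappa>] by (simp add: mult_ac)
    then show ?thesis using bracket_pos[of \<kappa>] by (simp add: mult_le_cancel_right)
  qed
  then show ?thesis using C(1) by blast
qed

lemma osc_int_measurable:
  fixes H :: "('p::euclidean_space \<times> 'v::euclidean_space) \<times> 'v \<Rightarrow> complex"
  shows "C_infinity H \<Longrightarrow> (\<lambda>\<kappa>. FT H (p, \<kappa>) \<kappa>) \<in> borel_measurable borel"
  by (intro FT_measurable continuous_intros)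

lemma osc_int_integrable:
  fixes H :: "('p::euclidean_space \<times> 'v::euclidean_space) \<times> 'v \<Rightarrow> complex"
  assumes H: "dec (\<lambda>_. 1) (\<lambda>q. W (fst q) * bracket (snd q) powr K) H" and W: "\<And>p. W p \<ge> 0"
  shows "integrable lborel (\<lambda>\<kappa>. FT H (p, \<kappa>) \<kappa>)"
proof -
  obtain C where "\<And>p \<kappa>. norm (FT H (p, \<kappa>) \<kappa>) \<le> C * W p * decay \<kappa>"
    using osc_int_integrand_diag[OF assms] by blast
  then show ?thesis
    by (intro integrable_by_decay[of _ "C * W p"] osc_int_measurable dec_smooth[OF H])
qed

lemma osc_int_bound:
  fixes H :: "('p::euclidean_space \<times> 'v::euclidean_space) \<times> 'v \<Rightarrow> complex"
  assumes H: "dec (\<lambda>_. 1) (\<lambda>q. W (fst q) * bracket (snd q) powr K) H" and W: "\<And>p. W p \<ge> 0"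
  shows "\<exists>C\<ge>0. \<forall>p. norm (osc_int H p) \<le> C * W p"
proof -
  obtain C where C: "C \<ge> 0" "\<And>p \<kappa>. norm (FT H (p, \<kappa>) \<kappa>) \<le> C * W p * decay \<kappa>"
    using osc_int_integrand_diag[OF assms] by blast
  have "norm (osc_int H p) \<le> (C * W p) * (LINT y|lborel. decay (y::'v))" for p
    unfolding osc_int_def using C by (intro integral_decay_bound osc_int_measurable dec_smooth[OF H]) auto
  moreover have "(LINT y|lborel. decay (y::'v)) \<ge> 0" by (rule integral_nonneg_AE) auto
  ultimately show ?thesis using C(1)
    by (intro exI[of _ "C * (LINT y|lborel. decay (y::'v))"]) (auto simp: mult_ac)
qed

text \<open>Each parameter derivative may have its own weight W and its own growth K. That is enough
  to differentiate \<open>osc_int\<close> under the integral any number of times; the precise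
  weights matter only in the final bounds.\<close>

definition osc :: "(('p::euclidean_space \<times> 'v::euclidean_space) \<times> 'v \<Rightarrow> complex) \<Rightarrow> bool"
  where "osc H \<longleftrightarrow> (\<forall>ds. set ds \<subseteq> Basis \<longrightarrow> (\<exists>W K. (\<forall>p. W p \<ge> 0) \<and> loc_bdd W \<and>
    dec (\<lambda>_. 1) (\<lambda>q. W (fst q) * bracket (snd q) powr K) (dir_derivs (map (\<lambda>d. ((d, 0), 0)) ds) H)))"

lemma osc_dec:
  assumes "osc H"
  obtains W K where "\<And>p. W p \<ge> 0" "loc_bdd W" "dec (\<lambda>_. 1) (\<lambda>q. W (fst q) * bracket (snd q) powr K) H"
  using assms[unfolded osc_def, rule_format, of "[]"] by auto

lemma osc_dir_deriv:
  fixes H :: "('p::euclidean_space \<times> 'v::euclidean_space) \<times> 'v \<Rightarrow> complex"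
  shows "osc H \<Longrightarrow> b \<in> Basis \<Longrightarrow> osc (dir_deriv ((b, 0), 0) H)"
  unfolding osc_def
proof (intro allI impI)
  fix ds :: "'p list" assume a: "\<forall>ds. set ds \<subseteq> Basis \<longrightarrow> (\<exists>W K. (\<forall>p. W p \<ge> 0) \<and> loc_bdd W \<and>
    dec (\<lambda>_. 1) (\<lambda>q. W (fst q) * bracket (snd q) powr K) (dir_derivs (map (\<lambda>d. ((d, 0), 0)) ds) H))"
    "b \<in> Basis" "set ds \<subseteq> Basis"
  then show "\<exists>W K. (\<forall>p. W p \<ge> 0) \<and> loc_bdd W \<and> dec (\<lambda>_. 1) (\<lambda>q. W (fst q) * bracket (snd q) powr K)
      (dir_derivs (map (\<lambda>d. ((d, 0), 0)) ds) (dir_deriv ((b, 0), 0) H))"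
    using a(1)[rule_format, of "ds @ [b]"] by simp
qed

lemma loc_bdd_mult_const: "loc_bdd W \<Longrightarrow> loc_bdd (\<lambda>p. W p * c)"
  unfolding loc_bdd_def
proof
  fix p assume "\<forall>p. \<exists>r>0. \<exists>M. \<forall>q\<in>ball p r. \<bar>W q\<bar> \<le> M"
  then obtain r M where "r > 0" "\<And>q. q \<in> ball p r \<Longrightarrow> \<bar>W q\<bar> \<le> M" by metis
  then have "\<forall>q\<in>ball p r. \<bar>W q * c\<bar> \<le> M * \<bar>c\<bar>" by (auto simp: abs_mult intro: mult_right_mono)
  then show "\<exists>r>0. \<exists>M. \<forall>q\<in>ball p r. \<bar>W q * c\<bar> \<le> M" using \<open>r > 0\<close> by blast
qed

lemma osc_int_has_derivative:
  fixes H :: "('p::euclidean_space \<times> 'v::euclidean_space) \<times> 'v \<Rightarrow> complex"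
  assumes H: "osc H"
  shows "(osc_int H has_derivative (\<lambda>h. \<Sum>b\<in>Basis. (h \<bullet> b) *\<^sub>R osc_int (dir_deriv ((b, 0), 0) H) p)) (at p)"
proof -
  obtain W0 K0 where 0: "\<And>p. W0 p \<ge> 0" "loc_bdd W0"
      "dec (\<lambda>_. 1) (\<lambda>q. W0 (fst q) * bracket (snd q) powr K0) H"
    by (rule osc_dec[OF H]) (rule that; assumption)
  have "\<forall>b\<in>Basis. \<exists>WK. (\<forall>p. fst WK p \<ge> 0) \<and> loc_bdd (fst WK) \<and>
      dec (\<lambda>_. 1) (\<lambda>q. fst WK (fst q) * bracket (snd q) powr snd WK) (dir_deriv ((b, 0), 0) H)"
    using osc_dir_deriv[OF H, unfolded osc_def, rule_format, of _ "[]"] by simp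
  from bchoice[OF this] obtain WK where WK: "\<forall>b\<in>Basis. (\<forall>p. fst (WK b) p \<ge> 0) \<and> loc_bdd (fst (WK b)) \<and>
      dec (\<lambda>_. 1) (\<lambda>q. fst (WK b) (fst q) * bracket (snd q) powr snd (WK b)) (dir_deriv ((b, 0), 0) H)"
    by (elim exE)
  define W where "W = (\<lambda>b. fst (WK b))"
  define K where "K = (\<lambda>b. snd (WK b))"
  have D: "\<And>b p. b \<in> Basis \<Longrightarrow> W b p \<ge> 0" "\<And>b. b \<in> Basis \<Longrightarrow> loc_bdd (W b)"
      "\<And>b. b \<in> Basis \<Longrightarrow> dec (\<lambda>_. 1) (\<lambda>q. W b (fst q) * bracket (snd q) powr K b) (dir_deriv ((b, 0), 0) H)"
    unfolding W_def K_def using WK by blast+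
  have "\<forall>b\<in>Basis. \<exists>C\<ge>0. \<forall>p \<kappa>. norm (FT (dir_deriv ((b, 0), 0) H) (p, \<kappa>) \<kappa>) \<le> C * W b p * decay \<kappa>"
    by (intro ballI osc_int_integrand_diag[OF D(3) D(1)])
  from bchoice[OF this] obtain C where C0: "\<forall>b\<in>Basis. C b \<ge> 0 \<and>
      (\<forall>p \<kappa>. norm (FT (dir_deriv ((b, 0), 0) H) (p, \<kappa>) \<kappa>) \<le> C b * W b p * decay \<kappa>)"
    by (elim exE)
  then have C: "\<And>b. b \<in> Basis \<Longrightarrow> C b \<ge> 0"
      "\<And>b p \<kappa>. b \<in> Basis \<Longrightarrow> norm (FT (dir_deriv ((b, 0), 0) H) (p, \<kappa>) \<kappa>) \<le> C b * W b p * decay \<kappa>"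
    by blast+
  obtain r M where r: "r > 0" "M \<ge> 0" "\<And>b q. b \<in> Basis \<Longrightarrow> q \<in> ball p r \<Longrightarrow> \<bar>W b q\<bar> \<le> M"
    using loc_bdd_family[of Basis W p] D(2) by auto
  define K' where "K' = (\<Sum>b\<in>(Basis::'p set). C b)"
  have CK: "C b \<le> K'" if "b \<in> Basis" for b
    unfolding K'_def using that C by (intro member_le_sum) auto
  show ?thesis
    unfolding osc_int_def
  proof (rule has_derivative_integral[where r = r and g = "\<lambda>w. K' * M * decay w"])
    show "integrable lborel (\<lambda>\<kappa>. FT H (q, \<kappa>) \<kappa>)" for q by (rule osc_int_integrable[OF 0(3,1)])
    show "(\<lambda>\<kappa>. FT (dir_deriv ((b, 0), 0) H) (p, \<kappa>) \<kappa>) \<in> borel_measurable lborel" for b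
      using osc_int_measurable[OF smooth_dir_deriv[OF dec_smooth[OF 0(3)]]] by simp
    show "((\<lambda>q. FT H (q, \<kappa>) \<kappa>) has_derivative
        (\<lambda>h. \<Sum>b\<in>Basis. (h \<bullet> b) *\<^sub>R FT (dir_deriv ((b, 0), 0) H) (q, \<kappa>) \<kappa>)) (at q)" for q \<kappa>
      by (rule FT_has_derivative[OF 0(3), where L = "\<lambda>b. (b, 0)", OF _ _ D(3)])
         (auto intro!: smooth_intros loc_bdd_mult_const D(2))
    show "norm (FT (dir_deriv ((b, 0), 0) H) (q, \<kappa>) \<kappa>) \<le> K' * M * decay \<kappa>"
      if q: "q \<in> ball p r" and b: "b \<in> Basis" for q \<kappa> b
    proof -
      have "W b q \<le> M" using r(3)[OF b q] by simp
      then have "C b * W b q * decay \<kappa> \<le> K' * M * decay \<kappa>"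
        using C(1)[OF b] CK[OF b] D(1)[OF b] by (intro mult_right_mono mult_mono) auto
      then show ?thesis using C(2)[OF b, of q \<kappa>] by linarith
    qed
    show "integrable lborel (\<lambda>w::'v. K' * M * decay w)"
      by (intro integrable_mult_right integrable_decay)
  qed (rule r)
qed

lemma osc_int_differentiable: "osc H \<Longrightarrow> osc_int H differentiable (at p)"
  using osc_int_has_derivative by (auto simp: differentiable_def)

lemma dir_deriv_osc_int: 
  assumes "osc H" "b \<in> Basis"
  shows "dir_deriv b (osc_int H) = osc_int (dir_deriv ((b, 0), 0) H)"
proof
  fix p
  have "dir_deriv b (osc_int H) p = (\<Sum>c\<in>Basis. (b \<bullet> c) *\<^sub>R osc_int (dir_deriv ((c, 0), 0) H) p)"
    by (rule dir_deriv_eqI[OF osc_int_has_derivative[OF assms(1)]])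
  also have "\<dots> = (\<Sum>c\<in>Basis. if b = c then osc_int (dir_deriv ((c, 0), 0) H) p else 0)"
    using assms(2) by (intro sum.cong) (auto simp: inner_Basis)
  finally show "dir_deriv b (osc_int H) p = osc_int (dir_deriv ((b, 0), 0) H) p"
    using assms(2) by simp
qed

lemma smooth_osc_int:
  assumes "osc H" shows "C_infinity (osc_int H)"
proof -
  have "Ck k (osc_int H)" for k
    using assms
  proof (induction k arbitrary: H)
    case 0
    then show ?case
      by (auto simp: continuous_on_eq_continuous_at intro: differentiable_imp_continuous_within osc_int_differentiable)
  next
    case (Suc k)
    then show ?case by (auto simp: osc_int_differentiable dir_deriv_osc_int osc_dir_deriv)
  qed
  then show ?thesis by (simp add: C_infinity_def)
qed

lemma osc_dir_derivs: "osc H \<Longrightarrow> set ds \<subseteq> Basis \<Longrightarrow> osc (dir_derivs (map (\<lambda>d. ((d, 0), 0)) ds) H)"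
  by (induction ds) (auto intro: osc_dir_deriv)

lemma dir_derivs_osc_int:
  "osc H \<Longrightarrow> set ds \<subseteq> Basis \<Longrightarrow> dir_derivs ds (osc_int H) = osc_int (dir_derivs (map (\<lambda>d. ((d, 0), 0)) ds) H)"
  by (induction ds) (auto simp: dir_deriv_osc_int osc_dir_derivs)

section \<open>Fourier inversion and the Taylor expansion of iterated integrals\<close>

definition gauss :: "'v::euclidean_space \<Rightarrow> real"
  where "gauss v = exp (- (norm v)\<^sup>2 / 2)"

text \<open>The characteristic function of the standard normal distribution, with its density
  written out.\<close>

lemma gauss_1D:
  "has_bochner_integral lborel (\<lambda>t::real. exp (- \<i> * complex_of_real (t * s)) * complex_of_real (exp (- t\<^sup>2 / 2)))
    (complex_of_real (sqrt (2 * pi) * exp (- s\<^sup>2 / 2)))"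
proof -
  let ?f = "\<lambda>t. iexp (- s * t)"
  have i: "integrable std_normal_distribution ?f"
    by (rule finite_measure.integrable_const_bound[of _ _ 1])
       (auto intro!: prob_space.finite_measure prob_space_normal_density)
  have "(CLINT t|std_normal_distribution. ?f t) = complex_of_real (exp (- s\<^sup>2 / 2))"
    using fun_cong[OF char_std_normal_distribution, of "- s"] by (simp add: char_def)
  then have "has_bochner_integral std_normal_distribution ?f (complex_of_real (exp (- s\<^sup>2 / 2)))"
    using i by (simp add: has_bochner_integral_iff)
  then have "has_bochner_integral lborel (\<lambda>t. std_normal_density t *\<^sub>R ?f t) (complex_of_real (exp (- s\<^sup>2 / 2)))"
    unfolding has_bochner_integral_iff by (simp add: integrable_density integral_density)
  then have "has_bochner_integral lborel (\<lambda>t. complex_of_real (sqrt (2 * pi)) * (std_normal_density t *\<^sub>R ?f t))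
      (complex_of_real (sqrt (2 * pi)) * complex_of_real (exp (- s\<^sup>2 / 2)))"
    by (rule has_bochner_integral_mult_right)
  moreover have "complex_of_real (sqrt (2 * pi)) * (std_normal_density t *\<^sub>R ?f t) =
      exp (- \<i> * complex_of_real (t * s)) * complex_of_real (exp (- t\<^sup>2 / 2))" for t
    by (simp add: std_normal_density_def scaleR_conv_of_real field_simps)
  ultimately show ?thesis by simp
qed

lemma gauss_FT:
  fixes w :: "'v::euclidean_space"
  shows "has_bochner_integral lborel (\<lambda>k. exp (- \<i> * complex_of_real (k \<bullet> w)) * complex_of_real (gauss k))
    (complex_of_real (sqrt (2 * pi) ^ DIM('v) * gauss w))"
proof -
  interpret product_sigma_finite "\<lambda>_::'v. lborel :: real measure" by standard
  let ?T = "\<lambda>f. \<Sum>b\<in>(Basis::'v set). f b *\<^sub>R b"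
  let ?F = "\<lambda>k::'v. exp (- \<i> * complex_of_real (k \<bullet> w)) * complex_of_real (gauss k)"
  let ?h = "\<lambda>b t. exp (- \<i> * complex_of_real (t * (w \<bullet> b))) * complex_of_real (exp (- t\<^sup>2 / 2))"
  have gm: "continuous_on UNIV (gauss :: 'v \<Rightarrow> real)"
    unfolding gauss_def by (intro continuous_intros) auto
  have Fm: "?F \<in> borel_measurable borel"
    by (intro borel_measurable_continuous_onI continuous_intros gm)
  have Tm: "?T \<in> measurable (\<Pi>\<^sub>M b\<in>(Basis::'v set). lborel) borel" by measurable
  have FT: "?F (?T f) = (\<Prod>b\<in>Basis. ?h b (f b))" for f
  proof -
    have "?T f \<bullet> w = (\<Sum>b\<in>Basis. f b * (w \<bullet> b))"
      unfolding inner_sum_left by (simp add: inner_commute)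
    moreover have "(norm (?T f))\<^sup>2 = (\<Sum>b\<in>Basis. (f b)\<^sup>2)"
      unfolding power2_norm_eq_inner by (subst euclidean_inner) (simp add: power2_eq_square)
    ultimately have "?F (?T f) = exp (\<Sum>b\<in>Basis. - \<i> * complex_of_real (f b * (w \<bullet> b))) *
        complex_of_real (exp (\<Sum>b\<in>Basis. - (f b)\<^sup>2 / 2))"
      by (simp add: gauss_def sum_distrib_left sum_negf sum_divide_distrib)
    then show ?thesis by (simp only: exp_sum[OF finite_Basis] of_real_prod prod.distrib)
  qed
  have hi: "integrable lborel (?h b)" and hv: "integral\<^sup>L lborel (?h b) = complex_of_real (sqrt (2 * pi) * exp (- (w \<bullet> b)\<^sup>2 / 2))" for b
    using gauss_1D[of "w \<bullet> b"] by (auto simp: has_bochner_integral_iff)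
  have "integrable lborel ?F"
    by (subst lborel_eq, subst integrable_distr_eq[OF Tm Fm], unfold FT)
       (intro product_integrable_prod finite_Basis hi)
  moreover have "integral\<^sup>L lborel ?F = (\<Prod>b\<in>(Basis::'v set). complex_of_real (sqrt (2 * pi) * exp (- (w \<bullet> b)\<^sup>2 / 2)))"
    by (subst lborel_eq, subst integral_distr[OF Tm Fm], unfold FT)
       (simp only: product_integral_prod[OF finite_Basis hi] hv)
  moreover have "(\<Prod>b\<in>(Basis::'v set). complex_of_real (sqrt (2 * pi) * exp (- (w \<bullet> b)\<^sup>2 / 2))) =
      complex_of_real (sqrt (2 * pi) ^ DIM('v) * gauss w)"
  proof -
    have "(norm w)\<^sup>2 = (\<Sum>b\<in>Basis. (w \<bullet> b)\<^sup>2)"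
      unfolding power2_norm_eq_inner by (subst euclidean_inner) (simp add: power2_eq_square)
    then show ?thesis
      by (simp add: gauss_def prod.distrib of_real_prod[symmetric] exp_sum[symmetric] sum_negf sum_divide_distrib del: of_real_prod)
  qed
  ultimately show ?thesis by (simp add: has_bochner_integral_iff)
qed

lemma gauss_le_1: "gauss v \<le> 1" and gauss_pos: "gauss v > 0"
  by (auto simp: gauss_def)

lemma gauss_continuous [continuous_intros]:
  "continuous_on S f \<Longrightarrow> continuous_on S (\<lambda>x. gauss (f x :: 'v::euclidean_space))"
  unfolding gauss_def by (intro continuous_intros) auto

lemma integrable_gauss: "integrable lborel (gauss :: 'v::euclidean_space \<Rightarrow> real)"
  and integral_gauss: "(LINT v|lborel. gauss (v::'v)) = sqrt (2 * pi) ^ DIM('v)"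
proof -
  have 1: "has_bochner_integral lborel (\<lambda>k::'v. complex_of_real (gauss k)) (complex_of_real (sqrt (2 * pi) ^ DIM('v)))"
    using gauss_FT[of "0::'v"] by (simp add: gauss_def)
  then show "integrable lborel (gauss :: 'v \<Rightarrow> real)"
    by (simp add: has_bochner_integral_iff complex_of_real_integrable_eq)
  show "(LINT v|lborel. gauss (v::'v)) = sqrt (2 * pi) ^ DIM('v)"
    using 1 by (simp only: has_bochner_integral_iff integral_complex_of_real of_real_eq_iff)
qed

lemma integrable_pair_mult:
  fixes f :: "'a::euclidean_space \<Rightarrow> real" and g :: "'b::euclidean_space \<Rightarrow> real"
  assumes f: "integrable lborel f" and g: "integrable lborel g"
  shows "integrable (lborel \<Otimes>\<^sub>M lborel) (\<lambda>(x, y). f x * g y)"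
proof (rule lborel_pair.Fubini_integrable)
  have [measurable]: "f \<in> borel_measurable borel" "g \<in> borel_measurable borel" using f g by auto
  show "(\<lambda>(x, y). f x * g y) \<in> borel_measurable (lborel \<Otimes>\<^sub>M lborel)" by measurable
  show "integrable lborel (\<lambda>x. LINT y|lborel. norm (case (x, y) of (x, y) \<Rightarrow> f x * g y))"
    using f by (simp add: abs_mult)
qed (use g in auto)

lemma lborel_Fubini_swap:
  fixes F :: "'a::euclidean_space \<Rightarrow> 'b::euclidean_space \<Rightarrow> complex"
  assumes m: "(\<lambda>z. F (fst z) (snd z)) \<in> borel_measurable borel"
    and b: "\<And>x y. norm (F x y) \<le> f x * g y" and f: "integrable lborel f" and g: "integrable lborel g"
  shows "(LINT x|lborel. LINT y|lborel. F x y) = (LINT y|lborel. LINT x|lborel. F x y)"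
proof -
  have "integrable (lborel \<Otimes>\<^sub>M lborel) (case_prod F)"
  proof (rule Bochner_Integration.integrable_bound[OF integrable_pair_mult[OF f g]])
    show "case_prod F \<in> borel_measurable (lborel \<Otimes>\<^sub>M lborel)"
      using borel_measurable_pairI[OF m] by (simp add: split_beta')
    show "AE z in lborel \<Otimes>\<^sub>M lborel. norm (case_prod F z) \<le> norm (case z of (x, y) \<Rightarrow> f x * g y)"
      by (rule AE_I2) (auto intro: order_trans[OF b abs_ge_self])
  qed
  from lborel_pair.Fubini_integral[OF this] show ?thesis by simp
qed

text \<open>Insert the factor \<open>gauss\<close> (\<epsilon> \<kappa>) and find the limit of the
  integral \<open>A\<close> for \<epsilon> tending to 0 in two ways: directly by dominated
  convergence, and after Fubini as an average of G(w + \<epsilon> v) against a Gaussian in v. The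
  Fourier transform and the total mass of the Gaussian contribute (2 \<pi>)^(n/2) each.\<close>

lemma fourier_inversion:
  fixes G :: "'v::euclidean_space \<Rightarrow> complex"
  assumes c: "continuous_on UNIV G" and B: "\<And>w. norm (G w) \<le> B" and i: "integrable lborel G"
    and G': "\<And>\<kappa>. G' \<kappa> = (LINT w|lborel. exp (- \<i> * complex_of_real (w \<bullet> \<kappa>)) * G w)" and i': "integrable lborel G'"
  shows "(LINT \<kappa>|lborel. exp (\<i> * complex_of_real (w \<bullet> \<kappa>)) * G' \<kappa>) = complex_of_real ((2 * pi) ^ DIM('v)) * G w"
proof -
  let ?n = "DIM('v)" and ?c = "sqrt (2 * pi) ^ DIM('v)"
  define \<epsilon> where "\<epsilon> = (\<lambda>j::nat. 1 / real (Suc j))"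
  have \<epsilon>: "\<epsilon> j > 0" for j by (simp add: \<epsilon>_def)
  have \<epsilon>0: "\<epsilon> \<longlonglongrightarrow> 0" unfolding \<epsilon>_def by (rule LIMSEQ_inverse_real_of_nat[unfolded inverse_eq_divide])
  define A where "A = (\<lambda>j. LINT \<kappa>|lborel. exp (\<i> * complex_of_real (w \<bullet> \<kappa>)) * G' \<kappa> * complex_of_real (gauss (\<epsilon> j *\<^sub>R \<kappa>)))"
  have [measurable]: "G' \<in> borel_measurable borel" "G \<in> borel_measurable borel" using i i' by auto
  have [measurable]: "(gauss :: 'v \<Rightarrow> real) \<in> borel_measurable borel"
    by (intro borel_measurable_continuous_onI continuous_intros)
  have [measurable]: "(\<lambda>\<kappa>::'v. exp (\<i> * complex_of_real (w \<bullet> \<kappa>))) \<in> borel_measurable borel" for w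
    by (intro borel_measurable_continuous_onI continuous_intros)
  have gauss_lim: "(\<lambda>j. gauss (\<epsilon> j *\<^sub>R \<kappa>)) \<longlonglongrightarrow> 1" for \<kappa> :: 'v
  proof -
    have "isCont gauss (0::'v)"
      using gauss_continuous[OF continuous_on_id, of "UNIV::'v set"] by (simp add: continuous_on_eq_continuous_at)
    moreover have "(\<lambda>j. \<epsilon> j *\<^sub>R \<kappa>) \<longlonglongrightarrow> 0" using tendsto_scaleR[OF \<epsilon>0 tendsto_const[of \<kappa>]] by simp
    ultimately have "(\<lambda>j. gauss (\<epsilon> j *\<^sub>R \<kappa>)) \<longlonglongrightarrow> gauss (0::'v)" by (rule isCont_tendsto_compose)
    then show ?thesis by (simp add: gauss_def)
  qed
  have lim1: "A \<longlonglongrightarrow> (LINT \<kappa>|lborel. exp (\<i> * complex_of_real (w \<bullet> \<kappa>)) * G' \<kappa>)"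
    unfolding A_def
  proof (rule integral_dominated_convergence[where w = "\<lambda>\<kappa>. norm (G' \<kappa>)"])
    show "AE x in lborel. (\<lambda>j. exp (\<i> * complex_of_real (w \<bullet> x)) * G' x * complex_of_real (gauss (\<epsilon> j *\<^sub>R x)))
        \<longlonglongrightarrow> exp (\<i> * complex_of_real (w \<bullet> x)) * G' x"
      using tendsto_mult[OF tendsto_const tendsto_of_real[OF gauss_lim]] by fastforce
    show "AE x in lborel. norm (exp (\<i> * complex_of_real (w \<bullet> x)) * G' x * complex_of_real (gauss (\<epsilon> j *\<^sub>R x))) \<le> norm (G' x)" for j
    proof (rule AE_I2)
      fix x
      show "norm (exp (\<i> * complex_of_real (w \<bullet> x)) * G' x * complex_of_real (gauss (\<epsilon> j *\<^sub>R x))) \<le> norm (G' x)"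
        using mult_left_mono[OF gauss_le_1[of "\<epsilon> j *\<^sub>R x"] norm_ge_zero[of "G' x"]] gauss_pos[of "\<epsilon> j *\<^sub>R x"]
        by (simp add: norm_mult)
    qed
  qed (use i' in auto)
  have inner: "(LINT \<kappa>|lborel. exp (- \<i> * complex_of_real (\<kappa> \<bullet> u)) * complex_of_real (gauss (\<epsilon> j *\<^sub>R \<kappa>))) =
      complex_of_real (?c * gauss ((1 / \<epsilon> j) *\<^sub>R u) / \<epsilon> j ^ ?n)" for j and u :: 'v
  proof -
    let ?f = "\<lambda>k. exp (- \<i> * complex_of_real (k \<bullet> ((1 / \<epsilon> j) *\<^sub>R u))) * complex_of_real (gauss k)"
    have "integral\<^sup>L lborel ?f = \<bar>\<epsilon> j\<bar> ^ ?n *\<^sub>R (LINT y|lborel. ?f (0 + \<epsilon> j *\<^sub>R y))"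
    proof (rule integral_lborel_affine[of ?f "\<epsilon> j" 0])
      show "?f \<in> borel_measurable borel" by (intro borel_measurable_continuous_onI continuous_intros)
    qed (use \<epsilon>[of j] in simp)
    also have "\<dots> = complex_of_real (\<epsilon> j ^ ?n) * (LINT \<kappa>|lborel. exp (- \<i> * complex_of_real (\<kappa> \<bullet> u)) * complex_of_real (gauss (\<epsilon> j *\<^sub>R \<kappa>)))"
      using \<epsilon>[of j] by (simp add: scaleR_conv_of_real)
    finally show ?thesis
      using gauss_FT[of "(1 / \<epsilon> j) *\<^sub>R u"] \<epsilon>[of j] by (simp add: has_bochner_integral_iff field_simps)
  qed
  have A2: "A j = (LINT v|lborel. G (w + \<epsilon> j *\<^sub>R v) * complex_of_real (?c * gauss v))" for j
  proof -
    let ?F = "\<lambda>\<kappa> w'. exp (- \<i> * complex_of_real (\<kappa> \<bullet> (w' - w))) * complex_of_real (gauss (\<epsilon> j *\<^sub>R \<kappa>)) * G w'"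
    have "A j = (LINT \<kappa>|lborel. LINT w'|lborel. ?F \<kappa> w')"
      unfolding A_def
    proof (intro Bochner_Integration.integral_cong refl)
      fix \<kappa> :: 'v
      have "(LINT w'|lborel. ?F \<kappa> w') =
          (LINT w'|lborel. (exp (\<i> * complex_of_real (w \<bullet> \<kappa>)) * complex_of_real (gauss (\<epsilon> j *\<^sub>R \<kappa>))) *
            (exp (- \<i> * complex_of_real (w' \<bullet> \<kappa>)) * G w'))"
        by (intro Bochner_Integration.integral_cong refl)
           (simp add: inner_diff_right inner_commute right_diff_distrib exp_diff exp_minus field_simps)
      then show "exp (\<i> * complex_of_real (w \<bullet> \<kappa>)) * G' \<kappa> * complex_of_real (gauss (\<epsilon> j *\<^sub>R \<kappa>)) = (LINT w'|lborel. ?F \<kappa> w')"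
        by (simp add: G')
    qed
    also have "\<dots> = (LINT w'|lborel. LINT \<kappa>|lborel. ?F \<kappa> w')"
    proof (rule lborel_Fubini_swap[where f = "\<lambda>\<kappa>. gauss (\<epsilon> j *\<^sub>R \<kappa>)" and g = "\<lambda>w. norm (G w)"])
      show "(\<lambda>z. ?F (fst z) (snd z)) \<in> borel_measurable borel"
        by (intro borel_measurable_continuous_onI continuous_intros continuous_on_compose2[OF c]) auto
      show "norm (?F x y) \<le> gauss (\<epsilon> j *\<^sub>R x) * norm (G y)" for x y
        using gauss_pos[of "\<epsilon> j *\<^sub>R x"] by (simp add: norm_mult)
      show "integrable lborel (\<lambda>k::'v. gauss (\<epsilon> j *\<^sub>R k))"
      \<comment> \<open>A function that is not integrable has integral 0 by convention, whereas the
        value given by \<open>inner\<close> at u = 0 is positive.\<close>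
      proof (rule ccontr)
        assume "\<not> integrable lborel (\<lambda>k::'v. gauss (\<epsilon> j *\<^sub>R k))"
        then have "(LINT k|lborel. complex_of_real (gauss (\<epsilon> j *\<^sub>R (k::'v)))) = 0"
          by (intro not_integrable_integral_eq) (simp add: complex_of_real_integrable_eq)
        then show False using inner[of 0 j] \<epsilon>[of j] gauss_pos[of "0::'v"] by simp
      qed
    qed (use i in auto)
    also have "\<dots> = (LINT w'|lborel. G w' * complex_of_real (?c * gauss ((1 / \<epsilon> j) *\<^sub>R (w' - w)) / \<epsilon> j ^ ?n))"
      using inner by (simp add: mult.commute)
    also have "\<dots> = \<bar>\<epsilon> j\<bar> ^ ?n *\<^sub>R (LINT v|lborel. G (w + \<epsilon> j *\<^sub>R v) *
        complex_of_real (?c * gauss ((1 / \<epsilon> j) *\<^sub>R (w + \<epsilon> j *\<^sub>R v - w)) / \<epsilon> j ^ ?n))"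
    proof (rule integral_lborel_affine[of _ "\<epsilon> j" w])
      show "(\<lambda>w'. G w' * complex_of_real (?c * gauss ((1 / \<epsilon> j) *\<^sub>R (w' - w)) / \<epsilon> j ^ ?n)) \<in> borel_measurable borel"
        using \<epsilon>[of j] by (intro borel_measurable_continuous_onI continuous_intros c) auto
    qed (use \<epsilon>[of j] in simp)
    also have "\<dots> = (LINT v|lborel. G (w + \<epsilon> j *\<^sub>R v) * complex_of_real (?c * gauss v))"
      using \<epsilon>[of j] by (simp add: scaleR_conv_of_real)
    finally show ?thesis .
  qed
  have "A \<longlonglongrightarrow> (LINT v|lborel. G w * complex_of_real (?c * gauss (v::'v)))"
    unfolding A2
  proof (rule integral_dominated_convergence[where w = "\<lambda>v. B * (?c * gauss v)"])
    show "AE v in lborel. (\<lambda>j. G (w + \<epsilon> j *\<^sub>R v) * complex_of_real (?c * gauss v)) \<longlonglongrightarrow> G w * complex_of_real (?c * gauss v)"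
    proof (rule AE_I2)
      fix v
      have "(\<lambda>j. w + \<epsilon> j *\<^sub>R v) \<longlonglongrightarrow> w"
        using tendsto_add[OF tendsto_const tendsto_scaleR[OF \<epsilon>0 tendsto_const[of v]], of w] by simp
      then have "(\<lambda>j. G (w + \<epsilon> j *\<^sub>R v)) \<longlonglongrightarrow> G w"
        using c by (intro isCont_tendsto_compose[of w G]) (simp add: continuous_on_eq_continuous_at)
      then show "(\<lambda>j. G (w + \<epsilon> j *\<^sub>R v) * complex_of_real (?c * gauss v)) \<longlonglongrightarrow> G w * complex_of_real (?c * gauss v)"
        by (intro tendsto_intros)
    qed
    show "AE v in lborel. norm (G (w + \<epsilon> j *\<^sub>R v) * complex_of_real (?c * gauss v)) \<le> B * (?c * gauss v)" for j
    proof (rule AE_I2)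
      fix v :: 'v
      have "norm (complex_of_real (?c * gauss v)) = ?c * gauss v"
        using gauss_pos[of v] by (subst norm_of_real) simp
      then show "norm (G (w + \<epsilon> j *\<^sub>R v) * complex_of_real (?c * gauss v)) \<le> B * (?c * gauss v)"
        using B[of "w + \<epsilon> j *\<^sub>R v"] gauss_pos[of v] by (simp only: norm_mult) (intro mult_right_mono, auto)
    qed
    show "integrable lborel (\<lambda>v::'v. B * (?c * gauss v))"
      by (intro integrable_mult_right integrable_gauss)
  qed measurable
  also have "(LINT v|lborel. G w * complex_of_real (?c * gauss (v::'v))) = G w * complex_of_real (?c * ?c)"
    by (simp only: integral_mult_right_zero integral_complex_of_real integral_gauss)
  finally have "A \<longlonglongrightarrow> G w * complex_of_real (?c * ?c)" .
  moreover have "?c * ?c = (2 * pi) ^ ?n"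
    by (subst power_mult_distrib[symmetric]) simp
  ultimately have "A \<longlonglongrightarrow> G w * complex_of_real ((2 * pi) ^ ?n)" by (simp only:)
  from LIMSEQ_unique[OF lim1 this] show ?thesis by (simp only: mult.commute)
qed

section \<open>Taylor expansion in the scaling parameter\<close>

definition mixed_op :: "(('p::euclidean_space \<times> 'v::euclidean_space) \<times> 'v \<Rightarrow> complex) \<Rightarrow> ('p \<times> 'v) \<times> 'v \<Rightarrow> complex"
  where "mixed_op H z = - \<i> * (\<Sum>b\<in>Basis. dir_deriv (0, b) (dir_deriv ((0, b), 0) H) z)"

definition osc_int_scaled :: "(('p \<times> 'v::euclidean_space) \<times> 'v \<Rightarrow> complex) \<Rightarrow> 'p \<Rightarrow> real \<Rightarrow> complex"
  where "osc_int_scaled H p t = (LINT \<kappa>|lborel. FT H (p, t *\<^sub>R \<kappa>) \<kappa>)"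

lemma osc_int_scaled_1: "osc_int_scaled H p 1 = osc_int H p"
  by (simp add: osc_int_scaled_def osc_int_def)

lemma bracket_scale_le:
  assumes "\<bar>t\<bar> \<le> s" "s \<ge> 1" shows "bracket (t *\<^sub>R x) \<le> s * bracket x"
proof (rule power2_le_imp_le)
  have "t\<^sup>2 \<le> s\<^sup>2" using assms by (simp add: abs_le_square_iff[symmetric])
  moreover have "1 \<le> s\<^sup>2" using assms by simp
  ultimately have "1 + t\<^sup>2 * (norm x)\<^sup>2 \<le> s\<^sup>2 + s\<^sup>2 * (norm x)\<^sup>2"
    by (intro add_mono mult_right_mono) auto
  then show "(bracket (t *\<^sub>R x))\<^sup>2 \<le> (s * bracket x)\<^sup>2"
    by (simp add: bracket_sq power_mult_distrib distrib_left)
qed (use assms in auto)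

lemma osc_int_scaled_integrand_bound:
  fixes H :: "('p::euclidean_space \<times> 'v::euclidean_space) \<times> 'v \<Rightarrow> complex"
  assumes H: "dec (\<lambda>_. 1) (\<lambda>q. W (fst q) * bracket (snd q) powr K) H" and W: "\<And>p. W p \<ge> 0" and K: "K \<ge> 0"
  shows "\<exists>C\<ge>0. \<forall>p \<kappa> t s. \<bar>t\<bar> \<le> s \<longrightarrow> 1 \<le> s \<longrightarrow> norm (FT H (p, t *\<^sub>R \<kappa>) \<kappa>) \<le> C * W p * s powr K * decay \<kappa>"
proof -
  obtain C where C: "C \<ge> 0" "\<And>p \<kappa> \<theta>. norm (FT H (p, \<kappa>) \<theta>) * bracket \<theta> powr K \<le> C * W p * bracket \<kappa> powr K * decay \<theta>"
    using osc_int_integrand[OF H W] by blast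
  have "norm (FT H (p, t *\<^sub>R \<kappa>) \<kappa>) \<le> C * W p * s powr K * decay \<kappa>" if ts: "\<bar>t\<bar> \<le> s" "1 \<le> s" for p \<kappa> t s
  proof -
    have "bracket (t *\<^sub>R \<kappa>) powr K \<le> (s * bracket \<kappa>) powr K"
      using bracket_scale_le[OF ts] K by (intro powr_mono2) auto
    then have "C * W p * bracket (t *\<^sub>R \<kappa>) powr K * decay \<kappa> \<le> C * W p * (s * bracket \<kappa>) powr K * decay \<kappa>"
      using C W by (intro mult_right_mono mult_left_mono) auto
    also have "\<dots> = (C * W p * s powr K * decay \<kappa>) * bracket \<kappa> powr K"
      using ts by (simp add: powr_mult mult_ac)
    finally have "norm (FT H (p, t *\<^sub>R \<kappa>) \<kappa>) * bracket \<kappa> powr K \<le> (C * W p * s powr K * decay \<kappa>) * bracket \<kappa> powr K"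
      using C(2)[of p "t *\<^sub>R \<kappa>" \<kappa>] by linarith
    then show ?thesis using bracket_pos[of \<kappa>] by (simp add: mult_le_cancel_right)
  qed
  then show ?thesis using C(1) by blast
qed

lemma osc_int_scaled_measurable:
  fixes H :: "('p::euclidean_space \<times> 'v::euclidean_space) \<times> 'v \<Rightarrow> complex"
  shows "C_infinity H \<Longrightarrow> (\<lambda>\<kappa>. FT H (p, t *\<^sub>R \<kappa>) \<kappa>) \<in> borel_measurable borel"
  by (intro FT_measurable continuous_intros)

lemma osc_int_scaled_bound:
  fixes H :: "('p::euclidean_space \<times> 'v::euclidean_space) \<times> 'v \<Rightarrow> complex"
  assumes H: "dec (\<lambda>_. 1) (\<lambda>q. W (fst q) * bracket (snd q) powr K) H" and W: "\<And>p. W p \<ge> 0" and K: "K \<ge> 0"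
  shows "\<exists>C\<ge>0. \<forall>p. \<forall>t\<in>{0..1}. norm (osc_int_scaled H p t) \<le> C * W p"
proof -
  obtain C where C: "C \<ge> 0" "\<And>p \<kappa> t s. \<bar>t\<bar> \<le> s \<Longrightarrow> 1 \<le> s \<Longrightarrow> norm (FT H (p, t *\<^sub>R \<kappa>) \<kappa>) \<le> C * W p * s powr K * decay \<kappa>"
    using osc_int_scaled_integrand_bound[OF H W K] by blast
  have "norm (osc_int_scaled H p t) \<le> (C * W p) * (LINT y|lborel. decay (y::'v))" if "t \<in> {0..1}" for p t
    unfolding osc_int_scaled_def using C(2)[of t 1 p] that by (intro integral_decay_bound osc_int_scaled_measurable dec_smooth[OF H]) auto
  moreover have "(LINT y|lborel. decay (y::'v)) \<ge> 0" by (rule integral_nonneg_AE) auto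
  ultimately show ?thesis using C(1)
    by (intro exI[of _ "C * (LINT y|lborel. decay (y::'v))"]) (auto simp: mult_ac)
qed

lemma FT_sum_mult:
  assumes "\<And>i. i \<in> I \<Longrightarrow> dec \<tau> (W i) (H i)"
  shows "FT (\<lambda>z. \<Sum>i\<in>I. c i * H i z) q \<theta> = (\<Sum>i\<in>I. c i * FT (H i) q \<theta>)"
proof -
  have "FT (\<lambda>z. \<Sum>i\<in>I. c i * H i z) q \<theta> = (LINT w|lborel. (\<Sum>i\<in>I. c i * (exp (- \<i> * complex_of_real (w \<bullet> \<theta>)) * H i (q, w))))"
    by (simp add: FT_def sum_distrib_left mult_ac)
  also have "\<dots> = (\<Sum>i\<in>I. c i * FT (H i) q \<theta>)"
    using dec_integrable[OF assms] by (simp add: FT_def Bochner_Integration.integral_sum)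
  finally show ?thesis .
qed

text \<open>Explains the form of \<open>mixed_op\<close>: \<theta>_b exp(- i w . \<theta>) is i
  times the w_b-derivative of the exponential, so integration by parts trades a factor \<theta>_b
  for - i times a w_b-derivative of the amplitude.\<close>

lemma FT_mixed_op:
  fixes H :: "('p::euclidean_space \<times> 'v::euclidean_space) \<times> 'v \<Rightarrow> complex"
  assumes D: "\<And>b. b \<in> Basis \<Longrightarrow> dec \<tau> W (dir_deriv ((0, b), 0) H)"
  shows "FT (mixed_op H) q \<theta> = (\<Sum>b\<in>Basis. complex_of_real (\<theta> \<bullet> b) * FT (dir_deriv ((0, b), 0) H) q \<theta>)"
proof -
  have "FT (mixed_op H) q \<theta> = FT (\<lambda>z. \<Sum>b\<in>Basis. - \<i> * dir_deriv (0, b) (dir_deriv ((0, b), 0) H) z) q \<theta>"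
    by (simp add: mixed_op_def[abs_def] sum_distrib_left)
  also have "\<dots> = (\<Sum>b\<in>Basis. - \<i> * FT (dir_deriv (0, b) (dir_deriv ((0, b), 0) H)) q \<theta>)"
    by (rule FT_sum_mult[OF dec_dir_deriv[OF D]])
  also have "\<dots> = (\<Sum>b\<in>Basis. complex_of_real (\<theta> \<bullet> b) * FT (dir_deriv ((0, b), 0) H) q \<theta>)"
    by (intro sum.cong refl) (simp add: FT_dir_deriv[OF D] inner_commute mult_ac)
  finally show ?thesis .
qed

text \<open>The t-derivative of the amplitude at t \<kappa> brings out factors of \<kappa>, which
  \<open>FT_mixed_op\<close> absorbs. The result is an integral of the same kind for
  \<open>mixed_op\<close> H, so higher derivatives follow by iteration. The signs K, L \<ge> 0 make
  the growth bounds monotone in |t|.\<close>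

lemma osc_int_scaled_has_vector_derivative:
  fixes H :: "('p::euclidean_space \<times> 'v::euclidean_space) \<times> 'v \<Rightarrow> complex"
  assumes H: "dec (\<lambda>_. 1) (\<lambda>q. W (fst q) * bracket (snd q) powr K) H"
    and D: "\<And>b. b \<in> Basis \<Longrightarrow> dec (\<lambda>_. 1) (\<lambda>q. V (fst q) * bracket (snd q) powr L) (dir_deriv ((0, b), 0) H)"
    and W: "\<And>p. W p \<ge> 0" and V: "\<And>p. V p \<ge> 0" and K: "K \<ge> 0" and L: "L \<ge> 0"
  shows "(osc_int_scaled H p has_vector_derivative osc_int_scaled (mixed_op H) p t) (at t)"
proof -
  note s = dec_smooth[OF H]
  have X: "dec (\<lambda>_. 1) (\<lambda>q. V (fst q) * bracket (snd q) powr L) (mixed_op H)"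
    unfolding mixed_op_def[abs_def]
    by (intro dec_mult_left dec_sum) (use dec_dir_deriv[OF D] in simp)
  obtain C where C: "C \<ge> 0" "\<And>p \<kappa> t s. \<bar>t\<bar> \<le> s \<Longrightarrow> 1 \<le> s \<Longrightarrow> norm (FT (mixed_op H) (p, t *\<^sub>R \<kappa>) \<kappa>) \<le> C * V p * s powr L * decay \<kappa>"
    using osc_int_scaled_integrand_bound[OF X V L] by blast
  obtain C' where C': "C' \<ge> 0" "\<And>p \<kappa> t s. \<bar>t\<bar> \<le> s \<Longrightarrow> 1 \<le> s \<Longrightarrow> norm (FT H (p, t *\<^sub>R \<kappa>) \<kappa>) \<le> C' * W p * s powr K * decay \<kappa>"
    using osc_int_scaled_integrand_bound[OF H W K] by blast
  have d: "((\<lambda>t. FT H (p, t *\<^sub>R \<kappa>) \<kappa>) has_derivative (\<lambda>h. \<Sum>b\<in>Basis. (h \<bullet> b) *\<^sub>R FT (mixed_op H) (p, t *\<^sub>R \<kappa>) \<kappa>)) (at t)" for t \<kappa>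
  proof -
    have eq: "dir_deriv ((0, \<kappa>), 0) H = (\<lambda>z. \<Sum>b\<in>Basis. complex_of_real (\<kappa> \<bullet> b) * dir_deriv ((0, b), 0) H z)"
    proof
      fix z
      interpret l: bounded_linear "\<lambda>h. dir_deriv h H z"
        by (rule linear_dir_deriv[OF smooth_differentiable[OF s]])
      have "((0, \<kappa>), 0) = (\<Sum>b\<in>Basis. (\<kappa> \<bullet> b) *\<^sub>R ((0::'p, b), 0::'v))"
        by (simp add: prod_eq_iff fst_sum snd_sum euclidean_representation)
      then show "dir_deriv ((0, \<kappa>), 0) H z = (\<Sum>b\<in>Basis. complex_of_real (\<kappa> \<bullet> b) * dir_deriv ((0, b), 0) H z)"
        by (simp only: l.sum l.scaleR) (simp add: scaleR_conv_of_real)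
    qed
    have FTeq: "FT (dir_deriv ((0, \<kappa>), 0) H) q \<kappa> = FT (mixed_op H) q \<kappa>" for q
      unfolding eq by (simp only: FT_sum_mult[OF D] FT_mixed_op[OF D])
    have "((\<lambda>t. FT H (p, t *\<^sub>R \<kappa>) \<kappa>) has_derivative
        (\<lambda>h. \<Sum>b\<in>Basis. (h \<bullet> b) *\<^sub>R FT (dir_deriv ((0, \<kappa>), 0) H) (p, t *\<^sub>R \<kappa>) \<kappa>)) (at t)"
    proof (rule FT_has_derivative[OF H, where L = "\<lambda>_. (0, \<kappa>)" and V = "\<lambda>_ q. V (fst q) * bracket (snd q) powr L"])
      show "dec (\<lambda>_. 1) (\<lambda>q. V (fst q) * bracket (snd q) powr L) (dir_deriv ((0::'p, \<kappa>), 0) H)" for b :: real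
        unfolding eq by (intro dec_sum dec_mult_left D)
      show "loc_bdd (\<lambda>t. V (fst (p, t *\<^sub>R \<kappa>)) * bracket (snd (p, t *\<^sub>R \<kappa>)) powr L)"
        by (rule loc_bdd_continuous, simp)
           (intro continuous_intros continuous_on_compose2[OF smooth_continuous[OF smooth_bracket, of UNIV]], auto)
    qed (auto intro!: smooth_intros simp: algebra_simps)
    then show ?thesis by (simp only: FTeq)
  qed
  have "(osc_int_scaled H p has_derivative (\<lambda>h. \<Sum>b\<in>Basis. (h \<bullet> b) *\<^sub>R (LINT \<kappa>|lborel. FT (mixed_op H) (p, t *\<^sub>R \<kappa>) \<kappa>))) (at t)"
    unfolding osc_int_scaled_def
  proof (rule has_derivative_integral[where r = 1 and g = "\<lambda>\<kappa>. C * V p * (\<bar>t\<bar> + 1) powr L * decay \<kappa>", OF _ _ _ d])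
    show "integrable lborel (\<lambda>\<kappa>. FT H (p, s *\<^sub>R \<kappa>) \<kappa>)" for s
      using C'(2)[of s "\<bar>s\<bar> + 1" p]
      by (intro integrable_by_decay[of _ "C' * W p * (\<bar>s\<bar> + 1) powr K"] osc_int_scaled_measurable s) auto
    show "(\<lambda>\<kappa>. FT (mixed_op H) (p, t *\<^sub>R \<kappa>) \<kappa>) \<in> borel_measurable lborel"
      using osc_int_scaled_measurable[OF dec_smooth[OF X]] by simp
    show "norm (FT (mixed_op H) (p, s *\<^sub>R \<kappa>) \<kappa>) \<le> C * V p * (\<bar>t\<bar> + 1) powr L * decay \<kappa>" if "s \<in> ball t 1" for s \<kappa>
      using C(2)[of s "\<bar>t\<bar> + 1" p \<kappa>] that by (auto simp: dist_real_def)
    show "integrable lborel (\<lambda>\<kappa>::'v. C * V p * (\<bar>t\<bar> + 1) powr L * decay \<kappa>)"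
      by (intro integrable_mult_right integrable_decay)
  qed auto
  then show ?thesis by (simp add: has_vector_derivative_def osc_int_scaled_def)
qed

text \<open>At \<open>t = 0\<close> the amplitude no longer depends on \<open>\<kappa>\<close>, so the double integral is a Fourier inversion.\<close>

lemma osc_int_scaled_0:
  fixes H :: "('p::euclidean_space \<times> 'v::euclidean_space) \<times> 'v \<Rightarrow> complex"
  assumes H: "dec (\<lambda>_. 1) (\<lambda>q. W (fst q) * bracket (snd q) powr K) H" and W: "\<And>p. W p \<ge> 0" and K: "K \<ge> 0"
  shows "osc_int_scaled H p 0 = complex_of_real ((2 * pi) ^ DIM('v)) * H ((p, 0), 0)"
proof -
  obtain C where C: "\<And>q w. norm (H (q, w)) \<le> C * (W (fst q) * bracket (snd q) powr K) * decay w"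
    using dec_bound[OF H] by blast
  obtain C' where C': "\<And>p \<kappa> t s. \<bar>t\<bar> \<le> s \<Longrightarrow> 1 \<le> s \<Longrightarrow> norm (FT H (p, t *\<^sub>R \<kappa>) \<kappa>) \<le> C' * W p * s powr K * decay \<kappa>"
    using osc_int_scaled_integrand_bound[OF H W K] by blast
  have "(LINT \<kappa>|lborel. exp (\<i> * complex_of_real (0 \<bullet> \<kappa>)) * FT H (p, 0) \<kappa>) =
      complex_of_real ((2 * pi) ^ DIM('v)) * H ((p, 0), 0)"
  proof (rule fourier_inversion[where G = "\<lambda>w. H ((p, 0), w)"])
    show "continuous_on UNIV (\<lambda>w. H ((p, 0), w))" by (rule continuous_section[OF dec_smooth[OF H]])
    show "norm (H ((p, 0), w)) \<le> \<bar>C * (W p * bracket (0::'v) powr K)\<bar>" for w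
    proof -
      have "decay w \<le> 1"
        using powr_mono[of "- 2 * real DIM('v)" 0 "bracket w"] bracket_ge_1[of w] by simp
      then have "C * (W p * bracket (0::'v) powr K) * decay w \<le> \<bar>C * (W p * bracket (0::'v) powr K)\<bar> * 1"
        by (intro mult_mono) auto
      then show ?thesis using C[of "(p, 0)" w] by simp
    qed
    show "integrable lborel (\<lambda>w. H ((p, 0), w))" by (rule dec_integrable0[OF H])
    show "FT H (p, 0) \<kappa> = (LINT w|lborel. exp (- \<i> * complex_of_real (w \<bullet> \<kappa>)) * H ((p, 0), w))" for \<kappa>
      by (simp add: FT_def)
    show "integrable lborel (FT H (p, 0))"
      using C'[of 0 1 p] osc_int_scaled_measurable[OF dec_smooth[OF H], of p 0]
      by (intro integrable_by_decay[of _ "C' * W p"]) auto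
  qed
  then show ?thesis by (simp add: osc_int_scaled_def)
qed

text \<open>Points are written \<open>((p, \<kappa>), w)\<close>. Derivatives in \<open>w\<close> are free, those in \<open>\<kappa>\<close> gain the small
  factor \<open>s p\<close> at the price of growth in \<open>\<kappa>\<close>.\<close>

definition wk_dirs :: "(('p::euclidean_space \<times> 'v::euclidean_space) \<times> 'v) set"
  where "wk_dirs = Pair 0 ` Basis \<union> (\<lambda>b. ((0, b), 0)) ` Basis"

definition wk_cost :: "('p \<Rightarrow> real) \<Rightarrow> real \<Rightarrow> ('p \<times> 'v) \<times> 'v \<Rightarrow> ('p \<times> 'v::euclidean_space) \<times> 'v \<Rightarrow> real"
  where "wk_cost s A d z = (if snd d = 0 then s (fst (fst z)) * bracket (snd (fst z)) powr A else 1)"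

definition wk_weight :: "('p \<Rightarrow> real) \<Rightarrow> real \<Rightarrow> ('p \<times> 'v::euclidean_space) \<times> 'v \<Rightarrow> real"
  where "wk_weight W K z = W (fst (fst z)) * bracket (snd (fst z)) powr K * decay (snd z)"

lemma wk_dec:
  assumes "symb wk_dirs (wk_cost s A) (wk_weight W K) H" "\<And>p. W p \<ge> 0"
  shows "dec (\<lambda>_. 1) (\<lambda>q. W (fst q) * bracket (snd q) powr K) H"
  unfolding dec_def
  by (rule symb_mono[OF assms(1)])
     (use assms(2) in \<open>auto simp: wk_dirs_def wk_cost_def wk_weight_def nonzero_Basis intro!: exI[of _ 1]\<close>)

lemma wk_deriv:
  assumes "symb wk_dirs (wk_cost s A) (wk_weight W K) H" "b \<in> Basis"
  shows "symb wk_dirs (wk_cost s A) (wk_weight (\<lambda>p. W p * s p) (K + A)) (dir_deriv ((0, b), 0) H)"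
    "symb wk_dirs (wk_cost s A) (wk_weight W K) (dir_deriv (0, b) H)"
  using symb_dir_deriv[OF assms(1), of "((0, b), 0)"] symb_dir_deriv[OF assms(1), of "(0, b)"] assms(2)
  by (auto simp: wk_dirs_def wk_cost_def wk_weight_def[abs_def] powr_add mult_ac nonzero_Basis)

lemma wk_mixed_op:
  assumes "symb wk_dirs (wk_cost s A) (wk_weight W K) H"
  shows "symb wk_dirs (wk_cost s A) (wk_weight (\<lambda>p. W p * s p) (K + A)) (mixed_op H)"
  unfolding mixed_op_def[abs_def]
  by (intro symb_mult_left symb_sum wk_deriv(2)[OF wk_deriv(1)[OF assms]])

lemma wk_mixed_op_iter:
  assumes "symb wk_dirs (wk_cost s A) (wk_weight W K) H"
  shows "symb wk_dirs (wk_cost s A) (wk_weight (\<lambda>p. W p * s p ^ N) (K + real N * A)) ((mixed_op ^^ N) H)"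
proof (induction N)
  case (Suc N)
  from wk_mixed_op[OF Suc] show ?case by (simp add: algebra_simps)
qed (use assms in simp)

text \<open>Taylor's formula with integral remainder in the scaling parameter. The j-th derivative
  at 0 is, by Fourier inversion, the value of the j-th iterate of \<open>mixed_op\<close> at
  \<kappa> = w = 0; the N-th derivative on [0, 1] carries the small factor s p ^ N.\<close>

lemma osc_int_expansion:
  fixes H :: "('p::euclidean_space \<times> 'v::euclidean_space) \<times> 'v \<Rightarrow> complex"
  assumes H: "symb wk_dirs (wk_cost s A) (wk_weight W K) H"
    and nn: "\<And>p. W p \<ge> 0" "\<And>p. s p \<ge> 0" "A \<ge> 0" "K \<ge> 0"
  shows "\<exists>C\<ge>0. \<forall>p. norm (osc_int H p - complex_of_real ((2 * pi) ^ DIM('v)) * (\<Sum>j<N. (mixed_op ^^ j) H ((p, 0), 0) / fact j))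
    \<le> C * (W p * s p ^ N)"
proof (cases "N = 0")
  \<comment> \<open>The remainder kernel (1 - t)^(N - 1) / (N - 1)! makes sense only for N > 0. For
    N = 0 the sum is empty and the claim is the plain bound.\<close>
  case True
  then show ?thesis using osc_int_bound[OF wk_dec[OF H nn(1)] nn(1)] by simp
next
  case False
  have dX: "dec (\<lambda>_. 1) (\<lambda>q. (W (fst q) * s (fst q) ^ j) * bracket (snd q) powr (K + real j * A)) ((mixed_op ^^ j) H)" for j
    by (rule wk_dec[OF wk_mixed_op_iter[OF H]]) (use nn in auto)
  have dD: "dec (\<lambda>_. 1) (\<lambda>q. (W (fst q) * s (fst q) ^ Suc j) * bracket (snd q) powr (K + real j * A + A))
      (dir_deriv ((0, b), 0) ((mixed_op ^^ j) H))" if "b \<in> Basis" for b j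
    using wk_dec[OF wk_deriv(1)[OF wk_mixed_op_iter[OF H, of j] that]] nn by (simp add: mult_ac)
  have der: "(osc_int_scaled ((mixed_op ^^ j) H) p has_vector_derivative osc_int_scaled ((mixed_op ^^ Suc j) H) p t) (at t)" for j p t
    using osc_int_scaled_has_vector_derivative[OF dX dD] nn by simp
  obtain C where C: "C \<ge> 0" "\<And>p t. t \<in> {0..1} \<Longrightarrow> norm (osc_int_scaled ((mixed_op ^^ N) H) p t) \<le> C * (W p * s p ^ N)"
    using osc_int_scaled_bound[OF dX[of N]] nn by auto
  have "norm (osc_int H p - complex_of_real ((2 * pi) ^ DIM('v)) * (\<Sum>j<N. (mixed_op ^^ j) H ((p, 0), 0) / fact j))
    \<le> C * (W p * s p ^ N)" for p
  proof -
    let ?i = "\<lambda>x. ((1 - x) ^ (N - 1) / fact (N - 1)) *\<^sub>R osc_int_scaled ((mixed_op ^^ N) H) p x"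
    have T: "(?i has_integral osc_int_scaled H p 1 - (\<Sum>j<N. ((1 - 0) ^ j / fact j) *\<^sub>R osc_int_scaled ((mixed_op ^^ j) H) p 0)) {0..1}"
      by (rule Taylor_has_integral[where Df = "\<lambda>j. osc_int_scaled ((mixed_op ^^ j) H) p"])
         (use False der in \<open>auto intro: has_vector_derivative_at_within simp del: funpow.simps\<close>)
    have "norm (osc_int_scaled H p 1 - (\<Sum>j<N. ((1 - 0) ^ j / fact j) *\<^sub>R osc_int_scaled ((mixed_op ^^ j) H) p 0)) \<le> (C * (W p * s p ^ N)) * measure lborel (cbox 0 (1::real))"
    proof (rule has_integral_bound)
      show "0 \<le> C * (W p * s p ^ N)" using C nn by auto
      show "(?i has_integral osc_int_scaled H p 1 - (\<Sum>j<N. ((1 - 0) ^ j / fact j) *\<^sub>R osc_int_scaled ((mixed_op ^^ j) H) p 0)) (cbox 0 1)"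
        using T by simp
      show "norm (?i x) \<le> C * (W p * s p ^ N)" if "x \<in> cbox 0 1" for x
      proof -
        have x: "x \<in> {0..1}" using that by simp
        have "(1 - x) ^ (N - 1) / fact (N - 1) \<le> 1"
          using x by (simp add: power_le_one divide_le_eq_1 order_trans[OF _ fact_ge_1])
        then have "norm (?i x) \<le> 1 * norm (osc_int_scaled ((mixed_op ^^ N) H) p x)"
          using x by (simp only: norm_scaleR) (intro mult_right_mono, auto)
        then show ?thesis using C(2)[OF x, of p] by linarith
      qed
    qed
    moreover have "osc_int_scaled ((mixed_op ^^ j) H) p 0 = complex_of_real ((2 * pi) ^ DIM('v)) * (mixed_op ^^ j) H ((p, 0), 0)" for j
      by (rule osc_int_scaled_0[OF dX]) (use nn in auto)
    ultimately show ?thesis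
      by (simp add: osc_int_scaled_1 sum_distrib_left scaleR_conv_of_real field_simps)
  qed
  then show ?thesis using C(1) by blast
qed

section \<open>Cutoff functions\<close>

text \<open>The functions t^(- k) exp(- 1 / t), extended by 0, are closed under differentiation up
  to linear combinations. Smoothness is therefore an induction for all k at once; k = 0 is the usual
  flat function.\<close>

definition bump_exp :: "nat \<Rightarrow> real \<Rightarrow> real"
  where "bump_exp k t = (if t \<le> 0 then 0 else inverse t ^ k * exp (- inverse t))"

text \<open>With m = k + 2 the inequality s / m \<le> exp(s / m) gives s^m \<le> m^m exp(s), applied
  to s = 1 / t. The two extra powers leave the factor t^2, which makes the difference quotient at 0
  tend to 0.\<close>

lemma bump_exp_le:
  assumes "t > 0" shows "bump_exp k t \<le> real (k + 2) ^ (k + 2) * t\<^sup>2"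
proof -
  let ?m = "k + 2"
  have "inverse t / real ?m \<le> exp (inverse t / real ?m)"
    using exp_ge_add_one_self[of "inverse t / real ?m"] by linarith
  then have "(inverse t / real ?m) ^ ?m \<le> exp (inverse t / real ?m) ^ ?m"
    using assms by (intro power_mono) auto
  also have "\<dots> = exp (inverse t)"
    by (simp add: exp_of_nat_mult[symmetric] del: power_Suc of_nat_add)
  finally have "inverse t ^ ?m \<le> real ?m ^ ?m * exp (inverse t)"
    by (simp add: power_divide divide_le_eq mult.commute del: power_Suc of_nat_add power_add)
  then have "inverse t ^ ?m * exp (- inverse t) * t\<^sup>2 \<le> real ?m ^ ?m * t\<^sup>2"
    by (intro mult_right_mono) (simp_all add: exp_minus divide_inverse[symmetric] divide_le_eq del: power_Suc of_nat_add power_add power_inverse)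
  moreover have "inverse t ^ ?m * exp (- inverse t) * t\<^sup>2 = bump_exp k t"
    using assms by (simp add: bump_exp_def power_add field_simps power2_eq_square)
  ultimately show ?thesis by simp
qed

lemma bump_exp_nonneg: "bump_exp k t \<ge> 0"
  by (simp add: bump_exp_def)

lemma bump_exp_deriv:
  "(bump_exp k has_real_derivative (bump_exp (k + 2) t - real k * bump_exp (k + 1) t)) (at t)"
proof -
  consider "t > 0" | "t < 0" | "t = 0" by linarith
  then show ?thesis
  proof cases
    case 1
    have "((\<lambda>t. inverse t ^ k * exp (- inverse t)) has_real_derivative (bump_exp (k + 2) t - real k * bump_exp (k + 1) t)) (at t)"
    proof -
      have "((\<lambda>t. inverse t ^ k * exp (- inverse t)) has_real_derivative
          (real k * inverse t ^ (k - Suc 0) * (- ((inverse t)\<^sup>2))) * exp (- inverse t) +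
          inverse t ^ k * (exp (- inverse t) * (inverse t)\<^sup>2)) (at t)"
        using 1 by (auto intro!: derivative_eq_intros simp: power2_eq_square)
      then show ?thesis
        using 1 by (cases k) (simp_all add: bump_exp_def algebra_simps power2_eq_square)
    qed
    then show ?thesis
      by (rule has_field_derivative_transform_within_open[where S = "{0<..}"]) (use 1 in \<open>auto simp: bump_exp_def\<close>)
  next
    case 2
    have "((\<lambda>t. 0) has_real_derivative 0) (at t)" by simp
    then have "(bump_exp k has_real_derivative 0) (at t)"
      by (rule has_field_derivative_transform_within_open[where S = "{..<0}"]) (use 2 in \<open>auto simp: bump_exp_def\<close>)
    then show ?thesis using 2 by (simp add: bump_exp_def)
  next
    case 3
    have "((\<lambda>h. bump_exp k h / h) \<longlongrightarrow> 0) (at 0)"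
    proof (rule Lim_null_comparison)
      show "\<forall>\<^sub>F h in at 0. norm (bump_exp k h / h) \<le> real (k + 2) ^ (k + 2) * \<bar>h\<bar>"
      proof (rule always_eventually, rule allI)
        fix h :: real
        show "norm (bump_exp k h / h) \<le> real (k + 2) ^ (k + 2) * \<bar>h\<bar>"
        proof (cases "h > 0")
          case True
          then show ?thesis using bump_exp_le[OF True, of k] bump_exp_nonneg[of k h]
            by (simp add: divide_le_eq power2_eq_square mult_ac del: power_Suc of_nat_add power_add)
        next
          case False
          then have "bump_exp k h = 0" by (simp add: bump_exp_def)
          then show ?thesis by simp
        qed
      qed
      have "((\<lambda>h::real. real (k + 2) ^ (k + 2) * \<bar>h\<bar>) \<longlongrightarrow> real (k + 2) ^ (k + 2) * \<bar>0\<bar>) (at 0)"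
        by (intro tendsto_intros)
      then show "((\<lambda>h::real. real (k + 2) ^ (k + 2) * \<bar>h\<bar>) \<longlongrightarrow> 0) (at 0)" by simp
    qed
    then show ?thesis by (simp add: 3 DERIV_def bump_exp_def)
  qed
qed

lemma smooth_bump_exp: "C_infinity (bump_exp k)"
proof -
  have "Ck j (bump_exp k)" for j
  proof (induction j arbitrary: k)
    case 0
    show ?case using DERIV_isCont[OF bump_exp_deriv] by (auto simp: continuous_on_eq_continuous_at)
  next
    case (Suc j)
    have "dir_deriv 1 (bump_exp k) = (\<lambda>t. bump_exp (k + 2) t + - (real k * bump_exp (k + 1) t))"
      using bump_exp_deriv[of k] by (auto simp: fun_eq_iff has_field_derivative_def intro!: dir_deriv_eqI[THEN trans])
    moreover have "Ck j (\<lambda>t. bump_exp (k + 2) t + - (real k * bump_exp (k + 1) t))"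
      by (intro Ck_add Ck_linear[OF bounded_linear_minus[OF bounded_linear_ident]] Ck_linear[OF bounded_linear_mult_right] Suc)
    ultimately show ?case
      using bump_exp_deriv[of k] by (auto simp: real_differentiable_def differentiable_def has_field_derivative_def)
  qed
  then show ?thesis by (simp add: C_infinity_def)
qed

definition step_fun :: "real \<Rightarrow> real"
  where "step_fun t = bump_exp 0 t / (bump_exp 0 t + bump_exp 0 (1 - t))"

lemma step_fun_denom: "bump_exp 0 t + bump_exp 0 (1 - t) > 0"
  by (auto simp: bump_exp_def add_pos_pos)

lemma smooth_step_fun: "C_infinity step_fun"
proof -
  have "C_infinity (\<lambda>t. bump_exp 0 (1 - t))"
    by (rule smooth_compose[OF smooth_bump_exp]) (intro smooth_intros)
  then show ?thesis
    unfolding step_fun_def[abs_def] using step_fun_denom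
    by (intro smooth_divide smooth_add smooth_bump_exp) (auto simp: less_le)
qed

lemma step_fun_simps: "t \<le> 0 \<Longrightarrow> step_fun t = 0" "t \<ge> 1 \<Longrightarrow> step_fun t = 1"
  "0 \<le> step_fun t" "step_fun t \<le> 1"
  using step_fun_denom[of t] bump_exp_nonneg[of 0] 
  by (auto simp: step_fun_def bump_exp_def divide_le_eq)

definition bump :: "real \<Rightarrow> real \<Rightarrow> real \<Rightarrow> real \<Rightarrow> real \<Rightarrow> real"
  where "bump r1 r2 r3 r4 t = step_fun ((t - r1) * inverse (r2 - r1)) * step_fun ((r4 - t) * inverse (r4 - r3))"

lemma smooth_bump: "C_infinity (bump r1 r2 r3 r4)"
  unfolding bump_def[abs_def] by (intro smooth_mult smooth_compose[OF smooth_step_fun] smooth_intros)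

lemma bump_range: "0 \<le> bump r1 r2 r3 r4 t" "bump r1 r2 r3 r4 t \<le> 1"
  by (auto simp: bump_def intro!: mult_nonneg_nonneg mult_le_one step_fun_simps)

lemma bump_eq_1:
  assumes "r1 < r2" "r3 < r4" "r2 \<le> t" "t \<le> r3" shows "bump r1 r2 r3 r4 t = 1"
proof -
  have "(t - r1) * inverse (r2 - r1) \<ge> 1" "(r4 - t) * inverse (r4 - r3) \<ge> 1"
    using assms by (auto simp: field_simps)
  then show ?thesis by (simp add: bump_def step_fun_simps)
qed

lemma bump_eq_0:
  assumes "r1 < r2" "r3 < r4" "t \<notin> {r1..r4}" shows "bump r1 r2 r3 r4 t = 0"
proof -
  have "(t - r1) * inverse (r2 - r1) \<le> 0 \<or> (r4 - t) * inverse (r4 - r3) \<le> 0"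
    using assms by (auto simp: mult_le_0_iff)
  then show ?thesis by (auto simp: bump_def step_fun_simps)
qed

lemma dir_deriv_cong_open:
  assumes "open U" "x \<in> U" "\<And>y. y \<in> U \<Longrightarrow> f y = g y"
  shows "dir_deriv v f x = dir_deriv v g x"
proof -
  have "open ((\<lambda>t::real. x + t *\<^sub>R v) -` U)"
    by (intro open_vimage assms(1) continuous_intros)
  then have "eventually (\<lambda>t::real. t \<in> (\<lambda>t. x + t *\<^sub>R v) -` U) (nhds 0)"
    using assms(2) by (intro eventually_nhds_in_open) auto
  then show ?thesis unfolding dir_deriv_def
    by (intro vector_derivative_cong_eq) (auto elim!: eventually_mono simp: assms(3))
qed

lemma dir_derivs_cong_open:
  assumes "open U" "\<And>y. y \<in> U \<Longrightarrow> f y = g y"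
  shows "x \<in> U \<Longrightarrow> dir_derivs ds f x = dir_derivs ds g x"
  using assms by (induction ds arbitrary: x) (auto intro: dir_deriv_cong_open[OF assms(1)])

lemma dir_derivs_const_0: "dir_derivs ds (\<lambda>x. 0) = (\<lambda>x. 0)"
proof (induction ds)
  case (Cons d ds)
  have "dir_deriv d (\<lambda>x::'a. 0::'b) = (\<lambda>x. 0)" by auto
  then show ?case by (simp add: Cons)
qed simp

text \<open>Derivatives vanish on the open complement of S as well. With the indicator in the weight
  the support stays available for later comparisons of costs.\<close>

lemma symb_indicator:
  assumes f: "symb D \<sigma> W f" and S: "closed S" "\<And>z. z \<notin> S \<Longrightarrow> f z = 0"
  shows "symb D \<sigma> (\<lambda>z. W z * indicator S z) f"
  unfolding symb_list_iff
proof (intro conjI allI impI)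
  fix ds assume "set ds \<subseteq> D"
  then obtain C where C: "\<And>z. norm (dir_derivs ds f z) \<le> C * (W z * (\<Prod>d\<leftarrow>ds. \<sigma> d z))"
    using f unfolding symb_list_iff by blast
  have "dir_derivs ds f z = 0" if "z \<notin> S" for z
    using dir_derivs_cong_open[of "- S" f "\<lambda>_. 0" z ds] S that by (simp add: dir_derivs_const_0 open_Compl)
  then show "\<exists>C. \<forall>z. norm (dir_derivs ds f z) \<le> C * (W z * indicator S z * (\<Prod>d\<leftarrow>ds. \<sigma> d z))"
    using C by (intro exI[of _ C]) (auto simp: indicator_def)
qed (use f in \<open>simp add: symb_smooth\<close>)

lemma symb_compact_support:
  assumes f: "C_infinity f" and S: "compact S" "\<And>z. z \<notin> S \<Longrightarrow> f z = 0"
  shows "symb D (\<lambda>_ _. 1) (indicator S) f"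
proof -
  have "symb D (\<lambda>_ _. 1) (\<lambda>_. 1) f"
    unfolding symb_list_iff
  proof (intro conjI allI impI f)
    fix ds
    have z: "dir_derivs ds f z = 0" if "z \<notin> S" for z
      using dir_derivs_cong_open[of "- S" f "\<lambda>_. 0" z ds] S that
      by (simp add: dir_derivs_const_0 open_Compl compact_imp_closed)
    have "bounded (dir_derivs ds f ` S)"
      by (intro compact_imp_bounded compact_continuous_image smooth_continuous smooth_dir_derivs f S)
    then obtain B where B: "B > 0" "\<And>z. z \<in> S \<Longrightarrow> norm (dir_derivs ds f z) \<le> B"
      by (auto simp: bounded_pos)
    then have "norm (dir_derivs ds f z) \<le> B * (1 * (\<Prod>d\<leftarrow>ds. 1))" for z
      using z[of z] by (cases "z \<in> S") (auto simp: prod_list_replicate map_replicate_const)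
    then show "\<exists>C. \<forall>z. norm (dir_derivs ds f z) \<le> C * (1 * (\<Prod>d\<leftarrow>ds. 1))" by blast
  qed
  from symb_indicator[OF this compact_imp_closed[OF S(1)] S(2)] show ?thesis by simp
qed

section \<open>Multi-indices and lists of directions\<close>

text \<open>Uses the same chosen enumeration of the coordinates as \<open>mi_deriv\<close>, so that
  the two agree for every function, smooth or not.\<close>

definition mi_dirs :: "'n::finite multi_index \<Rightarrow> (real^'n) list"
  where "mi_dirs \<alpha> = concat (map (\<lambda>i. replicate (\<alpha> i) (axis i 1))
    (SOME is. distinct is \<and> set is = (UNIV :: 'n set)))"

lemma univ_list: "distinct (SOME is. distinct is \<and> set is = (UNIV :: 'n::finite set))"
  "set (SOME is. distinct is \<and> set is = (UNIV :: 'n::finite set)) = UNIV"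
  using someI_ex[of "\<lambda>is. distinct is \<and> set is = (UNIV :: 'n set)"] finite_distinct_list[of "UNIV :: 'n set"]
  by (auto simp: conj_commute)

lemma mi_deriv_dirs: "mi_deriv \<alpha> f = dir_derivs (mi_dirs \<alpha>) f"
proof -
  have 1: "(partial i ^^ k) g = dir_derivs (replicate k (axis i 1)) g" for i :: 'a and k and g :: "real^'a \<Rightarrow> 'b"
    by (induction k) (auto simp: partial_def)
  have "foldr (\<lambda>i. partial i ^^ \<alpha> i) is f = dir_derivs (concat (map (\<lambda>i. replicate (\<alpha> i) (axis i 1)) is)) f" for "is"
    by (induction "is") (auto simp: 1)
  then show ?thesis by (simp add: mi_deriv_def mi_dirs_def)
qed

lemma mi_dirs_Basis: "set (mi_dirs \<alpha>) \<subseteq> Basis"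
  by (auto simp: mi_dirs_def axis_in_Basis_iff)

lemma length_mi_dirs: "length (mi_dirs \<alpha>) = mi_length \<alpha>"
proof -
  have "sum_list (map \<alpha> (SOME is. distinct is \<and> set is = UNIV)) = sum \<alpha> UNIV"
    by (simp only: sum_list_distinct_conv_sum_set[OF univ_list(1)] univ_list(2))
  then show ?thesis by (simp add: mi_dirs_def mi_length_def length_concat o_def)
qed

lemma count_mi_dirs: "count (mset (mi_dirs \<alpha>)) (axis i 1) = \<alpha> i"
proof -
  have "count (mset (concat (map (\<lambda>j. replicate (\<alpha> j) (axis j (1::real))) js))) (axis i 1) = (if i \<in> set js then \<alpha> i else 0)"
    if "distinct js" for js
    using that by (induction js) (auto simp: axis_eq_axis)
  from this[OF univ_list(1)] show ?thesis by (simp add: mi_dirs_def univ_list(2))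
qed

lemma mi_dirs_mset_eqI:
  fixes ds :: "(real^'n::finite) list"
  assumes "set ds \<subseteq> Basis" "\<And>i. count (mset ds) (axis i 1) = \<alpha> i"
  shows "mset ds = mset (mi_dirs \<alpha>)"
proof (rule multiset_eqI)
  fix d :: "real^'n"
  show "count (mset ds) d = count (mset (mi_dirs \<alpha>)) d"
  proof (cases "d \<in> Basis")
    case True
    then obtain i where "d = axis i 1" by (auto simp: Basis_vec_def)
    then show ?thesis by (metis assms(2) count_mi_dirs)
  next
    case False
    then have "d \<notin> set ds" "d \<notin> set (mi_dirs \<alpha>)" using assms(1) mi_dirs_Basis by auto
    then have "count (mset ds) d = 0" "count (mset (mi_dirs \<alpha>)) d = 0"
      by (simp_all add: count_eq_zero_iff)
    then show ?thesis by (simp only:)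
  qed
qed

lemma mi_dirs_ex: "set ds \<subseteq> Basis \<Longrightarrow> \<exists>\<alpha>. mset ds = mset (mi_dirs \<alpha>)"
  by (rule exI[of _ "\<lambda>i. count (mset ds) (axis i 1)"], rule mi_dirs_mset_eqI) auto

text \<open>Together with \<open>dir_derivs_mset\<close> this sorts a mixed derivative into the form
  \<open>mi_deriv2\<close> or \<open>mi_deriv3\<close> in which the hypotheses are stated.\<close>

lemma Basis_pair_lists:
  assumes "set ds \<subseteq> (Basis :: ('a::euclidean_space \<times> 'b::euclidean_space) set)"
  shows "\<exists>us vs. set us \<subseteq> Basis \<and> set vs \<subseteq> Basis \<and>
    mset ds = mset (map (\<lambda>u. (u, 0)) us @ map (\<lambda>v. (0, v)) vs)"
  using assms
proof (induction ds)
  case (Cons d ds)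
  then obtain us vs where uv: "set us \<subseteq> Basis" "set vs \<subseteq> Basis"
    "mset ds = mset (map (\<lambda>u. (u, 0)) us @ map (\<lambda>v. (0, v)) vs)" by auto
  consider u where "d = (u, 0)" "u \<in> Basis" | v where "d = (0, v)" "v \<in> Basis"
    using Cons.prems unfolding Basis_prod_def by auto
  then show ?case
  proof cases
    case (1 u)
    then show ?thesis using uv by (intro exI[of _ "u # us"] exI[of _ vs]) auto
  next
    case (2 v)
    then show ?thesis using uv by (intro exI[of _ us] exI[of _ "v # vs"]) auto
  qed
qed auto

lemma dir_derivs_section: "dir_derivs ds (\<lambda>w. H (q, w)) w = dir_derivs (map (\<lambda>d. (0, d)) ds) H (q, w)"
  by (induction ds arbitrary: w) (auto simp: dir_deriv_def)

lemma dir_derivs_section1: "dir_derivs ds (\<lambda>q. H (q, w)) q = dir_derivs (map (\<lambda>d. (d, 0)) ds) H (q, w)"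
  by (induction ds arbitrary: q) (auto simp: dir_deriv_def)

lemma mi_deriv2_dirs:
  "mi_deriv2 \<alpha> \<beta> f x \<xi> = dir_derivs (map (\<lambda>d. (d, 0)) (mi_dirs \<alpha>) @ map (\<lambda>d. (0, d)) (mi_dirs \<beta>))
    (\<lambda>(x, \<xi>). f x \<xi>) (x, \<xi>)"
  using dir_derivs_section[of _ "\<lambda>(x, \<xi>). f x \<xi>"] dir_derivs_section1[of _ "dir_derivs (map (\<lambda>d. (0, d)) (mi_dirs \<beta>)) (\<lambda>(x, \<xi>). f x \<xi>)"]
  by (simp add: mi_deriv2_def mi_deriv_dirs)

lemma mi_deriv3_dirs:
  "mi_deriv3 \<alpha> \<beta> \<gamma> f x y \<xi> = dir_derivs (map (\<lambda>d. (d, 0)) (mi_dirs \<alpha>) @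
    map (\<lambda>d. (0, d)) (map (\<lambda>d. (d, 0)) (mi_dirs \<beta>) @ map (\<lambda>d. (0, d)) (mi_dirs \<gamma>)))
    (\<lambda>(x, y, \<xi>). f x y \<xi>) (x, y, \<xi>)"
proof -
  let ?F = "\<lambda>(x, y, \<xi>). f x y \<xi>"
  have "mi_deriv \<beta> (\<lambda>y. mi_deriv \<gamma> (\<lambda>\<xi>. f x y \<xi>) \<xi>) y = mi_deriv2 \<beta> \<gamma> (f x) y \<xi>" for x
    by (simp add: mi_deriv2_def)
  also have "\<dots> x = dir_derivs (map (\<lambda>d. (d, 0)) (mi_dirs \<beta>) @ map (\<lambda>d. (0, d)) (mi_dirs \<gamma>)) (\<lambda>z. ?F (x, z)) (y, \<xi>)" for x
    by (simp only: mi_deriv2_dirs prod.case)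
  also have "\<dots> x = dir_derivs (map (\<lambda>d. (0, d)) (map (\<lambda>d. (d, 0)) (mi_dirs \<beta>) @ map (\<lambda>d. (0, d)) (mi_dirs \<gamma>))) ?F (x, (y, \<xi>))" for x
    by (rule dir_derivs_section)
  finally show ?thesis
    unfolding mi_deriv3_def by (simp only: mi_deriv_dirs[of \<alpha>] dir_derivs_section1 dir_derivs_simps)
qed

text \<open>Used below with r = <x> in the variable w and with r = 1 / <x> in the variable \<kappa>;
  the two powers that come out cancel.\<close>

lemma dir_derivs_affine:
  fixes f :: "'a::euclidean_space \<Rightarrow> complex"
  assumes f: "C_infinity f"
  shows "dir_derivs ds (\<lambda>w. c * f (y + r *\<^sub>R w)) w = c * complex_of_real (r ^ length ds) * dir_derivs ds f (y + r *\<^sub>R w)"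
proof (induction ds arbitrary: w)
  case (Cons d ds)
  let ?g = "dir_derivs ds f"
  have g: "?g differentiable (at z)" for z by (rule smooth_differentiable[OF smooth_dir_derivs[OF f]])
  have a: "((\<lambda>w. y + r *\<^sub>R w) has_derivative (\<lambda>h. r *\<^sub>R h)) (at w)"
    by (auto intro!: derivative_eq_intros)
  have "((\<lambda>w. ?g (y + r *\<^sub>R w)) has_derivative (\<lambda>h. dir_deriv (r *\<^sub>R h) ?g (y + r *\<^sub>R w))) (at w)"
    using diff_chain_at[OF a has_derivative_dir_deriv[OF g]] by (simp add: o_def)
  then have "((\<lambda>w. c * complex_of_real (r ^ length ds) * ?g (y + r *\<^sub>R w)) has_derivative
      (\<lambda>h. c * complex_of_real (r ^ length ds) * dir_deriv (r *\<^sub>R h) ?g (y + r *\<^sub>R w))) (at w)"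
    by (rule has_derivative_mult_right)
  then have "dir_deriv d (\<lambda>w. c * complex_of_real (r ^ length ds) * ?g (y + r *\<^sub>R w)) w =
      c * complex_of_real (r ^ length ds) * dir_deriv (r *\<^sub>R d) ?g (y + r *\<^sub>R w)"
    by (rule dir_deriv_eqI)
  also have "dir_deriv (r *\<^sub>R d) ?g (y + r *\<^sub>R w) = r *\<^sub>R dir_deriv d ?g (y + r *\<^sub>R w)"
    by (rule linear_cmul[OF bounded_linear.linear[OF linear_dir_deriv[OF g]]])
  finally show ?case
    by (simp add: Cons[abs_def] scaleR_conv_of_real mult_ac)
qed simp

section \<open>The multinomial formula for powers of \<open>mixed_op\<close>\<close>

definition mi_inc :: "'n \<Rightarrow> 'n multi_index \<Rightarrow> 'n multi_index"
  where "mi_inc i \<beta> = \<beta>(i := Suc (\<beta> i))"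

lemma mi_length_inc: "mi_length (mi_inc i \<beta>) = Suc (mi_length \<beta>)"
  by (simp add: mi_length_def mi_inc_def sum.remove[of UNIV i])

lemma mi_fact_inc: "mi_fact (mi_inc i \<beta>) = Suc (\<beta> i) * mi_fact \<beta>"
  by (simp add: mi_fact_def mi_inc_def prod.remove[of UNIV i] algebra_simps)

lemma mi_dirs_inc: "mset (axis i 1 # mi_dirs \<beta>) = mset (mi_dirs (mi_inc i \<beta>))"
  by (rule mi_dirs_mset_eqI) (use mi_dirs_Basis in \<open>auto simp: count_mi_dirs mi_inc_def axis_in_Basis_iff axis_eq_axis\<close>)

lemma finite_mi_length: "finite {\<beta> :: 'n::finite multi_index. mi_length \<beta> = j}"
  by (rule finite_subset[OF _ finite_mi_length_less[of "Suc j"]]) auto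

text \<open>A multi-index \<open>\<beta>\<close> of length \<open>j + 1\<close> is hit once for every \<open>i\<close> with \<open>\<beta> i > 0\<close>, with weight \<open>\<beta> i\<close>.\<close>

lemma sum_mi_inc:
  fixes F :: "'n::finite multi_index \<Rightarrow> complex"
  shows "(\<Sum>i\<in>UNIV. \<Sum>\<beta> | mi_length \<beta> = j. F (mi_inc i \<beta>) / of_nat (mi_fact \<beta>)) =
    of_nat (Suc j) * (\<Sum>\<beta> | mi_length \<beta> = Suc j. F \<beta> / of_nat (mi_fact \<beta>))"
proof -
  let ?B = "\<lambda>j. {\<beta> :: 'n multi_index. mi_length \<beta> = j}"
  have *: "(\<Sum>\<beta>\<in>?B j. F (mi_inc i \<beta>) / of_nat (mi_fact \<beta>)) = (\<Sum>\<beta>\<in>?B (Suc j). of_nat (\<beta> i) * (F \<beta> / of_nat (mi_fact \<beta>)))" for i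
  proof -
    have "(\<Sum>\<beta>\<in>?B (Suc j). of_nat (\<beta> i) * (F \<beta> / of_nat (mi_fact \<beta>))) =
        (\<Sum>\<beta>\<in>mi_inc i ` ?B j. of_nat (\<beta> i) * (F \<beta> / of_nat (mi_fact \<beta>)))"
    proof (rule sum.mono_neutral_right)
      show "mi_inc i ` ?B j \<subseteq> ?B (Suc j)" by (auto simp: mi_length_inc)
      show "\<forall>\<beta>\<in>?B (Suc j) - mi_inc i ` ?B j. of_nat (\<beta> i) * (F \<beta> / of_nat (mi_fact \<beta>)) = 0"
      proof
        fix \<beta> assume b: "\<beta> \<in> ?B (Suc j) - mi_inc i ` ?B j"
        have "\<beta> i = 0"
        proof (rule ccontr)
          assume "\<beta> i \<noteq> 0"
          then have e: "mi_inc i (\<beta>(i := \<beta> i - 1)) = \<beta>" by (auto simp: mi_inc_def)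
          then have "mi_length (\<beta>(i := \<beta> i - 1)) = j"
            using mi_length_inc[of i "\<beta>(i := \<beta> i - 1)"] b by simp
          then show False using b e by (metis (mono_tags, lifting) DiffD2 imageI mem_Collect_eq)
        qed
        then show "of_nat (\<beta> i) * (F \<beta> / of_nat (mi_fact \<beta>)) = 0" by simp
      qed
    qed (rule finite_mi_length)
    also have "\<dots> = (\<Sum>\<beta>\<in>?B j. of_nat (mi_inc i \<beta> i) * (F (mi_inc i \<beta>) / of_nat (mi_fact (mi_inc i \<beta>))))"
    proof (rule sum.reindex_cong[OF _ refl refl])
      show "inj_on (mi_inc i) (?B j)"
      proof (rule inj_onI)
        fix \<beta> \<gamma> :: "'n multi_index" assume "mi_inc i \<beta> = mi_inc i \<gamma>"
        then have "mi_inc i \<beta> k = mi_inc i \<gamma> k" for k by simp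
        then show "\<beta> = \<gamma>" unfolding mi_inc_def by (intro ext) (metis Suc_inject fun_upd_apply)
      qed
    qed
    also have "\<dots> = (\<Sum>\<beta>\<in>?B j. F (mi_inc i \<beta>) / of_nat (mi_fact \<beta>))"
    proof (rule sum.cong[OF refl])
      fix \<beta> :: "'n multi_index"
      have "mi_inc i \<beta> i = Suc (\<beta> i)" by (simp add: mi_inc_def)
      then show "of_nat (mi_inc i \<beta> i) * (F (mi_inc i \<beta>) / of_nat (mi_fact (mi_inc i \<beta>))) = F (mi_inc i \<beta>) / of_nat (mi_fact \<beta>)"
        by (simp only: mi_fact_inc of_nat_mult) (simp del: of_nat_Suc)
    qed
    finally show ?thesis by simp
  qed
  have "(\<Sum>i\<in>UNIV. \<Sum>\<beta>\<in>?B (Suc j). of_nat (\<beta> i) * (F \<beta> / of_nat (mi_fact \<beta>))) =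
      (\<Sum>\<beta>\<in>?B (Suc j). (\<Sum>i\<in>UNIV. of_nat (\<beta> i)) * (F \<beta> / of_nat (mi_fact \<beta>)))"
    by (subst sum.swap) (simp add: sum_distrib_right sum_divide_distrib)
  also have "\<dots> = (\<Sum>\<beta>\<in>?B (Suc j). of_nat (Suc j) * (F \<beta> / of_nat (mi_fact \<beta>)))"
    by (rule sum.cong[OF refl]) (simp add: mi_length_def of_nat_sum[symmetric] del: of_nat_sum of_nat_Suc)
  finally show ?thesis by (simp only: * sum_distrib_left)
qed

definition wk_derivs :: "'n::finite multi_index \<Rightarrow> (('p::euclidean_space \<times> (real^'n)) \<times> (real^'n) \<Rightarrow> complex) \<Rightarrow>
    ('p \<times> (real^'n)) \<times> (real^'n) \<Rightarrow> complex"
  where "wk_derivs \<beta> H = dir_derivs (map (\<lambda>d. ((0, d), 0)) (mi_dirs \<beta>) @ map (\<lambda>d. (0, d)) (mi_dirs \<beta>)) H"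

lemma smooth_mixed_op_iter: "C_infinity H \<Longrightarrow> C_infinity ((mixed_op ^^ j) H)"
proof (induction j)
  case (Suc j)
  then show ?case by (simp, unfold mixed_op_def[abs_def]) (intro smooth_intros)
qed simp

lemma sum_Basis_vec: "(\<Sum>b\<in>(Basis :: (real^'n::finite) set). f b) = (\<Sum>i\<in>UNIV. f (axis i 1))"
proof -
  have eq: "(Basis :: (real^'n) set) = (\<lambda>i. axis i 1) ` UNIV" by (auto simp: Basis_vec_def)
  show ?thesis unfolding eq by (subst sum.reindex) (auto simp: inj_on_def axis_eq_axis)
qed

text \<open>The power of a sum of commuting operators. One more application raises one entry of the
  multi-index, and \<open>sum_mi_inc\<close> turns the resulting weights into the factor j +
  1.\<close>

lemma mixed_op_iter:
  fixes H :: "('p::euclidean_space \<times> (real^'n::finite)) \<times> (real^'n) \<Rightarrow> complex"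
  assumes H: "C_infinity H"
  shows "(mixed_op ^^ j) H = (\<lambda>z. fact j * (- \<i>) ^ j * (\<Sum>\<beta> | mi_length \<beta> = j. wk_derivs \<beta> H z / of_nat (mi_fact \<beta>)))"
proof (induction j)
  case 0
  have "{\<beta> :: 'n multi_index. mi_length \<beta> = 0} = {\<lambda>_. 0}" by (auto simp: mi_length_def)
  moreover have "mi_dirs (\<lambda>_. 0 :: nat) = ([] :: (real^'n) list)"
    using length_mi_dirs[of "\<lambda>_::'n. 0::nat"] by (simp add: mi_length_def)
  ultimately show ?case by (simp add: wk_derivs_def mi_fact_def)
next
  case (Suc j)
  let ?c = "fact j * (- \<i>) ^ j :: complex"
  have sm: "C_infinity (wk_derivs \<beta> H)" for \<beta> unfolding wk_derivs_def by (rule smooth_dir_derivs[OF H])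
  have lin: "dir_deriv v (\<lambda>z. ?c * (\<Sum>\<beta> | mi_length \<beta> = j. F \<beta> z / of_nat (mi_fact \<beta>))) =
      (\<lambda>z. ?c * (\<Sum>\<beta> | mi_length \<beta> = j. dir_deriv v (F \<beta>) z / of_nat (mi_fact \<beta>)))"
    if F: "\<And>\<beta>. C_infinity (F \<beta>)" for v and F :: "'n multi_index \<Rightarrow> ('p \<times> (real^'n)) \<times> (real^'n) \<Rightarrow> complex"
    by (intro ext dir_deriv_eqI[THEN trans, OF _ refl]
        has_derivative_mult_right has_derivative_sum bounded_linear.has_derivative[OF bounded_linear_divide]
        has_derivative_dir_deriv smooth_differentiable F)
  have inc: "dir_deriv (0, axis i 1) (dir_deriv ((0, axis i 1), 0) (wk_derivs \<beta> H)) = wk_derivs (mi_inc i \<beta>) H" for i \<beta>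
  proof -
    have "dir_deriv (0, axis i 1) (dir_deriv ((0, axis i 1), 0) (wk_derivs \<beta> H)) =
      dir_derivs ((0, axis i 1) # ((0, axis i 1), 0) # map (\<lambda>d. ((0, d), 0)) (mi_dirs \<beta>) @ map (\<lambda>d. (0, d)) (mi_dirs \<beta>)) H"
      by (simp add: wk_derivs_def)
    also have "\<dots> = dir_derivs (map (\<lambda>d. ((0, d), 0)) (axis i 1 # mi_dirs \<beta>) @ map (\<lambda>d. (0, d)) (axis i 1 # mi_dirs \<beta>)) H"
      by (rule dir_derivs_mset[OF H]) simp
    also have "\<dots> = wk_derivs (mi_inc i \<beta>) H"
      unfolding wk_derivs_def
      by (rule dir_derivs_mset[OF H]) (simp only: mset_append mset_map mi_dirs_inc)
    finally show ?thesis .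
  qed
  have "(mixed_op ^^ Suc j) H z = fact (Suc j) * (- \<i>) ^ Suc j * (\<Sum>\<beta> | mi_length \<beta> = Suc j. wk_derivs \<beta> H z / of_nat (mi_fact \<beta>))" for z
  proof -
    have "(mixed_op ^^ Suc j) H z = - \<i> * (\<Sum>i\<in>UNIV. ?c * (\<Sum>\<beta> | mi_length \<beta> = j. wk_derivs (mi_inc i \<beta>) H z / of_nat (mi_fact \<beta>)))"
      by (simp add: mixed_op_def Suc sum_Basis_vec lin sm smooth_dir_deriv inc)
    also have "\<dots> = - \<i> * ?c * (\<Sum>i\<in>UNIV. (\<Sum>\<beta> | mi_length \<beta> = j. wk_derivs (mi_inc i \<beta>) H z / of_nat (mi_fact \<beta>)))"
      by (simp only: sum_distrib_left mult.assoc)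
    also have "\<dots> = fact (Suc j) * (- \<i>) ^ Suc j * (\<Sum>\<beta> | mi_length \<beta> = Suc j. wk_derivs \<beta> H z / of_nat (mi_fact \<beta>))"
      by (subst sum_mi_inc[of "\<lambda>\<beta>. wk_derivs \<beta> H z"]) (simp add: mult_ac)
    finally show ?thesis .
  qed
  then show ?case by blast
qed

section \<open>The amplitudes\<close>

lemma Basis_pairE:
  assumes "d \<in> (Basis :: ('a::euclidean_space \<times> 'b::euclidean_space) set)"
  obtains b where "d = (b, 0)" "b \<in> Basis" | b where "d = (0, b)" "b \<in> Basis"
  using assms unfolding Basis_prod_def by auto

lemma inverse_bracket_le_1: "inverse (bracket x) \<le> 1"
  using bracket_ge_1[of x] by (simp add: inverse_le_1_iff)

lemma bracket_fst_le: "bracket x \<le> bracket (x, y)" and bracket_snd_le: "bracket y \<le> bracket (x, y)"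
  by (auto intro!: bracket_mono simp: norm_fst_le norm_snd_le)

lemma bracket_pair_sq: "(bracket (x, y))\<^sup>2 = (bracket x)\<^sup>2 + (norm y)\<^sup>2"
  by (simp add: bracket_sq norm_Pair)

locale fio_data =
  fixes m1 m2 m3 :: real
    and \<phi> :: "real^'n::finite \<Rightarrow> real^'n \<Rightarrow> real"
    and a :: "real^'n \<Rightarrow> real^'n \<Rightarrow> real^'n \<Rightarrow> complex"
    and C1 C2 :: real
  assumes phi_smooth: "C_infinity (\<lambda>(x, \<xi>). \<phi> x \<xi>)"
    and C1: "C1 > 0"
    and phi_grad: "\<And>x \<xi>. C1 * bracket x \<le> bracket (grad_snd \<phi> x \<xi>)"
      "\<And>x \<xi>. bracket (grad_snd \<phi> x \<xi>) \<le> C2 * bracket x"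
    and phi_xi: "\<And>\<beta>. mi_length \<beta> \<ge> 1 \<Longrightarrow>
      \<exists>C. \<forall>x \<xi>. \<bar>mi_deriv \<beta> (\<lambda>\<xi>. \<phi> x \<xi>) \<xi>\<bar> \<le> C * bracket x"
    and phi_x_xi: "\<And>\<alpha> \<beta>. mi_length \<alpha> \<ge> 1 \<Longrightarrow> mi_length \<beta> \<ge> 1 \<Longrightarrow>
      \<exists>C. \<forall>x \<xi>. \<bar>mi_deriv2 \<alpha> \<beta> \<phi> x \<xi>\<bar> \<le> C"
    and a_smooth: "C_infinity (\<lambda>(x, y, \<xi>). a x y \<xi>)"
    and a_bound: "\<And>\<alpha> \<beta> \<gamma>. \<exists>C. \<forall>x y \<xi>. norm (mi_deriv3 \<alpha> \<beta> \<gamma> a x y \<xi>)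
      \<le> C * bracket x powr m1 * bracket y powr (m2 - real (mi_length \<beta>)) * bracket \<xi> powr m3"
begin

section \<open>The phase and the amplitude as weighted symbols\<close>

definition ph :: "(real^'n) \<times> (real^'n) \<Rightarrow> real"
  where "ph = (\<lambda>(x, \<xi>). \<phi> x \<xi>)"

definition phd :: "real^'n \<Rightarrow> (real^'n) \<times> (real^'n) \<Rightarrow> real"
  where "phd b = dir_deriv (0, b) ph"

definition grad :: "(real^'n) \<times> (real^'n) \<Rightarrow> real^'n"
  where "grad z = grad_snd \<phi> (fst z) (snd z)"

lemma smooth_ph: "C_infinity ph"
  using phi_smooth by (simp add: ph_def)

lemma grad_inner: "b \<in> Basis \<Longrightarrow> grad z \<bullet> b = phd b z"
  by (auto simp: Basis_vec_def grad_def grad_snd_def phd_def partial_def ph_def dir_deriv_def inner_axis split_beta)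

lemma grad_eq: "grad z = (\<Sum>b\<in>Basis. phd b z *\<^sub>R b)"
  using euclidean_representation[of "grad z"] by (simp add: grad_inner)

lemma smooth_phd: "C_infinity (phd b)"
  unfolding phd_def by (intro smooth_dir_deriv smooth_ph)

lemma smooth_grad: "C_infinity grad"
  unfolding grad_eq[abs_def] by (intro smooth_intros smooth_phd)

lemma grad_bracket: "C1 * bracket (fst z) \<le> bracket (grad z)" "bracket (grad z) \<le> C2 * bracket (fst z)"
  using phi_grad by (auto simp: grad_def)

lemma C2: "C2 > 0"
proof -
  have "C1 * bracket (0::real^'n) \<le> C2 * bracket (0::real^'n)"
    using grad_bracket[of "(0, 0)"] by simp
  then show ?thesis using C1 by (simp add: bracket_def)
qed

text \<open>Every derivative of \<open>phd\<close> b contains a \<xi>-derivative of the phase and so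
  falls under one of the two hypotheses: with no x-derivative it is bounded by a multiple of <x>,
  otherwise by a constant. Since 1 \<le> <x>, both fit one weight.\<close>

lemma symb_phd:
  assumes b: "b \<in> Basis"
  shows "symb Basis (\<lambda>_ _. 1) (\<lambda>z. bracket (fst z)) (phd b)"
  unfolding symb_list_iff
proof (intro conjI allI impI smooth_phd)
  fix ds :: "((real^'n) \<times> (real^'n)) list" assume ds: "set ds \<subseteq> Basis"
  have "set (ds @ [(0, b)]) \<subseteq> Basis" using ds b by (auto simp: Basis_prod_def)
  then obtain us vs where uv: "set us \<subseteq> Basis" "set vs \<subseteq> Basis"
    "mset (ds @ [(0, b)]) = mset (map (\<lambda>u. (u, 0)) us @ map (\<lambda>v. (0, v)) vs)"
    using Basis_pair_lists by blast
  obtain \<alpha> \<beta> where ab: "mset us = mset (mi_dirs \<alpha>)" "mset vs = mset (mi_dirs \<beta>)"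
    using mi_dirs_ex uv by metis
  have "(0, b) \<in> set (map (\<lambda>u. (u, 0)) us @ map (\<lambda>v. (0, v)) vs)"
    using uv(3) by (metis in_set_conv_decomp set_mset_mset)
  then have "vs \<noteq> []" using b nonzero_Basis by auto
  then have "mi_length \<beta> \<ge> 1" using ab(2) length_mi_dirs[of \<beta>]
    by (metis One_nat_def Suc_leI length_greater_0_conv mset_eq_length)
  have eq: "dir_derivs ds (phd b) (x, \<xi>) = mi_deriv2 \<alpha> \<beta> \<phi> x \<xi>" for x \<xi>
  proof -
    have "dir_derivs ds (phd b) = dir_derivs (ds @ [(0, b)]) ph" by (simp add: phd_def)
    also have "\<dots> = dir_derivs (map (\<lambda>d. (d, 0)) (mi_dirs \<alpha>) @ map (\<lambda>d. (0, d)) (mi_dirs \<beta>)) ph"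
      by (rule dir_derivs_mset[OF smooth_ph], unfold uv(3)) (simp only: mset_append mset_map ab)
    finally show ?thesis by (simp only: mi_deriv2_dirs ph_def)
  qed
  have "\<exists>C. \<forall>x \<xi>. \<bar>mi_deriv2 \<alpha> \<beta> \<phi> x \<xi>\<bar> \<le> C * bracket x"
  proof (cases "mi_length \<alpha> \<ge> 1")
    case True
    from phi_x_xi[OF True \<open>mi_length \<beta> \<ge> 1\<close>] obtain C where C: "\<And>x \<xi>. \<bar>mi_deriv2 \<alpha> \<beta> \<phi> x \<xi>\<bar> \<le> C" by blast
    have "\<bar>mi_deriv2 \<alpha> \<beta> \<phi> x \<xi>\<bar> \<le> \<bar>C\<bar> * bracket x" for x \<xi>
    proof -
      have "\<bar>mi_deriv2 \<alpha> \<beta> \<phi> x \<xi>\<bar> \<le> \<bar>C\<bar> * 1" using C[of x \<xi>] by simp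
      also have "\<dots> \<le> \<bar>C\<bar> * bracket x" by (intro mult_left_mono bracket_ge_1) auto
      finally show ?thesis .
    qed
    then show ?thesis by blast
  next
    case False
    then have "mi_length \<alpha> = 0" by simp
    then have "mi_dirs \<alpha> = []" using length_mi_dirs[of \<alpha>] by (metis length_0_conv)
    then have "mi_deriv2 \<alpha> \<beta> \<phi> x \<xi> = mi_deriv \<beta> (\<lambda>\<xi>. \<phi> x \<xi>) \<xi>" for x \<xi>
      by (simp add: mi_deriv2_def mi_deriv_dirs[of \<alpha>])
    then show ?thesis using phi_xi[OF \<open>mi_length \<beta> \<ge> 1\<close>] by simp
  qed
  then obtain C where "\<And>x \<xi>. \<bar>mi_deriv2 \<alpha> \<beta> \<phi> x \<xi>\<bar> \<le> C * bracket x" by blast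
  then show "\<exists>C. \<forall>z. norm (dir_derivs ds (phd b) z) \<le> C * (bracket (fst z) * (\<Prod>d\<leftarrow>ds. 1))"
    by (intro exI[of _ C] allI) (auto simp: eq map_replicate_const prod_list_replicate)
qed

definition am :: "(real^'n) \<times> (real^'n) \<times> (real^'n) \<Rightarrow> complex"
  where "am = (\<lambda>(x, y, \<xi>). a x y \<xi>)"

text \<open>For d in \<open>Basis\<close> the test fails exactly for y-directions, the only ones in
  which a gains decay.\<close>

definition cost3 :: "(real^'n) \<times> (real^'n) \<times> (real^'n) \<Rightarrow> (real^'n) \<times> (real^'n) \<times> (real^'n) \<Rightarrow> real"
  where "cost3 d z = (if fst (snd d) = 0 then 1 else inverse (bracket (fst (snd z))))"

definition wt3 :: "(real^'n) \<times> (real^'n) \<times> (real^'n) \<Rightarrow> real"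
  where "wt3 z = bracket (fst z) powr m1 * bracket (fst (snd z)) powr m2 * bracket (snd (snd z)) powr m3"

lemma cost3_nonneg: "cost3 d z \<ge> 0" and cost3_le_1: "cost3 d z \<le> 1"
  by (auto simp: cost3_def inverse_bracket_le_1)

lemma wt3_pos: "wt3 z > 0"
  by (simp add: wt3_def)

lemma symb_am: "symb Basis cost3 wt3 am"
  unfolding symb_list_iff
proof (intro conjI allI impI)
  show sm: "C_infinity am" using a_smooth by (simp add: am_def)
  fix ds :: "((real^'n) \<times> (real^'n) \<times> (real^'n)) list" assume ds: "set ds \<subseteq> Basis"
  then obtain us ws where uw: "set us \<subseteq> Basis" "set ws \<subseteq> Basis"
    "mset ds = mset (map (\<lambda>u. (u, 0)) us @ map (\<lambda>v. (0, v)) ws)"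
    using Basis_pair_lists by blast
  obtain vs ts where vt: "set vs \<subseteq> Basis" "set ts \<subseteq> Basis"
    "mset ws = mset (map (\<lambda>u. (u, 0)) vs @ map (\<lambda>v. (0, v)) ts)"
    using Basis_pair_lists[OF uw(2)] by blast
  obtain \<alpha> \<beta> \<gamma> where ab: "mset us = mset (mi_dirs \<alpha>)" "mset vs = mset (mi_dirs \<beta>)" "mset ts = mset (mi_dirs \<gamma>)"
    using mi_dirs_ex uw vt by metis
  let ?es = "map (\<lambda>d. (d, 0)) (mi_dirs \<alpha>) @
    map (\<lambda>d. (0, d)) (map (\<lambda>d. (d, 0)) (mi_dirs \<beta>) @ map (\<lambda>d. (0, d)) (mi_dirs \<gamma>))"
  have ms: "mset ds = mset ?es" by (simp only: uw(3) vt(3) ab mset_append mset_map)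
  have eq: "dir_derivs ds am (x, y, \<xi>) = mi_deriv3 \<alpha> \<beta> \<gamma> a x y \<xi>" for x y \<xi>
    unfolding mi_deriv3_dirs am_def[symmetric] by (simp only: dir_derivs_mset[OF sm ms])
  have pr: "(\<Prod>d\<leftarrow>ds. cost3 d z) = bracket (fst (snd z)) powr (- real (mi_length \<beta>))" for z
  proof -
    have "(\<Prod>d\<leftarrow>ds. cost3 d z) = prod_mset (image_mset (\<lambda>d. cost3 d z) (mset ds))"
      by (simp add: prod_mset_prod_list[symmetric] del: prod_mset_prod_list)
    also have "\<dots> = (\<Prod>d\<leftarrow>?es. cost3 d z)"
      unfolding ms by (simp only: mset_map[symmetric] prod_mset_prod_list)
    also have "\<dots> = (\<Prod>d\<leftarrow>mi_dirs \<beta>. inverse (bracket (fst (snd z))))"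
    proof -
      have "map (\<lambda>d. cost3 (0, d, 0) z) (mi_dirs \<beta>) = map (\<lambda>d. inverse (bracket (fst (snd z)))) (mi_dirs \<beta>)"
        using mi_dirs_Basis[of \<beta>] nonzero_Basis by (intro map_cong) (auto simp: cost3_def)
      then show ?thesis by (simp add: cost3_def o_def map_replicate_const prod_list_replicate)
    qed
    also have "\<dots> = inverse (bracket (fst (snd z))) ^ mi_length \<beta>"
      by (simp add: map_replicate_const prod_list_replicate length_mi_dirs)
    also have "\<dots> = bracket (fst (snd z)) powr (- real (mi_length \<beta>))"
      using bracket_pos[of "fst (snd z)"] by (simp add: powr_minus powr_realpow power_inverse)
    finally show ?thesis .
  qed
  obtain C where C: "\<And>x y \<xi>. norm (mi_deriv3 \<alpha> \<beta> \<gamma> a x y \<xi>)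
      \<le> C * bracket x powr m1 * bracket y powr (m2 - real (mi_length \<beta>)) * bracket \<xi> powr m3"
    using a_bound by blast
  have "norm (dir_derivs ds am z) \<le> C * (wt3 z * (\<Prod>d\<leftarrow>ds. cost3 d z))" for z
    using C[of "fst z" "fst (snd z)" "snd (snd z)"]
    by (simp add: eq[of "fst z" "fst (snd z)" "snd (snd z)", simplified] pr wt3_def powr_diff powr_minus divide_inverse mult_ac)
  then show "\<exists>C. \<forall>z. norm (dir_derivs ds am z) \<le> C * (wt3 z * (\<Prod>d\<leftarrow>ds. cost3 d z))" by blast
qed

section \<open>Cutoffs in <y> / <x>\<close>

definition ratio :: "(real^'n) \<times> (real^'n) \<times> (real^'n) \<Rightarrow> real"
  where "ratio z = (bracket (fst (snd z)))\<^sup>2 * (inverse (bracket (fst z)))\<^sup>2"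

lemma symb_bracket_y: "symb Basis cost3 (\<lambda>z. bracket (fst (snd z))) (\<lambda>z. bracket (fst (snd z)))"
  by (rule symb_affine[OF symb_bracket, where L = "\<lambda>d. fst (snd d)"])
     (auto intro!: smooth_intros elim!: Basis_pairE simp: cost3_def nonzero_Basis)

lemma symb_bracket_x: "symb Basis cost3 (\<lambda>z. bracket (fst z)) (\<lambda>z. bracket (fst z))"
  by (rule symb_affine[OF symb_bracket, where L = fst])
     (auto intro!: smooth_intros elim!: Basis_pairE simp: cost3_def nonzero_Basis inverse_bracket_le_1)

lemma symb_inverse_bracket_x:
  "symb Basis cost3 (\<lambda>z. inverse (bracket (fst z))) (\<lambda>z. inverse (bracket (fst z)))"
  by (rule symb_inverse[OF symb_bracket_x, of 1]) (auto simp: bracket_pos cost3_nonneg)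

lemma symb_ratio: "symb Basis cost3 ratio ratio"
  unfolding ratio_def[abs_def] power2_eq_square
  by (intro symb_mult symb_bracket_y symb_inverse_bracket_x)

lemma ratio_pos: "ratio z > 0"
  by (simp add: ratio_def bracket_pos)

text \<open>\<open>ratio\<close> is a symbol of its own size, so a derivative of the bump costs
  \<open>cost3\<close> times \<open>ratio\<close>; and \<open>ratio\<close> is at most r4 where the
  weight, an indicator, does not vanish. Thus the cutoff is a symbol of order 0.\<close>

lemma symb_bump_ratio:
  assumes r: "0 < r1" "r1 < r2" "r3 < r4"
  shows "symb Basis cost3 (\<lambda>z. indicator {r1..r4} (ratio z)) (\<lambda>z. bump r1 r2 r3 r4 (ratio z))"
proof (rule symb_compose[where \<sigma> = "\<lambda>_ _. 1" and \<tau> = "\<lambda>_. ratio"])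
  show "symb Basis (\<lambda>_ _. 1) (indicator {r1..r4}) (bump r1 r2 r3 r4)"
    by (rule symb_compact_support[OF smooth_bump]) (use bump_eq_0[OF r(2,3)] in auto)
  show "C_infinity ratio" using symb_ratio by (rule symb_smooth)
  show "symb Basis cost3 (\<lambda>z. cost3 b z * ratio z) (dir_deriv b (\<lambda>z. ratio z \<bullet> c))"
    if "b \<in> Basis" "c \<in> Basis" for b c
    using symb_dir_deriv[OF symb_ratio that(1)] that(2) by (simp add: mult.commute)
  show "\<exists>C. \<forall>z. indicat_real {r1..r4} (ratio z) \<noteq> 0 \<longrightarrow> 1 * ratio z \<le> C"
    by (rule exI[of _ r4]) (auto simp: indicator_def)
qed (auto simp: cost3_nonneg less_imp_le[OF ratio_pos])

text \<open>At y = \<nabla>\<phi> the value of \<open>ratio\<close> lies in [C1^2, C2^2]. Plateau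
  and support widen this interval by the factors 8 and 16 for \<open>chi\<close>, 4 and 8 for
  \<open>psi\<close>, so \<open>chi\<close> is 1 wherever \<open>psi\<close> is nonzero. The factor
  4 makes <y> and <\<nabla>\<phi>> differ by a factor 2 outside the plateau of
  \<open>psi\<close>.\<close>

definition chi :: "(real^'n) \<times> (real^'n) \<times> (real^'n) \<Rightarrow> real"
  where "chi z = bump (C1\<^sup>2 / 16) (C1\<^sup>2 / 8) (8 * C2\<^sup>2) (16 * C2\<^sup>2) (ratio z)"

definition psi :: "(real^'n) \<times> (real^'n) \<times> (real^'n) \<Rightarrow> real"
  where "psi z = bump (C1\<^sup>2 / 8) (C1\<^sup>2 / 4) (4 * C2\<^sup>2) (8 * C2\<^sup>2) (ratio z)"

lemma symb_chi: "symb Basis cost3 (\<lambda>z. indicator {C1\<^sup>2 / 16..16 * C2\<^sup>2} (ratio z)) chi"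
  unfolding chi_def[abs_def] by (rule symb_bump_ratio) (use C1 C2 in auto)

lemma symb_psi: "symb Basis cost3 (\<lambda>z. indicator {C1\<^sup>2 / 8..8 * C2\<^sup>2} (ratio z)) psi"
  unfolding psi_def[abs_def] by (rule symb_bump_ratio) (use C1 C2 in auto)

lemma symb_1_mono: 
  assumes "symb Basis cost3 W f" "\<And>z. W z \<le> C * V z" "\<And>z. W z \<ge> 0" "\<And>z. V z \<ge> 0"
  shows "symb Basis (\<lambda>_ _. 1) V f"
proof (rule symb_mono[OF assms(1)])
  show "\<exists>C. \<forall>z. W z \<le> C * V z" using assms(2) by blast
  show "\<exists>C. \<forall>z. W z \<noteq> 0 \<longrightarrow> cost3 b z \<le> C * 1" for b
    by (rule exI[of _ 1]) (simp add: cost3_le_1)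
qed (use assms(3-) in \<open>simp_all add: cost3_nonneg\<close>)

definition am_near :: "(real^'n) \<times> (real^'n) \<times> (real^'n) \<Rightarrow> complex"
  where "am_near z = complex_of_real (chi z) * am z"

definition am_far :: "(real^'n) \<times> (real^'n) \<times> (real^'n) \<Rightarrow> complex"
  where "am_far z = complex_of_real (1 - chi z) * am z"

lemma am_split: "am z = am_near z + am_far z"
  by (simp add: am_near_def am_far_def algebra_simps)

lemma symb_am_near: "symb Basis cost3 (\<lambda>z. indicator {C1\<^sup>2 / 16..16 * C2\<^sup>2} (ratio z) * wt3 z) am_near"
  unfolding am_near_def[abs_def] by (intro symb_mult symb_of_real symb_chi symb_am)

lemma symb_am_far: "symb Basis (\<lambda>_ _. 1) wt3 am_far"
proof -
  have "symb Basis (\<lambda>_ _. 1) (\<lambda>_. 1) chi"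
    by (rule symb_1_mono[OF symb_chi, of 1]) (auto simp: indicator_def)
  moreover have "symb Basis (\<lambda>_ _. 1) wt3 am"
    by (rule symb_1_mono[OF symb_am, of 1]) (auto simp: less_imp_le[OF wt3_pos])
  ultimately have "symb Basis (\<lambda>_ _. 1) (\<lambda>z. 1 * wt3 z) am_far"
    unfolding am_far_def[abs_def] by (intro symb_mult symb_of_real symb_diff symb_const)
  then show ?thesis by simp
qed

lemma psi_am_far: "psi z \<noteq> 0 \<Longrightarrow> am_far z = 0"
proof -
  assume "psi z \<noteq> 0"
  then have "ratio z \<in> {C1\<^sup>2 / 8..8 * C2\<^sup>2}"
    unfolding psi_def using bump_eq_0[of "C1\<^sup>2 / 8" "C1\<^sup>2 / 4" "4 * C2\<^sup>2" "8 * C2\<^sup>2" "ratio z"] C1 C2 by auto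
  then have "chi z = 1" unfolding chi_def using C1 C2 by (intro bump_eq_1) auto
  then show ?thesis by (simp add: am_far_def)
qed

section \<open>The vector field and the operator for integration by parts\<close>

definition rho :: "(real^'n) \<times> (real^'n) \<times> (real^'n) \<Rightarrow> real"
  where "rho z = bracket (fst z, fst (snd z))"

definition Fv :: "(real^'n) \<times> (real^'n) \<times> (real^'n) \<Rightarrow> real^'n"
  where "Fv z = grad (fst z, snd (snd z)) - fst (snd z)"

definition Fb :: "real^'n \<Rightarrow> (real^'n) \<times> (real^'n) \<times> (real^'n) \<Rightarrow> real"
  where "Fb b z = phd b (fst z, snd (snd z)) - fst (snd z) \<bullet> b"

text \<open>\<open>F = \<nabla>\<^sub>\<eta>\<phi>(x, \<eta>) - y\<close> can be small only where \<open>psi = 1\<close>, and \<open>psi\<close> vanishes on the support of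
  \<open>am_far\<close>. The last summand therefore keeps \<open>Qd\<close> elliptic of order \<open>\<langle>x\<rangle>\<^sup>2 + \<langle>y\<rangle>\<^sup>2\<close> without affecting the integration
  by parts.\<close>

definition Qd :: "(real^'n) \<times> (real^'n) \<times> (real^'n) \<Rightarrow> real"
  where "Qd z = (\<Sum>b\<in>Basis. Fb b z * Fb b z) + bracket (fst z) * bracket (fst z) * psi z"

definition Vb :: "real^'n \<Rightarrow> (real^'n) \<times> (real^'n) \<times> (real^'n) \<Rightarrow> real"
  where "Vb b z = Fb b z * inverse (Qd z)"

lemma Fb_eq: "b \<in> Basis \<Longrightarrow> Fb b z = Fv z \<bullet> b"
  by (simp add: Fb_def Fv_def inner_diff_left grad_inner)

lemma rho_pos: "rho z > 0" by (simp add: rho_def bracket_pos)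

lemma symb_Fb:
  assumes b: "b \<in> Basis" shows "symb Basis (\<lambda>_ _. 1) rho (Fb b)"
proof -
  have "symb Basis (\<lambda>_ _. 1) (\<lambda>z. bracket (fst (fst z, snd (snd z)))) (\<lambda>z. phd b (fst z, snd (snd z :: (real^'n) \<times> (real^'n))))"
    by (rule symb_affine[OF symb_phd[OF b], where L = "\<lambda>d. (fst d, snd (snd d))"])
       (auto intro!: smooth_intros elim!: Basis_pairE simp: Basis_prod_def zero_prod_def)
  then have 1: "symb Basis (\<lambda>_ _. 1) rho (\<lambda>z. phd b (fst z, snd (snd z)))"
    by (rule symb_weight_mono[where C = 1]) (auto simp: rho_def bracket_fst_le)
  have "symb Basis (\<lambda>_ _. 1) (\<lambda>z. bracket (fst (snd z))) (\<lambda>z::(real^'n) \<times> (real^'n) \<times> (real^'n). fst (snd z) \<bullet> b)"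
    by (rule symb_affine[OF symb_inner_left[OF b], where L = "\<lambda>d. fst (snd d)"])
       (auto intro!: smooth_intros elim!: Basis_pairE simp: inverse_bracket_le_1)
  then have 2: "symb Basis (\<lambda>_ _. 1) rho (\<lambda>z. fst (snd z) \<bullet> b)"
    by (rule symb_weight_mono[where C = 1]) (auto simp: rho_def bracket_snd_le)
  show ?thesis unfolding Fb_def[abs_def] by (rule symb_diff[OF 1 2])
qed

lemma symb_Qd: "symb Basis (\<lambda>_ _. 1) (\<lambda>z. rho z * rho z) Qd"
proof -
  have p: "symb Basis (\<lambda>_ _. 1) (\<lambda>_. 1) psi"
    by (rule symb_1_mono[OF symb_psi, of 1]) (auto simp: indicator_def)
  have x: "symb Basis (\<lambda>_ _. 1) rho (\<lambda>z. bracket (fst z))"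
    by (rule symb_1_mono[OF symb_bracket_x, of 1]) (auto simp: rho_def bracket_fst_le)
  have "symb Basis (\<lambda>_ _. 1) (\<lambda>z. rho z * rho z * 1) (\<lambda>z. bracket (fst z) * bracket (fst z) * psi z)"
    by (intro symb_mult p x)
  then have "symb Basis (\<lambda>_ _. 1) (\<lambda>z. rho z * rho z) (\<lambda>z. bracket (fst z) * bracket (fst z) * psi z)" by simp
  from symb_add[OF symb_sum[OF symb_mult[OF symb_Fb symb_Fb]] this]
  show ?thesis unfolding Qd_def[abs_def] .
qed

text \<open>Off the plateau of \<open>psi\<close> the brackets of y and \<nabla>\<phi> differ by a
  factor 2 at least, so |F| is at least half the larger one, which controls both <x> and <y>. On the
  plateau <y> is at most a multiple of <x>, and the summand <x>^2 \<open>psi\<close>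
  suffices.\<close>

lemma Qd_lower: "\<exists>c>0. \<forall>z. c * (rho z * rho z) \<le> Qd z"
proof -
  define A where "A = C1\<^sup>2"
  define B where "B = C2\<^sup>2"
  have A: "A > 0" and B: "B > 0" using C1 C2 by (auto simp: A_def B_def)
  \<comment> \<open>One entry for each region: the plateau of \<open>psi\<close>, small <y>, large
    <y>. Each is the lower bound of \<open>Qd\<close> divided by the upper bound of
    \<open>rho\<close> squared, in units of <x>^2 for the first two and of <y>^2 for the
    last.\<close>
  define c where "c = min (1 / (1 + 4 * B)) (min ((A / 4) / (1 + A / 4)) ((1 / 4) / (1 + 1 / (4 * B))))"
  have c: "c > 0" using A B by (simp add: c_def add_pos_pos)
  have c1: "c * (1 + 4 * B) \<le> 1"
  proof -
    have "c \<le> 1 / (1 + 4 * B)" by (simp add: c_def)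
    then show ?thesis using B by (simp add: pos_le_divide_eq)
  qed
  have c2: "c * (1 + A / 4) \<le> A / 4"
  proof -
    have "c \<le> (A / 4) / (1 + A / 4)" by (simp add: c_def)
    then show ?thesis using A by (simp only: pos_le_divide_eq)
  qed
  have c3: "c * (1 + 1 / (4 * B)) \<le> 1 / 4"
  proof -
    have "c \<le> (1 / 4) / (1 + 1 / (4 * B))" by (simp add: c_def)
    moreover have "0 < 1 + 1 / (4 * B)" using B by (simp add: add_pos_pos)
    ultimately show ?thesis by (simp only: pos_le_divide_eq)
  qed
  have "c * (rho z * rho z) \<le> Qd z" for z
  proof -
    obtain x y \<eta> where z: "z = (x, y, \<eta>)" by (metis surj_pair)
    let ?l = "bracket x" and ?Y = "bracket y" and ?D = "bracket (grad (x, \<eta>))" and ?F = "Fv z"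
    have Q: "Qd z = (norm ?F)\<^sup>2 + ?l\<^sup>2 * psi z"
    proof -
      have "(\<Sum>b\<in>Basis. Fb b z * Fb b z) = ?F \<bullet> ?F" by (subst euclidean_inner) (simp add: Fb_eq)
      then show ?thesis by (simp only: Qd_def dot_square_norm) (simp add: z power2_eq_square)
    qed
    have psi0: "psi z \<ge> 0" by (simp add: psi_def bump_range)
    have rho: "rho z * rho z \<le> ?l\<^sup>2 + ?Y\<^sup>2"
      by (simp add: rho_def z power2_eq_square[symmetric] bracket_pair_sq norm_le_bracket)
    have Fy: "?F = grad (x, \<eta>) - y" by (simp add: Fv_def z)
    have D1: "?D \<le> ?Y + norm ?F" using bracket_add_le[of y ?F] by (simp add: Fy)
    have D2: "?Y \<le> ?D + norm ?F" using bracket_add_le[of "grad (x, \<eta>)" "- ?F"] by (simp add: Fy norm_minus_commute)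
    have gl: "A * ?l\<^sup>2 \<le> ?D\<^sup>2" and gu: "?D\<^sup>2 \<le> B * ?l\<^sup>2"
      using power_mono[OF grad_bracket(1)[of "(x, \<eta>)"], of 2] power_mono[OF grad_bracket(2)[of "(x, \<eta>)"], of 2] C1
      by (auto simp: A_def B_def power_mult_distrib)
    have l0: "?l\<^sup>2 > 0" using bracket_pos[of x] by simp
    have rat: "ratio z = ?Y\<^sup>2 / ?l\<^sup>2" by (simp add: ratio_def z divide_inverse power_inverse)
    consider "ratio z < A / 4" | "ratio z > 4 * B" | "A / 4 \<le> ratio z" "ratio z \<le> 4 * B" by linarith
    then show ?thesis
    proof cases
      case 1
      then have "?Y\<^sup>2 \<le> (A * ?l\<^sup>2) / 4" using l0 by (simp add: rat pos_divide_less_eq)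
      then have Y: "?Y\<^sup>2 \<le> (A / 4) * ?l\<^sup>2" and "?Y\<^sup>2 \<le> (?D / 2)\<^sup>2" using gl by (auto simp: power_divide)
      then have "?Y \<le> ?D / 2" by (simp add: power2_le_iff_abs_le abs_le_square_iff[symmetric])
      then have "?D / 2 \<le> norm ?F" using D1 by linarith
      then have "(?D / 2)\<^sup>2 \<le> (norm ?F)\<^sup>2" by (intro power_mono) auto
      then have "(A / 4) * ?l\<^sup>2 \<le> (norm ?F)\<^sup>2" using gl by (simp add: power_divide)
      moreover have "c * (rho z * rho z) \<le> c * ((1 + A / 4) * ?l\<^sup>2)"
        using rho Y c by (intro mult_left_mono) (auto simp: distrib_right)
      moreover have "(c * (1 + A / 4)) * ?l\<^sup>2 \<le> (A / 4) * ?l\<^sup>2" using c2 by (intro mult_right_mono) auto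
      ultimately have "c * (rho z * rho z) \<le> (norm ?F)\<^sup>2" by (simp only: mult.assoc)
      then show ?thesis using psi0 by (simp add: Q add_increasing2)
    next
      case 2
      then have Y: "4 * (B * ?l\<^sup>2) \<le> ?Y\<^sup>2" using l0 by (simp add: rat pos_less_divide_eq)
      then have "?D\<^sup>2 \<le> (?Y / 2)\<^sup>2" using gu by (simp add: power_divide)
      then have "?D \<le> ?Y / 2" by (simp add: power2_le_iff_abs_le abs_le_square_iff[symmetric])
      then have "?Y / 2 \<le> norm ?F" using D2 by linarith
      then have "(?Y / 2)\<^sup>2 \<le> (norm ?F)\<^sup>2" by (intro power_mono) auto
      then have F: "1 / 4 * ?Y\<^sup>2 \<le> (norm ?F)\<^sup>2" by (simp add: power_divide)
      have "?l\<^sup>2 \<le> 1 / (4 * B) * ?Y\<^sup>2" using Y B by (simp add: field_simps)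
      then have "c * (rho z * rho z) \<le> c * ((1 + 1 / (4 * B)) * ?Y\<^sup>2)"
        using rho c by (intro mult_left_mono) (auto simp: distrib_right)
      also have "\<dots> = (c * (1 + 1 / (4 * B))) * ?Y\<^sup>2" by (simp only: mult.assoc)
      also have "\<dots> \<le> 1 / 4 * ?Y\<^sup>2" using c3 by (intro mult_right_mono) auto
      finally show ?thesis using psi0 F by (simp add: Q add_increasing2)
    next
      case 3
      then have "psi z = 1" unfolding psi_def using C1 C2 by (intro bump_eq_1) (auto simp: A_def B_def)
      have "?Y\<^sup>2 \<le> 4 * B * ?l\<^sup>2" using 3(2) l0 by (simp add: rat pos_divide_le_eq)
      then have "c * (rho z * rho z) \<le> c * ((1 + 4 * B) * ?l\<^sup>2)"
        using rho c by (intro mult_left_mono) (auto simp: distrib_right)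
      also have "\<dots> = (c * (1 + 4 * B)) * ?l\<^sup>2" by (simp only: mult.assoc)
      also have "\<dots> \<le> 1 * ?l\<^sup>2" using c1 by (intro mult_right_mono) auto
      finally show ?thesis by (simp add: Q \<open>psi z = 1\<close> add_increasing)
    qed
  qed
  then show ?thesis using c by blast
qed

lemma Qd_pos: "Qd z > 0"
proof -
  obtain c where c: "c > 0" "\<And>z. c * (rho z * rho z) \<le> Qd z" using Qd_lower by blast
  have "0 < c * (rho z * rho z)" using c(1) rho_pos[of z] by simp
  then show ?thesis using c(2)[of z] by linarith
qed

lemma symb_Vb:
  assumes "b \<in> Basis" shows "symb Basis (\<lambda>_ _. 1) (\<lambda>z. inverse (rho z)) (Vb b)"
proof -
  obtain c where c: "c > 0" "\<And>z. c * (rho z * rho z) \<le> Qd z" using Qd_lower by blast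
  have "symb Basis (\<lambda>_ _. 1) (\<lambda>z. inverse (rho z * rho z)) (\<lambda>z. inverse (Qd z))"
  proof (rule symb_inverse[OF symb_Qd Qd_pos, of "1 / c"])
    show "rho z * rho z \<le> 1 / c * Qd z" for z using c(1) c(2)[of z] by (simp add: field_simps)
    show "0 < rho z * rho z" for z using rho_pos[of z] by simp
  qed simp
  from symb_mult[OF symb_Fb[OF assms] this]
  have "symb Basis (\<lambda>_ _. 1) (\<lambda>z. rho z * inverse (rho z * rho z)) (Vb b)"
    unfolding Vb_def[abs_def] .
  moreover have "rho z * inverse (rho z * rho z) = inverse (rho z)" for z
    using rho_pos[of z] by (simp add: field_simps)
  ultimately show ?thesis by (simp only:)
qed

lemma Vb_Fb: "psi z = 0 \<Longrightarrow> (\<Sum>b\<in>Basis. Fb b z * Vb b z) = 1"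
proof -
  assume "psi z = 0"
  then have "Qd z = (\<Sum>b\<in>Basis. Fb b z * Fb b z)" by (simp add: Qd_def)
  moreover have "(\<Sum>b\<in>Basis. Fb b z * Vb b z) = (\<Sum>b\<in>Basis. Fb b z * Fb b z) * inverse (Qd z)"
    by (simp add: Vb_def sum_distrib_right mult.assoc)
  ultimately show ?thesis using Qd_pos[of z] by simp
qed

definition VB :: "real^'n \<Rightarrow> ((real^'n) \<times> (real^'n) \<times> (real^'n) \<Rightarrow> complex) \<Rightarrow> (real^'n) \<times> (real^'n) \<times> (real^'n) \<Rightarrow> complex"
  where "VB b B z = complex_of_real (Vb b z) * B z"

text \<open>The transpose of \<open>- \<i> V \<cdot> \<partial>\<^sub>\<eta>\<close>, which fixes \<open>exp (\<i> (\<phi>(x, \<eta>) - y \<cdot> \<eta>))\<close> wherever \<open>psi = 0\<close>.\<close>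

definition Lop :: "((real^'n) \<times> (real^'n) \<times> (real^'n) \<Rightarrow> complex) \<Rightarrow> (real^'n) \<times> (real^'n) \<times> (real^'n) \<Rightarrow> complex"
  where "Lop B z = \<i> * (\<Sum>b\<in>Basis. dir_deriv (0, 0, b) (VB b B) z)"

definition Lk :: "nat \<Rightarrow> (real^'n) \<times> (real^'n) \<times> (real^'n) \<Rightarrow> complex"
  where "Lk k = (Lop ^^ k) am_far"

lemma Lk_Suc: "Lk (Suc k) = Lop (Lk k)" by (simp add: Lk_def)

lemma symb_VB:
  assumes "symb Basis (\<lambda>_ _. 1) W B" "b \<in> Basis"
  shows "symb Basis (\<lambda>_ _. 1) (\<lambda>z. inverse (rho z) * W z) (VB b B)"
  unfolding VB_def[abs_def] by (intro symb_mult symb_of_real symb_Vb assms)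

lemma symb_Lop:
  assumes "symb Basis (\<lambda>_ _. 1) W B"
  shows "symb Basis (\<lambda>_ _. 1) (\<lambda>z. inverse (rho z) * W z) (Lop B)"
  unfolding Lop_def[abs_def]
proof (intro symb_mult_left symb_sum)
  fix b :: "real^'n" assume b: "b \<in> Basis"
  then have "(0, 0, b) \<in> (Basis :: ((real^'n) \<times> (real^'n) \<times> (real^'n)) set)" by (simp add: Basis_prod_def)
  from symb_dir_deriv[OF symb_VB[OF assms b] this]
  show "symb Basis (\<lambda>_ _. 1) (\<lambda>z. inverse (rho z) * W z) (dir_deriv (0, 0, b) (VB b B))" by simp
qed

lemma symb_Lk: "symb Basis (\<lambda>_ _. 1) (\<lambda>z. inverse (rho z) ^ k * wt3 z) (Lk k)"
proof (induction k)
  case 0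
  then show ?case using symb_am_far by (simp add: Lk_def)
next
  case (Suc k)
  from symb_Lop[OF Suc] show ?case by (simp add: Lk_Suc mult.assoc)
qed

text \<open>\<open>psi\<close> does not depend on \<eta> and \<open>Lop\<close> differentiates in
  \<eta> only, so vanishing for given x and y persists through all iterations.\<close>

lemma psi_Lk: "psi (x, y, \<eta>) \<noteq> 0 \<Longrightarrow> Lk k (x, y, \<eta>) = 0"
proof (induction k arbitrary: \<eta>)
  case 0
  then show ?case by (simp add: Lk_def psi_am_far)
next
  case (Suc k)
  have "Lk k (x, y, \<eta>') = 0" for \<eta>'
    using Suc by (intro Suc.IH) (simp add: psi_def ratio_def)
  then have "dir_deriv (0, 0, b) (VB b (Lk k)) (x, y, \<eta>) = 0" for b
    by (simp add: dir_deriv_def VB_def)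
  then show ?case by (simp add: Lk_Suc Lop_def)
qed

text \<open>Where \<open>psi\<close> = 0 the field satisfies F . V = 1; elsewhere both sides vanish.
  This is the identity that starts each further integration by parts.\<close>

lemma Lk_VF: "Lk k z = (\<Sum>b\<in>Basis. complex_of_real (Fb b z) * VB b (Lk k) z)"
proof (cases "psi z = 0")
  case True
  have "(\<Sum>b\<in>Basis. complex_of_real (Fb b z) * VB b (Lk k) z) = complex_of_real (\<Sum>b\<in>Basis. Fb b z * Vb b z) * Lk k z"
    by (simp add: VB_def sum_distrib_right mult.assoc)
  then show ?thesis by (simp only: Vb_Fb[OF True]) simp
next
  case False
  then have "Lk k z = 0" using psi_Lk[of "fst z" "fst (snd z)" "snd (snd z)" k] by simp
  then show ?thesis by (simp add: VB_def)
qed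

end

lemma bracket_ray_le: "0 \<le> t \<Longrightarrow> t \<le> 1 \<Longrightarrow> bracket (t *\<^sub>R v) \<le> bracket v"
  using bracket_scale_le[of t 1 v] by simp

lemma symb_vanish:
  fixes f :: "'p::euclidean_space \<times> 'v::euclidean_space \<Rightarrow> 'b::euclidean_space"
  assumes f: "C_infinity f" "\<And>p. f (p, 0) = 0"
    and e: "\<And>b. b \<in> Basis \<Longrightarrow> symb Basis \<omega> W (dir_deriv (0, b) f)"
    and W: "\<And>p v t. 0 \<le> t \<Longrightarrow> t \<le> 1 \<Longrightarrow> W (p, t *\<^sub>R v) \<le> W (p, v)"
    and V: "\<And>p v. norm v * W (p, v) \<le> V (p, v)"
      "\<And>b z. b \<in> Basis \<Longrightarrow> W z \<le> V z * \<omega> (0, b) z"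
    and nn: "\<And>z. W z \<ge> 0" "\<And>z. V z \<ge> 0"
    and \<omega>: "\<And>d p v t. d \<in> Basis \<Longrightarrow> 0 \<le> t \<Longrightarrow> t \<le> 1 \<Longrightarrow> \<omega> d (p, t *\<^sub>R v) \<le> \<omega> d (p, v)"
      "\<And>b z. b \<in> Basis \<Longrightarrow> \<omega> b z \<ge> 0"
  shows "symb Basis \<omega> V f"
  unfolding symb_def
proof (intro conjI allI f(1))
  fix k
  have e': "est k Basis \<omega> W (dir_deriv (0, b) f)" if "b \<in> Basis" for b
    using e[OF that] by (simp add: symb_def)
  show "est k Basis \<omega> V f" by (rule est_vanish[OF f e' W V nn \<omega>])
qed

lemma dir_deriv_affine_map:
  assumes "\<And>z t. g (z + t *\<^sub>R d) = g z + t *\<^sub>R L"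
  shows "dir_deriv d (\<lambda>z. f (g z)) = (\<lambda>z. dir_deriv L f (g z))"
  by (rule ext) (simp add: dir_deriv_def assms)

lemma symb_const_le:
  assumes "\<And>z. 1 \<le> V z" "\<And>b z. b \<in> D \<Longrightarrow> \<sigma> b z \<ge> 0"
  shows "symb D \<sigma> V (\<lambda>z. c)"
  by (rule symb_weight_mono[OF symb_const, where C = 1]) (use assms order_trans[OF zero_le_one] in auto)

lemma powr_le_max:
  fixes r :: real
  assumes "0 < l" "l \<le> r" "r \<le> h" shows "r powr m \<le> max (l powr m) (h powr m)"
proof (cases "m \<ge> 0")
  case True
  then have "r powr m \<le> h powr m" using assms by (intro powr_mono2) auto
  then show ?thesis by simp
next
  case False
  then have "r powr m \<le> l powr m" using assms by (intro powr_mono2') auto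
  then show ?thesis by simp
qed

type_synonym 'm pv = "((real^'m) \<times> (real^'m)) \<times> (real^'m)"

section \<open>The rescaled integral near the critical point\<close>

context fio_data
begin

definition lam :: "(real^'n) \<times> (real^'n) \<Rightarrow> real"
  where "lam p = bracket (fst p)"

definition slam :: "(real^'n) \<times> (real^'n) \<Rightarrow> real"
  where "slam p = lam p powr (- (1/2))"

lemma lam_ge_1: "lam p \<ge> 1" and lam_pos: "lam p > 0"
  by (auto simp: lam_def bracket_ge_1 bracket_pos)

lemma slam_pos: "slam p > 0" and slam_le_1: "slam p \<le> 1" and slam_sq: "slam p * slam p = inverse (lam p)"
proof -
  show "slam p > 0" using lam_pos[of p] by (simp add: slam_def)
  show "slam p \<le> 1" using powr_mono[of "- (1/2)" 0 "lam p"] lam_ge_1[of p] by (simp add: slam_def)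
  have "slam p * slam p = lam p powr (- (1/2) + - (1/2))" by (simp only: slam_def powr_add)
  also have "\<dots> = inverse (lam p powr 1)" by (simp add: powr_minus)
  finally show "slam p * slam p = inverse (lam p)" using lam_pos[of p] by simp
qed

text \<open>The phase of the rescaled integral has size \<open>|\<kappa>|\<^sup>2 / \<langle>x\<rangle>\<close>, so a \<open>\<kappa>\<close>-derivative gains only \<open>\<langle>x\<rangle>\<close> to the
  power \<open>- 1/2\<close>.\<close>

definition csq :: "real \<Rightarrow> 'n pv \<Rightarrow> 'n pv \<Rightarrow> real"
  where "csq A d z = (if snd d = 0 then 1 else slam (fst z)) * bracket (snd z) powr A"

lemma csq_nonneg: "csq A d z \<ge> 0"
  using slam_pos[of "fst z"] by (simp add: csq_def)

lemma csq_mono: "A \<le> B \<Longrightarrow> csq A d z \<le> csq B d z"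
  using slam_pos[of "fst z"] bracket_ge_1[of "snd z"]
  by (auto simp: csq_def powr_mono intro!: mult_left_mono)

lemma csq_ray: "A \<ge> 0 \<Longrightarrow> 0 \<le> t \<Longrightarrow> t \<le> 1 \<Longrightarrow> csq A d (p, t *\<^sub>R v) \<le> csq A d (p, v)"
  using slam_pos[of p] bracket_ray_le[of t v] by (auto simp: csq_def intro!: mult_left_mono powr_mono2)

lemma symb_csq_mono:
  assumes "symb Basis (csq A) W f" "A \<le> B" "\<And>z. W z \<le> V z" "\<And>z. W z \<ge> 0"
  shows "symb Basis (csq B) V f"
proof (rule symb_mono[OF assms(1) subset_refl])
  show "\<exists>C. \<forall>z. W z \<le> C * V z" using assms(3) by (intro exI[of _ 1]) simp
  show "\<exists>C. \<forall>z. W z \<noteq> 0 \<longrightarrow> csq A b z \<le> C * csq B b z" for b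
    using csq_mono[OF assms(2)] by (intro exI[of _ 1]) simp
qed (use assms(4) order_trans[OF assms(4) assms(3)] in \<open>simp_all add: csq_nonneg\<close>)

definition hc :: "real^'n \<Rightarrow> 'n pv \<Rightarrow> real"
  where "hc b z = inverse (lam (fst z)) * (snd z \<bullet> b)"

lemma symb_inverse_lam: "symb Basis (csq 0) (\<lambda>z. inverse (lam (fst z))) (\<lambda>z. inverse (lam (fst z)))"
proof -
  have "symb Basis (\<lambda>_ x. inverse (bracket x)) (\<lambda>x::real^'n. inverse (bracket x)) (\<lambda>x. inverse (bracket x))"
    by (rule symb_inverse[OF symb_bracket, of 1]) (auto simp: bracket_pos)
  then show ?thesis
    unfolding lam_def
    by (rule symb_affine[where L = "\<lambda>d. fst (fst d)"])
       (auto intro!: smooth_intros elim!: Basis_pairE simp: csq_def inverse_bracket_le_1 less_imp_le[OF slam_pos])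
qed

text \<open>The factor \<kappa> . b receives the weight <\<kappa>> / \<open>slam\<close>: its
  \<kappa>-derivative is a constant and has to be bounded by the weight times the cost
  \<open>slam\<close>. The prefactor 1 / <x> = \<open>slam\<close>^2 then leaves \<open>slam\<close>
  <\<kappa>>.\<close>

lemma symb_hc:
  assumes b: "b \<in> Basis" shows "symb Basis (csq 0) (\<lambda>z. slam (fst z) * bracket (snd z)) (hc b)"
proof -
  have "symb Basis (csq 0) (\<lambda>z. inverse (slam (fst z)) * bracket (snd z)) (\<lambda>z. snd z \<bullet> b)"
  proof (rule symb_SucI[where C = 1])
    show "C_infinity (\<lambda>z::'n pv. snd z \<bullet> b)" by (intro smooth_intros)
    show "norm (snd z \<bullet> b) \<le> 1 * (inverse (slam (fst z)) * bracket (snd z))" for z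
    proof -
      have "norm (snd z \<bullet> b) \<le> 1 * bracket (snd z)" using abs_inner_le_bracket[OF b] by simp
      also have "\<dots> \<le> inverse (slam (fst z)) * bracket (snd z)"
        using slam_pos[of "fst z"] slam_le_1[of "fst z"] by (intro mult_right_mono) (auto simp: one_le_inverse)
      finally show ?thesis by simp
    qed
    fix d :: "'n pv" assume d: "d \<in> Basis"
    have D: "dir_deriv d (\<lambda>z. snd z \<bullet> b) = (\<lambda>z. snd d \<bullet> b)"
      by (intro ext dir_deriv_eqI[of _ "\<lambda>h. snd h \<bullet> b"]) (auto intro!: derivative_eq_intros)
    show "symb Basis (csq 0) (\<lambda>z. inverse (slam (fst z)) * bracket (snd z) * csq 0 d z) (dir_deriv d (\<lambda>z. snd z \<bullet> b))"
    proof (cases "snd d = 0")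
      case True then show ?thesis by (simp add: D symb_zero)
    next
      case False
      have "inverse (slam (fst z)) * bracket (snd z) * csq 0 d z = bracket (snd z)" for z
        using False slam_pos[of "fst z"] bracket_pos[of "snd z"] by (simp add: csq_def field_simps)
      then show ?thesis unfolding D by (simp only:) (intro symb_const_le; simp add: csq_nonneg bracket_ge_1)
    qed
  qed
  from symb_mult[OF symb_inverse_lam this]
  have "symb Basis (csq 0) (\<lambda>z. inverse (lam (fst z)) * (inverse (slam (fst z)) * bracket (snd z))) (hc b)"
    unfolding hc_def[abs_def] .
  moreover have "inverse (lam p) * (inverse (slam p) * k) = slam p * k" for p k
    using slam_pos[of p] by (simp add: slam_sq[symmetric])
  ultimately show ?thesis by (simp only:)
qed

definition g2 :: "'n pv \<Rightarrow> (real^'n) \<times> (real^'n)"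
  where "g2 z = (fst (fst z), snd (fst z) + inverse (lam (fst z)) *\<^sub>R snd z)"

lemma g2_inner: "g2 z \<bullet> (b, c) = fst (fst z) \<bullet> b + (snd (fst z) \<bullet> c + hc c z)"
  by (simp add: g2_def hc_def inner_add_left)

lemma smooth_g2: "C_infinity g2"
  unfolding g2_def[abs_def]
  by (intro smooth_intros symb_smooth[OF symb_inverse_lam])

lemma dir_deriv_fst_fst_inner: "dir_deriv d (\<lambda>z::'n pv. fst (fst z) \<bullet> b) = (\<lambda>z. fst (fst d) \<bullet> b)"
  by (intro ext dir_deriv_eqI[of _ "\<lambda>h. fst (fst h) \<bullet> b"]) (auto intro!: derivative_eq_intros)

lemma dir_deriv_snd_fst_inner: "dir_deriv d (\<lambda>z::'n pv. snd (fst z) \<bullet> b) = (\<lambda>z. snd (fst d) \<bullet> b)"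
  by (intro ext dir_deriv_eqI[of _ "\<lambda>h. snd (fst h) \<bullet> b"]) (auto intro!: derivative_eq_intros)

text \<open>The derivatives of the components of \<open>g2\<close> are no larger than the cost of
  the direction, so composition with \<open>g2\<close> preserves symbols whose derivatives cost
  1.\<close>

lemma symb_g2:
  assumes d: "d \<in> Basis" and c: "c \<in> Basis"
  shows "symb Basis (csq 1) (csq 1 d) (dir_deriv d (\<lambda>z. g2 z \<bullet> c))"
proof -
  have const: "symb Basis (csq 1) (csq 1 d) (\<lambda>z. fst d \<bullet> b)" for b
  proof (cases "snd d = 0")
    case True
    then show ?thesis
      by (intro symb_const_le) (auto simp: csq_def bracket_ge_1 less_imp_le[OF slam_pos])
  next
    case False
    then have "fst d = 0" using d by (auto elim!: Basis_pairE)
    then show ?thesis by (simp add: symb_zero)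
  qed
  show ?thesis
    using c
  proof (cases rule: Basis_pairE)
    case (1 b)
    then have "(\<lambda>z. g2 z \<bullet> c) = (\<lambda>z. fst (fst z) \<bullet> b)" by (simp add: g2_def)
    then show ?thesis using const[of "(b, 0)"] by (simp add: dir_deriv_fst_fst_inner inner_prod_def)
  next
    case (2 b)
    then have eq: "(\<lambda>z. g2 z \<bullet> c) = (\<lambda>z. snd (fst z) \<bullet> b + hc b z)" using g2_inner[of _ 0 b] by auto
    have "dir_deriv d (\<lambda>z. g2 z \<bullet> c) = (\<lambda>z. snd (fst d) \<bullet> b + dir_deriv d (hc b) z)"
      unfolding eq
      by (rule ext, subst dir_deriv_add)
         (auto simp: dir_deriv_snd_fst_inner intro!: smooth_differentiable smooth_intros symb_smooth[OF symb_hc[OF 2(2)]])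
    moreover have "symb Basis (csq 1) (csq 1 d) (dir_deriv d (hc b))"
    proof (rule symb_csq_mono[OF symb_dir_deriv[OF symb_hc[OF 2(2)] d]])
      show "slam (fst z) * bracket (snd z) * csq 0 d z \<le> csq 1 d z" for z
        using slam_pos[of "fst z"] slam_le_1[of "fst z"] bracket_pos[of "snd z"]
        by (auto simp: csq_def mult_le_cancel_right2 mult_ac)
      show "0 \<le> slam (fst z) * bracket (snd z) * csq 0 d z" for z
        using slam_pos[of "fst z"] csq_nonneg by simp
    qed simp
    ultimately show ?thesis using const[of "(0, b)"] symb_add[of Basis "csq 1" "csq 1 d" "\<lambda>z. fst d \<bullet> (0, b)" "dir_deriv d (hc b)"]
      by (simp add: inner_prod_def)
  qed
qed

lemma symb_compose_g2:
  fixes f :: "(real^'n) \<times> (real^'n) \<Rightarrow> real"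
  assumes "symb Basis (\<lambda>_ _. 1) (\<lambda>z. bracket (fst z)) f"
  shows "symb Basis (csq 1) (\<lambda>z. lam (fst z)) (\<lambda>z. f (g2 z))"
proof -
  have "symb Basis (csq 1) (\<lambda>z. bracket (fst (g2 z))) (\<lambda>z. f (g2 z))"
    by (rule symb_compose[OF assms smooth_g2, where \<tau> = "\<lambda>_ _. 1"])
       (auto simp: csq_nonneg symb_g2)
  then show ?thesis by (simp add: g2_def lam_def)
qed

lemma g2_kappa: "g2 (z + t *\<^sub>R (0, c)) = g2 z + t *\<^sub>R (0, inverse (lam (fst z)) *\<^sub>R c)"
  by (simp add: g2_def scaleR_add_right mult.commute)

lemma dir_deriv_g2:
  fixes f :: "(real^'n) \<times> (real^'n) \<Rightarrow> real"
  assumes "C_infinity f"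
  shows "dir_deriv (0, c) (\<lambda>z. f (g2 z)) z = inverse (lam (fst z)) * dir_deriv (0, c) f (g2 z)"
proof -
  have "dir_deriv (0, c) (\<lambda>z. f (g2 z)) z = dir_deriv (0, inverse (lam (fst z)) *\<^sub>R c) f (g2 z)"
    by (simp only: dir_deriv_def g2_kappa)
  also have "(0, inverse (lam (fst z)) *\<^sub>R c) = inverse (lam (fst z)) *\<^sub>R (0::real^'n, c)" by simp
  finally show ?thesis
    by (simp only: linear_cmul[OF bounded_linear.linear[OF linear_dir_deriv[OF smooth_differentiable[OF assms]]]] real_scaleR_def)
qed

text \<open>This is \<Psi> at \<eta> = \<xi> + \<kappa> / <x>. The linear term stems from the shift
  of y by \<nabla>\<phi>(x, \<xi>) and makes the phase vanish to second order at \<kappa> =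
  0.\<close>

definition phase_near :: "'n pv \<Rightarrow> real"
  where "phase_near z = ph (g2 z) - ph (fst z) - inverse (lam (fst z)) * (snd z \<bullet> grad (fst z))"

lemma smooth_ph_g2: "C_infinity (\<lambda>z. ph (g2 z))" 
  by (rule smooth_compose[OF smooth_ph smooth_g2])

lemma smooth_phase_near: "C_infinity phase_near"
  unfolding phase_near_def[abs_def]
  by (intro smooth_intros smooth_ph_g2 smooth_compose[OF smooth_ph] smooth_compose[OF smooth_grad] symb_smooth[OF symb_inverse_lam])

definition theta :: "real^'n \<Rightarrow> 'n pv \<Rightarrow> real"
  where "theta b z = phd b (g2 z) - phd b (fst z)"

lemma smooth_theta: "C_infinity (theta b)"
  unfolding theta_def[abs_def]
  by (intro smooth_diff smooth_compose[OF smooth_phd] smooth_g2 smooth_intros)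

lemma dir_deriv_theta: "dir_deriv (0, c) (theta b) z = inverse (lam (fst z)) * dir_deriv (0, c) (phd b) (g2 z)"
proof -
  have "dir_deriv (0, c) (theta b) z = dir_deriv (0, c) (\<lambda>z. phd b (g2 z) + - phd b (fst z)) z"
    by (simp add: theta_def[abs_def])
  also have "\<dots> = dir_deriv (0, c) (\<lambda>z. phd b (g2 z)) z + dir_deriv (0, c) (\<lambda>z. - phd b (fst z)) z"
    by (intro dir_deriv_add smooth_differentiable smooth_uminus smooth_compose[OF smooth_phd] smooth_g2 smooth_intros)
  also have "dir_deriv (0, c) (\<lambda>z::'n pv. - phd b (fst z)) z = 0"
    by (simp add: dir_deriv_def)
  finally show ?thesis by (simp add: dir_deriv_g2[OF smooth_phd])
qed

lemma dir_deriv_phase_near: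
  assumes "b \<in> Basis"
  shows "dir_deriv (0, b) phase_near z = inverse (lam (fst z)) * theta b z"
proof -
  have "dir_deriv (0, b) phase_near z = dir_deriv (0, b) (\<lambda>z. ph (g2 z) + - (ph (fst z) + inverse (lam (fst z)) * (snd z \<bullet> grad (fst z)))) z"
    by (simp only: phase_near_def[abs_def] diff_diff_eq) (simp only: diff_conv_add_uminus)
  also have "\<dots> = dir_deriv (0, b) (\<lambda>z. ph (g2 z)) z +
      dir_deriv (0, b) (\<lambda>z. - (ph (fst z) + inverse (lam (fst z)) * (snd z \<bullet> grad (fst z)))) z"
    by (intro dir_deriv_add smooth_differentiable smooth_ph_g2 smooth_intros smooth_compose[OF smooth_ph]
        smooth_compose[OF smooth_grad] symb_smooth[OF symb_inverse_lam])
  also have "dir_deriv (0, b) (\<lambda>z. - (ph (fst z) + inverse (lam (fst z)) * (snd z \<bullet> grad (fst z)))) z =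
      - (inverse (lam (fst z)) * (b \<bullet> grad (fst z)))"
    unfolding dir_deriv_def
    by (rule vector_derivative_at)
       (auto simp: inner_add_left has_real_derivative_iff_has_vector_derivative[symmetric] intro!: derivative_eq_intros)
  also have "b \<bullet> grad (fst z) = phd b (fst z)" using grad_inner[OF assms] by (simp add: inner_commute)
  finally show ?thesis
    by (simp add: dir_deriv_g2[OF smooth_ph] theta_def phd_def right_diff_distrib)
qed

lemma g2_0: "g2 (p, 0) = p" by (simp add: g2_def)

lemma csq_kappa: "b \<noteq> 0 \<Longrightarrow> csq A (0, b) z = slam (fst z) * bracket (snd z) powr A"
  by (simp add: csq_def)

text \<open>\<open>theta\<close> vanishes at \<kappa> = 0, and its \<kappa>-derivative is 1 / <x>
  times a second \<xi>-derivative of the phase of size <x>, hence of order 1. The factor 1 /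
  \<open>slam\<close> in the weight keeps it so: a \<kappa>-derivative multiplies the weight by
  \<open>slam\<close>.\<close>

lemma symb_theta:
  assumes b: "b \<in> Basis"
  shows "symb Basis (csq 1) (\<lambda>z. inverse (slam (fst z)) * bracket (snd z)) (theta b)"
proof (rule symb_vanish[OF smooth_theta, where W = "\<lambda>_. 1"])
  show "theta b (p, 0) = 0" for p by (simp add: theta_def g2_0)
  fix c :: "real^'n" assume c: "c \<in> Basis"
  have "symb Basis (\<lambda>_ _. 1) (\<lambda>z. bracket (fst z) * 1) (dir_deriv (0, c) (phd b))"
    by (rule symb_dir_deriv[OF symb_phd[OF b]]) (use c in \<open>simp add: Basis_prod_def\<close>)
  then have 1: "symb Basis (csq 1) (\<lambda>z. lam (fst z)) (\<lambda>z. dir_deriv (0, c) (phd b) (g2 z))"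
    by (intro symb_compose_g2) simp
  have 2: "symb Basis (csq 1) (\<lambda>z. inverse (lam (fst z))) (\<lambda>z. inverse (lam (fst z)))"
    by (rule symb_csq_mono[OF symb_inverse_lam]) (auto simp: less_imp_le[OF lam_pos])
  have "symb Basis (csq 1) (\<lambda>z. inverse (lam (fst z)) * lam (fst z)) (dir_deriv (0, c) (theta b))"
    using symb_mult[OF 2 1] unfolding dir_deriv_theta[abs_def, symmetric] by (simp only: dir_deriv_theta[abs_def])
  moreover have "inverse (lam p) * lam p = 1" for p using lam_pos[of p] by simp
  ultimately show "symb Basis (csq 1) (\<lambda>_. 1) (dir_deriv (0, c) (theta b))" by simp
  show "1 \<le> inverse (slam (fst z)) * bracket (snd z) * csq 1 (0, c) z" for z
  proof -
    have "inverse (slam (fst z)) * bracket (snd z) * csq 1 (0, c) z = bracket (snd z) * bracket (snd z)"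
      using c slam_pos[of "fst z"] by (simp add: csq_kappa nonzero_Basis)
    then show ?thesis using mult_mono[OF bracket_ge_1[of "snd z"] bracket_ge_1[of "snd z"]] by (simp only:) simp
  qed
next
  show "norm v * 1 \<le> inverse (slam (fst (p, v))) * bracket (snd (p, v))" for p v
  proof -
    have "norm v \<le> 1 * bracket v" using norm_le_bracket by simp
    also have "\<dots> \<le> inverse (slam p) * bracket v"
      using slam_pos[of p] slam_le_1[of p] by (intro mult_right_mono) (auto simp: one_le_inverse)
    finally show ?thesis by simp
  qed
qed (use slam_pos in \<open>auto simp: csq_ray csq_nonneg less_imp_le\<close>)

text \<open>The second use of \<open>symb_vanish\<close>: the \<kappa>-derivative is
  \<open>theta\<close> / <x>, of size \<open>slam\<close> <\<kappa>>, and integration from \<kappa>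
  = 0 gives <\<kappa>>^2 because \<open>slam\<close> \<le> 1. The two uses together exploit the
  vanishing of second order.\<close>

lemma symb_phase_near: "symb Basis (csq 1) (\<lambda>z. bracket (snd z) powr 2) phase_near"
proof (rule symb_vanish[OF smooth_phase_near, where W = "\<lambda>z. slam (fst z) * bracket (snd z)"])
  show "phase_near (p, 0) = 0" for p by (simp add: phase_near_def g2_0)
  fix b :: "real^'n" assume b: "b \<in> Basis"
  have 2: "symb Basis (csq 1) (\<lambda>z. inverse (lam (fst z))) (\<lambda>z. inverse (lam (fst z)))"
    by (rule symb_csq_mono[OF symb_inverse_lam]) (auto simp: less_imp_le[OF lam_pos])
  have eq: "dir_deriv (0, b) phase_near = (\<lambda>z. inverse (lam (fst z)) * theta b z)"
    by (rule ext) (rule dir_deriv_phase_near[OF b])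
  from symb_mult[OF 2 symb_theta[OF b]]
  have "symb Basis (csq 1) (\<lambda>z. inverse (lam (fst z)) * (inverse (slam (fst z)) * bracket (snd z))) (dir_deriv (0, b) phase_near)"
    unfolding eq .
  moreover have "inverse (lam p) * (inverse (slam p) * k) = slam p * k" for p k
    using slam_pos[of p] by (simp add: slam_sq[symmetric])
  ultimately show "symb Basis (csq 1) (\<lambda>z. slam (fst z) * bracket (snd z)) (dir_deriv (0, b) phase_near)"
    by (simp only:)
  show "slam (fst z) * bracket (snd z) \<le> bracket (snd z) powr 2 * csq 1 (0, b) z" for z
  proof -
    have "slam (fst z) * bracket (snd z) * 1 \<le> slam (fst z) * bracket (snd z) * (bracket (snd z))\<^sup>2"
      using slam_pos[of "fst z"] bracket_ge_1[of "snd z"] by (intro mult_left_mono) (auto simp: one_le_power)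
    then show ?thesis using b by (simp add: csq_kappa nonzero_Basis mult_ac)
  qed
next
  show "norm v * (slam (fst (p, v)) * bracket (snd (p, v))) \<le> bracket (snd (p, v)) powr 2" for p v
  proof -
    have "norm v * (slam p * bracket v) \<le> bracket v * (1 * bracket v)"
      using norm_le_bracket slam_le_1[of p] slam_pos[of p] by (intro mult_mono) auto
    then show ?thesis by (simp add: power2_eq_square)
  qed
  show "slam (fst (p, t *\<^sub>R v)) * bracket (snd (p, t *\<^sub>R v)) \<le> slam (fst (p, v)) * bracket (snd (p, v))"
    if "0 \<le> t" "t \<le> 1" for p v t
    using that slam_pos[of p] bracket_ray_le by (auto intro: mult_left_mono)
qed (use slam_pos in \<open>auto simp: csq_ray csq_nonneg less_imp_le\<close>)

text \<open>Origin of the exponent 3: a derivative of the phase has size <\<kappa>>^2 times the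
  factor <\<kappa>> in \<open>csq 1\<close>.\<close>

lemma symb_exp_phase_near: "symb Basis (csq 3) (\<lambda>_. 1) (\<lambda>z. exp (\<i> * complex_of_real (phase_near z)))"
proof (rule symb_cis[OF smooth_phase_near])
  fix d :: "'n pv" assume d: "d \<in> Basis"
  show "symb Basis (csq 3) (csq 3 d) (dir_deriv d phase_near)"
  proof (rule symb_csq_mono[OF symb_dir_deriv[OF symb_phase_near d]])
    show "bracket (snd z) powr 2 * csq 1 d z \<le> csq 3 d z" for z
      using powr_add[of "bracket (snd z)" 2 1] by (simp add: csq_def mult_ac)
  qed (auto simp: csq_nonneg)
qed

definition cE :: "'n pv \<times> (real^'n) \<Rightarrow> 'n pv \<times> (real^'n) \<Rightarrow> real"
  where "cE d z = (if snd d = 0 then csq 3 (fst d) (fst z) else 1)"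

lemma cE_nonneg: "cE d z \<ge> 0" by (simp add: cE_def csq_nonneg)

text \<open>The substitution \<open>y = \<nabla>\<^sub>\<xi>\<phi>(x, \<xi>) + \<langle>x\<rangle> w\<close>, \<open>\<eta> = \<xi> + \<kappa> / \<langle>x\<rangle>\<close> at the point \<open>(((x, \<xi>), \<kappa>), w)\<close>; its
  Jacobian is \<open>1\<close>.\<close>

definition sub_near :: "'n pv \<times> (real^'n) \<Rightarrow> (real^'n) \<times> (real^'n) \<times> (real^'n)"
  where "sub_near z = (fst (fst (fst z)), grad (fst (fst z)) + lam (fst (fst z)) *\<^sub>R snd z, snd (g2 (fst z)))"

definition H_near :: "'n pv \<times> (real^'n) \<Rightarrow> complex"
  where "H_near z = exp (\<i> * complex_of_real (phase_near (fst z))) * am_near (sub_near z)"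

definition W_near :: "(real^'n) \<times> (real^'n) \<Rightarrow> real"
  where "W_near p = bracket (fst p) powr (m1 + m2) * bracket (snd p) powr m3"

lemma W_near_nonneg: "W_near p \<ge> 0" by (simp add: W_near_def)

lemma symb_pull_fst:
  fixes f :: "'n pv \<Rightarrow> 'c::real_normed_vector"
  assumes "symb Basis (csq A) W f" "A \<le> 3" "\<And>z. W z \<ge> 0"
  shows "symb Basis cE (\<lambda>z. W (fst z)) (\<lambda>z. f (fst z))"
  by (rule symb_affine[OF assms(1), where L = fst])
     (use assms(2,3) in \<open>auto intro!: smooth_intros elim!: Basis_pairE[where 'a="'n pv"] simp: cE_def csq_nonneg csq_mono\<close>)

lemma symb_pull_p:
  fixes f :: "(real^'n) \<times> (real^'n) \<Rightarrow> real"
  assumes "symb Basis (\<lambda>_ _. 1) W f" "\<And>z. W z \<ge> 0"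
  shows "symb Basis cE (\<lambda>z. W (fst (fst z))) (\<lambda>z. f (fst (fst z)))"
proof (rule symb_affine[OF assms(1), where L = "\<lambda>d. fst (fst d)"])
  show "fst (fst b) = 0 \<or> fst (fst b) \<in> Basis \<and> (\<forall>z. 1 \<le> cE b z)" if "b \<in> Basis" for b :: "'n pv \<times> (real^'n)"
  proof -
    have "1 \<le> cE ((d, 0), 0) z" for d z
      using powr_mono[of 0 3 "bracket (snd (fst z))"] bracket_ge_1[of "snd (fst z)"] by (simp add: cE_def csq_def)
    then show ?thesis using that by (auto simp: Basis_prod_def zero_prod_def)
  qed
qed (use assms(2) in \<open>auto intro!: smooth_intros simp: cE_nonneg\<close>)

lemma symb_y_comp:
  assumes c: "c \<in> Basis"
  shows "symb Basis cE (\<lambda>z. lam (fst (fst z)) * bracket (snd z)) (\<lambda>z. (grad (fst (fst z)) + lam (fst (fst z)) *\<^sub>R snd z) \<bullet> c)"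
proof -
  have 1: "symb Basis cE (\<lambda>z. lam (fst (fst z))) (\<lambda>z. phd c (fst (fst z)))"
    using symb_pull_p[OF symb_phd[OF c]] by (simp add: lam_def)
  have 2: "symb Basis cE (\<lambda>z. lam (fst (fst z)) * bracket (snd z)) (\<lambda>z. phd c (fst (fst z)))"
  proof (rule symb_weight_mono[OF 1])
    show "lam (fst (fst z)) \<le> 1 * (lam (fst (fst z)) * bracket (snd z))" for z :: "'n pv \<times> (real^'n)"
      using mult_left_mono[OF bracket_ge_1[of "snd z"] less_imp_le[OF lam_pos[of "fst (fst z)"]]] by simp
  qed (use less_imp_le[OF lam_pos] in \<open>simp_all add: cE_nonneg\<close>)
  have "symb Basis (\<lambda>_ _. 1) (\<lambda>z::(real^'n) \<times> (real^'n). bracket (fst z)) (\<lambda>z. bracket (fst z))"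
    by (rule symb_affine[OF symb_bracket, where L = fst])
       (auto intro!: smooth_intros elim!: Basis_pairE simp: inverse_bracket_le_1)
  then have 3: "symb Basis cE (\<lambda>z. lam (fst (fst z))) (\<lambda>z. lam (fst (fst z)))"
    using symb_pull_p[of "\<lambda>z. bracket (fst z)" "\<lambda>z. bracket (fst z)"] by (simp add: lam_def)
  have 4: "symb Basis cE (\<lambda>z. bracket (snd z)) (\<lambda>z. snd z \<bullet> c)"
    by (rule symb_affine[OF symb_inner_left[OF c], where L = snd])
       (auto intro!: smooth_intros elim!: Basis_pairE[where 'a="'n pv"] simp: cE_def cE_nonneg inverse_bracket_le_1 nonzero_Basis csq_nonneg)
  have "(grad (fst (fst z)) + lam (fst (fst z)) *\<^sub>R snd z) \<bullet> c = phd c (fst (fst z)) + lam (fst (fst z)) * (snd z \<bullet> c)" for z :: "'n pv \<times> (real^'n)"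
    by (simp add: inner_add_left grad_inner[OF c])
  then show ?thesis using symb_add[OF 2 symb_mult[OF 3 4]] by simp
qed

text \<open>Relative size of the derivatives of the components of \<open>sub_near\<close>. The
  y-component grows like <x> <w>; on the support of the cutoff this is absorbed by the cost 1 / <y>
  of a y-derivative of the amplitude.\<close>

definition tau1 :: "(real^'n) \<times> (real^'n) \<times> (real^'n) \<Rightarrow> 'n pv \<times> (real^'n) \<Rightarrow> real"
  where "tau1 c z = (if fst (snd c) = 0 then 1 else lam (fst (fst z)) * bracket (snd z))"

lemma smooth_lam: "C_infinity lam"
  unfolding lam_def[abs_def] by (intro smooth_compose[OF smooth_bracket] smooth_intros)

lemma smooth_sub_near: "C_infinity sub_near"
  unfolding sub_near_def[abs_def]
  by (intro smooth_intros smooth_compose[OF smooth_grad] smooth_compose[OF smooth_lam] smooth_compose[OF smooth_g2])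

lemma symb_sub_near:
  assumes d: "d \<in> Basis" and c: "c \<in> Basis"
  shows "symb Basis cE (\<lambda>z. cE d z * tau1 c z) (dir_deriv d (\<lambda>z. sub_near z \<bullet> c))"
  using c
proof (cases rule: Basis_pairE)
  case (1 b)
  have A: "(\<lambda>z. sub_near z \<bullet> c) = (\<lambda>z. g2 (fst z) \<bullet> (b, 0))" by (simp add: 1 sub_near_def g2_def)
  have T: "tau1 c = (\<lambda>_. 1)" by (simp add: 1 tau1_def fun_eq_iff)
  have b: "(b, 0) \<in> (Basis :: ((real^'n) \<times> (real^'n)) set)" using 1 by (simp add: Basis_prod_def)
  show ?thesis
  proof (cases "snd d = 0")
    case True
    then have fd: "fst d \<in> Basis" using d by (auto simp: Basis_prod_def nonzero_Basis)
    have "dir_deriv d (\<lambda>z. g2 (fst z) \<bullet> (b, 0)) = (\<lambda>z. dir_deriv (fst d) (\<lambda>z. g2 z \<bullet> (b, 0)) (fst z))"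
      by (rule dir_deriv_affine_map) simp
    moreover have "symb Basis cE (\<lambda>z. csq 3 (fst d) (fst z)) (\<lambda>z. dir_deriv (fst d) (\<lambda>z. g2 z \<bullet> (b, 0)) (fst z))"
      by (rule symb_pull_fst[OF symb_csq_mono[OF symb_g2[OF fd b], of 3]]) (auto simp: csq_mono csq_nonneg)
    ultimately show ?thesis using True by (simp add: A T cE_def)
  next
    case False
    then have "fst d = 0" using d by (auto simp: Basis_prod_def)
    then have "dir_deriv d (\<lambda>z. g2 (fst z) \<bullet> (b, 0)) = (\<lambda>z. 0)" by (simp add: dir_deriv_def fun_eq_iff)
    then show ?thesis by (simp add: A symb_zero)
  qed
next
  case (2 c')
  from 2(2) show ?thesis
  proof (cases rule: Basis_pairE)
    case (1 b)
    then have A: "(\<lambda>z. sub_near z \<bullet> c) = (\<lambda>z. (grad (fst (fst z)) + lam (fst (fst z)) *\<^sub>R snd z) \<bullet> b)"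
      by (simp add: 2 sub_near_def)
    have T: "tau1 c = (\<lambda>z. lam (fst (fst z)) * bracket (snd z))"
      using 1 by (simp add: 2 tau1_def fun_eq_iff nonzero_Basis)
    show ?thesis
      using symb_dir_deriv[OF symb_y_comp[OF 1(2)] d] by (simp add: A T mult.commute)
  next
    case (2 b)
    then have A: "(\<lambda>z. sub_near z \<bullet> c) = (\<lambda>z. g2 (fst z) \<bullet> (0, b))" by (simp add: \<open>c = (0, c')\<close> sub_near_def g2_def)
    have T: "tau1 c = (\<lambda>_. 1)" by (simp add: \<open>c = (0, c')\<close> 2 tau1_def fun_eq_iff)
    have b: "(0, b) \<in> (Basis :: ((real^'n) \<times> (real^'n)) set)" using 2 by (simp add: Basis_prod_def)
    show ?thesis
    proof (cases "snd d = 0")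
      case True
      then have fd: "fst d \<in> Basis" using d by (auto simp: Basis_prod_def nonzero_Basis)
      have "dir_deriv d (\<lambda>z. g2 (fst z) \<bullet> (0, b)) = (\<lambda>z. dir_deriv (fst d) (\<lambda>z. g2 z \<bullet> (0, b)) (fst z))"
        by (rule dir_deriv_affine_map) simp
      moreover have "symb Basis cE (\<lambda>z. csq 3 (fst d) (fst z)) (\<lambda>z. dir_deriv (fst d) (\<lambda>z. g2 z \<bullet> (0, b)) (fst z))"
        by (rule symb_pull_fst[OF symb_csq_mono[OF symb_g2[OF fd b], of 3]]) (auto simp: csq_mono csq_nonneg)
      ultimately show ?thesis using True by (simp add: A T cE_def)
    next
      case False
      then have "fst d = 0" using d by (auto simp: Basis_prod_def)
      then have "dir_deriv d (\<lambda>z. g2 (fst z) \<bullet> (0, b)) = (\<lambda>z. 0)" by (simp add: dir_deriv_def fun_eq_iff)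
      then show ?thesis by (simp add: A symb_zero)
    qed
  qed
qed

text \<open>On the support of the cutoff <y> is comparable to <x>. Since <x> w = y -
  \<nabla>\<phi>(x, \<xi>), the bounds 4 C2 <x> for y and C2 <x> for the gradient add up to |w|
  \<le> 5 C2.\<close>

lemma ratio_sub_near:
  assumes r: "ratio (sub_near z) \<in> {C1\<^sup>2 / 16..16 * C2\<^sup>2}"
  shows "C1 / 4 * lam (fst (fst z)) \<le> bracket (fst (snd (sub_near z)))"
    and "bracket (fst (snd (sub_near z))) \<le> 4 * C2 * lam (fst (fst z))"
    and "bracket (snd z) \<le> 1 + 5 * C2"
proof -
  let ?p = "fst (fst z)" and ?y = "fst (snd (sub_near z))"
  have l: "lam ?p > 0" by (rule lam_pos)
  have rat: "ratio (sub_near z) = (bracket ?y)\<^sup>2 / (lam ?p)\<^sup>2"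
    by (simp add: ratio_def sub_near_def lam_def divide_inverse power_inverse)
  have "(C1 / 4 * lam ?p)\<^sup>2 \<le> (bracket ?y)\<^sup>2"
    using r l by (simp add: rat pos_le_divide_eq power_mult_distrib power_divide)
  then show 1: "C1 / 4 * lam ?p \<le> bracket ?y" by (rule power2_le_imp_le) simp
  have "(bracket ?y)\<^sup>2 \<le> (4 * C2 * lam ?p)\<^sup>2"
    using r l by (simp add: rat pos_divide_le_eq power_mult_distrib)
  then show 2: "bracket ?y \<le> 4 * C2 * lam ?p" by (rule power2_le_imp_le) (use C2 l in simp)
  have "lam ?p *\<^sub>R snd z = ?y - grad ?p" by (simp add: sub_near_def)
  then have "lam ?p * norm (snd z) \<le> norm ?y + norm (grad ?p)"
    using norm_triangle_ineq4[of ?y "grad ?p"] l by (metis abs_of_pos norm_scaleR)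
  also have "\<dots> \<le> 4 * C2 * lam ?p + C2 * lam ?p"
    using 2 norm_le_bracket[of ?y] norm_le_bracket[of "grad ?p"] grad_bracket(2)[of ?p] by (simp add: lam_def)
  finally have "lam ?p * norm (snd z) \<le> lam ?p * (5 * C2)" by (simp add: algebra_simps)
  then have "norm (snd z) \<le> 5 * C2" using l by simp
  then show "bracket (snd z) \<le> 1 + 5 * C2" using bracket_le_norm[of "snd z"] by simp
qed

lemma symb_am_near_sub_near:
  "symb Basis cE (\<lambda>z. indicator {C1\<^sup>2 / 16..16 * C2\<^sup>2} (ratio (sub_near z)) * wt3 (sub_near z)) (\<lambda>z. am_near (sub_near z))"
proof (rule symb_compose[OF symb_am_near smooth_sub_near, where \<tau> = tau1])
  fix c :: "(real^'n) \<times> (real^'n) \<times> (real^'n)" assume "c \<in> Basis"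
  show "\<exists>C. \<forall>z. indicat_real {C1\<^sup>2 / 16..16 * C2\<^sup>2} (ratio (sub_near z)) * wt3 (sub_near z) \<noteq> 0 \<longrightarrow> cost3 c (sub_near z) * tau1 c z \<le> C"
  \<comment> \<open>On the support 4 / C1 bounds <x> / <y> and 1 + 5 C2 bounds <w>; in x- and
    \<eta>-directions the product is 1.\<close>
  proof (intro exI[of _ "max 1 (4 / C1 * (1 + 5 * C2))"] allI impI)
    fix z assume "indicat_real {C1\<^sup>2 / 16..16 * C2\<^sup>2} (ratio (sub_near z)) * wt3 (sub_near z) \<noteq> 0"
    then have r: "ratio (sub_near z) \<in> {C1\<^sup>2 / 16..16 * C2\<^sup>2}" by (auto simp: indicator_def split: if_splits)
    show "cost3 c (sub_near z) * tau1 c z \<le> max 1 (4 / C1 * (1 + 5 * C2))"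
    proof (cases "fst (snd c) = 0")
      case False
      have "lam (fst (fst z)) / bracket (fst (snd (sub_near z))) \<le> 4 / C1"
        using ratio_sub_near(1)[OF r] C1 bracket_pos[of "fst (snd (sub_near z))"] by (simp add: field_simps)
      then have "lam (fst (fst z)) / bracket (fst (snd (sub_near z))) * bracket (snd z) \<le> 4 / C1 * (1 + 5 * C2)"
        using ratio_sub_near(3)[OF r] C1 by (intro mult_mono) auto
      then show ?thesis using False by (simp add: cost3_def tau1_def divide_inverse mult_ac le_max_iff_disj)
    qed (simp add: cost3_def tau1_def)
  qed
next
  show "symb Basis cE (\<lambda>z. cE b z * tau1 c z) (dir_deriv b (\<lambda>z. sub_near z \<bullet> c))" if "b \<in> Basis" "c \<in> Basis" for b c
    by (rule symb_sub_near[OF that])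
qed (simp_all add: cost3_nonneg cE_nonneg tau1_def less_imp_le[OF wt3_pos] less_imp_le[OF lam_pos])

text \<open>On the support <y>^m2 may be replaced by <x>^m2 for either sign of m2. Peetre's
  inequality turns <\<eta>>^m3 into <\<xi>>^m3 <\<kappa>>^|m3|, since |\<kappa>| / <x> \<le>
  |\<kappa>|. Boundedness of w makes the factor \<open>decay\<close> available at no cost.\<close>

lemma wt_H_near:
  "\<exists>C. \<forall>z. indicator {C1\<^sup>2 / 16..16 * C2\<^sup>2} (ratio (sub_near z)) * wt3 (sub_near z) \<le> C * wk_weight W_near \<bar>m3\<bar> z"
proof -
  define K where "K = max ((C1 / 4) powr m2) ((4 * C2) powr m2)"
  define N where "N = 2 * real DIM(real^'n)"
  have K: "K > 0" using C1 by (simp add: K_def less_max_iff_disj)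
  have "indicat_real {C1\<^sup>2 / 16..16 * C2\<^sup>2} (ratio (sub_near z)) * wt3 (sub_near z) \<le> (K * 2 powr \<bar>m3\<bar> * (1 + 5 * C2) powr N) * wk_weight W_near \<bar>m3\<bar> z" for z
  proof (cases "ratio (sub_near z) \<in> {C1\<^sup>2 / 16..16 * C2\<^sup>2}")
    case True
    let ?p = "fst (fst z)" and ?y = "fst (snd (sub_near z))" and ?k = "snd (fst z)"
    have l: "lam ?p > 0" by (rule lam_pos)
    have "(bracket ?y / lam ?p) powr m2 \<le> K"
      unfolding K_def using ratio_sub_near[OF True] C1 l by (intro powr_le_max) (auto simp: field_simps)
    then have y: "bracket ?y powr m2 \<le> K * lam ?p powr m2"
      using l by (simp add: powr_divide divide_le_eq)
    have "bracket (snd ?p + inverse (lam ?p) *\<^sub>R ?k) powr m3 \<le> 2 powr \<bar>m3\<bar> * bracket (snd ?p) powr m3 * bracket (inverse (lam ?p) *\<^sub>R ?k) powr \<bar>m3\<bar>"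
      by (rule bracket_powr_peetre)
    also have "\<dots> \<le> 2 powr \<bar>m3\<bar> * bracket (snd ?p) powr m3 * bracket ?k powr \<bar>m3\<bar>"
      using lam_ge_1[of ?p] l by (intro mult_left_mono powr_mono2 bracket_ray_le) (auto simp: inverse_le_1_iff)
    finally have e: "bracket (snd (snd (sub_near z))) powr m3 \<le> 2 powr \<bar>m3\<bar> * bracket (snd ?p) powr m3 * bracket ?k powr \<bar>m3\<bar>"
      by (simp add: sub_near_def g2_def)
    have "bracket (snd z) powr N \<le> (1 + 5 * C2) powr N"
      using ratio_sub_near(3)[OF True] by (intro powr_mono2) (auto simp: N_def)
    then have w: "1 \<le> (1 + 5 * C2) powr N * decay (snd z)"
      using bracket_pos[of "snd z"] by (simp add: N_def powr_minus divide_simps)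
    have "wt3 (sub_near z) \<le> lam ?p powr m1 * (K * lam ?p powr m2) * (2 powr \<bar>m3\<bar> * bracket (snd ?p) powr m3 * bracket ?k powr \<bar>m3\<bar>)"
      unfolding wt3_def using y e K
      by (intro mult_mono) (auto simp: sub_near_def lam_def)
    also have "\<dots> = (K * 2 powr \<bar>m3\<bar>) * (W_near ?p * bracket ?k powr \<bar>m3\<bar>) * 1"
      by (simp add: W_near_def lam_def powr_add mult_ac)
    also have "\<dots> \<le> (K * 2 powr \<bar>m3\<bar>) * (W_near ?p * bracket ?k powr \<bar>m3\<bar>) * ((1 + 5 * C2) powr N * decay (snd z))"
      using w K W_near_nonneg by (intro mult_left_mono) auto
    finally show ?thesis using True by (simp add: wk_weight_def mult_ac)
  next
    case False
    then show ?thesis using K W_near_nonneg by (simp add: wk_weight_def)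
  qed
  then show ?thesis by blast
qed

lemma wk_weight_nonneg: "(\<And>p. W p \<ge> 0) \<Longrightarrow> wk_weight W K z \<ge> 0"
  by (simp add: wk_weight_def)

lemma symb_H_near: "symb Basis cE (wk_weight W_near \<bar>m3\<bar>) H_near"
proof -
  obtain C where C: "\<And>z. indicator {C1\<^sup>2 / 16..16 * C2\<^sup>2} (ratio (sub_near z)) * wt3 (sub_near z) \<le> C * wk_weight W_near \<bar>m3\<bar> z"
    using wt_H_near by blast
  have "symb Basis cE (wk_weight W_near \<bar>m3\<bar>) (\<lambda>z. am_near (sub_near z))"
    by (rule symb_weight_mono[OF symb_am_near_sub_near C])
       (auto simp: cE_nonneg wk_weight_nonneg W_near_nonneg less_imp_le[OF wt3_pos])
  from symb_mult[OF symb_pull_fst[OF symb_exp_phase_near] this] show ?thesis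
    unfolding H_near_def[abs_def] by simp
qed

lemma symb_dir_derivs_p:
  fixes H :: "'n pv \<times> (real^'n) \<Rightarrow> complex"
  assumes H: "symb Basis cost (wk_weight W K) H" and ds: "set ds \<subseteq> Basis"
    and cost: "\<And>d z. cost ((d, 0), 0) z = r (fst (fst z)) * bracket (snd (fst z)) powr A"
  shows "symb Basis cost (wk_weight (\<lambda>p. W p * r p ^ length ds) (K + real (length ds) * A))
    (dir_derivs (map (\<lambda>d. ((d, 0), 0)) ds) H)"
  using ds
proof (induction ds)
  case (Cons d ds)
  have "((d, 0), 0) \<in> (Basis :: ('n pv \<times> (real^'n)) set)" using Cons by (simp add: Basis_prod_def)
  from symb_dir_deriv[OF Cons.IH this]
  have "symb Basis cost (\<lambda>z. wk_weight (\<lambda>p. W p * r p ^ length ds) (K + real (length ds) * A) z * cost ((d, 0), 0) z)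
      (dir_derivs (map (\<lambda>d. ((d, 0), 0)) (d # ds)) H)"
    using Cons.prems by simp
  moreover have "wk_weight (\<lambda>p. W p * r p ^ length ds) (K + real (length ds) * A) z * cost ((d, 0), 0) z =
      wk_weight (\<lambda>p. W p * r p ^ length (d # ds)) (K + real (length (d # ds)) * A) z" for z
  proof -
    have "K + real (length (d # ds)) * A = (K + real (length ds) * A) + A" by (simp add: algebra_simps)
    then show ?thesis by (simp only: wk_weight_def cost powr_add) (simp add: mult_ac)
  qed
  ultimately show ?case by (simp only:)
qed (use H in simp)

lemma symb_H_near_derivs:
  assumes "set ds \<subseteq> Basis"
  shows "symb Basis cE (wk_weight W_near (\<bar>m3\<bar> + real (length ds) * 3)) (dir_derivs (map (\<lambda>d. ((d, 0), 0)) ds) H_near)"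
  using symb_dir_derivs_p[OF symb_H_near assms, of "\<lambda>_. 1" 3] by (simp add: cE_def csq_def)

lemma wk_dirs_Basis: "wk_dirs \<subseteq> Basis"
  by (auto simp: wk_dirs_def Basis_prod_def)

text \<open>A derivative in (x, \<xi>) costs <\<kappa>>^3 but no power of <x>, so weight
  \<open>W_near\<close> and gain \<open>slam\<close> are preserved. Hence the derivatives of the
  near part and of its expansion obey the same powers of <x>.\<close>

lemma wk_H_near_derivs:
  assumes "set ds \<subseteq> Basis"
  shows "symb wk_dirs (wk_cost slam 3) (wk_weight W_near (\<bar>m3\<bar> + real (length ds) * 3))
    (dir_derivs (map (\<lambda>d. ((d, 0), 0)) ds) H_near)"
proof (rule symb_mono[OF symb_H_near_derivs[OF assms] wk_dirs_Basis])
  show "\<exists>C. \<forall>z. wk_weight W_near K z \<le> C * wk_weight W_near K z" for K by (rule exI[of _ 1]) simp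
  show "\<exists>C. \<forall>z. wk_weight W_near K z \<noteq> 0 \<longrightarrow> cE b z \<le> C * wk_cost slam 3 b z" if "b \<in> wk_dirs" for b K
    using that by (intro exI[of _ 1]) (auto simp: wk_dirs_def cE_def wk_cost_def csq_def nonzero_Basis)
qed (auto simp: wk_weight_nonneg W_near_nonneg cE_nonneg wk_cost_def less_imp_le[OF slam_pos])

lemma loc_bdd_bracket_powr:
  "loc_bdd (\<lambda>p :: (real^'n) \<times> (real^'n). bracket (fst p) powr r * bracket (snd p) powr t)"
  by (rule loc_bdd_continuous)
     (intro continuous_intros continuous_on_compose2[OF smooth_continuous[OF smooth_bracket, of UNIV]], auto)

lemma osc_H_near: "osc H_near"
  unfolding osc_def
proof (intro allI impI exI conjI)
  fix ds :: "((real^'n) \<times> (real^'n)) list" assume "set ds \<subseteq> Basis"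
  from wk_dec[OF wk_H_near_derivs[OF this] W_near_nonneg]
  show "dec (\<lambda>_. 1) (\<lambda>q. W_near (fst q) * bracket (snd q) powr (\<bar>m3\<bar> + real (length ds) * 3))
    (dir_derivs (map (\<lambda>d. ((d, 0), 0)) ds) H_near)" .
  show "loc_bdd W_near" unfolding W_near_def[abs_def] by (rule loc_bdd_bracket_powr)
qed (rule W_near_nonneg)

section \<open>The integral away from the critical point\<close>

definition phase_far :: "'n pv \<Rightarrow> real"
  where "phase_far z = ph (fst (fst z), snd (fst z) + snd z) - ph (fst z)"

text \<open>Away from the critical point \<open>\<eta> = \<xi> + \<kappa>\<close> and \<open>y = w\<close> are not rescaled.\<close>

definition sub_far :: "'n pv \<times> (real^'n) \<Rightarrow> (real^'n) \<times> (real^'n) \<times> (real^'n)"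
  where "sub_far z = (fst (fst (fst z)), snd z, snd (fst (fst z)) + snd (fst z))"

definition H_far :: "nat \<Rightarrow> 'n pv \<times> (real^'n) \<Rightarrow> complex"
  where "H_far k z = exp (\<i> * complex_of_real (phase_far (fst z))) * Lk k (sub_far z)"

text \<open>The size of \<open>phase_far\<close>, hence the cost of differentiating its exponential.
  In contrast to the near part a factor <x> is lost per derivative; it is absorbed by the free
  parameter M of \<open>W_far\<close>.\<close>

definition c2 :: "'n pv \<Rightarrow> real"
  where "c2 z = lam (fst z) * bracket (snd z)"

definition cF :: "'n pv \<times> (real^'n) \<Rightarrow> 'n pv \<times> (real^'n) \<Rightarrow> real"
  where "cF d z = (if snd d = 0 then c2 (fst z) else 1)"

lemma c2_ge_1: "c2 z \<ge> 1"
  using mult_mono[OF lam_ge_1[of "fst z"] bracket_ge_1[of "snd z"]] lam_pos[of "fst z"] by (simp add: c2_def)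

lemma smooth_phase_far: "C_infinity phase_far"
  unfolding phase_far_def[abs_def] by (intro smooth_diff smooth_compose[OF smooth_ph] smooth_intros)

lemma symb_phase_far: "symb Basis (\<lambda>_ _. 1) c2 phase_far"
proof (rule symb_vanish[OF smooth_phase_far, where W = "\<lambda>z. lam (fst z)"])
  show "phase_far (p, 0) = 0" for p by (simp add: phase_far_def)
  fix b :: "real^'n" assume b: "b \<in> Basis"
  have "dir_deriv (0, b) phase_far z = phd b (fst (fst z), snd (fst z) + snd z)" for z
  proof -
    have "((\<lambda>t. ph (fst (fst z), snd (fst z) + snd z + t *\<^sub>R b)) has_vector_derivative phd b (fst (fst z), snd (fst z) + snd z)) (at 0)"
      using dir_deriv_line[of ph "(fst (fst z), snd (fst z) + snd z)" 0 "(0, b)"] smooth_differentiable[OF smooth_ph]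
      by (simp add: phd_def)
    then have "((\<lambda>t. ph (fst (fst z), snd (fst z) + snd z + t *\<^sub>R b) - ph (fst z)) has_vector_derivative phd b (fst (fst z), snd (fst z) + snd z) - 0) (at 0)"
      by (intro has_vector_derivative_diff has_vector_derivative_const)
    then show ?thesis unfolding dir_deriv_def phase_far_def
      by (intro vector_derivative_at) (simp add: add.assoc)
  qed
  then have eq: "dir_deriv (0, b) phase_far = (\<lambda>z. phd b (fst (fst z), snd (fst z) + snd z))" by blast
  have "symb Basis (\<lambda>_ _. 1) (\<lambda>z. bracket (fst (fst (fst z), snd (fst z) + snd z))) (\<lambda>z::'n pv. phd b (fst (fst z), snd (fst z) + snd z))"
    by (rule symb_affine[OF symb_phd[OF b], where L = "\<lambda>d. (fst (fst d), snd (fst d) + snd d)"])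
       (auto intro!: smooth_intros elim!: Basis_pairE simp: Basis_prod_def zero_prod_def algebra_simps)
  then show "symb Basis (\<lambda>_ _. 1) (\<lambda>z. lam (fst z)) (dir_deriv (0, b) phase_far)"
    unfolding eq by (simp add: lam_def)
next
  show "norm v * lam (fst (p, v)) \<le> c2 (p, v)" for p v
    using mult_right_mono[OF norm_le_bracket[of v], of "lam p"] lam_pos[of p] by (simp add: c2_def mult.commute)
  show "lam (fst z) \<le> c2 z * 1" for z
    using mult_left_mono[OF bracket_ge_1[of "snd z"], of "lam (fst z)"] lam_pos[of "fst z"] by (simp add: c2_def)
qed (auto simp: c2_def less_imp_le[OF lam_pos])

lemma symb_exp_phase_far: "symb Basis cF (\<lambda>_. 1) (\<lambda>z. exp (\<i> * complex_of_real (phase_far (fst z))))"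
proof -
  have "symb Basis (\<lambda>_. c2) (\<lambda>_. 1) (\<lambda>z. exp (\<i> * complex_of_real (phase_far z)))"
  proof (rule symb_cis[OF smooth_phase_far])
    fix d :: "'n pv" assume "d \<in> Basis"
    from symb_dir_deriv[OF symb_phase_far this] have "symb Basis (\<lambda>_ _. 1) c2 (dir_deriv d phase_far)" by simp
    then show "symb Basis (\<lambda>_. c2) c2 (dir_deriv d phase_far)"
      by (rule symb_mono)
         (use c2_ge_1 order_trans[OF zero_le_one c2_ge_1] in \<open>auto intro!: exI[of _ 1]\<close>)
  qed
  then show ?thesis
    by (rule symb_affine[where L = fst])
       (use order_trans[OF zero_le_one c2_ge_1] in \<open>auto intro!: smooth_intros elim!: Basis_pairE[where 'a="'n pv"] simp: cF_def\<close>)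
qed

lemma cF_nonneg: "cF d z \<ge> 0" and cF_ge_1: "cF d z \<ge> 1"
  using c2_ge_1[of "fst z"] by (auto simp: cF_def)

lemma symb_H_far_raw: "symb Basis cF (\<lambda>z. inverse (rho (sub_far z)) ^ k * wt3 (sub_far z)) (H_far k)"
proof -
  have nn: "inverse (rho z) ^ k * wt3 z \<ge> 0" for z
    using rho_pos[of z] wt3_pos[of z] by simp
  have "symb Basis cF (\<lambda>z. inverse (rho (sub_far z)) ^ k * wt3 (sub_far z)) (\<lambda>z. Lk k (sub_far z))"
  proof (rule symb_affine[OF symb_Lk, where L = "\<lambda>d. (fst (fst (fst d)), snd d, snd (fst (fst d)) + snd (fst d))"])
    show "C_infinity sub_far" unfolding sub_far_def[abs_def] by (intro smooth_intros)
    show "sub_far (z + t *\<^sub>R b) = sub_far z + t *\<^sub>R (fst (fst (fst b)), snd b, snd (fst (fst b)) + snd (fst b))" for z b t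
      by (simp add: sub_far_def algebra_simps)
    show "(fst (fst (fst b)), snd b, snd (fst (fst b)) + snd (fst b)) = 0 \<or>
      (fst (fst (fst b)), snd b, snd (fst (fst b)) + snd (fst b)) \<in> Basis \<and> (\<forall>z. 1 \<le> cF b z)" if "b \<in> Basis" for b :: "'n pv \<times> (real^'n)"
      using that by (auto simp: Basis_prod_def cF_ge_1 zero_prod_def)
  qed (use nn cF_nonneg in auto)
  from symb_mult[OF symb_exp_phase_far this] show ?thesis unfolding H_far_def[abs_def] by simp
qed

definition W_far :: "real \<Rightarrow> (real^'n) \<times> (real^'n) \<Rightarrow> real"
  where "W_far M p = bracket (fst p) powr (m1 + m2 - M) * bracket (snd p) powr m3"

lemma W_far_nonneg: "W_far M p \<ge> 0" by (simp add: W_far_def)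

text \<open>\<open>rho\<close> dominates both <x> and <y>. Of the k factors 1 / \<open>rho\<close>,
  n1 supply the decay in x, n2 the decay in y, and the others are at most 1.\<close>

lemma rho_weight:
  "\<exists>k0. \<forall>k\<ge>k0. \<forall>z. inverse (rho z) ^ k * bracket (fst (snd z)) powr m2 \<le> bracket (fst z) powr (m2 - M) * bracket (fst (snd z)) powr (- r)"
proof -
  obtain n1 :: nat where n1: "real n1 \<ge> M - m2" using real_arch_simple by blast
  obtain n2 :: nat where n2: "real n2 \<ge> m2 + r" using real_arch_simple by blast
  have "inverse (rho z) ^ k * bracket (fst (snd z)) powr m2 \<le> bracket (fst z) powr (m2 - M) * bracket (fst (snd z)) powr (- r)"
    if k: "k \<ge> n1 + n2" for k z
  proof -
    let ?x = "bracket (fst z)" and ?y = "bracket (fst (snd z))"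
    have r1: "rho z \<ge> 1" by (simp add: rho_def bracket_ge_1)
    have i1: "inverse (rho z) \<le> 1" using r1 by (simp add: inverse_le_1_iff)
    have ix: "inverse (rho z) \<le> inverse ?x" and iy: "inverse (rho z) \<le> inverse ?y"
      by (auto simp: rho_def bracket_pos bracket_fst_le bracket_snd_le intro!: le_imp_inverse_le)
    have "inverse (rho z) ^ k \<le> inverse (rho z) ^ (n1 + n2)"
      using k i1 r1 by (intro power_decreasing) auto
    also have "\<dots> \<le> inverse ?x ^ n1 * inverse ?y ^ n2"
      unfolding power_add using ix iy r1 by (intro mult_mono power_mono) auto
    also have "\<dots> = ?x powr (- real n1) * ?y powr (- real n2)"
      by (simp add: powr_minus powr_realpow bracket_pos power_inverse)
    also have "\<dots> \<le> ?x powr (m2 - M) * ?y powr (- (m2 + r))"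
      using n1 n2 bracket_ge_1[of "fst z"] bracket_ge_1[of "fst (snd z)"] by (intro mult_mono powr_mono) auto
    finally have "inverse (rho z) ^ k * ?y powr m2 \<le> ?x powr (m2 - M) * ?y powr (- (m2 + r)) * ?y powr m2"
      by (intro mult_right_mono) auto
    also have "\<dots> = ?x powr (m2 - M) * ?y powr (- r)"
      by (simp add: powr_add[symmetric])
    finally show ?thesis .
  qed
  then show ?thesis by blast
qed

lemma symb_H_far: "\<exists>k0. \<forall>k\<ge>k0. symb Basis cF (wk_weight (W_far M) \<bar>m3\<bar>) (H_far k)"
proof -
  obtain k0 where k0: "\<And>k z. k \<ge> k0 \<Longrightarrow> inverse (rho z) ^ k * bracket (fst (snd z)) powr m2 \<le>
      bracket (fst z) powr (m2 - M) * bracket (fst (snd z)) powr (- (2 * real DIM(real^'n)))"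
    using rho_weight by blast
  have "symb Basis cF (wk_weight (W_far M) \<bar>m3\<bar>) (H_far k)" if k: "k \<ge> k0" for k
  proof (rule symb_weight_mono[OF symb_H_far_raw])
    fix z :: "'n pv \<times> (real^'n)"
    let ?x = "fst (fst (fst z))" and ?\<xi> = "snd (fst (fst z))" and ?\<zeta> = "snd (fst z)"
    have g: "fst (sub_far z) = ?x" "fst (snd (sub_far z)) = snd z" "snd (snd (sub_far z)) = ?\<xi> + ?\<zeta>" by (auto simp: sub_far_def)
    have "inverse (rho (sub_far z)) ^ k * wt3 (sub_far z) =
        (inverse (rho (sub_far z)) ^ k * bracket (snd z) powr m2) * (bracket ?x powr m1 * bracket (?\<xi> + ?\<zeta>) powr m3)"
      by (simp add: wt3_def g mult_ac)
    also have "\<dots> \<le> (bracket ?x powr (m2 - M) * decay (snd z)) * (bracket ?x powr m1 *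
        (2 powr \<bar>m3\<bar> * bracket ?\<xi> powr m3 * bracket ?\<zeta> powr \<bar>m3\<bar>))"
    proof (rule mult_mono)
      show "inverse (rho (sub_far z)) ^ k * bracket (snd z) powr m2 \<le> bracket ?x powr (m2 - M) * decay (snd z)"
        using k0[OF k, of "sub_far z"] by (simp add: g)
      show "bracket ?x powr m1 * bracket (?\<xi> + ?\<zeta>) powr m3 \<le>
          bracket ?x powr m1 * (2 powr \<bar>m3\<bar> * bracket ?\<xi> powr m3 * bracket ?\<zeta> powr \<bar>m3\<bar>)"
        using bracket_powr_peetre[of ?\<xi> ?\<zeta> m3] by (intro mult_left_mono) auto
    qed auto
    also have "\<dots> = 2 powr \<bar>m3\<bar> * wk_weight (W_far M) \<bar>m3\<bar> z"
      by (simp add: wk_weight_def W_far_def powr_add[symmetric] mult_ac) (simp add: algebra_simps powr_add[symmetric])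
    finally show "inverse (rho (sub_far z)) ^ k * wt3 (sub_far z) \<le> 2 powr \<bar>m3\<bar> * wk_weight (W_far M) \<bar>m3\<bar> z" .
    show "0 \<le> inverse (rho (sub_far z)) ^ k * wt3 (sub_far z)"
      using rho_pos[of "sub_far z"] wt3_pos[of "sub_far z"] by simp
  qed (auto simp: wk_weight_nonneg W_far_nonneg cF_nonneg)
  then show ?thesis by blast
qed

text \<open>Every derivative costs <x> <\<kappa>>, which lowers M by 1 and raises the growth in
  \<kappa> by 1.\<close>

lemma dec_H_far_derivs:
  assumes "symb Basis cF (wk_weight (W_far M) \<bar>m3\<bar>) (H_far k)" "set ds \<subseteq> Basis"
  shows "dec (\<lambda>_. 1) (\<lambda>q. W_far (M - real (length ds)) (fst q) * bracket (snd q) powr (\<bar>m3\<bar> + real (length ds)))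
    (dir_derivs (map (\<lambda>d. ((d, 0), 0)) ds) (H_far k))"
proof -
  have "symb Basis cF (wk_weight (\<lambda>p. W_far M p * lam p ^ length ds) (\<bar>m3\<bar> + real (length ds) * 1)) (dir_derivs (map (\<lambda>d. ((d, 0), 0)) ds) (H_far k))"
    by (rule symb_dir_derivs_p[OF assms]) (simp add: cF_def c2_def)
  moreover have "W_far M p * lam p ^ length ds = W_far (M - real (length ds)) p" for p
  proof -
    have "lam p ^ length ds = bracket (fst p) powr real (length ds)"
      by (simp add: lam_def powr_realpow bracket_pos)
    then show ?thesis by (simp add: W_far_def mult_ac) (simp add: powr_add[symmetric] algebra_simps)
  qed
  ultimately have s: "symb Basis cF (wk_weight (W_far (M - real (length ds))) (\<bar>m3\<bar> + real (length ds))) (dir_derivs (map (\<lambda>d. ((d, 0), 0)) ds) (H_far k))"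
    by simp
  show ?thesis
    unfolding dec_def
  proof (rule symb_mono[OF s])
    show "\<exists>C. \<forall>z. wk_weight (W_far (M - real (length ds))) (\<bar>m3\<bar> + real (length ds)) z \<le> C *
        (W_far (M - real (length ds)) (fst (fst z)) * bracket (snd (fst z)) powr (\<bar>m3\<bar> + real (length ds)) * decay (snd z))"
      by (rule exI[of _ 1]) (simp add: wk_weight_def)
    show "\<exists>C. \<forall>z. wk_weight (W_far (M - real (length ds))) (\<bar>m3\<bar> + real (length ds)) z \<noteq> 0 \<longrightarrow> cF b z \<le> C * 1"
      if "b \<in> Pair 0 ` Basis" for b
      using that by (intro exI[of _ 1]) (auto simp: cF_def nonzero_Basis)
  qed (auto simp: Basis_prod_def wk_weight_nonneg W_far_nonneg cF_nonneg)
qed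

lemma osc_H_far:
  assumes "symb Basis cF (wk_weight (W_far M) \<bar>m3\<bar>) (H_far k)"
  shows "osc (H_far k)"
  unfolding osc_def
proof (intro allI impI exI conjI)
  fix ds :: "((real^'n) \<times> (real^'n)) list" assume "set ds \<subseteq> Basis"
  from dec_H_far_derivs[OF assms this]
  show "dec (\<lambda>_. 1) (\<lambda>q. W_far (M - real (length ds)) (fst q) * bracket (snd q) powr (\<bar>m3\<bar> + real (length ds)))
    (dir_derivs (map (\<lambda>d. ((d, 0), 0)) ds) (H_far k))" .
  show "loc_bdd (W_far (M - real (length ds)))" unfolding W_far_def[abs_def] by (rule loc_bdd_bracket_powr)
qed (rule W_far_nonneg)

end

section \<open>Integration by parts and the oscillatory integral\<close>

lemma continuous_decay_bracket: "continuous_on S (\<lambda>x. bracket (x::'v::euclidean_space) powr r)"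
  by (intro continuous_intros smooth_continuous[OF smooth_bracket]) auto

text \<open>Supplies the continuity of the derivative that \<open>integral_dir_deriv_eq_0\<close>
  asks for.\<close>

lemma FT_continuous:
  fixes H :: "'q::euclidean_space \<times> 'v::euclidean_space \<Rightarrow> complex" and g :: "'s::euclidean_space \<Rightarrow> 'q"
  assumes H: "dec \<tau> W H" and W: "loc_bdd W" and g: "continuous_on UNIV g" "continuous_on UNIV h"
  shows "continuous_on UNIV (\<lambda>s. FT H (g s) (h s))"
  unfolding continuous_on_eq_continuous_at[OF open_UNIV]
proof
  fix s
  obtain C where C: "\<And>q w. norm (H (q, w)) \<le> C * W q * decay w" using dec_bound[OF H] by blast
  obtain r M where r: "r > 0" "\<And>q. q \<in> ball (g s) r \<Longrightarrow> \<bar>W q\<bar> \<le> M" using W unfolding loc_bdd_def by metis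
  have cg: "isCont g s" and ch: "isCont h s" using g by (auto simp: continuous_on_eq_continuous_at)
  let ?F = "\<lambda>s w. exp (- \<i> * complex_of_real (w \<bullet> h s)) * H (g s, w)"
  show "isCont (\<lambda>s. FT H (g s) (h s)) s"
    unfolding continuous_at_sequentially
  proof (intro allI impI)
    fix X assume X: "X \<longlonglongrightarrow> s"
    have "eventually (\<lambda>n. g (X n) \<in> ball (g s) r) sequentially"
      using tendstoD[OF isCont_tendsto_compose[OF cg X] r(1)] by (auto simp: dist_commute elim: eventually_mono)
    then obtain N where N: "\<And>n. n \<ge> N \<Longrightarrow> g (X n) \<in> ball (g s) r" by (auto simp: eventually_sequentially)
    have "(\<lambda>n. LINT w|lborel. ?F (X (n + N)) w) \<longlonglongrightarrow> (LINT w|lborel. ?F s w)"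
    proof (rule integral_dominated_convergence[where w = "\<lambda>w. \<bar>C\<bar> * M * decay w"])
      show "AE w in lborel. (\<lambda>n. ?F (X (n + N)) w) \<longlonglongrightarrow> ?F s w"
      proof (rule AE_I2)
        fix w :: 'v
        have "isCont (\<lambda>s. ?F s w) s"
          using smooth_continuous[OF dec_smooth[OF H], of UNIV]
          by (intro continuous_intros ch isCont_o2[of s "\<lambda>s. (g s, w)" H] cg) (simp add: continuous_on_eq_continuous_at)
        from isCont_tendsto_compose[OF this LIMSEQ_ignore_initial_segment[OF X]]
        show "(\<lambda>n. ?F (X (n + N)) w) \<longlonglongrightarrow> ?F s w" .
      qed
      show "AE w in lborel. norm (?F (X (n + N)) w) \<le> \<bar>C\<bar> * M * decay w" for n
      proof (rule AE_I2)
        fix w :: 'v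
        have "\<bar>W (g (X (n + N)))\<bar> \<le> M" using N r(2) by simp
        then have "\<bar>C\<bar> * \<bar>W (g (X (n + N)))\<bar> * decay w \<le> \<bar>C\<bar> * M * decay w"
          by (intro mult_right_mono mult_left_mono) auto
        moreover have "C * W (g (X (n + N))) * decay w \<le> \<bar>C\<bar> * \<bar>W (g (X (n + N)))\<bar> * decay w"
          by (intro mult_right_mono) (auto simp: abs_mult[symmetric])
        ultimately show "norm (?F (X (n + N)) w) \<le> \<bar>C\<bar> * M * decay w"
          using order_trans[OF C[of "g (X (n + N))" w]] by (simp only: norm_mult norm_exp_uminus_i mult_1)
      qed
      show "integrable lborel (\<lambda>w::'v. \<bar>C\<bar> * M * decay w)" by (intro integrable_mult_right integrable_decay)
    qed (use FT_integrand_measurable[OF dec_smooth[OF H]] in auto)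
    then have "(\<lambda>n. FT H (g (X (n + N))) (h (X (n + N)))) \<longlonglongrightarrow> FT H (g s) (h s)" by (simp add: FT_def)
    then show "((\<lambda>s. FT H (g s) (h s)) \<circ> X) \<longlonglongrightarrow> FT H (g s) (h s)"
      using LIMSEQ_offset[of "\<lambda>n. FT H (g (X n)) (h (X n))" N] by (simp add: o_def)
  qed
qed

abbreviation (input) poly_dec :: "real \<Rightarrow> ('v::euclidean_space \<times> 'v \<Rightarrow> complex) \<Rightarrow> bool"
  where "poly_dec K B \<equiv> dec (\<lambda>_. 1) (\<lambda>\<eta>. bracket \<eta> powr K) B"

text \<open>Peetre's inequality converts rapid decay in \<eta> - \<xi> into rapid decay in \<eta>
  with polynomial growth in \<xi>. The growth is later absorbed by the Fourier transform of a
  Schwartz function.\<close>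

lemma FT_shift_bound:
  fixes B :: "'v::euclidean_space \<times> 'v \<Rightarrow> complex"
  assumes B: "poly_dec K B"
  shows "\<exists>C\<ge>0. \<exists>L. \<forall>\<eta> \<xi>. norm (FT B \<eta> (\<eta> - \<xi>)) \<le> C * bracket \<eta> powr (- r) * bracket \<xi> powr L"
proof -
  obtain l :: nat where l: "2 * real l \<ge> K + r"
    using real_arch_simple[of "(K + r) / 2"] by (auto simp: field_simps)
  have "\<exists>C. \<forall>q \<theta>. norm (FT B q \<theta>) \<le> C * (bracket q powr K) * 1 ^ (2 * l) * bracket \<theta> powr (- 2 * real l)"
    by (rule FT_decay[OF B]) auto
  then obtain C where C: "\<And>q \<theta>. norm (FT B q \<theta>) \<le> C * bracket q powr K * bracket \<theta> powr (- 2 * real l)" by auto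
  have "norm (FT B \<eta> (\<eta> - \<xi>)) \<le> (\<bar>C\<bar> * 2 powr (2 * real l)) * bracket \<eta> powr (- r) * bracket \<xi> powr (2 * real l)" for \<eta> \<xi>
  proof -
    have "bracket (\<eta> - \<xi>) powr (- 2 * real l) \<le> 2 powr (2 * real l) * bracket \<eta> powr (- 2 * real l) * bracket \<xi> powr (2 * real l)"
      using bracket_powr_peetre[of \<eta> "- \<xi>" "- 2 * real l"] by (simp add: bracket_def)
    then have "C * bracket \<eta> powr K * bracket (\<eta> - \<xi>) powr (- 2 * real l) \<le>
        \<bar>C\<bar> * bracket \<eta> powr K * (2 powr (2 * real l) * bracket \<eta> powr (- 2 * real l) * bracket \<xi> powr (2 * real l))"
      by (intro mult_mono) auto
    also have "\<dots> = (\<bar>C\<bar> * 2 powr (2 * real l)) * bracket \<eta> powr (K - 2 * real l) * bracket \<xi> powr (2 * real l)"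
      by (simp add: powr_diff powr_minus divide_inverse mult_ac)
    also have "\<dots> \<le> (\<bar>C\<bar> * 2 powr (2 * real l)) * bracket \<eta> powr (- r) * bracket \<xi> powr (2 * real l)"
      using l bracket_ge_1[of \<eta>] by (intro mult_right_mono mult_left_mono powr_mono) auto
    finally show ?thesis using C[of \<eta> "\<eta> - \<xi>"] by linarith
  qed
  then show ?thesis by (intro exI[of _ "\<bar>C\<bar> * 2 powr (2 * real l)"]) auto
qed

lemma FT_shift_measurable:
  fixes B :: "'v::euclidean_space \<times> 'v \<Rightarrow> complex"
  shows "C_infinity B \<Longrightarrow> (\<lambda>\<eta>. FT B \<eta> (\<eta> - \<xi>)) \<in> borel_measurable borel"
  by (intro FT_measurable continuous_intros)

lemma FT_shift_integrable:
  fixes B :: "'v::euclidean_space \<times> 'v \<Rightarrow> complex"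
  assumes B: "poly_dec K B" and P: "continuous_on UNIV P" "\<And>\<eta>. norm (P \<eta>) \<le> 1"
  shows "integrable lborel (\<lambda>\<eta>. P \<eta> * FT B \<eta> (\<eta> - \<xi>))"
proof -
  obtain C L where C: "C \<ge> 0" "\<And>\<eta> \<xi>. norm (FT B \<eta> (\<eta> - \<xi>)) \<le> C * bracket \<eta> powr (- (2 * real DIM('v))) * bracket \<xi> powr L"
    using FT_shift_bound[OF B] by metis
  have [measurable]: "P \<in> borel_measurable borel" using P(1) by (rule borel_measurable_continuous_onI)
  have [measurable]: "(\<lambda>\<eta>. FT B \<eta> (\<eta> - \<xi>)) \<in> borel_measurable borel"
    by (rule FT_shift_measurable[OF dec_smooth[OF B]])
  show ?thesis
  proof (rule integrable_by_decay[of _ "C * bracket \<xi> powr L"])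
    show "norm (P \<eta> * FT B \<eta> (\<eta> - \<xi>)) \<le> C * bracket \<xi> powr L * decay \<eta>" for \<eta>
      using mult_mono[OF P(2)[of \<eta>] C(2)[of \<eta> \<xi>]] by (simp add: norm_mult mult_ac)
  qed measurable
qed

text \<open>The integrand is - i times the \<eta>-divergence of the field whose components
  \<open>K'\<close> b are the y-integrals of exp(i (p(\<eta>) - y . (\<eta> - \<xi>))) G_b. A
  derivative that falls on the exponential produces the factor with the gradient of p minus y, and
  every full derivative integrates to 0.\<close>

lemma integral_phase_divergence:
  fixes G :: "'v::euclidean_space \<Rightarrow> 'v \<times> 'v \<Rightarrow> complex" and p :: "'v \<Rightarrow> real"
  assumes p: "C_infinity p"
    and G: "\<And>b. b \<in> Basis \<Longrightarrow> poly_dec K (G b)"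
    and DG: "\<And>b c. b \<in> Basis \<Longrightarrow> c \<in> Basis \<Longrightarrow> poly_dec K (dir_deriv (c, 0) (G b))"
    and FG: "\<And>b c. b \<in> Basis \<Longrightarrow> c \<in> Basis \<Longrightarrow>
      poly_dec K (\<lambda>z. complex_of_real (dir_deriv c p (fst z) - snd z \<bullet> c) * G b z)"
  shows "(LINT \<eta>|lborel. exp (\<i> * complex_of_real (p \<eta>)) *
    FT (\<lambda>z. \<Sum>b\<in>Basis. complex_of_real (dir_deriv b p (fst z) - snd z \<bullet> b) * G b z - \<i> * dir_deriv (b, 0) (G b) z) \<eta> (\<eta> - \<xi>)) = 0"
proof -
  let ?P = "\<lambda>\<eta>. exp (\<i> * complex_of_real (p \<eta>))"
  let ?F = "\<lambda>c z. complex_of_real (dir_deriv c p (fst z) - snd z \<bullet> c)"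
  let ?J = "\<lambda>b c z. \<i> * (?F c z * G b z) + dir_deriv (c, 0) (G b) z"
  let ?N = "\<lambda>b z. ?F b z * G b z - \<i> * dir_deriv (b, 0) (G b) z"
  define K' where "K' = (\<lambda>b \<eta>. ?P \<eta> * FT (G b) \<eta> (\<eta> - \<xi>))"
  let ?E = "\<lambda>\<eta> y. exp (\<i> * complex_of_real (p \<eta> - y \<bullet> (\<eta> - \<xi>)))"
  have P: "continuous_on UNIV ?P" "norm (?P \<eta>) \<le> 1" for \<eta>
    by (auto intro!: continuous_intros smooth_continuous[OF p])
  have J: "poly_dec K (?J b c)" if "b \<in> Basis" "c \<in> Basis" for b c
    by (intro dec_add dec_mult_left FG DG that)
  have N: "poly_dec K (?N b)" if "b \<in> Basis" for b
    by (intro dec_diff dec_mult_left FG DG that)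
  have EP: "?E \<eta> y = ?P \<eta> * exp (- \<i> * complex_of_real (y \<bullet> (\<eta> - \<xi>)))" for \<eta> y
    by (simp add: exp_diff exp_minus right_diff_distrib divide_inverse)
  have EFT: "(LINT y|lborel. ?E \<eta> y * B (\<eta>, y)) = ?P \<eta> * FT B \<eta> (\<eta> - \<xi>)" if "poly_dec K B" for B :: "'v \<times> 'v \<Rightarrow> complex" and \<eta>
    unfolding FT_def EP mult.assoc by (rule integral_mult_right_zero)
  have D: "(K' b has_derivative (\<lambda>h. \<Sum>c\<in>Basis. (h \<bullet> c) *\<^sub>R (?P \<eta> * FT (?J b c) \<eta> (\<eta> - \<xi>)))) (at \<eta>)" if b: "b \<in> Basis" for b \<eta>
  proof -
    have "\<forall>c\<in>Basis. \<exists>C. \<forall>q w. norm (?J b c (q, w)) \<le> C * bracket q powr K * decay w"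
      using dec_bound[OF J[OF b]] by blast
    from bchoice[OF this] obtain C where C: "\<And>c q w. c \<in> Basis \<Longrightarrow> norm (?J b c (q, w)) \<le> C c * bracket q powr K * decay w"
      by blast
    obtain r M where r: "r > 0" "\<And>q. q \<in> ball \<eta> r \<Longrightarrow> \<bar>bracket q powr K\<bar> \<le> M"
      using loc_bdd_continuous[OF continuous_decay_bracket[of UNIV K]] unfolding loc_bdd_def by metis
    define C' where "C' = (\<Sum>c\<in>(Basis::'v set). \<bar>C c\<bar>)"
    have CC: "\<bar>C c\<bar> \<le> C'" if "c \<in> Basis" for c
      unfolding C'_def using that by (intro member_le_sum) auto
    have "((\<lambda>\<eta>. LINT y|lborel. ?E \<eta> y * G b (\<eta>, y)) has_derivative
        (\<lambda>h. \<Sum>c\<in>Basis. (h \<bullet> c) *\<^sub>R (LINT y|lborel. ?E \<eta> y * ?J b c (\<eta>, y)))) (at \<eta>)"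
    proof (rule has_derivative_integral[where r = r and g = "\<lambda>y. C' * M * decay y"])
      show "integrable lborel (\<lambda>y. ?E q y * G b (q, y))" for q
        unfolding EP mult.assoc by (intro integrable_mult_right dec_integrable[OF G[OF b]])
      have "(\<lambda>y. ?P \<eta> * (exp (- \<i> * complex_of_real (y \<bullet> (\<eta> - \<xi>))) * ?J b c (\<eta>, y))) \<in> borel_measurable borel" if "c \<in> Basis" for c
        by (intro borel_measurable_times borel_measurable_const FT_integrand_measurable[OF dec_smooth[OF J[OF b that]]])
      then show "(\<lambda>y. ?E \<eta> y * ?J b c (\<eta>, y)) \<in> borel_measurable lborel" if "c \<in> Basis" for c
        unfolding EP mult.assoc using that by simp
      show "((\<lambda>\<eta>. ?E \<eta> y * G b (\<eta>, y)) has_derivative (\<lambda>h. \<Sum>c\<in>Basis. (h \<bullet> c) *\<^sub>R (?E q y * ?J b c (q, y)))) (at q)" for q y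
      proof -
        have sp: "C_infinity (\<lambda>\<eta>. p \<eta> - y \<bullet> (\<eta> - \<xi>))" by (intro smooth_intros p)
        have sE: "C_infinity (\<lambda>\<eta>. ?E \<eta> y)" by (rule smooth_cis[OF sp])
        have sG: "C_infinity (\<lambda>\<eta>. G b (\<eta>, y))" by (rule smooth_section1[OF dec_smooth[OF G[OF b]]])
        have d: "(\<lambda>\<eta>. ?E \<eta> y * G b (\<eta>, y)) differentiable (at q)"
          by (intro smooth_differentiable smooth_mult sE sG)
        have "dir_deriv c (\<lambda>\<eta>. ?E \<eta> y * G b (\<eta>, y)) q = ?E q y * ?J b c (q, y)" for c
        proof -
          have "dir_deriv c (\<lambda>\<eta>. p \<eta> - y \<bullet> (\<eta> - \<xi>)) q = dir_deriv c p q - y \<bullet> c"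
            by (rule dir_deriv_eqI[of _ "\<lambda>h. dir_deriv h p q - y \<bullet> h"])
               (auto intro!: derivative_eq_intros has_derivative_dir_deriv smooth_differentiable[OF p])
          then have "dir_deriv c (\<lambda>\<eta>. ?E \<eta> y) q = \<i> * complex_of_real (dir_deriv c p q - y \<bullet> c) * ?E q y"
            using dir_deriv_cis[OF smooth_differentiable[OF sp], of c q] by simp
          then show ?thesis
            by (subst dir_deriv_bilinear[OF bounded_bilinear_mult smooth_differentiable[OF sE] smooth_differentiable[OF sG]])
               (simp add: dir_deriv_section1 distrib_left mult_ac)
        qed
        then have "(\<lambda>h. dir_deriv h (\<lambda>\<eta>. ?E \<eta> y * G b (\<eta>, y)) q) = (\<lambda>h. \<Sum>c\<in>Basis. (h \<bullet> c) *\<^sub>R (?E q y * ?J b c (q, y)))"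
          by (intro ext, subst dir_deriv_Basis[OF d]) simp
        then show ?thesis using has_derivative_dir_deriv[OF d] by simp
      qed
      show "norm (?E q y * ?J b c (q, y)) \<le> C' * M * decay y" if q: "q \<in> ball \<eta> r" and c: "c \<in> Basis" for q y c
      proof -
        have "norm (?E q y * ?J b c (q, y)) = norm (?J b c (q, y))" by (simp only: norm_mult norm_exp_i mult_1)
        also have "\<dots> \<le> C c * bracket q powr K * decay y" by (rule C[OF c])
        also have "\<dots> \<le> C' * M * decay y"
        proof (rule mult_right_mono)
          have "C c * bracket q powr K \<le> \<bar>C c\<bar> * \<bar>bracket q powr K\<bar>" by (simp add: mult_right_mono)
          also have "\<dots> \<le> C' * M" using CC[OF c] r(2)[OF q] by (intro mult_mono) (auto simp: C'_def sum_nonneg)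
          finally show "C c * bracket q powr K \<le> C' * M" .
        qed simp
        finally show ?thesis .
      qed
      show "integrable lborel (\<lambda>y::'v. C' * M * decay y)" by (intro integrable_mult_right integrable_decay)
    qed (rule r)
    then show ?thesis
      unfolding K'_def using EFT[OF G[OF b]] EFT[OF J[OF b]] by simp
  qed
  have DK: "dir_deriv b (K' b) = (\<lambda>\<eta>. ?P \<eta> * FT (?J b b) \<eta> (\<eta> - \<xi>))" if b: "b \<in> Basis" for b
  proof
    fix \<eta>
    have "dir_deriv b (K' b) \<eta> = (\<Sum>c\<in>Basis. (b \<bullet> c) *\<^sub>R (?P \<eta> * FT (?J b c) \<eta> (\<eta> - \<xi>)))"
      by (rule dir_deriv_eqI[OF D[OF b]])
    also have "\<dots> = (\<Sum>c\<in>Basis. if b = c then ?P \<eta> * FT (?J b c) \<eta> (\<eta> - \<xi>) else 0)"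
      using b by (intro sum.cong) (auto simp: inner_Basis)
    finally show "dir_deriv b (K' b) \<eta> = ?P \<eta> * FT (?J b b) \<eta> (\<eta> - \<xi>)" using b by simp
  qed
  have Z: "(LINT \<eta>|lborel. ?P \<eta> * FT (?J b b) \<eta> (\<eta> - \<xi>)) = 0" if b: "b \<in> Basis" for b
  proof -
    have "integral\<^sup>L lborel (dir_deriv b (K' b)) = 0"
    proof (rule integral_dir_deriv_eq_0)
      show "K' b differentiable (at \<eta>)" for \<eta> using D[OF b] by (auto simp: differentiable_def)
      show "continuous_on UNIV (dir_deriv b (K' b))"
        unfolding DK[OF b]
        by (intro continuous_on_mult P FT_continuous[OF J[OF b b]] loc_bdd_continuous continuous_decay_bracket continuous_intros)
      show "integrable lborel (K' b)" unfolding K'_def by (rule FT_shift_integrable[OF G[OF b] P])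
      show "integrable lborel (dir_deriv b (K' b))" unfolding DK[OF b] by (rule FT_shift_integrable[OF J[OF b b] P])
    qed
    then show ?thesis unfolding DK[OF b] .
  qed
  have "FT (\<lambda>z. \<Sum>b\<in>Basis. ?N b z) \<eta> (\<eta> - \<xi>) = (\<Sum>b\<in>Basis. - \<i> * FT (?J b b) \<eta> (\<eta> - \<xi>))" for \<eta>
  proof -
    have "(\<lambda>z. \<Sum>b\<in>Basis. ?N b z) = (\<lambda>z. \<Sum>b\<in>Basis. - \<i> * ?J b b z)"
      by (intro ext sum.cong refl) (simp add: algebra_simps)
    then show ?thesis by (simp only: FT_sum_mult[OF J])
  qed
  then have "(LINT \<eta>|lborel. ?P \<eta> * FT (\<lambda>z. \<Sum>b\<in>Basis. ?N b z) \<eta> (\<eta> - \<xi>)) =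
      (LINT \<eta>|lborel. (\<Sum>b\<in>Basis. - \<i> * (?P \<eta> * FT (?J b b) \<eta> (\<eta> - \<xi>))))"
    by (simp only: sum_distrib_left mult_ac)
  also have "\<dots> = (\<Sum>b\<in>Basis. - \<i> * (LINT \<eta>|lborel. ?P \<eta> * FT (?J b b) \<eta> (\<eta> - \<xi>)))"
  proof (subst Bochner_Integration.integral_sum)
    show "integrable lborel (\<lambda>\<eta>. - \<i> * (?P \<eta> * FT (?J b b) \<eta> (\<eta> - \<xi>)))" if "b \<in> Basis" for b
      by (intro integrable_mult_right FT_shift_integrable[OF J P] that)
  qed (simp only: integral_mult_right_zero)
  also have "\<dots> = 0" using Z by simp
  finally show ?thesis .
qed

section \<open>Schwartz functions and their Fourier transforms\<close>

lemma bracket_power_le: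
  fixes x :: "real^'n::finite"
  shows "bracket x ^ N \<le> (real CARD('n) + 1) ^ N * (1 + (\<Sum>i\<in>UNIV. \<bar>x $ i\<bar> ^ N))"
proof -
  define m where "m = Max (insert 1 ((\<lambda>i. \<bar>x $ i\<bar>) ` UNIV))"
  have mi: "\<bar>x $ i\<bar> \<le> m" for i unfolding m_def by (intro Max_ge) auto
  have m1: "1 \<le> m" unfolding m_def by (intro Max_ge) auto
  have "m \<in> insert 1 ((\<lambda>i. \<bar>x $ i\<bar>) ` UNIV)" unfolding m_def by (intro Max_in) auto
  then have mN: "m ^ N \<le> 1 + (\<Sum>i\<in>UNIV. \<bar>x $ i\<bar> ^ N)"
  proof
    assume "m = 1" then show ?thesis by (simp add: sum_nonneg)
  next
    assume "m \<in> (\<lambda>i. \<bar>x $ i\<bar>) ` UNIV"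
    then obtain i where "m = \<bar>x $ i\<bar>" by auto
    moreover have "\<bar>x $ i\<bar> ^ N \<le> (\<Sum>i\<in>UNIV. \<bar>x $ i\<bar> ^ N)" by (rule member_le_sum) auto
    ultimately show ?thesis by simp
  qed
  have "bracket x \<le> 1 + (\<Sum>i\<in>UNIV. \<bar>x $ i\<bar>)"
    using bracket_le_norm[of x] norm_le_l1_cart[of x] by simp
  also have "\<dots> \<le> m + (\<Sum>i\<in>(UNIV::'n set). m)" using m1 mi by (intro add_mono sum_mono) auto
  also have "\<dots> = (real CARD('n) + 1) * m" by (simp add: algebra_simps)
  finally have "bracket x ^ N \<le> ((real CARD('n) + 1) * m) ^ N" by (intro power_mono) auto
  also have "\<dots> \<le> (real CARD('n) + 1) ^ N * (1 + (\<Sum>i\<in>UNIV. \<bar>x $ i\<bar> ^ N))"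
    unfolding power_mult_distrib using mN by (intro mult_left_mono) auto
  finally show ?thesis .
qed

text \<open>Of the seminorms only those with a pure power x_i^N or with no power enter, since <x>^N
  is dominated by a multiple of 1 plus the sum of all |x_i|^N.\<close>

lemma schwartz_symb:
  fixes u :: "real^'n::finite \<Rightarrow> complex"
  assumes u: "schwartz u"
  shows "symb Basis (\<lambda>_ _. 1) (\<lambda>y. bracket y powr (- real N)) u"
  unfolding symb_list_iff
proof (intro conjI allI impI)
  show s: "C_infinity u" using u by (simp add: schwartz_def)
  fix ds :: "(real^'n) list" assume "set ds \<subseteq> Basis"
  then obtain \<beta> where \<beta>: "mset ds = mset (mi_dirs \<beta>)" using mi_dirs_ex by blast
  have eq: "dir_derivs ds u = mi_deriv \<beta> u"
    by (simp only: mi_deriv_dirs dir_derivs_mset[OF s \<beta>])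
  have S: "\<exists>C. \<forall>x. norm ((\<Prod>i\<in>UNIV. (x $ i) ^ \<alpha> i) *\<^sub>R mi_deriv \<beta> u x) \<le> C" for \<alpha>
    using u unfolding schwartz_def by blast
  obtain C0 where C0: "\<And>x. norm (mi_deriv \<beta> u x) \<le> C0" using S[of "\<lambda>_. 0"] by auto
  have "\<exists>C. \<forall>x. \<bar>x $ i\<bar> ^ N * norm (mi_deriv \<beta> u x) \<le> C" for i
  proof -
    have "(\<Prod>j\<in>UNIV. (x $ j) ^ (if j = i then N else 0)) = (x $ i) ^ N" for x :: "real^'n"
    proof -
      have "(\<Prod>j\<in>UNIV. (x $ j) ^ (if j = i then N else 0)) = (\<Prod>j\<in>UNIV. if j = i then (x $ j) ^ N else 1)"
        by (intro prod.cong) auto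
      then show ?thesis by (simp add: prod.delta)
    qed
    then show ?thesis using S[of "\<lambda>j. if j = i then N else 0"] by (simp add: power_abs)
  qed
  then obtain C where C: "\<And>i x. \<bar>x $ i\<bar> ^ N * norm (mi_deriv \<beta> u x) \<le> C i" by metis
  let ?c = "(real CARD('n) + 1) ^ N"
  have "norm (mi_deriv \<beta> u x) \<le> ?c * (C0 + (\<Sum>i\<in>UNIV. C i)) * bracket x powr (- real N)" for x
  proof -
    have "bracket x ^ N * norm (mi_deriv \<beta> u x) \<le> ?c * (1 + (\<Sum>i\<in>UNIV. \<bar>x $ i\<bar> ^ N)) * norm (mi_deriv \<beta> u x)"
      using bracket_power_le by (intro mult_right_mono) auto
    also have "\<dots> = ?c * (norm (mi_deriv \<beta> u x) + (\<Sum>i\<in>UNIV. \<bar>x $ i\<bar> ^ N * norm (mi_deriv \<beta> u x)))"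
      by (simp add: distrib_left distrib_right sum_distrib_right mult.assoc)
    also have "\<dots> \<le> ?c * (C0 + (\<Sum>i\<in>UNIV. C i))"
      using C0[of x] C by (intro mult_left_mono add_mono sum_mono) auto
    finally have "norm (mi_deriv \<beta> u x) \<le> ?c * (C0 + (\<Sum>i\<in>UNIV. C i)) / bracket x ^ N"
      by (subst pos_le_divide_eq) (auto simp: bracket_pos mult.commute)
    then show ?thesis by (simp add: powr_minus powr_realpow bracket_pos divide_inverse)
  qed
  then show "\<exists>C. \<forall>z. norm (dir_derivs ds u z) \<le> C * (bracket z powr (- real N) * (\<Prod>d\<leftarrow>ds. 1))"
    by (auto simp: eq map_replicate_const prod_list_replicate)
qed

lemma dec_fourier:
  fixes u :: "real^'n::finite \<Rightarrow> complex"
  assumes u: "schwartz u"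
  shows "dec (\<lambda>_. 1) (\<lambda>_. 1) (\<lambda>z::(real^'n) \<times> (real^'n). u (snd z))"
  unfolding dec_def
proof -
  have "symb (Pair 0 ` Basis) (\<lambda>_ _. 1) (\<lambda>z::(real^'n) \<times> (real^'n). bracket (snd z) powr (- real (2 * DIM(real^'n)))) (\<lambda>z. u (snd z))"
    by (rule symb_affine[OF schwartz_symb[OF u], where L = snd]) (auto intro!: smooth_intros)
  then show "symb (Pair 0 ` Basis) (\<lambda>_ _. 1) (\<lambda>z::(real^'n) \<times> (real^'n). 1 * decay (snd z)) (\<lambda>z. u (snd z))" by simp
qed

lemma fourier_FT: "fourier u \<xi> = FT (\<lambda>z::(real^'n::finite) \<times> (real^'n). u (snd z)) q \<xi>"
  by (simp add: fourier_def FT_def)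

lemma fourier_decay:
  assumes u: "schwartz u"
  shows "\<exists>C\<ge>0. \<forall>\<xi>. norm (fourier u \<xi>) \<le> C * bracket \<xi> powr (- r)"
proof -
  obtain l :: nat where l: "2 * real l \<ge> r" using real_arch_simple[of "r / 2"] by (auto simp: field_simps)
  have "\<exists>C. \<forall>q \<theta>. norm (FT (\<lambda>z::(real^'a) \<times> (real^'a). u (snd z)) q \<theta>) \<le> C * 1 * 1 ^ (2 * l) * bracket \<theta> powr (- 2 * real l)"
    by (rule FT_decay[OF dec_fourier[OF u]]) auto
  then obtain C where C: "\<And>\<xi>. norm (fourier u \<xi>) \<le> C * bracket \<xi> powr (- 2 * real l)"
    unfolding fourier_FT[of u _ 0] by auto
  have "norm (fourier u \<xi>) \<le> \<bar>C\<bar> * bracket \<xi> powr (- r)" for \<xi>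
  proof -
    have "C * bracket \<xi> powr (- 2 * real l) \<le> \<bar>C\<bar> * bracket \<xi> powr (- r)"
      using l bracket_ge_1[of \<xi>] by (intro mult_mono powr_mono) auto
    then show ?thesis using C[of \<xi>] by linarith
  qed
  then show ?thesis by (intro exI[of _ "\<bar>C\<bar>"]) auto
qed

lemma fourier_measurable: 
  assumes u: "schwartz u" shows "fourier u \<in> borel_measurable borel"
  using FT_measurable[OF dec_smooth[OF dec_fourier[OF u]] continuous_on_const[of _ 0] continuous_on_id]
  by (simp add: fourier_FT[of u _ 0, abs_def])

lemma schwartz_inversion:
  fixes u :: "real^'n::finite \<Rightarrow> complex"
  assumes u: "schwartz u"
  shows "(LINT \<xi>|lborel. exp (\<i> * complex_of_real (y \<bullet> \<xi>)) * fourier u \<xi>) = complex_of_real ((2 * pi) ^ CARD('n)) * u y"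
proof -
  have s: "C_infinity u" using u by (simp add: schwartz_def)
  obtain C where C: "\<And>y. norm (u y) \<le> C * bracket y powr (- real 0)" using symb_bound[OF schwartz_symb[OF u, of 0]] by blast
  obtain C' where C': "\<And>\<xi>. norm (fourier u \<xi>) \<le> C' * bracket \<xi> powr (- (2 * real DIM(real^'n)))"
    using fourier_decay[OF u] by blast
  have "(LINT \<xi>|lborel. exp (\<i> * complex_of_real (y \<bullet> \<xi>)) * fourier u \<xi>) = complex_of_real ((2 * pi) ^ DIM(real^'n)) * u y"
  proof (rule fourier_inversion[where B = C])
    show "norm (u w) \<le> C" for w using C[of w] by simp
    show "integrable lborel u" using dec_integrable0[OF dec_fourier[OF u], of 0] by simp
    show "integrable lborel (fourier u)"
      using C' by (intro integrable_by_decay[of _ C'] fourier_measurable u) simp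
  qed (auto simp: fourier_def smooth_continuous[OF s])
  then show ?thesis by simp
qed

text \<open>Express u by its Fourier transform inside the y-integral and exchange integrations
  twice, first y with \<xi>, then \<eta> with \<xi>. An operator acting on u becomes a kernel acting
  on \<open>fourier\<close> u.\<close>

lemma FT_schwartz_swap:
  fixes B :: "(real^'n::finite) \<times> (real^'n) \<Rightarrow> complex"
  assumes B: "poly_dec K B" and u: "schwartz u" and P: "continuous_on UNIV P" "\<And>\<eta>. norm (P \<eta>) \<le> 1"
  shows "complex_of_real ((2 * pi) ^ CARD('n)) * (LINT \<eta>|lborel. P \<eta> * FT (\<lambda>z. B z * u (snd z)) \<eta> \<eta>) =
    (LINT \<xi>|lborel. fourier u \<xi> * (LINT \<eta>|lborel. P \<eta> * FT B \<eta> (\<eta> - \<xi>)))"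
proof -
  note [measurable] = fourier_measurable[OF u]
  note sB = dec_smooth[OF B]
  obtain CB where CB: "\<And>q w. norm (B (q, w)) \<le> CB * bracket q powr K * decay w" using dec_bound[OF B] by blast
  obtain C L where C: "C \<ge> 0" "\<And>\<eta> \<xi>. norm (FT B \<eta> (\<eta> - \<xi>)) \<le> C * bracket \<eta> powr (- (2 * real DIM(real^'n))) * bracket \<xi> powr L"
    using FT_shift_bound[OF B] by metis
  obtain C1 where C1: "\<And>\<xi>. norm (fourier u \<xi>) \<le> C1 * bracket \<xi> powr (- (2 * real DIM(real^'n)))"
    using fourier_decay[OF u] by blast
  \<comment> \<open>The second exchange meets the growth <\<xi>>^L of \<open>FT_shift_bound\<close>,
    so L more powers of decay are requested.\<close>
  obtain C2 where C2: "\<And>\<xi>. norm (fourier u \<xi>) \<le> C2 * bracket \<xi> powr (- (2 * real DIM(real^'n) + L))"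
    using fourier_decay[OF u] by blast
  have inner: "complex_of_real ((2 * pi) ^ CARD('n)) * FT (\<lambda>z. B z * u (snd z)) \<eta> \<eta> =
      (LINT \<xi>|lborel. fourier u \<xi> * FT B \<eta> (\<eta> - \<xi>))" for \<eta>
  proof -
    let ?F = "\<lambda>y \<xi>. exp (- \<i> * complex_of_real (y \<bullet> (\<eta> - \<xi>))) * B (\<eta>, y) * fourier u \<xi>"
    have "complex_of_real ((2 * pi) ^ CARD('n)) * FT (\<lambda>z. B z * u (snd z)) \<eta> \<eta> =
        (LINT y|lborel. exp (- \<i> * complex_of_real (y \<bullet> \<eta>)) * B (\<eta>, y) * (complex_of_real ((2 * pi) ^ CARD('n)) * u y))"
      unfolding FT_def by (subst integral_mult_right_zero[symmetric]) (simp add: mult_ac)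
    also have "\<dots> = (LINT y|lborel. LINT \<xi>|lborel. ?F y \<xi>)"
    proof (intro Bochner_Integration.integral_cong refl)
      fix y :: "real^'n"
      have "exp (- \<i> * complex_of_real (y \<bullet> \<eta>)) * B (\<eta>, y) * (complex_of_real ((2 * pi) ^ CARD('n)) * u y) =
          (LINT \<xi>|lborel. exp (- \<i> * complex_of_real (y \<bullet> \<eta>)) * B (\<eta>, y) * (exp (\<i> * complex_of_real (y \<bullet> \<xi>)) * fourier u \<xi>))"
        by (simp only: schwartz_inversion[OF u, symmetric] integral_mult_right_zero)
      also have "\<dots> = (LINT \<xi>|lborel. ?F y \<xi>)"
        by (intro Bochner_Integration.integral_cong refl)
           (simp add: inner_diff_right right_diff_distrib exp_diff exp_minus field_simps)
      finally show "exp (- \<i> * complex_of_real (y \<bullet> \<eta>)) * B (\<eta>, y) * (complex_of_real ((2 * pi) ^ CARD('n)) * u y) =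
          (LINT \<xi>|lborel. ?F y \<xi>)" .
    qed
    also have "\<dots> = (LINT \<xi>|lborel. LINT y|lborel. ?F y \<xi>)"
    proof (rule lborel_Fubini_swap[where f = "\<lambda>y. CB * bracket \<eta> powr K * decay y" and g = "\<lambda>\<xi>. C1 * decay \<xi>"])
      have "(\<lambda>z::(real^'n) \<times> (real^'n). exp (- \<i> * complex_of_real (fst z \<bullet> (\<eta> - snd z))) * B (\<eta>, fst z)) \<in> borel_measurable borel"
        by (intro borel_measurable_continuous_onI continuous_intros continuous_on_compose2[OF smooth_continuous[OF sB, of UNIV]]) auto
      moreover have "(\<lambda>z::(real^'n) \<times> (real^'n). fourier u (snd z)) \<in> borel_measurable borel"
        by (rule measurable_compose[OF _ fourier_measurable[OF u]])
           (intro borel_measurable_continuous_onI continuous_intros)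
      ultimately show "(\<lambda>z. ?F (fst z) (snd z)) \<in> borel_measurable borel" by (rule borel_measurable_times)
      show "norm (?F y \<xi>) \<le> CB * bracket \<eta> powr K * decay y * (C1 * decay \<xi>)" for y \<xi>
        using mult_mono'[OF CB[of \<eta> y] C1[of \<xi>]] by (simp add: norm_mult)
    qed (intro integrable_mult_right integrable_decay)+
    also have "\<dots> = (LINT \<xi>|lborel. fourier u \<xi> * FT B \<eta> (\<eta> - \<xi>))"
      unfolding FT_def by (simp add: mult.commute)
    finally show ?thesis .
  qed
  have "complex_of_real ((2 * pi) ^ CARD('n)) * (LINT \<eta>|lborel. P \<eta> * FT (\<lambda>z. B z * u (snd z)) \<eta> \<eta>) =
      (LINT \<eta>|lborel. P \<eta> * (complex_of_real ((2 * pi) ^ CARD('n)) * FT (\<lambda>z. B z * u (snd z)) \<eta> \<eta>))"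
    by (subst integral_mult_right_zero[symmetric]) (simp only: mult_ac)
  also have "\<dots> = (LINT \<eta>|lborel. LINT \<xi>|lborel. fourier u \<xi> * (P \<eta> * FT B \<eta> (\<eta> - \<xi>)))"
    unfolding inner integral_mult_right_zero[symmetric] by (simp only: mult_ac)
  also have "\<dots> = (LINT \<xi>|lborel. LINT \<eta>|lborel. fourier u \<xi> * (P \<eta> * FT B \<eta> (\<eta> - \<xi>)))"
  proof (rule lborel_Fubini_swap[where f = "\<lambda>\<eta>. C * decay \<eta>" and g = "\<lambda>\<xi>. C2 * decay \<xi>"])
    have [measurable]: "(\<lambda>z::(real^'n) \<times> (real^'n). fourier u (snd z)) \<in> borel_measurable borel"
      by (rule measurable_compose[OF _ fourier_measurable[OF u]])
         (intro borel_measurable_continuous_onI continuous_intros)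
    have [measurable]: "(\<lambda>z::(real^'n) \<times> (real^'n). P (fst z)) \<in> borel_measurable borel"
      by (intro borel_measurable_continuous_onI continuous_on_compose2[OF P(1)] continuous_intros) auto
    have [measurable]: "(\<lambda>z::(real^'n) \<times> (real^'n). FT B (fst z) (fst z - snd z)) \<in> borel_measurable borel"
      by (intro FT_measurable sB continuous_intros)
    show "(\<lambda>z. fourier u (snd z) * (P (fst z) * FT B (fst z) (fst z - snd z))) \<in> borel_measurable borel"
      by measurable
    show "norm (fourier u \<xi> * (P \<eta> * FT B \<eta> (\<eta> - \<xi>))) \<le> C * decay \<eta> * (C2 * decay \<xi>)" for \<eta> \<xi>
    proof -
      have "norm (fourier u \<xi> * (P \<eta> * FT B \<eta> (\<eta> - \<xi>))) \<le> (C2 * bracket \<xi> powr (- (2 * real DIM(real^'n) + L))) *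
          (1 * (C * bracket \<eta> powr (- (2 * real DIM(real^'n))) * bracket \<xi> powr L))"
        unfolding norm_mult using C2[of \<xi>] C(2)[of \<eta> \<xi>] P(2)[of \<eta>]
        by (intro mult_mono) (auto intro: order_trans[OF norm_ge_zero])
      also have "\<dots> = (C * decay \<eta>) * (C2 * (bracket \<xi> powr (- (2 * real DIM(real^'n) + L)) * bracket \<xi> powr L))"
        by (simp add: mult_ac)
      also have "bracket \<xi> powr (- (2 * real DIM(real^'n) + L)) * bracket \<xi> powr L = decay \<xi>"
        by (simp add: powr_add[symmetric])
      finally show ?thesis .
    qed
  qed (intro integrable_mult_right integrable_decay)+
  finally show ?thesis by simp
qed

section \<open>Integration by parts and change of variables for fixed x\<close>

context fio_data
begin

text \<open>Freezes x and puts \<eta> before y, because \<open>FT\<close> integrates over the second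
  component and treats the first as parameter.\<close>

definition sec :: "real^'n \<Rightarrow> ((real^'n) \<times> (real^'n) \<times> (real^'n) \<Rightarrow> complex) \<Rightarrow> (real^'n) \<times> (real^'n) \<Rightarrow> complex"
  where "sec x B z = B (x, snd z, fst z)"

definition phase :: "real^'n \<Rightarrow> real^'n \<Rightarrow> complex"
  where "phase x \<eta> = exp (\<i> * complex_of_real (ph (x, \<eta>)))"

lemma phase_continuous: "continuous_on UNIV (phase x)" and norm_phase [simp]: "norm (phase x \<eta>) = 1"
  by (auto simp: phase_def[abs_def] intro!: continuous_intros continuous_section[OF smooth_of_real[OF smooth_ph], where S=UNIV])

lemma smooth_sec: "C_infinity B \<Longrightarrow> C_infinity (sec x B)"
  unfolding sec_def[abs_def] by (rule smooth_compose[of B]) (assumption, intro smooth_intros)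

lemma dir_deriv_sec: "dir_deriv (c, 0) (sec x B) = sec x (dir_deriv (0, 0, c) B)"
  unfolding sec_def[abs_def] by (rule dir_deriv_affine_map) simp

lemma symb_sec:
  assumes "symb Basis (\<lambda>_ _. 1) W B" "\<And>z. W z \<ge> 0"
  shows "symb (Pair 0 ` Basis) (\<lambda>_ _. 1) (\<lambda>z. W (x, snd z, fst z)) (sec x B)"
  unfolding sec_def[abs_def]
  by (rule symb_affine[OF assms(1), where L = "\<lambda>d. (0, snd d, fst d)"])
     (use assms(2) in \<open>auto intro!: smooth_intros simp: Basis_prod_def\<close>)

lemma dec_sec:
  assumes "symb Basis (\<lambda>_ _. 1) W B" "\<And>z. W z \<ge> 0"
    and "\<And>\<eta> y. W (x, y, \<eta>) \<le> C * (bracket \<eta> powr m3 * decay y)"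
  shows "poly_dec m3 (sec x B)"
  unfolding dec_def
  by (rule symb_weight_mono[OF symb_sec[OF assms(1,2)], of _ C]) (use assms(2,3) in auto)

text \<open>The factor u supplies the decay in y that an amplitude of order m2 lacks; N is chosen to
  beat m2 and leave - 2n.\<close>

lemma dec_sec_schwartz:
  assumes B: "symb Basis (\<lambda>_ _. 1) W B" "\<And>z. W z \<ge> 0" "\<And>z. W z \<le> wt3 z" and u: "schwartz u"
  shows "poly_dec m3 (\<lambda>z. sec x B z * u (snd z))"
proof -
  obtain N :: nat where N: "real N \<ge> m2 + 2 * real DIM(real^'n)" using real_arch_simple by blast
  have "symb (Pair 0 ` Basis) (\<lambda>_ _. 1) (\<lambda>z::(real^'n) \<times> (real^'n). bracket (snd z) powr (- real N)) (\<lambda>z. u (snd z))"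
    by (rule symb_affine[OF schwartz_symb[OF u], where L = snd]) (auto intro!: smooth_intros)
  from symb_mult[OF symb_sec[OF B(1,2)] this]
  have "symb (Pair 0 ` Basis) (\<lambda>_ _. 1) (\<lambda>z. W (x, snd z, fst z) * bracket (snd z) powr (- real N)) (\<lambda>z. sec x B z * u (snd z))" .
  then show ?thesis
    unfolding dec_def
  proof (rule symb_weight_mono)
    fix z :: "(real^'n) \<times> (real^'n)"
    have "W (x, snd z, fst z) * bracket (snd z) powr (- real N) \<le> wt3 (x, snd z, fst z) * bracket (snd z) powr (- real N)"
      by (intro mult_right_mono B) auto
    also have "\<dots> = bracket x powr m1 * (bracket (fst z) powr m3 * bracket (snd z) powr (m2 - real N))"
      by (simp add: wt3_def powr_diff powr_minus divide_inverse mult_ac)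
    also have "\<dots> \<le> bracket x powr m1 * (bracket (fst z) powr m3 * decay (snd z))"
      using N bracket_ge_1[of "snd z"] by (intro mult_left_mono powr_mono) auto
    finally show "W (x, snd z, fst z) * bracket (snd z) powr (- real N) \<le> bracket x powr m1 * (bracket (fst z) powr m3 * decay (snd z))" .
  qed (use B(2) in auto)
qed

lemma symb_am_near_1: "symb Basis (\<lambda>_ _. 1) (\<lambda>z. indicator {C1\<^sup>2 / 16..16 * C2\<^sup>2} (ratio z) * wt3 z) am_near"
  by (rule symb_1_mono[OF symb_am_near, of 1]) (auto simp: less_imp_le[OF wt3_pos])

lemma symb_am_1: "symb Basis (\<lambda>_ _. 1) wt3 am"
  by (rule symb_1_mono[OF symb_am, of 1]) (auto simp: less_imp_le[OF wt3_pos])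

lemma ind_wt3: "0 \<le> indicator A (ratio z) * wt3 z" "indicator A (ratio z) * wt3 z \<le> wt3 z"
  by (auto simp: indicator_def less_imp_le[OF wt3_pos])

text \<open>For fixed x the cutoff bounds <y>, so powers of <y> may be exchanged for constants that
  depend on x.\<close>

lemma dec_sec_am_near: "poly_dec m3 (sec x am_near)"
proof -
  define R where "R = max 1 (4 * C2 * bracket x)"
  define K where "K = max (1 powr m2) (R powr m2)"
  have K: "K > 0" by (simp add: K_def less_max_iff_disj)
  have "indicat_real {C1\<^sup>2 / 16..16 * C2\<^sup>2} (ratio (x, y, \<eta>)) * wt3 (x, y, \<eta>) \<le>
      (bracket x powr m1 * K * R powr (2 * real DIM(real^'n))) * (bracket \<eta> powr m3 * decay y)" for y \<eta>
  proof (cases "ratio (x, y, \<eta>) \<in> {C1\<^sup>2 / 16..16 * C2\<^sup>2}")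
    case True
    have "(bracket y)\<^sup>2 \<le> (4 * C2 * bracket x)\<^sup>2"
      using True bracket_pos[of x] by (simp add: ratio_def power_mult_distrib power_inverse divide_inverse[symmetric] pos_divide_le_eq)
    then have "bracket y \<le> 4 * C2 * bracket x" by (rule power2_le_imp_le) (use C2 in simp)
    then have y: "bracket y \<le> R" by (simp add: R_def)
    have 1: "bracket y powr m2 \<le> K" unfolding K_def using y bracket_ge_1[of y] by (intro powr_le_max) auto
    have "bracket y powr (2 * real DIM(real^'n)) \<le> R powr (2 * real DIM(real^'n))" using y by (intro powr_mono2) auto
    then have 2: "1 \<le> R powr (2 * real DIM(real^'n)) * decay y"
      using bracket_pos[of y] by (simp add: powr_minus divide_simps)
    have "wt3 (x, y, \<eta>) \<le> (bracket x powr m1 * K * bracket \<eta> powr m3) * 1"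
      using 1 by (simp add: wt3_def mult_right_mono mult_left_mono)
    also have "\<dots> \<le> (bracket x powr m1 * K * bracket \<eta> powr m3) * (R powr (2 * real DIM(real^'n)) * decay y)"
      using 2 K by (intro mult_left_mono) auto
    finally show ?thesis using True by (simp add: mult_ac)
  next
    case False
    then show ?thesis using K by (simp add: R_def)
  qed
  then show ?thesis by (rule dec_sec[OF symb_am_near_1 ind_wt3(1)])
qed

lemma rho_ge_1: "rho z \<ge> 1" by (simp add: rho_def bracket_ge_1)

lemma inverse_rho: "0 \<le> inverse (rho z)" "inverse (rho z) \<le> 1"
  using rho_ge_1[of z] rho_pos[of z] by (auto simp: inverse_le_1_iff less_imp_le)

definition wtk :: "nat \<Rightarrow> (real^'n) \<times> (real^'n) \<times> (real^'n) \<Rightarrow> real"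
  where "wtk k z = inverse (rho z) ^ k * wt3 z"

lemma wtk_nonneg: "wtk k z \<ge> 0" and wtk_le: "wtk k z \<le> wt3 z"
  unfolding wtk_def using inverse_rho[of z] wt3_pos[of z]
  by (auto intro!: mult_left_le_one_le power_le_one mult_nonneg_nonneg simp del: power_inverse)

lemma inverse_rho_wtk: "inverse (rho z) * wtk k z \<le> wtk k z"
  by (rule mult_left_le_one_le[OF wtk_nonneg inverse_rho])

lemma symb_Lk_wtk: "symb Basis (\<lambda>_ _. 1) (wtk k) (Lk k)"
  using symb_Lk by (simp add: wtk_def[abs_def])

lemma symb_VB_Lk:
  assumes b: "b \<in> Basis"
  shows "symb Basis (\<lambda>_ _. 1) (wtk k) (VB b (Lk k))"
    and "c \<in> Basis \<Longrightarrow> symb Basis (\<lambda>_ _. 1) (wtk k) (dir_deriv (0, 0, c) (VB b (Lk k)))"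
    and "c \<in> Basis \<Longrightarrow> symb Basis (\<lambda>_ _. 1) (wtk k) (\<lambda>z. complex_of_real (Fb c z) * VB b (Lk k) z)"
proof -
  have V: "symb Basis (\<lambda>_ _. 1) (\<lambda>z. inverse (rho z) * wtk k z) (VB b (Lk k))"
    by (rule symb_VB[OF symb_Lk_wtk b])
  show V': "symb Basis (\<lambda>_ _. 1) (wtk k) (VB b (Lk k))"
    by (rule symb_weight_mono[OF V, of 1]) (simp_all add: inverse_rho_wtk wtk_nonneg mult_nonneg_nonneg[OF inverse_rho(1) wtk_nonneg])
  show "symb Basis (\<lambda>_ _. 1) (wtk k) (dir_deriv (0, 0, c) (VB b (Lk k)))" if "c \<in> Basis"
  proof -
    have "(0, 0, c) \<in> (Basis :: ((real^'n) \<times> (real^'n) \<times> (real^'n)) set)" using that by (simp add: Basis_prod_def)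
    from symb_dir_deriv[OF V' this] show ?thesis by simp
  qed
  show "symb Basis (\<lambda>_ _. 1) (wtk k) (\<lambda>z. complex_of_real (Fb c z) * VB b (Lk k) z)" if "c \<in> Basis"
  proof -
    have "symb Basis (\<lambda>_ _. 1) (\<lambda>z. rho z * (inverse (rho z) * wtk k z)) (\<lambda>z. complex_of_real (Fb c z) * VB b (Lk k) z)"
      by (intro symb_mult symb_of_real symb_Fb V that)
    moreover have "rho z * (inverse (rho z) * wtk k z) = wtk k z" for z using rho_pos[of z] by simp
    ultimately show ?thesis by (simp only:)
  qed
qed

lemma wtk_decay: "\<exists>k0. \<forall>k\<ge>k0. \<forall>x y \<eta>. wtk k (x, y, \<eta>) \<le> bracket x powr m1 * (bracket \<eta> powr m3 * decay y)"
proof -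
  obtain k0 where k0: "\<And>k z. k \<ge> k0 \<Longrightarrow> inverse (rho z) ^ k * bracket (fst (snd z)) powr m2 \<le>
      bracket (fst z) powr (m2 - m2) * bracket (fst (snd z)) powr (- (2 * real DIM(real^'n)))"
    using rho_weight by blast
  have "wtk k (x, y, \<eta>) \<le> bracket x powr m1 * (bracket \<eta> powr m3 * decay y)" if "k \<ge> k0" for k x y \<eta>
  proof -
    have "wtk k (x, y, \<eta>) = (bracket x powr m1 * bracket \<eta> powr m3) * (inverse (rho (x, y, \<eta>)) ^ k * bracket y powr m2)"
      by (simp add: wtk_def wt3_def mult_ac)
    also have "\<dots> \<le> (bracket x powr m1 * bracket \<eta> powr m3) * decay y"
      using k0[OF that, of "(x, y, \<eta>)"] by (intro mult_left_mono) auto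
    finally show ?thesis by (simp add: mult_ac)
  qed
  then show ?thesis by blast
qed

lemma dir_deriv_fst_mult:
  assumes "C_infinity B" "C_infinity v"
  shows "dir_deriv (c, 0) (\<lambda>z. B z * v (snd z)) = (\<lambda>z::(real^'n) \<times> (real^'n). dir_deriv (c, 0) B z * (v (snd z) :: complex))"
proof
  fix z :: "(real^'n) \<times> (real^'n)"
  have v: "C_infinity (\<lambda>z::(real^'n) \<times> (real^'n). v (snd z))"
    by (rule smooth_compose[OF assms(2)]) (intro smooth_intros)
  have "dir_deriv (c, 0) (\<lambda>z::(real^'n) \<times> (real^'n). v (snd z)) z = 0" by (simp add: dir_deriv_def)
  then show "dir_deriv (c, 0) (\<lambda>z. B z * v (snd z)) z = dir_deriv (c, 0) B z * v (snd z)"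
    by (subst dir_deriv_bilinear[OF bounded_bilinear_mult smooth_differentiable[OF assms(1)] smooth_differentiable[OF v]]) simp
qed

text \<open>The factor v serves two purposes: v = u with \<xi> = 0 for the operator applied to u,
  and v = 1 with any \<xi> for the kernel. \<open>integral_phase_divergence\<close> is applied to
  the field V times \<open>Lk\<close> k times v; its product with F restores \<open>Lk\<close> k by
  \<open>Lk_VF\<close>, and its divergence yields \<open>Lk\<close> (Suc k).\<close>

lemma by_parts:
  assumes v: "C_infinity v"
    and dec: "\<And>B. symb Basis (\<lambda>_ _. 1) (wtk k) B \<Longrightarrow> poly_dec m3 (\<lambda>z. sec x B z * v (snd z))"
    and dec': "poly_dec m3 (\<lambda>z. sec x (Lk (Suc k)) z * v (snd z))"
  shows "(LINT \<eta>|lborel. phase x \<eta> * FT (\<lambda>z. sec x (Lk k) z * v (snd z)) \<eta> (\<eta> - \<xi>)) =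
    (LINT \<eta>|lborel. phase x \<eta> * FT (\<lambda>z. sec x (Lk (Suc k)) z * v (snd z)) \<eta> (\<eta> - \<xi>))"
proof -
  let ?G = "\<lambda>b z. sec x (VB b (Lk k)) z * v (snd z)"
  let ?p = "\<lambda>\<eta>. ph (x, \<eta>)"
  have D: "dir_deriv (c, 0) (?G b) = (\<lambda>z. sec x (dir_deriv (0, 0, c) (VB b (Lk k))) z * v (snd z))" if "b \<in> Basis" for b c
    using dir_deriv_fst_mult[OF smooth_sec[OF symb_smooth[OF symb_VB_Lk(1)[OF that]]] v] by (simp add: dir_deriv_sec)
  have F: "dir_deriv c ?p (fst z) - snd z \<bullet> c = Fb c (x, snd z, fst z)" for c z
    by (simp add: Fb_def phd_def dir_deriv_section)
  have FG: "complex_of_real (dir_deriv c ?p (fst z) - snd z \<bullet> c) * ?G b z =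
      sec x (\<lambda>z. complex_of_real (Fb c z) * VB b (Lk k) z) z * v (snd z)" for b c z
    unfolding F by (simp add: sec_def)
  have eq: "(\<lambda>z. \<Sum>b\<in>Basis. complex_of_real (dir_deriv b ?p (fst z) - snd z \<bullet> b) * ?G b z - \<i> * dir_deriv (b, 0) (?G b) z) =
      (\<lambda>z. sec x (Lk k) z * v (snd z) - sec x (Lk (Suc k)) z * v (snd z))"
  proof
    fix z
    have "(\<Sum>b\<in>Basis. complex_of_real (dir_deriv b ?p (fst z) - snd z \<bullet> b) * ?G b z - \<i> * dir_deriv (b, 0) (?G b) z) =
        (\<Sum>b\<in>Basis. complex_of_real (Fb b (x, snd z, fst z)) * VB b (Lk k) (x, snd z, fst z)) * v (snd z) -
        \<i> * (\<Sum>b\<in>Basis. dir_deriv (0, 0, b) (VB b (Lk k)) (x, snd z, fst z)) * v (snd z)"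
    proof -
      have "(\<Sum>b\<in>Basis. complex_of_real (dir_deriv b ?p (fst z) - snd z \<bullet> b) * ?G b z - \<i> * dir_deriv (b, 0) (?G b) z) =
        (\<Sum>b\<in>Basis. complex_of_real (Fb b (x, snd z, fst z)) * VB b (Lk k) (x, snd z, fst z) * v (snd z) -
          \<i> * dir_deriv (0, 0, b) (VB b (Lk k)) (x, snd z, fst z) * v (snd z))"
        by (intro sum.cong refl, unfold FG, simp only: D) (simp only: sec_def mult.assoc)
      then show ?thesis by (simp only: sum_subtractf sum_distrib_left sum_distrib_right)
    qed
    then show "(\<Sum>b\<in>Basis. complex_of_real (dir_deriv b ?p (fst z) - snd z \<bullet> b) * ?G b z - \<i> * dir_deriv (b, 0) (?G b) z) =
        sec x (Lk k) z * v (snd z) - sec x (Lk (Suc k)) z * v (snd z)"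
      by (simp only: Lk_VF[symmetric]) (simp add: sec_def Lk_Suc Lop_def)
  qed
  have "(LINT \<eta>|lborel. exp (\<i> * complex_of_real (?p \<eta>)) *
    FT (\<lambda>z. \<Sum>b\<in>Basis. complex_of_real (dir_deriv b ?p (fst z) - snd z \<bullet> b) * ?G b z - \<i> * dir_deriv (b, 0) (?G b) z) \<eta> (\<eta> - \<xi>)) = 0"
  proof (rule integral_phase_divergence[where K = m3])
    show "C_infinity ?p" by (rule smooth_section[OF smooth_ph])
    show "poly_dec m3 (?G b)" if "b \<in> Basis" for b by (rule dec[OF symb_VB_Lk(1)[OF that]])
    show "poly_dec m3 (dir_deriv (c, 0) (?G b))" if "b \<in> Basis" "c \<in> Basis" for b c
      unfolding D[OF that(1)] by (rule dec[OF symb_VB_Lk(2)[OF that]])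
    show "poly_dec m3 (\<lambda>z. complex_of_real (dir_deriv c ?p (fst z) - snd z \<bullet> c) * ?G b z)" if "b \<in> Basis" "c \<in> Basis" for b c
      unfolding FG by (rule dec[OF symb_VB_Lk(3)[OF that]])
  qed
  then have 0: "(LINT \<eta>|lborel. phase x \<eta> * FT (\<lambda>z. sec x (Lk k) z * v (snd z) - sec x (Lk (Suc k)) z * v (snd z)) \<eta> (\<eta> - \<xi>)) = 0"
    unfolding eq phase_def .
  note d1 = dec[OF symb_Lk_wtk] and d2 = dec'
  have FTd: "FT (\<lambda>z. sec x (Lk k) z * v (snd z) - sec x (Lk (Suc k)) z * v (snd z)) \<eta> \<theta> =
      FT (\<lambda>z. sec x (Lk k) z * v (snd z)) \<eta> \<theta> - FT (\<lambda>z. sec x (Lk (Suc k)) z * v (snd z)) \<eta> \<theta>" for \<eta> \<theta>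
    using dec_integrable[OF d1] dec_integrable[OF d2] unfolding FT_def
    by (simp only: right_diff_distrib) (rule Bochner_Integration.integral_diff)
  have i: "integrable lborel (\<lambda>\<eta>. phase x \<eta> * FT B \<eta> (\<eta> - \<xi>))" if "poly_dec m3 B" for B
    by (rule FT_shift_integrable[OF that phase_continuous]) simp
  show ?thesis
    using 0 Bochner_Integration.integral_diff[OF i[OF d1] i[OF d2]]
    unfolding FTd right_diff_distrib by simp
qed

text \<open>With u as a factor every step is legitimate from k = 0 on, so the chain starts at
  \<open>am_far\<close> itself.\<close>

lemma by_parts_schwartz:
  assumes u: "schwartz u"
  shows "(LINT \<eta>|lborel. phase x \<eta> * FT (\<lambda>z. sec x am_far z * u (snd z)) \<eta> \<eta>) =
    (LINT \<eta>|lborel. phase x \<eta> * FT (\<lambda>z. sec x (Lk k) z * u (snd z)) \<eta> \<eta>)"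
proof (induction k)
  case (Suc k)
  have "(LINT \<eta>|lborel. phase x \<eta> * FT (\<lambda>z. sec x (Lk k) z * u (snd z)) \<eta> (\<eta> - 0)) =
    (LINT \<eta>|lborel. phase x \<eta> * FT (\<lambda>z. sec x (Lk (Suc k)) z * u (snd z)) \<eta> (\<eta> - 0))"
  proof (rule by_parts)
    show "C_infinity u" using u by (simp add: schwartz_def)
  qed (auto intro: dec_sec_schwartz[OF _ wtk_nonneg wtk_le u] symb_Lk_wtk)
  then show ?case using Suc by simp
qed (simp add: Lk_def)

lemma dec_sec_wtk: "\<exists>k0. \<forall>k\<ge>k0. \<forall>x B. symb Basis (\<lambda>_ _. 1) (wtk k) B \<longrightarrow> poly_dec m3 (sec x B)"
proof -
  obtain k0 where k0: "\<And>k x y \<eta>. k \<ge> k0 \<Longrightarrow> wtk k (x, y, \<eta>) \<le> bracket x powr m1 * (bracket \<eta> powr m3 * decay y)"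
    using wtk_decay by blast
  have "poly_dec m3 (sec x B)" if "k \<ge> k0" "symb Basis (\<lambda>_ _. 1) (wtk k) B" for k x B
    by (rule dec_sec[OF that(2) wtk_nonneg k0[OF that(1)]])
  then show ?thesis by blast
qed

text \<open>Without the factor u, large k secures the decay in y. From k0 on each integration by
  parts leaves the value unchanged, so k may be enlarged for every order of decay while the
  amplitude stays the same.\<close>

lemma dec_sec_Lk: "\<exists>k0. \<forall>k\<ge>k0. \<forall>x \<xi>. poly_dec m3 (sec x (Lk k)) \<and>
  (LINT \<eta>|lborel. phase x \<eta> * FT (sec x (Lk k)) \<eta> (\<eta> - \<xi>)) = (LINT \<eta>|lborel. phase x \<eta> * FT (sec x (Lk k0)) \<eta> (\<eta> - \<xi>))"
proof -
  obtain k0 where k0: "\<And>k x B. k \<ge> k0 \<Longrightarrow> symb Basis (\<lambda>_ _. 1) (wtk k) B \<Longrightarrow> poly_dec m3 (sec x B)"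
    using dec_sec_wtk by blast
  have step: "(LINT \<eta>|lborel. phase x \<eta> * FT (sec x (Lk k)) \<eta> (\<eta> - \<xi>)) = (LINT \<eta>|lborel. phase x \<eta> * FT (sec x (Lk (Suc k))) \<eta> (\<eta> - \<xi>))"
    if k: "k \<ge> k0" for k x \<xi>
    using by_parts[of "\<lambda>_. 1" k x \<xi>] k0[OF k] k0[of "Suc k", OF _ symb_Lk_wtk] k by (simp add: smooth_const)
  have "(LINT \<eta>|lborel. phase x \<eta> * FT (sec x (Lk k)) \<eta> (\<eta> - \<xi>)) = (LINT \<eta>|lborel. phase x \<eta> * FT (sec x (Lk k0)) \<eta> (\<eta> - \<xi>))"
    if "k \<ge> k0" for k x \<xi>
    using that by (induction k rule: dec_induct) (simp_all add: step[symmetric])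
  then show ?thesis using k0[OF _ symb_Lk_wtk] by blast
qed

lemma phase_H_far:
  "phase x \<xi> * osc_int (H_far k) (x, \<xi>) = (LINT \<eta>|lborel. phase x \<eta> * FT (sec x (Lk k)) \<eta> (\<eta> - \<xi>))"
proof -
  have "(LINT \<eta>|lborel. phase x \<eta> * FT (sec x (Lk k)) \<eta> (\<eta> - \<xi>)) =
      (LINT \<zeta>|lborel. phase x (\<zeta> + \<xi>) * FT (sec x (Lk k)) (\<zeta> + \<xi>) (\<zeta> + \<xi> - \<xi>))"
  proof (rule integral_lborel_translate[symmetric])
    have [measurable]: "phase x \<in> borel_measurable borel" by (intro borel_measurable_continuous_onI phase_continuous)
    have [measurable]: "(\<lambda>\<eta>. FT (sec x (Lk k)) \<eta> (\<eta> - \<xi>)) \<in> borel_measurable borel"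
      by (rule FT_shift_measurable[OF smooth_sec[OF symb_smooth[OF symb_Lk]]])
    show "(\<lambda>\<eta>. phase x \<eta> * FT (sec x (Lk k)) \<eta> (\<eta> - \<xi>)) \<in> borel_measurable borel" by measurable
  qed
  also have "\<dots> = (LINT \<zeta>|lborel. phase x \<xi> * FT (H_far k) ((x, \<xi>), \<zeta>) \<zeta>)"
  proof (intro Bochner_Integration.integral_cong refl)
    fix \<zeta> :: "real^'n"
    have ph: "phase x (\<zeta> + \<xi>) = phase x \<xi> * exp (\<i> * complex_of_real (phase_far ((x, \<xi>), \<zeta>)))"
      by (simp add: phase_def phase_far_def exp_add[symmetric] algebra_simps)
    have "FT (H_far k) ((x, \<xi>), \<zeta>) \<zeta> = exp (\<i> * complex_of_real (phase_far ((x, \<xi>), \<zeta>))) * FT (sec x (Lk k)) (\<zeta> + \<xi>) \<zeta>"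
      unfolding FT_def H_far_def sec_def sub_far_def
      by (subst integral_mult_right_zero[symmetric]) (simp add: mult_ac add.commute)
    then show "phase x (\<zeta> + \<xi>) * FT (sec x (Lk k)) (\<zeta> + \<xi>) (\<zeta> + \<xi> - \<xi>) = phase x \<xi> * FT (H_far k) ((x, \<xi>), \<zeta>) \<zeta>"
      by (simp add: ph mult_ac)
  qed
  finally show ?thesis by (simp add: osc_int_def)
qed

text \<open>The Jacobians <x>^(- n) and <x>^n of the two substitutions cancel. Under them y .
  (\<eta> - \<xi>) becomes w . \<kappa> plus \<nabla>\<phi> . \<kappa> / <x>; the latter is constant
  in w and is the linear term of \<open>phase_near\<close>.\<close>

lemma phase_H_near:
  "phase x \<xi> * osc_int H_near (x, \<xi>) = (LINT \<eta>|lborel. phase x \<eta> * FT (sec x am_near) \<eta> (\<eta> - \<xi>))"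
proof -
  let ?p = "(x, \<xi>)" and ?l = "lam (x, \<xi>)" and ?n = "DIM(real^'n)"
  let ?i = "inverse (lam (x, \<xi>))"
  have l: "?l > 0" by (rule lam_pos)
  have "(LINT \<eta>|lborel. phase x \<eta> * FT (sec x am_near) \<eta> (\<eta> - \<xi>)) =
      \<bar>?i\<bar> ^ ?n *\<^sub>R (LINT \<kappa>|lborel. phase x (\<xi> + ?i *\<^sub>R \<kappa>) * FT (sec x am_near) (\<xi> + ?i *\<^sub>R \<kappa>) (\<xi> + ?i *\<^sub>R \<kappa> - \<xi>))"
  proof (rule integral_lborel_affine)
    have [measurable]: "phase x \<in> borel_measurable borel" by (intro borel_measurable_continuous_onI phase_continuous)
    have [measurable]: "(\<lambda>\<eta>. FT (sec x am_near) \<eta> (\<eta> - \<xi>)) \<in> borel_measurable borel"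
      by (rule FT_shift_measurable[OF dec_smooth[OF dec_sec_am_near]])
    show "(\<lambda>\<eta>. phase x \<eta> * FT (sec x am_near) \<eta> (\<eta> - \<xi>)) \<in> borel_measurable borel" by measurable
  qed (use l in simp)
  also have "\<dots> = \<bar>?i\<bar> ^ ?n *\<^sub>R (LINT \<kappa>|lborel. complex_of_real (?l ^ ?n) * (phase x \<xi> * FT H_near (?p, \<kappa>) \<kappa>))"
  proof (intro arg_cong[where f = "scaleR (\<bar>?i\<bar> ^ ?n)"] Bochner_Integration.integral_cong refl)
    fix \<kappa> :: "real^'n"
    let ?\<eta> = "\<xi> + ?i *\<^sub>R \<kappa>"
    let ?f = "\<lambda>y. exp (- \<i> * complex_of_real (y \<bullet> (?i *\<^sub>R \<kappa>))) * am_near (x, y, ?\<eta>)"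
    have "FT (sec x am_near) ?\<eta> (?\<eta> - \<xi>) = integral\<^sup>L lborel ?f" by (simp add: FT_def sec_def)
    also have "\<dots> = \<bar>?l\<bar> ^ ?n *\<^sub>R (LINT w|lborel. ?f (grad ?p + ?l *\<^sub>R w))"
    proof (rule integral_lborel_affine)
      show "?f \<in> borel_measurable borel"
        using FT_integrand_measurable[OF dec_smooth[OF dec_sec_am_near], of "?i *\<^sub>R \<kappa>" x ?\<eta>] by (simp add: sec_def)
    qed (use l in simp)
    also have "(LINT w|lborel. ?f (grad ?p + ?l *\<^sub>R w)) =
        (LINT w|lborel. exp (- \<i> * complex_of_real (?i * (\<kappa> \<bullet> grad ?p))) * (exp (- \<i> * complex_of_real (w \<bullet> \<kappa>)) * am_near (sub_near ((?p, \<kappa>), w))))"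
    proof (intro Bochner_Integration.integral_cong refl)
      fix w :: "real^'n"
      have "(grad ?p + ?l *\<^sub>R w) \<bullet> (?i *\<^sub>R \<kappa>) = ?i * (\<kappa> \<bullet> grad ?p) + w \<bullet> \<kappa>"
      proof -
        have "(grad ?p + ?l *\<^sub>R w) \<bullet> (?i *\<^sub>R \<kappa>) = ?i * (grad ?p \<bullet> \<kappa>) + (?i * ?l) * (w \<bullet> \<kappa>)"
          by (simp only: inner_add_left inner_scaleR_left inner_scaleR_right mult.assoc) (simp add: mult.left_commute distrib_left)
        then show ?thesis using l by (simp add: inner_commute[of "grad ?p"])
      qed
      then show "?f (grad ?p + ?l *\<^sub>R w) = exp (- \<i> * complex_of_real (?i * (\<kappa> \<bullet> grad ?p))) * (exp (- \<i> * complex_of_real (w \<bullet> \<kappa>)) * am_near (sub_near ((?p, \<kappa>), w)))"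
        by (simp only:) (simp add: sub_near_def g2_def exp_add[symmetric] algebra_simps)
    qed
    also have "\<dots> = exp (- \<i> * complex_of_real (?i * (\<kappa> \<bullet> grad ?p))) * (LINT w|lborel. exp (- \<i> * complex_of_real (w \<bullet> \<kappa>)) * am_near (sub_near ((?p, \<kappa>), w)))"
      by (rule integral_mult_right_zero)
    finally have 1: "FT (sec x am_near) ?\<eta> (?\<eta> - \<xi>) = complex_of_real (?l ^ ?n) * (exp (- \<i> * complex_of_real (?i * (\<kappa> \<bullet> grad ?p))) *
        (LINT w|lborel. exp (- \<i> * complex_of_real (w \<bullet> \<kappa>)) * am_near (sub_near ((?p, \<kappa>), w))))"
      using l by (simp add: scaleR_conv_of_real)
    have 2: "FT H_near (?p, \<kappa>) \<kappa> = exp (\<i> * complex_of_real (phase_near (?p, \<kappa>))) *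
        (LINT w|lborel. exp (- \<i> * complex_of_real (w \<bullet> \<kappa>)) * am_near (sub_near ((?p, \<kappa>), w)))"
      unfolding FT_def H_near_def by (subst integral_mult_right_zero[symmetric]) (simp add: mult_ac)
    have 3: "phase x ?\<eta> * exp (- \<i> * complex_of_real (?i * (\<kappa> \<bullet> grad ?p))) = phase x \<xi> * exp (\<i> * complex_of_real (phase_near (?p, \<kappa>)))"
      by (simp add: phase_def phase_near_def g2_def exp_add[symmetric] algebra_simps)
    show "phase x ?\<eta> * FT (sec x am_near) ?\<eta> (?\<eta> - \<xi>) = complex_of_real (?l ^ ?n) * (phase x \<xi> * FT H_near (?p, \<kappa>) \<kappa>)"
    proof -
      have gen: "r * (s * (t * v)) = s * ((r * t) * v)" for r s t v :: complex by (simp add: mult_ac)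
      show ?thesis unfolding 1 2 by (subst gen, subst 3) (simp only: mult.assoc)
    qed
  qed
  also have "\<dots> = phase x \<xi> * osc_int H_near ?p"
    using l by (simp add: osc_int_def scaleR_conv_of_real power_inverse)
  finally show ?thesis by simp
qed

end

lemma FT_add:
  assumes "dec \<tau> W H" "dec \<tau>' W' G"
  shows "FT (\<lambda>z. H z + G z) q \<theta> = FT H q \<theta> + FT G q \<theta>"
  using Bochner_Integration.integral_add[OF dec_integrable[OF assms(1)] dec_integrable[OF assms(2)]]
  by (simp add: FT_def distrib_left)

lemma dir_derivs_add:
  fixes f g :: "'a::euclidean_space \<Rightarrow> complex"
  assumes "C_infinity f" "C_infinity g"
  shows "dir_derivs ds (\<lambda>x. f x + g x) = (\<lambda>x. dir_derivs ds f x + dir_derivs ds g x)"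
  by (induction ds) (auto simp: dir_deriv_add smooth_differentiable smooth_dir_derivs assms)

lemma dir_derivs_cmult:
  fixes f :: "'a::euclidean_space \<Rightarrow> complex"
  assumes "C_infinity f"
  shows "dir_derivs ds (\<lambda>x. c * f x) = (\<lambda>x. c * dir_derivs ds f x)"
  by (induction ds)
     (auto simp: dir_deriv_linear[OF bounded_linear_mult_right] smooth_differentiable smooth_dir_derivs assms)

lemma dir_derivs_sum:
  fixes f :: "'i \<Rightarrow> 'a::euclidean_space \<Rightarrow> complex"
  assumes "\<And>i. i \<in> I \<Longrightarrow> C_infinity (f i)"
  shows "dir_derivs ds (\<lambda>x. \<Sum>i\<in>I. f i x) = (\<lambda>x. \<Sum>i\<in>I. dir_derivs ds (f i) x)"
  using assms
  by (induction I rule: infinite_finite_induct) (auto simp: dir_derivs_const_0 dir_derivs_add smooth_sum)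

lemma dir_derivs_mixed_op:
  fixes H :: "('p::euclidean_space \<times> 'v::euclidean_space) \<times> 'v \<Rightarrow> complex"
  assumes H: "C_infinity H"
  shows "dir_derivs ds (mixed_op H) = mixed_op (dir_derivs ds H)"
proof -
  have "dir_derivs ds (mixed_op H) = (\<lambda>z. - \<i> * (\<Sum>b\<in>Basis. dir_derivs ds (dir_deriv (0, b) (dir_deriv ((0, b), 0) H)) z))"
    unfolding mixed_op_def[abs_def]
    by (subst dir_derivs_cmult dir_derivs_sum; (intro smooth_sum smooth_dir_deriv H)?)+ (rule refl)
  also have "\<dots> = mixed_op (dir_derivs ds H)"
    by (simp add: mixed_op_def[abs_def] dir_derivs_commute1[OF H] dir_derivs_commute1[OF smooth_dir_deriv[OF H]])
  finally show ?thesis .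
qed

text \<open>Allows \<open>osc_int_expansion\<close> to be applied to the differentiated amplitude:
  the terms of its expansion are the derivatives of the original terms.\<close>

lemma dir_derivs_mixed_op_iter:
  fixes H :: "('p::euclidean_space \<times> 'v::euclidean_space) \<times> 'v \<Rightarrow> complex"
  assumes H: "C_infinity H"
  shows "dir_derivs ds ((mixed_op ^^ j) H) = (mixed_op ^^ j) (dir_derivs ds H)"
  by (induction j) (auto simp: dir_derivs_mixed_op[OF smooth_mixed_op_iter[OF H]])

lemma dir_derivs_at_origin:
  "dir_derivs ds (\<lambda>p. F ((p, \<kappa>), w)) p = dir_derivs (map (\<lambda>d. ((d, 0), 0)) ds) F ((p, \<kappa>), w)"
  using dir_derivs_section1[of ds "\<lambda>q. F (q, w)" \<kappa> p] dir_derivs_section1[of "map (\<lambda>d. (d, 0)) ds" F w "(p, \<kappa>)"]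
  by (simp add: o_def)

lemma i_powi_minus: "\<i> powi (- int m) = (- \<i>) ^ m"
  by (simp add: power_int_minus power_inverse[symmetric])

lemma symb_cutoff:
  assumes "cutoff \<gamma>" shows "symb Basis (\<lambda>_ _. 1) (\<lambda>_. 1) \<gamma>"
proof -
  have "C_infinity \<gamma>" "compact (closure {z. \<gamma> z \<noteq> 0})" using assms by (auto simp: cutoff_def)
  moreover have "\<gamma> z = 0" if "z \<notin> closure {z. \<gamma> z \<noteq> 0}" for z
    using that closure_subset[of "{z. \<gamma> z \<noteq> 0}"] by auto
  ultimately have "symb Basis (\<lambda>_ _. 1) (indicator (closure {z. \<gamma> z \<noteq> 0})) \<gamma>" by (rule symb_compact_support)
  then show ?thesis by (rule symb_weight_mono[where C = 1]) (auto simp: indicator_def)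
qed

section \<open>The value of the oscillatory integral, the amplitude c and its expansion\<close>

context fio_data
begin

lemma am_eq: "am (x, y, \<eta>) = a x y \<eta>" by (simp add: am_def)

text \<open>The regularization \<epsilon> becomes part of the parameter (\<epsilon>, \<eta>) of
  \<open>FT\<close>, so that a single decay estimate covers all \<epsilon>.\<close>

definition damp :: "real^'n \<Rightarrow> ((real^'n) \<times> (real^'n) \<Rightarrow> complex) \<Rightarrow> (real^'n \<Rightarrow> complex) \<Rightarrow>
    (real \<times> (real^'n)) \<times> (real^'n) \<Rightarrow> complex"
  where "damp x \<gamma> u z = sec x am (snd (fst z), snd z) * u (snd z) * \<gamma> (fst (fst z) *\<^sub>R snd z, fst (fst z) *\<^sub>R snd (fst z))"

text \<open>A y-derivative of \<gamma>(\<epsilon> y, \<epsilon> \<eta>) brings out a factor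
  \<epsilon>, hence the cost <\<epsilon>>.\<close>

lemma dec_damp:
  assumes \<gamma>: "cutoff \<gamma>" and u: "schwartz u"
  shows "dec (\<lambda>q. bracket (fst q)) (\<lambda>q. bracket (snd q) powr m3) (damp x \<gamma> u)"
proof -
  let ?D = "Pair 0 ` Basis :: ((real \<times> (real^'n)) \<times> (real^'n)) set"
  let ?\<omega> = "\<lambda>_ z. bracket (fst (fst z)) :: real"
  let ?g = "\<lambda>z::(real \<times> (real^'n)) \<times> (real^'n). (fst (fst z) *\<^sub>R snd z, fst (fst z) *\<^sub>R snd (fst z))"
  have B: "poly_dec m3 (\<lambda>z. sec x am z * u (snd z))"
    by (rule dec_sec_schwartz[OF symb_am_1 _ _ u]) (auto simp: less_imp_le[OF wt3_pos])
  have 1: "symb ?D ?\<omega> (\<lambda>z. bracket (snd (fst z)) powr m3 * decay (snd z)) (\<lambda>z. sec x am (snd (fst z), snd z) * u (snd z))"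
  proof -
    have "(snd (fst d), snd d) \<in> Pair 0 ` Basis" if "d \<in> ?D" for d using that by auto
    moreover have "C_infinity (\<lambda>z::(real \<times> (real^'n)) \<times> (real^'n). (snd (fst z), snd z))" by (intro smooth_intros)
    ultimately show ?thesis
      using symb_affine[OF B[unfolded dec_def], where L = "\<lambda>d. (snd (fst d), snd d)" and g = "\<lambda>z. (snd (fst z), snd z)" and D = ?D and \<omega> = ?\<omega>]
      by (simp add: bracket_ge_1)
  qed
  have 2: "symb ?D ?\<omega> (\<lambda>z. 1) (\<lambda>z. \<gamma> (?g z))"
  proof (rule symb_compose[OF symb_cutoff[OF \<gamma>], where \<tau> = "\<lambda>_ _. 1"])
    show "C_infinity ?g" by (intro smooth_intros)
    fix b :: "(real \<times> (real^'n)) \<times> (real^'n)" and c :: "(real^'n) \<times> (real^'n)"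
    assume "b \<in> ?D"
    then obtain b' where b: "b = (0, b')" by auto
    have "dir_deriv b (\<lambda>z. ?g z \<bullet> c) = (\<lambda>z. fst (fst z) * (b' \<bullet> fst c))"
    proof
      fix z
      have "((\<lambda>t. ?g (z + t *\<^sub>R b) \<bullet> c) has_real_derivative fst (fst z) * (b' \<bullet> fst c)) (at 0)"
        by (auto simp: b inner_prod_def inner_add_left intro!: derivative_eq_intros)
      then show "dir_deriv b (\<lambda>z. ?g z \<bullet> c) z = fst (fst z) * (b' \<bullet> fst c)"
        unfolding dir_deriv_def by (simp add: vector_derivative_at has_real_derivative_iff_has_vector_derivative)
    qed
    moreover have "symb ?D ?\<omega> (\<lambda>z. bracket (fst (fst z))) (\<lambda>z. fst (fst z) * k)" for k
    proof (rule symb_SucI[where C = "\<bar>k\<bar>"])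
      show "C_infinity (\<lambda>z::(real \<times> (real^'n)) \<times> (real^'n). fst (fst z) * k)" by (intro smooth_intros)
      show "norm (fst (fst z) * k) \<le> \<bar>k\<bar> * bracket (fst (fst z))" for z :: "(real \<times> (real^'n)) \<times> (real^'n)"
        using mult_right_mono[OF norm_le_bracket[of "fst (fst z)"], of "\<bar>k\<bar>"] by (simp add: abs_mult mult.commute)
      fix d assume "d \<in> ?D"
      then have "dir_deriv d (\<lambda>z. fst (fst z) * k) = (\<lambda>z. 0)" by (auto simp: dir_deriv_def fun_eq_iff)
      then show "symb ?D ?\<omega> (\<lambda>z. bracket (fst (fst z)) * bracket (fst (fst z))) (dir_deriv d (\<lambda>z. fst (fst z) * k))"
        by (simp add: symb_zero)
    qed
    ultimately show "symb ?D ?\<omega> (\<lambda>z. bracket (fst (fst z)) * 1) (dir_deriv b (\<lambda>z. ?g z \<bullet> c))" by simp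
  qed auto
  from symb_mult[OF 1 2] show ?thesis unfolding dec_def damp_def[abs_def] by simp
qed

lemma fio_double_damp:
  "fio_double \<phi> (\<lambda>x y \<xi>. a x y \<xi> * \<gamma> (\<epsilon> *\<^sub>R y, \<epsilon> *\<^sub>R \<xi>)) u x =
    complex_of_real (1 / (2 * pi) ^ CARD('n)) * (LINT \<eta>|lborel. phase x \<eta> * FT (damp x \<gamma> u) (\<epsilon>, \<eta>) \<eta>)"
proof -
  have "(LINT y|lborel. exp (\<i> * complex_of_real (\<phi> x \<eta> - y \<bullet> \<eta>)) * (a x y \<eta> * \<gamma> (\<epsilon> *\<^sub>R y, \<epsilon> *\<^sub>R \<eta>)) * u y) =
      phase x \<eta> * FT (damp x \<gamma> u) (\<epsilon>, \<eta>) \<eta>" for \<eta>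
    unfolding FT_def damp_def integral_mult_right_zero[symmetric]
    by (intro Bochner_Integration.integral_cong refl)
       (simp add: phase_def ph_def sec_def am_eq right_diff_distrib exp_diff exp_minus divide_inverse mult_ac)
  then show ?thesis by (simp add: fio_double_def)
qed

text \<open>Dominated convergence twice: in y for fixed \<eta>, where u provides the majorant, and
  then in \<eta>, where the decay of the inner integral is uniform for bounded \<epsilon>. The limit
  is the same for all cutoffs because only \<gamma>(0) = 1 survives.\<close>

lemma osc_limit:
  assumes u: "schwartz u"
  shows "has_osc_value \<phi> a u x (complex_of_real (1 / (2 * pi) ^ CARD('n)) *
    (LINT \<eta>|lborel. phase x \<eta> * FT (\<lambda>z. sec x am z * u (snd z)) \<eta> \<eta>))"
  unfolding has_osc_value_def fio_double_damp
proof (intro allI impI tendsto_mult tendsto_const)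
  fix \<gamma> :: "(real^'n) \<times> (real^'n) \<Rightarrow> complex" assume \<gamma>: "cutoff \<gamma>"
  let ?S = "\<lambda>z. sec x am z * u (snd z)"
  note dd = dec_damp[OF \<gamma> u, of x]
  have dS: "poly_dec m3 ?S"
    by (rule dec_sec_schwartz[OF symb_am_1 _ _ u]) (auto simp: less_imp_le[OF wt3_pos])
  obtain CS where CS: "\<And>q w. norm (?S (q, w)) \<le> CS * bracket q powr m3 * decay w" using dec_bound[OF dS] by blast
  have g0: "\<gamma> 0 = 1" using \<gamma> eventually_nhds_x_imp_x unfolding cutoff_def by blast
  have cg: "isCont \<gamma> 0"
    using smooth_continuous[of \<gamma> UNIV] \<gamma> unfolding cutoff_def continuous_on_eq_continuous_at[OF open_UNIV] by blast
  obtain Cg where Cg: "\<And>z. norm (\<gamma> z) \<le> Cg * 1" using symb_bound[OF symb_cutoff[OF \<gamma>]] by blast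
  obtain l :: nat where l: "2 * real l \<ge> m3 + 2 * real DIM(real^'n)"
    using real_arch_simple[of "(m3 + 2 * real DIM(real^'n)) / 2"] by (auto simp: field_simps)
  have "\<exists>C. \<forall>q \<theta>. norm (FT (damp x \<gamma> u) q \<theta>) \<le> C * bracket (snd q) powr m3 * bracket (fst q) ^ (2 * l) * bracket \<theta> powr (- 2 * real l)"
    by (rule FT_decay[OF dd]) (auto simp: bracket_ge_1)
  then obtain C where C: "\<And>q \<theta>. norm (FT (damp x \<gamma> u) q \<theta>) \<le> C * bracket (snd q) powr m3 * bracket (fst q) ^ (2 * l) * bracket \<theta> powr (- 2 * real l)"
    by blast
  have C': "norm (FT (damp x \<gamma> u) (\<epsilon>, \<eta>) \<eta>) \<le> \<bar>C\<bar> * bracket \<epsilon> ^ (2 * l) * decay \<eta>" for \<epsilon> \<eta>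
  proof -
    have "C * bracket \<eta> powr m3 * bracket \<epsilon> ^ (2 * l) * bracket \<eta> powr (- 2 * real l) =
        C * bracket \<epsilon> ^ (2 * l) * bracket \<eta> powr (m3 - 2 * real l)"
      by (simp add: powr_diff powr_minus divide_inverse mult_ac)
    also have "\<dots> \<le> \<bar>C\<bar> * bracket \<epsilon> ^ (2 * l) * decay \<eta>"
      using l bracket_ge_1[of \<eta>] by (intro mult_mono powr_mono) (auto intro!: mult_right_mono)
    finally show ?thesis using C[of "(\<epsilon>, \<eta>)" \<eta>] by simp
  qed
  show "((\<lambda>\<epsilon>. LINT \<eta>|lborel. phase x \<eta> * FT (damp x \<gamma> u) (\<epsilon>, \<eta>) \<eta>) \<longlongrightarrow>
      (LINT \<eta>|lborel. phase x \<eta> * FT ?S \<eta> \<eta>)) (at 0)"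
    unfolding tendsto_at_iff_sequentially
  proof (intro allI impI)
    fix X :: "nat \<Rightarrow> real" assume "\<forall>i. X i \<in> UNIV - {0}" and X: "X \<longlonglongrightarrow> 0"
    obtain R where R: "\<And>n. norm (X n) \<le> R" using convergent_imp_Bseq[OF convergentI[OF X]] by (auto simp: Bseq_def)
    have bX: "bracket (X n) \<le> 1 + R" for n using bracket_le_norm[of "X n"] R[of n] by simp
    have [measurable]: "phase x \<in> borel_measurable borel" by (intro borel_measurable_continuous_onI phase_continuous)
    have [measurable]: "(\<lambda>\<eta>. FT ?S \<eta> \<eta>) \<in> borel_measurable borel"
      by (rule FT_measurable[OF dec_smooth[OF dS]]) (intro continuous_intros)+
    have [measurable]: "(\<lambda>\<eta>. FT (damp x \<gamma> u) (\<epsilon>, \<eta>) \<eta>) \<in> borel_measurable borel" for \<epsilon>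
      by (rule FT_measurable[OF dec_smooth[OF dd]]) (intro continuous_intros)+
    have pt: "(\<lambda>n. FT (damp x \<gamma> u) (X n, \<eta>) \<eta>) \<longlonglongrightarrow> FT ?S \<eta> \<eta>" for \<eta>
      unfolding FT_def
    proof (rule integral_dominated_convergence[where w = "\<lambda>y. (CS * bracket \<eta> powr m3 * Cg) * decay y"])
      let ?e = "\<lambda>y. exp (- \<i> * complex_of_real (y \<bullet> \<eta>))"
      show "AE y in lborel. (\<lambda>n. ?e y * damp x \<gamma> u ((X n, \<eta>), y)) \<longlonglongrightarrow> ?e y * ?S (\<eta>, y)"
      proof (rule AE_I2)
        fix y :: "real^'n"
        have "(\<lambda>n. (X n *\<^sub>R y, X n *\<^sub>R \<eta>)) \<longlonglongrightarrow> (0 *\<^sub>R y, 0 *\<^sub>R \<eta>)" by (intro tendsto_intros X)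
        then have "(\<lambda>n. (X n *\<^sub>R y, X n *\<^sub>R \<eta>)) \<longlonglongrightarrow> 0" by (simp add: zero_prod_def)
        then have "(\<lambda>n. \<gamma> (X n *\<^sub>R y, X n *\<^sub>R \<eta>)) \<longlonglongrightarrow> \<gamma> 0"
          by (rule isCont_tendsto_compose[OF cg])
        then have "(\<lambda>n. ?e y * (?S (\<eta>, y) * \<gamma> (X n *\<^sub>R y, X n *\<^sub>R \<eta>))) \<longlonglongrightarrow> ?e y * (?S (\<eta>, y) * 1)"
          unfolding g0 by (intro tendsto_intros)
        then show "(\<lambda>n. ?e y * damp x \<gamma> u ((X n, \<eta>), y)) \<longlonglongrightarrow> ?e y * ?S (\<eta>, y)"
          by (simp add: damp_def)
      qed
      show "AE y in lborel. norm (?e y * damp x \<gamma> u ((X n, \<eta>), y)) \<le> (CS * bracket \<eta> powr m3 * Cg) * decay y" for n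
      proof (rule AE_I2)
        fix y :: "real^'n"
        have "norm (?S (\<eta>, y)) * norm (\<gamma> (X n *\<^sub>R y, X n *\<^sub>R \<eta>)) \<le> (CS * bracket \<eta> powr m3 * decay y) * (Cg * 1)"
          using CS[of \<eta> y] Cg by (intro mult_mono) (auto intro: order_trans[OF norm_ge_zero])
        then show "norm (?e y * damp x \<gamma> u ((X n, \<eta>), y)) \<le> (CS * bracket \<eta> powr m3 * Cg) * decay y"
          by (simp add: norm_mult damp_def mult_ac)
      qed
      show "integrable lborel (\<lambda>y::real^'n. (CS * bracket \<eta> powr m3 * Cg) * decay y)"
        by (intro integrable_mult_right integrable_decay)
    qed (use FT_integrand_measurable[OF dec_smooth[OF dS]] FT_integrand_measurable[OF dec_smooth[OF dd]] in auto)
    have "(\<lambda>n. LINT \<eta>|lborel. phase x \<eta> * FT (damp x \<gamma> u) (X n, \<eta>) \<eta>) \<longlonglongrightarrow> (LINT \<eta>|lborel. phase x \<eta> * FT ?S \<eta> \<eta>)"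
    proof (rule integral_dominated_convergence[where w = "\<lambda>\<eta>. (\<bar>C\<bar> * (1 + R) ^ (2 * l)) * decay \<eta>"])
      show "AE \<eta> in lborel. (\<lambda>n. phase x \<eta> * FT (damp x \<gamma> u) (X n, \<eta>) \<eta>) \<longlonglongrightarrow> phase x \<eta> * FT ?S \<eta> \<eta>"
        by (intro AE_I2 tendsto_mult tendsto_const pt)
      show "AE \<eta> in lborel. norm (phase x \<eta> * FT (damp x \<gamma> u) (X n, \<eta>) \<eta>) \<le> (\<bar>C\<bar> * (1 + R) ^ (2 * l)) * decay \<eta>" for n
      proof (rule AE_I2)
        fix \<eta>
        have "\<bar>C\<bar> * bracket (X n) ^ (2 * l) * decay \<eta> \<le> \<bar>C\<bar> * (1 + R) ^ (2 * l) * decay (\<eta>::real^'n)"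
          using bX[of n] by (intro mult_right_mono mult_left_mono power_mono) auto
        then show "norm (phase x \<eta> * FT (damp x \<gamma> u) (X n, \<eta>) \<eta>) \<le> (\<bar>C\<bar> * (1 + R) ^ (2 * l)) * decay \<eta>"
          using C'[of "X n" \<eta>] by (simp only: norm_mult norm_phase mult_1)
      qed
      show "integrable lborel (\<lambda>\<eta>::real^'n. (\<bar>C\<bar> * (1 + R) ^ (2 * l)) * decay \<eta>)"
        by (intro integrable_mult_right integrable_decay)
    qed measurable
    then show "((\<lambda>\<epsilon>. LINT \<eta>|lborel. phase x \<eta> * FT (damp x \<gamma> u) (\<epsilon>, \<eta>) \<eta>) \<circ> X) \<longlonglongrightarrow>
      (LINT \<eta>|lborel. phase x \<eta> * FT ?S \<eta> \<eta>)" by (simp add: o_def)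
  qed
qed

definition amp :: "nat \<Rightarrow> real^'n \<Rightarrow> real^'n \<Rightarrow> complex"
  where "amp k x \<xi> = complex_of_real (1 / (2 * pi) ^ CARD('n)) * (osc_int H_near (x, \<xi>) + osc_int (H_far k) (x, \<xi>))"

text \<open>\<open>FT_schwartz_swap\<close> leads from \<open>fourier\<close> u back to u and
  cancels one factor (2 \<pi>)^(- n). In the presence of u the integrations by parts can then be
  undone down to k = 0, which reassembles near and far part to the full amplitude.\<close>

lemma fio_single_amp:
  assumes k: "\<And>x. poly_dec m3 (sec x (Lk k))" and u: "schwartz u"
  shows "fio_single \<phi> (amp k) u x = complex_of_real (1 / (2 * pi) ^ CARD('n)) *
    (LINT \<eta>|lborel. phase x \<eta> * FT (\<lambda>z. sec x am z * u (snd z)) \<eta> \<eta>)"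
proof -
  let ?c = "complex_of_real (1 / (2 * pi) ^ CARD('n))"
  let ?B = "\<lambda>z. sec x am_near z + sec x (Lk k) z"
  let ?T = "\<lambda>B. LINT \<eta>|lborel. phase x \<eta> * FT (\<lambda>z. sec x B z * u (snd z)) \<eta> \<eta>"
  have P: "norm (phase x \<eta>) \<le> 1" for \<eta> by simp
  have cc: "?c * complex_of_real ((2 * pi) ^ CARD('n)) = 1"
    unfolding of_real_mult[symmetric] by simp
  have dB: "poly_dec m3 ?B" by (intro dec_add dec_sec_am_near k)
  have i: "integrable lborel (\<lambda>\<eta>. phase x \<eta> * FT B \<eta> (\<eta> - \<xi>))" if "poly_dec m3 B" for B \<xi>
    by (rule FT_shift_integrable[OF that phase_continuous P])
  have d1: "poly_dec m3 (\<lambda>z. sec x am_near z * u (snd z))"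
    by (rule dec_sec_schwartz[OF symb_am_near_1 ind_wt3 u])
  have d2: "poly_dec m3 (\<lambda>z. sec x am_far z * u (snd z))"
    by (rule dec_sec_schwartz[OF symb_am_far _ _ u]) (auto simp: less_imp_le[OF wt3_pos])
  have d3: "poly_dec m3 (\<lambda>z. sec x (Lk k) z * u (snd z))"
    by (rule dec_sec_schwartz[OF symb_Lk_wtk wtk_nonneg wtk_le u])
  have A: "phase x \<xi> * amp k x \<xi> = ?c * (LINT \<eta>|lborel. phase x \<eta> * FT ?B \<eta> (\<eta> - \<xi>))" for \<xi>
  proof -
    have "phase x \<xi> * amp k x \<xi> = ?c * (phase x \<xi> * osc_int H_near (x, \<xi>) + phase x \<xi> * osc_int (H_far k) (x, \<xi>))"
      by (simp only: amp_def distrib_left mult_ac)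
    also have "\<dots> = ?c * (LINT \<eta>|lborel. phase x \<eta> * FT (sec x am_near) \<eta> (\<eta> - \<xi>) + phase x \<eta> * FT (sec x (Lk k)) \<eta> (\<eta> - \<xi>))"
      unfolding phase_H_near phase_H_far by (subst Bochner_Integration.integral_add[OF i[OF dec_sec_am_near] i[OF k]]) (rule refl)
    finally show ?thesis by (simp only: FT_add[OF dec_sec_am_near k] distrib_left)
  qed
  have "fio_single \<phi> (amp k) u x = ?c * (LINT \<xi>|lborel. ?c * (fourier u \<xi> * (LINT \<eta>|lborel. phase x \<eta> * FT ?B \<eta> (\<eta> - \<xi>))))"
  proof -
    have "exp (\<i> * complex_of_real (\<phi> x \<xi>)) * amp k x \<xi> * fourier u \<xi> =
        ?c * (fourier u \<xi> * (LINT \<eta>|lborel. phase x \<eta> * FT ?B \<eta> (\<eta> - \<xi>)))" for \<xi>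
      using A[of \<xi>] by (simp add: phase_def ph_def mult_ac)
    then show ?thesis by (simp add: fio_single_def)
  qed
  also have "\<dots> = ?c * (?c * (LINT \<xi>|lborel. fourier u \<xi> * (LINT \<eta>|lborel. phase x \<eta> * FT ?B \<eta> (\<eta> - \<xi>))))"
    by (simp only: integral_mult_right_zero)
  also have "\<dots> = ?c * ((?c * complex_of_real ((2 * pi) ^ CARD('n))) * (LINT \<eta>|lborel. phase x \<eta> * FT (\<lambda>z. ?B z * u (snd z)) \<eta> \<eta>))"
    by (simp only: FT_schwartz_swap[OF dB u phase_continuous P, symmetric] mult.assoc)
  also have "\<dots> = ?c * (LINT \<eta>|lborel. phase x \<eta> * FT (\<lambda>z. ?B z * u (snd z)) \<eta> \<eta>)"
    by (simp only: cc mult_1)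
  also have "(LINT \<eta>|lborel. phase x \<eta> * FT (\<lambda>z. ?B z * u (snd z)) \<eta> \<eta>) = ?T am_near + ?T (Lk k)"
    using Bochner_Integration.integral_add[OF i[OF d1, of 0] i[OF d3, of 0]]
    by (simp add: distrib_right FT_add[OF d1 d3] distrib_left)
  also have "\<dots> = ?T am_near + ?T am_far" by (simp only: by_parts_schwartz[OF u, of x k])
  also have "\<dots> = (LINT \<eta>|lborel. phase x \<eta> * FT (\<lambda>z. sec x am z * u (snd z)) \<eta> \<eta>)"
  proof -
    have "(\<lambda>z. sec x am z * u (snd z)) = (\<lambda>z. sec x am_near z * u (snd z) + sec x am_far z * u (snd z))"
      by (simp add: sec_def am_split distrib_right)
    then show ?thesis
      using Bochner_Integration.integral_add[OF i[OF d1, of 0] i[OF d2, of 0]]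
      by (simp add: FT_add[OF d1 d2] distrib_left)
  qed
  finally show ?thesis .
qed

text \<open>At y = \<nabla>\<phi> the value of \<open>ratio\<close> lies in [C1^2, C2^2], in the
  interior of the plateau of \<open>chi\<close>. So the cutoff leaves no trace in the expansion
  terms.\<close>

lemma am_near_eq_am:
  "dir_derivs ds (\<lambda>y. am_near (x, y, \<eta>)) (grad (x, \<xi>)) = dir_derivs ds (\<lambda>y. am (x, y, \<eta>)) (grad (x, \<xi>))"
proof -
  let ?U = "(\<lambda>y. ratio (x, y, \<eta>)) -` {C1\<^sup>2 / 8<..<8 * C2\<^sup>2}"
  have "continuous_on UNIV (\<lambda>y. ratio (x, y, \<eta>))"
    unfolding ratio_def by (simp, intro continuous_intros smooth_continuous[OF smooth_bracket])
  then have o: "open ?U" by (intro open_vimage) auto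
  have "am_near (x, y, \<eta>) = am (x, y, \<eta>)" if "y \<in> ?U" for y
  proof -
    have "chi (x, y, \<eta>) = 1" unfolding chi_def using that C1 C2 by (intro bump_eq_1) auto
    then show ?thesis by (simp add: am_near_def)
  qed
  moreover have "grad (x, \<xi>) \<in> ?U"
  proof -
    let ?D = "bracket (grad (x, \<xi>))" and ?l = "bracket x"
    have "C1\<^sup>2 * ?l\<^sup>2 \<le> ?D\<^sup>2" "?D\<^sup>2 \<le> C2\<^sup>2 * ?l\<^sup>2"
      using power_mono[OF grad_bracket(1)[of "(x, \<xi>)"], of 2] power_mono[OF grad_bracket(2)[of "(x, \<xi>)"], of 2] C1
      by (auto simp: power_mult_distrib)
    moreover have "ratio (x, grad (x, \<xi>), \<eta>) = ?D\<^sup>2 / ?l\<^sup>2" by (simp add: ratio_def divide_inverse power_inverse)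
    moreover have "?l\<^sup>2 > 0" using bracket_pos[of x] by simp
    ultimately have "C1\<^sup>2 \<le> ratio (x, grad (x, \<xi>), \<eta>)" "ratio (x, grad (x, \<xi>), \<eta>) \<le> C2\<^sup>2"
      by (auto simp: pos_le_divide_eq pos_divide_le_eq)
    moreover have "C1\<^sup>2 > 0" "C2\<^sup>2 > 0" using C1 C2 by auto
    ultimately have "C1\<^sup>2 / 8 < ratio (x, grad (x, \<xi>), \<eta>)" "ratio (x, grad (x, \<xi>), \<eta>) < 8 * C2\<^sup>2" by linarith+
    then show ?thesis by simp
  qed
  ultimately show ?thesis using o by (intro dir_derivs_cong_open) auto
qed

lemma phase_near_Psi: "phase_near ((x, \<xi>), \<kappa>) = Psi \<phi> (\<xi> + inverse (lam (x, \<xi>)) *\<^sub>R \<kappa>) \<xi> x"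
  by (simp add: phase_near_def Psi_def g2_def ph_def grad_def)

text \<open>The w-derivatives at w = 0 are <x>^|\<beta>| times y-derivatives at y = \<nabla>\<phi>,
  and the \<kappa>-derivatives at \<kappa> = 0 are <x>^(- |\<beta>|) times \<eta>-derivatives at
  \<eta> = \<xi>; the powers of <x> cancel.\<close>

lemma expansion_term_wk:
  "expansion_term \<phi> a \<beta> x \<xi> = (- \<i>) ^ mi_length \<beta> / of_nat (mi_fact \<beta>) * wk_derivs \<beta> H_near (((x, \<xi>), 0), 0)"
proof -
  let ?L = "mi_dirs \<beta> :: (real^'n) list" and ?p = "(x, \<xi>)" and ?l = "lam (x, \<xi>)" and ?i = "inverse (lam (x, \<xi>))"
  define E where "E = (\<lambda>\<eta>. exp (\<i> * complex_of_real (Psi \<phi> \<eta> \<xi> x)) * dir_derivs ?L (\<lambda>y. am (x, y, \<eta>)) (grad ?p))"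
  have sam: "C_infinity am" by (rule symb_smooth[OF symb_am])
  have sE: "C_infinity E"
  proof -
    have eq: "(\<lambda>\<eta>. dir_derivs ?L (\<lambda>y. am (x, y, \<eta>)) (grad ?p)) = (\<lambda>\<eta>. dir_derivs (map (\<lambda>d. (d, 0)) ?L) (\<lambda>z. am (x, z)) (grad ?p, \<eta>))"
      using dir_derivs_section1[of ?L "\<lambda>z. am (x, z)"] by simp
    have "C_infinity (\<lambda>\<eta>. dir_derivs ?L (\<lambda>y. am (x, y, \<eta>)) (grad ?p))"
      unfolding eq by (intro smooth_section smooth_dir_derivs sam)
    moreover have "C_infinity (\<lambda>\<eta>. Psi \<phi> \<eta> \<xi> x)"
      using smooth_section[OF smooth_ph, of x] unfolding Psi_def ph_def
      by (intro smooth_intros) simp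
    ultimately show ?thesis unfolding E_def by (intro smooth_mult smooth_cis)
  qed
  have sy: "C_infinity (\<lambda>y. am_near (x, y, \<eta>))" for \<eta>
    by (rule smooth_compose[OF symb_smooth[OF symb_am_near]]) (intro smooth_intros)
  have F: "dir_derivs (map (\<lambda>d. (0, d)) ?L) H_near ((?p, \<kappa>), 0) = complex_of_real (?l ^ length ?L) * E (\<xi> + ?i *\<^sub>R \<kappa>)" for \<kappa>
  proof -
    have "dir_derivs (map (\<lambda>d. (0, d)) ?L) H_near ((?p, \<kappa>), 0) = dir_derivs ?L (\<lambda>w. H_near ((?p, \<kappa>), w)) 0"
      by (rule dir_derivs_section[symmetric])
    also have "(\<lambda>w. H_near ((?p, \<kappa>), w)) = (\<lambda>w. exp (\<i> * complex_of_real (phase_near (?p, \<kappa>))) * am_near (x, grad ?p + ?l *\<^sub>R w, \<xi> + ?i *\<^sub>R \<kappa>))"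
      by (simp add: H_near_def sub_near_def g2_def)
    also have "dir_derivs ?L \<dots> 0 = exp (\<i> * complex_of_real (phase_near (?p, \<kappa>))) * complex_of_real (?l ^ length ?L) *
        dir_derivs ?L (\<lambda>y. am_near (x, y, \<xi> + ?i *\<^sub>R \<kappa>)) (grad ?p + ?l *\<^sub>R 0)"
      by (rule dir_derivs_affine[OF sy])
    finally show ?thesis by (simp add: am_near_eq_am E_def phase_near_Psi mult_ac)
  qed
  have "wk_derivs \<beta> H_near ((?p, 0), 0) = dir_derivs (map (\<lambda>d. (d, 0)) (map (\<lambda>d. (0, d)) ?L)) (dir_derivs (map (\<lambda>d. (0, d)) ?L) H_near) ((?p, 0), 0)"
    by (simp add: wk_derivs_def o_def)
  also have "\<dots> = dir_derivs (map (\<lambda>d. (0, d)) ?L) (\<lambda>q. dir_derivs (map (\<lambda>d. (0, d)) ?L) H_near (q, 0)) (?p, 0)"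
    by (rule dir_derivs_section1[symmetric])
  also have "\<dots> = dir_derivs ?L (\<lambda>\<kappa>. dir_derivs (map (\<lambda>d. (0, d)) ?L) H_near ((?p, \<kappa>), 0)) 0"
    by (rule dir_derivs_section[symmetric])
  also have "\<dots> = dir_derivs ?L (\<lambda>\<kappa>. complex_of_real (?l ^ length ?L) * E (\<xi> + ?i *\<^sub>R \<kappa>)) 0"
    unfolding F ..
  also have "\<dots> = complex_of_real (?l ^ length ?L) * complex_of_real (?i ^ length ?L) * dir_derivs ?L E (\<xi> + ?i *\<^sub>R 0)"
    by (rule dir_derivs_affine[OF sE])
  also have "\<dots> = dir_derivs ?L E \<xi>"
    using lam_pos[of ?p] by (simp add: of_real_mult[symmetric] power_mult_distrib[symmetric] del: of_real_mult of_real_power of_real_inverse)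
  finally show ?thesis
    by (simp add: expansion_term_def i_powi_minus mi_deriv_dirs E_def am_eq grad_def)
qed

text \<open>Grouped by length, the terms with |\<beta>| = j form the multinomial expansion of the
  j-th Taylor coefficient.\<close>

lemma expansion_sum:
  "(\<Sum>\<kappa> | mi_length \<kappa> < N. expansion_term \<phi> a \<kappa> x \<xi>) = (\<Sum>j<N. (mixed_op ^^ j) H_near (((x, \<xi>), 0), 0) / fact j)"
proof -
  have "(\<Sum>\<kappa> | mi_length \<kappa> < N. expansion_term \<phi> a \<kappa> x \<xi>) =
      (\<Sum>j<N. \<Sum>\<kappa> | \<kappa> \<in> {\<kappa>. mi_length \<kappa> < N} \<and> mi_length \<kappa> = j. expansion_term \<phi> a \<kappa> x \<xi>)"
    by (rule sum.group[symmetric]) (auto intro: finite_mi_length_less)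
  also have "\<dots> = (\<Sum>j<N. (mixed_op ^^ j) H_near (((x, \<xi>), 0), 0) / fact j)"
  proof (rule sum.cong[OF refl])
    fix j assume "j \<in> {..<N}"
    then have "{\<kappa> :: 'n multi_index. \<kappa> \<in> {\<kappa>. mi_length \<kappa> < N} \<and> mi_length \<kappa> = j} = {\<kappa>. mi_length \<kappa> = j}" by auto
    then have "(\<Sum>\<kappa> | \<kappa> \<in> {\<kappa>. mi_length \<kappa> < N} \<and> mi_length \<kappa> = j. expansion_term \<phi> a \<kappa> x \<xi>) =
        (\<Sum>\<kappa> | mi_length \<kappa> = j. (- \<i>) ^ j * (wk_derivs \<kappa> H_near (((x, \<xi>), 0), 0) / of_nat (mi_fact \<kappa>)))"
      by (simp add: expansion_term_wk)
    also have "\<dots> = (mixed_op ^^ j) H_near (((x, \<xi>), 0), 0) / fact j"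
      unfolding mixed_op_iter[OF symb_smooth[OF symb_H_near]] sum_distrib_left[symmetric] by simp
    finally show "(\<Sum>\<kappa> | \<kappa> \<in> {\<kappa>. mi_length \<kappa> < N} \<and> mi_length \<kappa> = j. expansion_term \<phi> a \<kappa> x \<xi>) =
        (mixed_op ^^ j) H_near (((x, \<xi>), 0), 0) / fact j" .
  qed
  finally show ?thesis .
qed

lemma fio_representation:
  "\<exists>c :: real^'n \<Rightarrow> real^'n \<Rightarrow> complex.
    C_infinity (\<lambda>(x, \<xi>). c x \<xi>) \<and>
    (\<forall>u. schwartz u \<longrightarrow> (\<forall>x. has_osc_value \<phi> a u x (fio_single \<phi> c u x))) \<and>
    (\<forall>\<alpha> \<beta>. \<exists>C. \<forall>x \<xi>. norm (mi_deriv2 \<alpha> \<beta> c x \<xi>)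
      \<le> C * bracket x powr (m1 + m2) * bracket \<xi> powr m3) \<and>
    asymp_expansion_x c (expansion_term \<phi> a) (m1 + m2) m3"
proof -
  let ?e = "complex_of_real (1 / (2 * pi) ^ CARD('n))"
  obtain k1 where k1: "\<And>k x. k \<ge> k1 \<Longrightarrow> poly_dec m3 (sec x (Lk k))"
    "\<And>k x \<xi>. k \<ge> k1 \<Longrightarrow> (LINT \<eta>|lborel. phase x \<eta> * FT (sec x (Lk k)) \<eta> (\<eta> - \<xi>)) =
      (LINT \<eta>|lborel. phase x \<eta> * FT (sec x (Lk k1)) \<eta> (\<eta> - \<xi>))"
    using dec_sec_Lk by blast
  \<comment> \<open>The factor \<open>phase\<close> in \<open>phase_H_far\<close> never vanishes and
    can be cancelled.\<close>
  have same: "osc_int (H_far k) = osc_int (H_far k1)" if "k \<ge> k1" for k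
  proof
    fix p :: "(real^'n) \<times> (real^'n)"
    obtain x \<xi> where p: "p = (x, \<xi>)" by (cases p)
    have "phase x \<xi> * osc_int (H_far k) p = phase x \<xi> * osc_int (H_far k1) p"
      unfolding p phase_H_far by (rule k1(2)[OF that])
    then show "osc_int (H_far k) p = osc_int (H_far k1) p" by (simp add: phase_def)
  qed
  obtain k2 where k2: "\<And>k. k \<ge> k2 \<Longrightarrow> symb Basis cF (wk_weight (W_far 0) \<bar>m3\<bar>) (H_far k)"
    using symb_H_far by blast
  have s1: "C_infinity (osc_int H_near)" by (rule smooth_osc_int[OF osc_H_near])
  have s2: "C_infinity (osc_int (H_far k1))"
    using smooth_osc_int[OF osc_H_far[OF k2[of "max k1 k2"]]] same[of "max k1 k2"] by simp
  \<comment> \<open>Differentiation costs \<open>length ds\<close> powers of <x>, so the number of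
    integrations by parts is chosen for M + \<open>length ds\<close>. By \<open>same\<close> the
    estimated function is still the one that belongs to \<open>k1\<close>.\<close>
  have R2: "\<exists>C. \<forall>p. norm (dir_derivs ds (osc_int (H_far k1)) p) \<le> C * W_far M p" if ds: "set ds \<subseteq> Basis" for ds M
  proof -
    obtain k3 where k3: "\<And>k. k \<ge> k3 \<Longrightarrow> symb Basis cF (wk_weight (W_far (M + real (length ds))) \<bar>m3\<bar>) (H_far k)"
      using symb_H_far by blast
    define k where "k = max k1 k3"
    have k: "symb Basis cF (wk_weight (W_far (M + real (length ds))) \<bar>m3\<bar>) (H_far k)" by (rule k3) (simp add: k_def)
    have "\<exists>C\<ge>0. \<forall>p. norm (osc_int (dir_derivs (map (\<lambda>d. ((d, 0), 0)) ds) (H_far k)) p) \<le> C * W_far M p"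
      using osc_int_bound[OF dec_H_far_derivs[OF k ds] W_far_nonneg] by simp
    moreover have "dir_derivs ds (osc_int (H_far k1)) = osc_int (dir_derivs (map (\<lambda>d. ((d, 0), 0)) ds) (H_far k))"
      using same[of k] dir_derivs_osc_int[OF osc_H_far[OF k] ds] by (simp add: k_def)
    ultimately show ?thesis by auto
  qed
  have R1: "\<exists>C\<ge>0. \<forall>p. norm (dir_derivs ds (osc_int H_near) p - complex_of_real ((2 * pi) ^ CARD('n)) *
      (\<Sum>j<N. dir_derivs ds (\<lambda>p. (mixed_op ^^ j) H_near ((p, 0), 0)) p / fact j)) \<le> C * (W_near p * slam p ^ N)"
    if ds: "set ds \<subseteq> Basis" for ds N
  proof -
    let ?H = "dir_derivs (map (\<lambda>d. ((d, 0), 0)) ds) H_near"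
    have "dir_derivs ds (\<lambda>p. (mixed_op ^^ j) H_near ((p, 0), 0)) p = (mixed_op ^^ j) ?H ((p, 0), 0)" for j p
      unfolding dir_derivs_at_origin dir_derivs_mixed_op_iter[OF symb_smooth[OF symb_H_near]] ..
    then show ?thesis
      using osc_int_expansion[OF wk_H_near_derivs[OF ds] W_near_nonneg less_imp_le[OF slam_pos], of N]
      unfolding dir_derivs_osc_int[OF osc_H_near ds] by simp
  qed
  define ds where "ds = (\<lambda>\<alpha> \<beta>. map (\<lambda>d. (d, 0)) (mi_dirs \<alpha>) @ map (\<lambda>d. (0, d)) (mi_dirs \<beta>) :: ((real^'n) \<times> (real^'n)) list)"
  have ds: "set (ds \<alpha> \<beta>) \<subseteq> Basis" for \<alpha> \<beta>
    using mi_dirs_Basis[of \<alpha>] mi_dirs_Basis[of \<beta>] by (auto simp: ds_def Basis_prod_def)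
  have mi2: "mi_deriv2 \<alpha> \<beta> f x \<xi> = dir_derivs (ds \<alpha> \<beta>) (\<lambda>(x, \<xi>). f x \<xi>) (x, \<xi>)" for \<alpha> \<beta> x \<xi> and f :: "real^'n \<Rightarrow> real^'n \<Rightarrow> complex"
    by (simp only: mi_deriv2_dirs ds_def)
  have e1: "norm ?e \<le> 1"
  proof -
    have "1 \<le> 2 * pi" using pi_gt3 by simp
    then have "1 \<le> (2 * pi) ^ CARD('n)" by (rule one_le_power)
    then show ?thesis by (subst norm_of_real) (simp add: divide_le_eq_1)
  qed
  \<comment> \<open>The condition N \<ge> 2 M arises because N factors \<open>slam\<close> amount to
    <x>^(- N/2). The far part is bounded with any M and contributes no terms to the series.\<close>
  have bound: "\<exists>C. \<forall>x \<xi>. norm (mi_deriv2 \<alpha> \<beta> (\<lambda>x \<xi>. amp k1 x \<xi> - (\<Sum>\<kappa> | mi_length \<kappa> < N. expansion_term \<phi> a \<kappa> x \<xi>)) x \<xi>) \<le>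
      C * bracket x powr (m1 + m2 - M) * bracket \<xi> powr m3" if N: "real N \<ge> 2 * M" for \<alpha> \<beta> M N
  proof -
    let ?ds = "ds \<alpha> \<beta>" and ?F = "\<lambda>j p. (mixed_op ^^ j) H_near ((p, 0), 0)"
    obtain D1 where D1: "D1 \<ge> 0" "\<And>p. norm (dir_derivs ?ds (osc_int H_near) p - complex_of_real ((2 * pi) ^ CARD('n)) *
      (\<Sum>j<N. dir_derivs ?ds (?F j) p / fact j)) \<le> D1 * (W_near p * slam p ^ N)" using R1[OF ds] by blast
    obtain D2 where D2: "\<And>p. norm (dir_derivs ?ds (osc_int (H_far k1)) p) \<le> D2 * W_far M p" using R2[OF ds] by blast
    have sF: "C_infinity (?F j)" for j
      by (rule smooth_compose[OF smooth_mixed_op_iter[OF symb_smooth[OF symb_H_near]]]) (intro smooth_intros)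
    have WN: "W_near p * slam p ^ N \<le> W_far M p" for p
    proof -
      have "slam p ^ N = lam p powr (- (real N / 2))"
        using lam_pos[of p] by (simp add: slam_def powr_realpow[symmetric] powr_powr)
      also have "\<dots> \<le> lam p powr (- M)" using N lam_ge_1[of p] by (intro powr_mono) auto
      finally have "W_near p * slam p ^ N \<le> W_near p * lam p powr (- M)" by (intro mult_left_mono W_near_nonneg)
      also have "\<dots> = W_far M p" by (simp add: W_near_def W_far_def lam_def powr_diff powr_minus divide_inverse mult_ac)
      finally show ?thesis .
    qed
    have eq: "(\<lambda>(x, \<xi>). amp k1 x \<xi> - (\<Sum>\<kappa> | mi_length \<kappa> < N. expansion_term \<phi> a \<kappa> x \<xi>)) =
        (\<lambda>p. ?e * (osc_int H_near p + osc_int (H_far k1) p) + (\<Sum>j<N. - (1 / fact j) * ?F j p))"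
      by (auto simp: fun_eq_iff amp_def expansion_sum sum_negf)
    have D: "dir_derivs ?ds (\<lambda>(x, \<xi>). amp k1 x \<xi> - (\<Sum>\<kappa> | mi_length \<kappa> < N. expansion_term \<phi> a \<kappa> x \<xi>)) p =
        ?e * (dir_derivs ?ds (osc_int H_near) p + dir_derivs ?ds (osc_int (H_far k1)) p) + (\<Sum>j<N. - (1 / fact j) * dir_derivs ?ds (?F j) p)" for p
    proof -
      have "C_infinity (\<lambda>p. ?e * (osc_int H_near p + osc_int (H_far k1) p))" "C_infinity (\<lambda>p. \<Sum>j<N. - (1 / fact j) * ?F j p)"
        by (intro smooth_add smooth_mult smooth_const s1 s2 smooth_sum sF)+
      then show ?thesis
        unfolding eq
        by (simp only: dir_derivs_add dir_derivs_cmult[OF smooth_add[OF s1 s2]] s1 s2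
            dir_derivs_sum[OF smooth_mult[OF smooth_const sF]] dir_derivs_cmult[OF sF])
    qed
    have cc: "?e * complex_of_real ((2 * pi) ^ CARD('n)) = 1"
      unfolding of_real_mult[symmetric] by simp
    have D': "dir_derivs ?ds (\<lambda>(x, \<xi>). amp k1 x \<xi> - (\<Sum>\<kappa> | mi_length \<kappa> < N. expansion_term \<phi> a \<kappa> x \<xi>)) p =
        ?e * (dir_derivs ?ds (osc_int H_near) p - complex_of_real ((2 * pi) ^ CARD('n)) * (\<Sum>j<N. dir_derivs ?ds (?F j) p / fact j)) +
        ?e * dir_derivs ?ds (osc_int (H_far k1)) p" for p
    proof -
      have "?e * (complex_of_real ((2 * pi) ^ CARD('n)) * S) = S" for S
        using cc by (simp only: mult.assoc[symmetric] mult_1)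
      then show ?thesis unfolding D by (simp only: right_diff_distrib distrib_left) (simp add: sum_negf)
    qed
    have "norm (mi_deriv2 \<alpha> \<beta> (\<lambda>x \<xi>. amp k1 x \<xi> - (\<Sum>\<kappa> | mi_length \<kappa> < N. expansion_term \<phi> a \<kappa> x \<xi>)) x \<xi>) \<le>
        (D1 + D2) * bracket x powr (m1 + m2 - M) * bracket \<xi> powr m3" for x \<xi>
    proof -
      let ?p = "(x, \<xi>)"
      have m: "norm (?e * z) \<le> norm z" for z
        using mult_right_mono[OF e1, of "norm z"] by (simp only: norm_mult mult_1 norm_ge_zero)
      have "norm (mi_deriv2 \<alpha> \<beta> (\<lambda>x \<xi>. amp k1 x \<xi> - (\<Sum>\<kappa> | mi_length \<kappa> < N. expansion_term \<phi> a \<kappa> x \<xi>)) x \<xi>) \<le>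
          D1 * (W_near ?p * slam ?p ^ N) + D2 * W_far M ?p"
        unfolding mi2 D'
        by (rule order_trans[OF norm_triangle_ineq add_mono[OF order_trans[OF m D1(2)] order_trans[OF m D2]]])
      also have "\<dots> \<le> D1 * W_far M ?p + D2 * W_far M ?p"
        using WN[of ?p] D1(1) by (intro add_right_mono mult_left_mono)
      finally show ?thesis by (simp add: W_far_def algebra_simps)
    qed
    then show ?thesis by blast
  qed
  have "C_infinity (\<lambda>(x, \<xi>). amp k1 x \<xi>)"
  proof -
    have "(\<lambda>(x, \<xi>). amp k1 x \<xi>) = (\<lambda>p. ?e * (osc_int H_near p + osc_int (H_far k1) p))" by (auto simp: fun_eq_iff amp_def)
    then show ?thesis by (simp only:) (intro smooth_add smooth_mult smooth_const s1 s2)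
  qed
  moreover have "has_osc_value \<phi> a u x (fio_single \<phi> (amp k1) u x)" if "schwartz u" for u x
    using osc_limit[OF that, of x] fio_single_amp[OF k1(1)[OF order_refl] that, of x] by simp
  \<comment> \<open>With M = 0 and N = 0 the sum is empty, and the remainder estimate becomes the
    symbol estimate for c.\<close>
  moreover have "\<exists>C. \<forall>x \<xi>. norm (mi_deriv2 \<alpha> \<beta> (amp k1) x \<xi>) \<le> C * bracket x powr (m1 + m2) * bracket \<xi> powr m3" for \<alpha> \<beta>
    using bound[of 0 0 \<alpha> \<beta>] by simp
  moreover have "asymp_expansion_x (amp k1) (expansion_term \<phi> a) (m1 + m2) m3"
    unfolding asymp_expansion_x_def
  proof (intro allI)
    fix \<alpha> \<beta> :: "'n multi_index" and M :: real
    obtain N :: nat where "real N \<ge> 2 * M" using real_arch_simple by blast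
    from bound[OF this, of \<alpha> \<beta>]
    show "\<exists>N C. \<forall>x \<xi>. norm (mi_deriv2 \<alpha> \<beta> (\<lambda>x \<xi>. amp k1 x \<xi> - (\<Sum>\<kappa> | mi_length \<kappa> < N. expansion_term \<phi> a \<kappa> x \<xi>)) x \<xi>)
        \<le> C * bracket x powr (m1 + m2 - M) * bracket \<xi> powr m3" by blast
  qed
  ultimately show ?thesis by (intro exI[of _ "amp k1"]) blast
qed

end

theorem corollary2p9:
  fixes m1 m2 m3 :: real
    and \<phi> :: "real^'n::finite \<Rightarrow> real^'n \<Rightarrow> real"
    and a :: "real^'n \<Rightarrow> real^'n \<Rightarrow> real^'n \<Rightarrow> complex"
  assumes phi_smooth: "C_infinity (\<lambda>(x, \<xi>). \<phi> x \<xi>)"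
    and phi_grad: "\<exists>C1>0. \<exists>C2>0. \<forall>x \<xi>.
      C1 * bracket x \<le> bracket (grad_snd \<phi> x \<xi>) \<and> bracket (grad_snd \<phi> x \<xi>) \<le> C2 * bracket x"
    and phi_xi: "\<And>\<beta>. mi_length \<beta> \<ge> 1 \<Longrightarrow>
      \<exists>C. \<forall>x \<xi>. \<bar>mi_deriv \<beta> (\<lambda>\<xi>. \<phi> x \<xi>) \<xi>\<bar> \<le> C * bracket x"
    and phi_x_xi: "\<And>\<alpha> \<beta>. mi_length \<alpha> \<ge> 1 \<Longrightarrow> mi_length \<beta> \<ge> 1 \<Longrightarrow>
      \<exists>C. \<forall>x \<xi>. \<bar>mi_deriv2 \<alpha> \<beta> \<phi> x \<xi>\<bar> \<le> C"
    and a_smooth: "C_infinity (\<lambda>(x, y, \<xi>). a x y \<xi>)"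
    and a_bound: "\<And>\<alpha> \<beta> \<gamma>. \<exists>C. \<forall>x y \<xi>. norm (mi_deriv3 \<alpha> \<beta> \<gamma> a x y \<xi>)
      \<le> C * bracket x powr m1 * bracket y powr (m2 - real (mi_length \<beta>)) * bracket \<xi> powr m3"
  shows "\<exists>c :: real^'n \<Rightarrow> real^'n \<Rightarrow> complex.
    C_infinity (\<lambda>(x, \<xi>). c x \<xi>) \<and>
    (\<forall>u. schwartz u \<longrightarrow> (\<forall>x. has_osc_value \<phi> a u x (fio_single \<phi> c u x))) \<and>
    (\<forall>\<alpha> \<beta>. \<exists>C. \<forall>x \<xi>. norm (mi_deriv2 \<alpha> \<beta> c x \<xi>)
      \<le> C * bracket x powr (m1 + m2) * bracket \<xi> powr m3) \<and>
    asymp_expansion_x c (expansion_term \<phi> a) (m1 + m2) m3"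
proof -
  obtain C1 C2 where C: "C1 > 0" "\<And>x \<xi>. C1 * bracket x \<le> bracket (grad_snd \<phi> x \<xi>)"
    "\<And>x \<xi>. bracket (grad_snd \<phi> x \<xi>) \<le> C2 * bracket x"
    using phi_grad by blast
  interpret fio_data m1 m2 m3 \<phi> a C1 C2
    by (standard; fact phi_smooth C phi_xi phi_x_xi a_smooth a_bound)
  show ?thesis by (rule fio_representation)
qed

end
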